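(* Let $V$ be a quasi-vertex operator algebra and for $\gamma=\begin{pmatrix}a&b\\c&d\end{pmatrix}\in \mathrm{GL}_2(\mathbb R)^+$, $\tau\in\mathbb H$ put $$K(\gamma,\tau)=e^{-\det(\gamma)^{-1}c\,j(\gamma,\tau)L(1)}\,j(\gamma,\tau)^{-2L(0)}(\det\gamma)^{L(0)}\in\mathrm{End}(V),\qquad j(\gamma,\tau)=c\tau+d .$$ (1) For all $\gamma,\beta\in\mathrm{GL}_2(\mathbb R)^+$ and $\tau\in\mathbb H$ one has $K(\gamma\beta,\tau)=K(\gamma,\beta\tau)K(\beta,\tau)$, so that $\gamma(\tau,v)=(\gamma\tau,K(\gamma,\tau)v)$ defines a left action of $\mathrm{GL}_2(\mathbb R)^+$ on $\mathbb H\times V$. (2) In particular, for every Fuchsian group $\Gamma\subset\mathrm{PSL}_2(\mathbb R)$ of the first kind, $K$ defines a left action of $\Gamma$ on $\mathbb H\times V$, and the quotient $\mathcal V_Y=\Gamma\backslash(\mathbb H\times V)$ is a well-defined (orbifold; ordinary if $\Gamma$ is torsion-free) vector bundle on $Y=\Gamma\backslash\mathbb H$, which extends canonically across the cusps to a bundle $\mathcal V_X$ on the compactified curve $X$. The sections of weight $k$ of $\mathcal V_X$ are exactly the $V$-valued automorphic forms $M_k(V,\Gamma)$ for $\Gamma$.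
   Context: QVOA: a quasi-vertex operator algebra is a $\mathbb Z$-graded vertex algebra $V=\bigoplus_n V_n$ (vertex operators $Y$, vacuum $\mathbf 1$) with $\dim V_n<\infty$ and $V_n=0$ for $n\ll0$, together with operators $L(-1),L(0),L(1)$ satisfying $[L(m),L(n)]=(m-n)L(m+n)$, where $L(-1)$ is the canonical derivation (translation operator), $L(0)$ acts on $V_n$ as multiplication by $n$ and $[L(1),Y(u,z)]=Y((L(1)+2zL(0)+z^2L(-1))u,z)$. $F_NV=\bigoplus_{n\le N}V_n$; $L(1)$ lowers degree by 1, so it is nilpotent on $F_NV$. The possibly infinite-rank bundle is understood as the union of the finite-rank pieces built from $F_NV$ (each $K(\gamma,\tau)$ preserves $F_NV$). Fuchsian groups: $\Gamma\subset\mathrm{PSL}_2(\mathbb R)$ is discrete, finitely generated, of finite hyperbolic covolume; $X=\Gamma\backslash\overline{\mathbb H}$ with $\overline{\mathbb H}=\mathbb H\cup\{\text{cusps of }\Gamma\}$. Elements of $\Gamma$ are lifted to $\mathrm{SL}_2(\mathbb R)$ (all lifts are used, i.e. the full preimage of $\Gamma$). An orbifold bundle on $Y$ means the datum of a $\Gamma$-automorphy factor on $\mathbb H$. At a cusp $s=\sigma\infty$ ($\sigma\in\mathrm{SL}_2(\mathbb R)$), the stabilizer of $\infty$ in $\sigma^{-1}\Gamma\sigma$ is generated up to sign by $\tau\mapsto\tau+\lambda$, which acts trivially on $V$ through $K$; with local parameter $q_\lambda=e^{2\pi i\tau/\lambda}$ the bundle is extended so that its sections near the cusp are those with holomorphic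 $q_\lambda$-expansion. Forms: $f\Vert_k\gamma(\tau)=j(\gamma,\tau)^{-k}(\det\gamma)^{k/2}K(\gamma,\tau)^{-1}f(\gamma\tau)$. $M_k(V,\Gamma)$ is the space of holomorphic maps $f:\mathbb H\to F_NV$ (for some $N$) with $f\Vert_k\gamma=f$ for all $\gamma\in\Gamma$ such that (a) at every cusp $s=\sigma\infty$, $f\Vert_k\sigma\in F_NV[[q_\lambda]]$; (b) at every elliptic point $\tau_i$ with stabilizer generator $\gamma_i$, $f(\tau_i)$ is fixed by $j(\gamma_i,\tau_i)^kK(\gamma_i,\tau_i)$. A section of weight $k$ of $\mathcal V_X$ is a holomorphic section, of bounded conformal degree, of the bundle obtained by twisting the automorphy factor $K$ by $j^k$. *)

theory Defs
  imports
    "HOL-Analysis.Analysis"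
    "HOL-Algebra.Group_Action"
    "HOL-Algebra.Generated_Groups"
    "HOL-Library.Groups_Big_Fun"
begin

section \<open>Quasi-vertex operator algebras\<close>

text \<open>
  \<open>Y u n\<close> is the mode \<open>u\<^sub>n\<close> in \<open>Y(u,z) = \<Sum>n. u\<^sub>n z\<^sup>-\<^sup>n\<^sup>-\<^sup>1\<close>. The identity \<open>borcherds\<close> is the
  component form of the Jacobi identity; by \<open>truncation\<close> all its sums have finite support,
  so that \<^const>\<open>Sum_any\<close> (which is 0 on infinite support) is a genuine sum.
\<close>

locale vertex_algebra = vector_space scale
  for scale :: "complex \<Rightarrow> 'v::ab_group_add \<Rightarrow> 'v" +
  fixes Y :: "'v \<Rightarrow> int \<Rightarrow> 'v \<Rightarrow> 'v"
    and vac :: 'v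
  assumes linear_left: "Vector_Spaces.linear scale scale (\<lambda>u. Y u n v)"
    and linear_right: "Vector_Spaces.linear scale scale (Y u n)"
    and truncation: "\<exists>N. \<forall>n\<ge>N. Y u n v = 0"
    and vacuum: "Y vac n v = (if n = -1 then v else 0)"
    and creation: "n \<ge> 0 \<Longrightarrow> Y u n vac = 0" "Y u (-1) vac = u"
    and borcherds:
      "Sum_any (\<lambda>i::nat. scale ((of_int m :: complex) gchoose i)
           (Y (Y u (l + int i) v) (m + n - int i) w)) =
       Sum_any (\<lambda>i::nat. scale ((-1) ^ i * ((of_int l :: complex) gchoose i))
           (Y u (l + m - int i) (Y v (n + int i) w)
            - scale ((-1) powi l) (Y v (l + n - int i) (Y u (m + int i) w))))"

record 'v qvoa =
  smul :: "complex \<Rightarrow> 'v \<Rightarrow> 'v"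
  vop :: "'v \<Rightarrow> int \<Rightarrow> 'v \<Rightarrow> 'v"
  vacuum :: 'v
  grade :: "int \<Rightarrow> 'v set"
  Lop :: "int \<Rightarrow> 'v \<Rightarrow> 'v"

definition homogeneous_decomp :: "'v::ab_group_add qvoa \<Rightarrow> 'v \<Rightarrow> (int \<Rightarrow> 'v) \<Rightarrow> bool" where
  "homogeneous_decomp A v c \<longleftrightarrow>
     (\<forall>n. c n \<in> grade A n) \<and> finite {n. c n \<noteq> 0} \<and> v = Sum_any c"

text \<open>Only the operators \<open>Lop A m\<close> with \<open>m \<in> {-1,0,1}\<close> are part of the structure. The last
  axiom is the coefficient of \<open>z\<^sup>-\<^sup>n\<^sup>-\<^sup>1\<close> in
  \<open>[L(1),Y(u,z)] = Y((L(1) + 2zL(0) + z\<^sup>2L(-1))u, z)\<close>.\<close>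

locale quasi_VOA = vertex_algebra "smul A" "vop A" "vacuum A"
  for A :: "'v::ab_group_add qvoa" +
  assumes grade_subspace: "module.subspace (smul A) (grade A n)"
    and grade_finite_dim: "\<exists>B. finite B \<and> grade A n = module.span (smul A) B"
    and grade_bounded_below: "\<exists>n0. \<forall>n<n0. grade A n = {0}"
    and grade_direct_sum: "\<exists>!c. homogeneous_decomp A v c"
    and vacuum_grade: "vacuum A \<in> grade A 0"
    and mode_grade: "u \<in> grade A k \<Longrightarrow> v \<in> grade A m \<Longrightarrow> vop A u n v \<in> grade A (k + m - n - 1)"
    and L_linear: "m \<in> {-1, 0, 1} \<Longrightarrow> Vector_Spaces.linear (smul A) (smul A) (Lop A m)"
    and L_bracket: "m \<in> {-1, 0, 1} \<Longrightarrow> n \<in> {-1, 0, 1} \<Longrightarrow>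
       Lop A m (Lop A n v) - Lop A n (Lop A m v) = smul A (of_int (m - n)) (Lop A (m + n) v)"
    and L_minus1: "Lop A (-1) u = vop A u (-2) (vacuum A)"
    and L_0: "v \<in> grade A n \<Longrightarrow> Lop A 0 v = smul A (of_int n) v"
    and L_1: "Lop A 1 (vop A u n v) - vop A u n (Lop A 1 v) =
       vop A (Lop A 1 u) n v + smul A 2 (vop A (Lop A 0 u) (n + 1) v) + vop A (Lop A (-1) u) (n + 2) v"

definition component :: "'v::ab_group_add qvoa \<Rightarrow> 'v \<Rightarrow> int \<Rightarrow> 'v" where
  "component A v = (THE c. homogeneous_decomp A v c)"

definition filt :: "'v::ab_group_add qvoa \<Rightarrow> int \<Rightarrow> 'v set" where
  "filt A N = module.span (smul A) (\<Union>n\<in>{..N}. grade A n)"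

text \<open>\<open>x\<^bsup>L(0)\<^esup>\<close>, acting on \<open>V\<^sub>n\<close> as \<open>x\<^sup>n\<close>.\<close>

definition power_L0 :: "'v::ab_group_add qvoa \<Rightarrow> complex \<Rightarrow> 'v \<Rightarrow> 'v" where
  "power_L0 A x v = Sum_any (\<lambda>n. smul A (x powi n) (component A v n))"

text \<open>The exponential of a locally nilpotent operator.\<close>

definition op_exp :: "'v::ab_group_add qvoa \<Rightarrow> ('v \<Rightarrow> 'v) \<Rightarrow> 'v \<Rightarrow> 'v" where
  "op_exp A T v = Sum_any (\<lambda>k::nat. smul A (1 / fact k) ((T ^^ k) v))"


section \<open>The groups and their actions\<close>

type_synonym mat2 = "real^2^2"

definition upper_half :: "complex set" (\<open>\<bbbH>\<close>) where
  "\<bbbH> = {\<tau>. Im \<tau> > 0}"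

definition GL2p :: "mat2 monoid" where
  "GL2p = \<lparr>carrier = {\<gamma>. det \<gamma> > 0}, mult = (**), one = mat 1\<rparr>"

definition SL2 :: "mat2 monoid" where
  "SL2 = \<lparr>carrier = {\<gamma>. det \<gamma> = 1}, mult = (**), one = mat 1\<rparr>"

definition PSL2 :: "mat2 set monoid" where
  "PSL2 = SL2 Mod {mat 1, - mat 1}"

definition jfac :: "mat2 \<Rightarrow> complex \<Rightarrow> complex" where
  "jfac \<gamma> \<tau> = of_real (\<gamma>$2$1) * \<tau> + of_real (\<gamma>$2$2)"

definition moeb :: "mat2 \<Rightarrow> complex \<Rightarrow> complex" where
  "moeb \<gamma> \<tau> = (of_real (\<gamma>$1$1) * \<tau> + of_real (\<gamma>$1$2)) / jfac \<gamma> \<tau>"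

text \<open>The same action on the Riemann sphere, with \<^const>\<open>None\<close> as the point at infinity.\<close>

definition moeb_sphere :: "mat2 \<Rightarrow> complex option \<Rightarrow> complex option" where
  "moeb_sphere \<gamma> s = (case s of
      None \<Rightarrow> if \<gamma>$2$1 = 0 then None else Some (of_real (\<gamma>$1$1 / \<gamma>$2$1))
    | Some z \<Rightarrow> if jfac \<gamma> z = 0 then None else Some (moeb \<gamma> z))"

definition K :: "'v::ab_group_add qvoa \<Rightarrow> mat2 \<Rightarrow> complex \<Rightarrow> 'v \<Rightarrow> 'v" where
  "K A \<gamma> \<tau> v =
     op_exp A (\<lambda>w. smul A (- (of_real (inverse (det \<gamma>)) * of_real (\<gamma>$2$1) * jfac \<gamma> \<tau>)) (Lop A 1 w))
       (power_L0 A (jfac \<gamma> \<tau> powi (-2)) (power_L0 A (of_real (det \<gamma>)) v))"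

definition twisted_K :: "'v::ab_group_add qvoa \<Rightarrow> int \<Rightarrow> mat2 \<Rightarrow> complex \<Rightarrow> 'v \<Rightarrow> 'v" where
  "twisted_K A k \<gamma> \<tau> v = smul A (jfac \<gamma> \<tau> powi k) (K A \<gamma> \<tau> v)"

definition bundle_act :: "(mat2 \<Rightarrow> complex \<Rightarrow> 'v \<Rightarrow> 'v) \<Rightarrow> mat2 \<Rightarrow> complex \<times> 'v \<Rightarrow> complex \<times> 'v" where
  "bundle_act J \<gamma> = (\<lambda>(\<tau>, v). (moeb \<gamma> \<tau>, J \<gamma> \<tau> v))"


section \<open>Fuchsian groups of the first kind\<close>

text \<open>A subgroup \<open>\<Gamma>\<close> of \<^const>\<open>PSL2\<close> is a set of cosets, so \<open>\<Union>\<Gamma>\<close> is its full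
  preimage in \<open>SL\<^sub>2(\<real>)\<close>.\<close>

definition lifts :: "mat2 set set \<Rightarrow> mat2 set" where
  "lifts \<Gamma> = \<Union>\<Gamma>"

definition hyperbolic_area :: "complex measure" where
  "hyperbolic_area = density lborel (\<lambda>z. ennreal (indicator \<bbbH> z / (Im z)\<^sup>2))"

definition fundamental_domain :: "mat2 set set \<Rightarrow> complex set \<Rightarrow> bool" where
  "fundamental_domain \<Gamma> F \<longleftrightarrow>
     F \<in> sets borel \<and> F \<subseteq> \<bbbH> \<and> (\<Union>\<gamma>\<in>lifts \<Gamma>. moeb \<gamma> ` F) = \<bbbH> \<and>
     (\<forall>\<gamma>\<in>lifts \<Gamma> - {mat 1, - mat 1}. F \<inter> moeb \<gamma> ` F \<in> null_sets lborel)"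

text \<open>As \<open>SL\<^sub>2(\<real>) \<rightarrow> PSL\<^sub>2(\<real>)\<close> is a twofold covering, \<open>\<Gamma>\<close> is discrete iff its preimage is.\<close>

definition fuchsian_first_kind :: "mat2 set set \<Rightarrow> bool" where
  "fuchsian_first_kind \<Gamma> \<longleftrightarrow>
     subgroup \<Gamma> PSL2 \<and> discrete (lifts \<Gamma>) \<and>
     (\<exists>S. finite S \<and> S \<subseteq> carrier PSL2 \<and> generate PSL2 S = \<Gamma>) \<and>
     (\<exists>F. fundamental_domain \<Gamma> F \<and> emeasure hyperbolic_area F < \<infinity>)"

definition torsion_free :: "mat2 set set \<Rightarrow> bool" where
  "torsion_free \<Gamma> \<longleftrightarrow> (\<forall>g\<in>\<Gamma>. \<forall>n>0. g [^]\<^bsub>PSL2\<^esub> (n::nat) = \<one>\<^bsub>PSL2\<^esub> \<longrightarrow> g = \<one>\<^bsub>PSL2\<^esub>)"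

definition cusps :: "mat2 set set \<Rightarrow> complex option set" where
  "cusps \<Gamma> = {s \<in> insert None (Some ` \<real>).
     \<exists>\<gamma>\<in>lifts \<Gamma> - {mat 1, - mat 1}. (trace \<gamma>)\<^sup>2 = 4 \<and> moeb_sphere \<gamma> s = s}"

definition cusp_frames :: "mat2 set set \<Rightarrow> mat2 set" where
  "cusp_frames \<Gamma> = {\<sigma> \<in> carrier SL2. moeb_sphere \<sigma> None \<in> cusps \<Gamma>}"

definition conj_stab :: "mat2 set set \<Rightarrow> mat2 \<Rightarrow> mat2 set" where
  "conj_stab \<Gamma> \<sigma> =
     {\<gamma> \<in> (\<lambda>\<gamma>. matrix_inv \<sigma> ** \<gamma> ** \<sigma>) ` lifts \<Gamma>. moeb_sphere \<gamma> None = None}"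

definition translation :: "real \<Rightarrow> mat2" where
  "translation t = vector [vector [1, t], vector [0, 1]]"

text \<open>The stabilizer of \<open>\<infinity>\<close> in \<open>\<sigma>\<^sup>-\<^sup>1\<Gamma>\<sigma>\<close> is generated, up to sign, by \<open>\<tau> \<mapsto> \<tau> + \<omega>\<close>.\<close>

definition cusp_width :: "mat2 set set \<Rightarrow> mat2 \<Rightarrow> real \<Rightarrow> bool" where
  "cusp_width \<Gamma> \<sigma> \<omega> \<longleftrightarrow> \<omega> > 0 \<and>
     conj_stab \<Gamma> \<sigma> = generate SL2 {translation \<omega>, - mat 1}"

definition qpar :: "real \<Rightarrow> complex \<Rightarrow> complex" where
  "qpar \<omega> \<tau> = exp (2 * of_real pi * \<i> * \<tau> / of_real \<omega>)"

text \<open>A preimage of \<open>q\<close> under \<open>qpar \<lambda>\<close>, in \<open>\<bbbH>\<close> if \<open>0 < |q| < 1\<close>.\<close>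

definition qlog :: "real \<Rightarrow> complex \<Rightarrow> complex" where
  "qlog \<omega> q = of_real \<omega> * Ln q / (2 * of_real pi * \<i>)"

definition ext_half_plane :: "mat2 set set \<Rightarrow> complex option set" where
  "ext_half_plane \<Gamma> = Some ` \<bbbH> \<union> cusps \<Gamma>"

definition orb :: "mat2 set set \<Rightarrow> complex option \<Rightarrow> complex option set" where
  "orb \<Gamma> s = (\<lambda>\<gamma>. moeb_sphere \<gamma> s) ` lifts \<Gamma>"

definition curve_Y :: "mat2 set set \<Rightarrow> complex option set set" where
  "curve_Y \<Gamma> = orb \<Gamma> ` Some ` \<bbbH>"

definition curve_X :: "mat2 set set \<Rightarrow> complex option set set" where
  "curve_X \<Gamma> = orb \<Gamma> ` ext_half_plane \<Gamma>"


section \<open>Holomorphic vector bundles on curves and orbifold curves\<close>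

text \<open>Holomorphic maps into a finite-dimensional subspace \<open>W\<close>, through coordinates with respect
  to a basis.\<close>

definition basis_of :: "'v::ab_group_add qvoa \<Rightarrow> 'v set \<Rightarrow> 'v set \<Rightarrow> bool" where
  "basis_of A W B \<longleftrightarrow> \<not> module.dependent (smul A) B \<and> module.span (smul A) B = W"

definition holomorphic_into ::
    "'v::ab_group_add qvoa \<Rightarrow> 'v set \<Rightarrow> complex set \<Rightarrow> (complex \<Rightarrow> 'v) \<Rightarrow> bool" where
  "holomorphic_into A W U f \<longleftrightarrow> f ` U \<subseteq> W \<and>
     (\<exists>B. finite B \<and> basis_of A W B \<and>
        (\<forall>b\<in>B. (\<lambda>z. module.representation (smul A) B (f z) b) holomorphic_on U))"

definition holomorphic_GL ::
    "'v::ab_group_add qvoa \<Rightarrow> 'v set \<Rightarrow> complex set \<Rightarrow> (complex \<Rightarrow> 'v \<Rightarrow> 'v) \<Rightarrow> bool" where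
  "holomorphic_GL A W U g \<longleftrightarrow>
     (\<forall>z\<in>U. bij_betw (g z) W W \<and>
        (\<forall>v\<in>W. \<forall>w\<in>W. g z (v + w) = g z v + g z w) \<and>
        (\<forall>a. \<forall>v\<in>W. g z (smul A a v) = smul A a (g z v))) \<and>
     (\<forall>v\<in>W. holomorphic_into A W U (\<lambda>z. g z v))"

text \<open>An orbifold bundle on \<open>Y\<close> with fibre \<open>W\<close>, as the datum of an automorphy factor. The last
  clause says that the full preimage of \<open>\<Gamma>\<close> acts through \<open>\<Gamma>\<close>.\<close>

definition automorphy_factor ::
    "'v::ab_group_add qvoa \<Rightarrow> mat2 set set \<Rightarrow> 'v set \<Rightarrow> (mat2 \<Rightarrow> complex \<Rightarrow> 'v \<Rightarrow> 'v) \<Rightarrow> bool" where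
  "automorphy_factor A \<Gamma> W J \<longleftrightarrow>
     (\<forall>\<gamma>\<in>lifts \<Gamma>. holomorphic_GL A W \<bbbH> (J \<gamma>)) \<and>
     (\<forall>\<gamma>\<in>lifts \<Gamma>. \<forall>\<beta>\<in>lifts \<Gamma>. \<forall>\<tau>\<in>\<bbbH>. \<forall>v\<in>W. J (\<gamma> ** \<beta>) \<tau> v = J \<gamma> (moeb \<beta> \<tau>) (J \<beta> \<tau> v)) \<and>
     (\<forall>\<tau>\<in>\<bbbH>. \<forall>v\<in>W. J (- mat 1) \<tau> v = v)"

text \<open>A chart \<open>(U, p, P)\<close> of a bundle \<open>\<pi> : E \<rightarrow> X\<close> consists of an open \<open>U \<subseteq> \<complex>\<close>, a map
  \<open>p : U \<rightarrow> X\<close> and a map \<open>P : U \<times> W \<rightarrow> E\<close> over \<open>p\<close>. It is an orbifold chart if there is a finite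
  group \<open>G\<close> of holomorphic bundle automorphisms of \<open>U \<times> W\<close> such that \<open>p\<close> and \<open>P\<close> induce
  \<open>U/G \<cong> p(U)\<close> and \<open>(U \<times> W)/G \<cong> \<pi>\<^sup>-\<^sup>1(p(U))\<close>.\<close>

type_synonym ('v, 'x, 'e) bchart = "complex set \<times> (complex \<Rightarrow> 'x) \<times> (complex \<times> 'v \<Rightarrow> 'e)"

definition bundle_automorphism ::
    "'v::ab_group_add qvoa \<Rightarrow> 'v set \<Rightarrow> complex set \<Rightarrow> (complex \<times> 'v \<Rightarrow> complex \<times> 'v) \<Rightarrow> bool" where
  "bundle_automorphism A W U \<phi> \<longleftrightarrow>
     (\<exists>h g. h holomorphic_on U \<and> bij_betw h U U \<and> holomorphic_GL A W U g \<and>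
        (\<forall>z\<in>U. \<forall>v\<in>W. \<phi> (z, v) = (h z, g z v)))"

definition orbifold_chart ::
    "'v::ab_group_add qvoa \<Rightarrow> 'v set \<Rightarrow> 'x set \<Rightarrow> 'e set \<Rightarrow> ('e \<Rightarrow> 'x) \<Rightarrow> ('v, 'x, 'e) bchart \<Rightarrow> bool" where
  "orbifold_chart A W X E \<pi> = (\<lambda>(U, p, P).
     open U \<and> p ` U \<subseteq> X \<and> P ` (U \<times> W) = {e \<in> E. \<pi> e \<in> p ` U} \<and>
     (\<forall>z\<in>U. \<forall>v\<in>W. \<pi> (P (z, v)) = p z) \<and>
     (\<exists>G. finite G \<and> subgroup G (BijGroup (U \<times> W)) \<and> (\<forall>\<phi>\<in>G. bundle_automorphism A W U \<phi>) \<and>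
        (\<forall>z\<in>U. \<forall>z'\<in>U. p z = p z' \<longleftrightarrow> (\<exists>\<phi>\<in>G. fst (\<phi> (z, 0)) = z')) \<and>
        (\<forall>x\<in>U \<times> W. \<forall>y\<in>U \<times> W. P x = P y \<longleftrightarrow> (\<exists>\<phi>\<in>G. \<phi> x = y))))"

definition compatible_charts ::
    "'v::ab_group_add qvoa \<Rightarrow> 'v set \<Rightarrow> ('v, 'x, 'e) bchart \<Rightarrow> ('v, 'x, 'e) bchart \<Rightarrow> bool" where
  "compatible_charts A W = (\<lambda>(U, p, P) (U', p', P').
     \<forall>z\<in>U. \<forall>z'\<in>U'. p z = p' z' \<longrightarrow>
       (\<exists>D h g. open D \<and> z \<in> D \<and> D \<subseteq> U \<and>
          h holomorphic_on D \<and> inj_on h D \<and> h ` D \<subseteq> U' \<and> h z = z' \<and> holomorphic_GL A W D g \<and>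
          (\<forall>w\<in>D. p w = p' (h w) \<and> (\<forall>v\<in>W. P (w, v) = P' (h w, g w v)))))"

definition hausdorff_atlas :: "'x set \<Rightarrow> ('v, 'x, 'e) bchart set \<Rightarrow> bool" where
  "hausdorff_atlas X \<A> \<longleftrightarrow>
     (\<forall>x\<in>X. \<forall>y\<in>X. x \<noteq> y \<longrightarrow>
        (\<exists>(U, p, P)\<in>\<A>. \<exists>(U', p', P')\<in>\<A>. x \<in> p ` U \<and> y \<in> p' ` U' \<and> p ` U \<inter> p' ` U' = {}))"

definition orbifold_bundle ::
    "'v::ab_group_add qvoa \<Rightarrow> 'v set \<Rightarrow> 'x set \<Rightarrow> 'e set \<Rightarrow> ('e \<Rightarrow> 'x) \<Rightarrow> ('v, 'x, 'e) bchart set \<Rightarrow> bool" where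
  "orbifold_bundle A W X E \<pi> \<A> \<longleftrightarrow>
     (\<forall>c\<in>\<A>. orbifold_chart A W X E \<pi> c) \<and>
     (\<forall>c\<in>\<A>. \<forall>c'\<in>\<A>. compatible_charts A W c c') \<and>
     \<pi> ` E \<subseteq> X \<and> X = (\<Union>(U, p, P)\<in>\<A>. p ` U) \<and> hausdorff_atlas X \<A>"

text \<open>Injectivity of all charts makes the local groups trivial, the base a complex manifold and the
  charts local trivializations with holomorphic linear transition functions.\<close>

definition ordinary_bundle ::
    "'v::ab_group_add qvoa \<Rightarrow> 'v set \<Rightarrow> 'x set \<Rightarrow> 'e set \<Rightarrow> ('e \<Rightarrow> 'x) \<Rightarrow> ('v, 'x, 'e) bchart set \<Rightarrow> bool" where
  "ordinary_bundle A W X E \<pi> \<A> \<longleftrightarrow>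
     orbifold_bundle A W X E \<pi> \<A> \<and> (\<forall>(U, p, P)\<in>\<A>. inj_on p U \<and> inj_on P (U \<times> W))"


section \<open>The bundles \<open>\<V>\<^sub>Y\<close> and \<open>\<V>\<^sub>X\<close>\<close>

definition class_Y ::
    "mat2 set set \<Rightarrow> (mat2 \<Rightarrow> complex \<Rightarrow> 'v \<Rightarrow> 'v) \<Rightarrow> complex \<times> 'v \<Rightarrow> (complex \<times> 'v) set" where
  "class_Y \<Gamma> J x = (\<lambda>\<gamma>. bundle_act J \<gamma> x) ` lifts \<Gamma>"

definition total_Y ::
    "mat2 set set \<Rightarrow> (mat2 \<Rightarrow> complex \<Rightarrow> 'v \<Rightarrow> 'v) \<Rightarrow> 'v set \<Rightarrow> (complex \<times> 'v) set set" where
  "total_Y \<Gamma> J W = class_Y \<Gamma> J ` (\<bbbH> \<times> W)"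

text \<open>The projection maps the class of \<open>(\<tau>, v)\<close> to the orbit of \<open>\<tau>\<close>, as a set of points.\<close>

definition proj_Y :: "(complex \<times> 'v) set \<Rightarrow> complex option set" where
  "proj_Y e = (\<lambda>x. Some (fst x)) ` e"

text \<open>The fibres at the cusps. For \<open>\<sigma>\<infinity>\<close> a cusp, \<open>(\<sigma>, v)\<close> stands for the limit of the points
  \<open>(\<sigma>\<tau>, J(\<sigma>,\<tau>)v)\<close> as \<open>\<tau> \<rightarrow> i\<infinity>\<close>. Hence it is identified with \<open>(\<gamma>\<sigma>\<beta>\<^sup>-\<^sup>1, J(\<beta>,\<tau>)v)\<close> for
  \<open>\<gamma> \<in> \<Gamma>\<close> and \<open>\<beta>\<close> fixing \<open>\<infinity>\<close>. For the factors used here \<open>J(\<beta>,\<tau>)\<close> does not depend on \<open>\<tau>\<close>,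
  and it is evaluated at \<open>\<tau> = \<i>\<close>.\<close>

definition class_cusp ::
    "mat2 set set \<Rightarrow> (mat2 \<Rightarrow> complex \<Rightarrow> 'v \<Rightarrow> 'v) \<Rightarrow> mat2 \<times> 'v \<Rightarrow> (mat2 \<times> 'v) set" where
  "class_cusp \<Gamma> J = (\<lambda>(\<sigma>, v).
     {(\<gamma> ** \<sigma> ** matrix_inv \<beta>, J \<beta> \<i> v) | \<gamma> \<beta>.
        \<gamma> \<in> lifts \<Gamma> \<and> \<beta> \<in> carrier SL2 \<and> moeb_sphere \<beta> None = None})"

definition total_X ::
    "mat2 set set \<Rightarrow> (mat2 \<Rightarrow> complex \<Rightarrow> 'v \<Rightarrow> 'v) \<Rightarrow> 'v set \<Rightarrow>
     ((complex \<times> 'v) set + (mat2 \<times> 'v) set) set" where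
  "total_X \<Gamma> J W = total_Y \<Gamma> J W <+> class_cusp \<Gamma> J ` (cusp_frames \<Gamma> \<times> W)"

definition proj_X :: "(complex \<times> 'v) set + (mat2 \<times> 'v) set \<Rightarrow> complex option set" where
  "proj_X e = (case e of Inl e \<Rightarrow> proj_Y e | Inr e \<Rightarrow> (\<lambda>x. moeb_sphere (fst x) None) ` e)"

definition precisely_invariant :: "mat2 set set \<Rightarrow> complex set \<Rightarrow> bool" where
  "precisely_invariant \<Gamma> U \<longleftrightarrow> open U \<and> U \<subseteq> \<bbbH> \<and>
     (\<exists>\<tau>\<in>U. \<forall>\<gamma>\<in>lifts \<Gamma>.
        if moeb \<gamma> \<tau> = \<tau> then moeb \<gamma> ` U = U else moeb \<gamma> ` U \<inter> U = {})"

definition cusp_radius :: "mat2 set set \<Rightarrow> mat2 \<Rightarrow> real \<Rightarrow> real \<Rightarrow> bool" where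
  "cusp_radius \<Gamma> \<sigma> \<omega> r \<longleftrightarrow> 0 < r \<and> r \<le> 1 \<and>
     (\<forall>\<gamma>\<in>lifts \<Gamma>. \<forall>\<tau>\<in>\<bbbH>. \<forall>\<tau>'\<in>\<bbbH>.
        norm (qpar \<omega> \<tau>) < r \<and> norm (qpar \<omega> \<tau>') < r \<and> moeb \<gamma> (moeb \<sigma> \<tau>) = moeb \<sigma> \<tau>' \<longrightarrow>
        moeb_sphere \<gamma> (moeb_sphere \<sigma> None) = moeb_sphere \<sigma> None)"

definition cusp_base :: "mat2 set set \<Rightarrow> mat2 \<Rightarrow> real \<Rightarrow> complex \<Rightarrow> complex option set" where
  "cusp_base \<Gamma> \<sigma> \<omega> q =
     orb \<Gamma> (if q = 0 then moeb_sphere \<sigma> None else Some (moeb \<sigma> (qlog \<omega> q)))"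

definition cusp_triv ::
    "mat2 set set \<Rightarrow> (mat2 \<Rightarrow> complex \<Rightarrow> 'v \<Rightarrow> 'v) \<Rightarrow> mat2 \<Rightarrow> real \<Rightarrow>
     complex \<times> 'v \<Rightarrow> (complex \<times> 'v) set + (mat2 \<times> 'v) set" where
  "cusp_triv \<Gamma> J \<sigma> \<omega> = (\<lambda>(q, v).
     if q = 0 then Inr (class_cusp \<Gamma> J (\<sigma>, v))
     else Inl (class_Y \<Gamma> J (bundle_act J \<sigma> (qlog \<omega> q, v))))"

definition atlas_Y ::
    "mat2 set set \<Rightarrow> (mat2 \<Rightarrow> complex \<Rightarrow> 'v \<Rightarrow> 'v) \<Rightarrow>
     ('v, complex option set, (complex \<times> 'v) set) bchart set" where
  "atlas_Y \<Gamma> J = {(U, \<lambda>\<tau>. orb \<Gamma> (Some \<tau>), class_Y \<Gamma> J) | U. precisely_invariant \<Gamma> U}"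

text \<open>All frames \<open>\<sigma>\<close> at all cusps are used: compatibility of the resulting charts expresses that
  the extension across the cusps does not depend on choices.\<close>

definition atlas_X ::
    "mat2 set set \<Rightarrow> (mat2 \<Rightarrow> complex \<Rightarrow> 'v \<Rightarrow> 'v) \<Rightarrow>
     ('v, complex option set, (complex \<times> 'v) set + (mat2 \<times> 'v) set) bchart set" where
  "atlas_X \<Gamma> J =
     {(U, p, Inl \<circ> P) | U p P. (U, p, P) \<in> atlas_Y \<Gamma> J} \<union>
     {(ball 0 r, cusp_base \<Gamma> \<sigma> \<omega>, cusp_triv \<Gamma> J \<sigma> \<omega>) | r \<sigma> \<omega>.
        \<sigma> \<in> cusp_frames \<Gamma> \<and> cusp_width \<Gamma> \<sigma> \<omega> \<and> cusp_radius \<Gamma> \<sigma> \<omega> r}"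


section \<open>Sections and automorphic forms\<close>

text \<open>A holomorphic section with values in \<open>W\<close> of the bundle on \<open>X\<close> defined by \<open>J\<close>: over \<open>Y\<close> it
  is an orbifold section, i.e. induced by a holomorphic section \<open>\<tau> \<mapsto> (\<tau>, f \<tau>)\<close> of \<open>\<bbbH> \<times> W\<close>
  invariant under the full preimage of \<open>\<Gamma>\<close>; near a cusp it is holomorphic in the trivialization
  over the \<open>q\<close>-disc.\<close>

definition holomorphic_section ::
    "'v::ab_group_add qvoa \<Rightarrow> mat2 set set \<Rightarrow> (mat2 \<Rightarrow> complex \<Rightarrow> 'v \<Rightarrow> 'v) \<Rightarrow> 'v set \<Rightarrow>
     (complex option set \<Rightarrow> (complex \<times> 'v) set + (mat2 \<times> 'v) set) \<Rightarrow> bool" where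
  "holomorphic_section A \<Gamma> J W s \<longleftrightarrow>
     s \<in> curve_X \<Gamma> \<rightarrow>\<^sub>E total_X \<Gamma> J W \<and> (\<forall>x\<in>curve_X \<Gamma>. proj_X (s x) = x) \<and>
     (\<exists>f. holomorphic_into A W \<bbbH> f \<and>
        (\<forall>\<gamma>\<in>lifts \<Gamma>. \<forall>\<tau>\<in>\<bbbH>. bundle_act J \<gamma> (\<tau>, f \<tau>) = (moeb \<gamma> \<tau>, f (moeb \<gamma> \<tau>))) \<and>
        (\<forall>\<tau>\<in>\<bbbH>. s (orb \<Gamma> (Some \<tau>)) = Inl (class_Y \<Gamma> J (\<tau>, f \<tau>)))) \<and>
     (\<forall>\<sigma>\<in>cusp_frames \<Gamma>. \<forall>\<omega>. cusp_width \<Gamma> \<sigma> \<omega> \<longrightarrow>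
        (\<exists>r g. 0 < r \<and> r \<le> 1 \<and> holomorphic_into A W (ball 0 r) g \<and>
           (\<forall>q\<in>ball 0 r. s (cusp_base \<Gamma> \<sigma> \<omega> q) = cusp_triv \<Gamma> J \<sigma> \<omega> (q, g q))))"

definition weight_sections ::
    "'v::ab_group_add qvoa \<Rightarrow> mat2 set set \<Rightarrow> int \<Rightarrow>
     (complex option set \<Rightarrow> (complex \<times> 'v) set + (mat2 \<times> 'v) set) set" where
  "weight_sections A \<Gamma> k = {s. \<exists>N. holomorphic_section A \<Gamma> (twisted_K A k) (filt A N) s}"

definition slash ::
    "'v::ab_group_add qvoa \<Rightarrow> int \<Rightarrow> mat2 \<Rightarrow> (complex \<Rightarrow> 'v) \<Rightarrow> complex \<Rightarrow> 'v" where
  "slash A k \<gamma> f \<tau> =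
     smul A (jfac \<gamma> \<tau> powi (- k) * of_real (det \<gamma> powr (of_int k / 2)))
       (inv_into UNIV (K A \<gamma> \<tau>) (f (moeb \<gamma> \<tau>)))"

text \<open>\<open>h \<in> W[[q\<^sub>\<omega>]]\<close>, with convergence on \<open>\<bbbH>\<close> in the finite-dimensional space \<open>W\<close>.\<close>

definition q_expansion :: "'v::ab_group_add qvoa \<Rightarrow> 'v set \<Rightarrow> real \<Rightarrow> (complex \<Rightarrow> 'v) \<Rightarrow> bool" where
  "q_expansion A W \<omega> h \<longleftrightarrow> h ` \<bbbH> \<subseteq> W \<and>
     (\<exists>a B. range a \<subseteq> W \<and> finite B \<and> basis_of A W B \<and>
        (\<forall>\<tau>\<in>\<bbbH>. \<forall>b\<in>B.
           (\<lambda>n. module.representation (smul A) B (a n) b * qpar \<omega> \<tau> ^ n) sums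
             module.representation (smul A) B (h \<tau>) b))"

definition stab :: "mat2 set set \<Rightarrow> complex \<Rightarrow> mat2 set" where
  "stab \<Gamma> \<tau> = {\<gamma> \<in> lifts \<Gamma>. moeb \<gamma> \<tau> = \<tau>}"

definition elliptic_points :: "mat2 set set \<Rightarrow> complex set" where
  "elliptic_points \<Gamma> = {\<tau> \<in> \<bbbH>. stab \<Gamma> \<tau> \<noteq> {mat 1, - mat 1}}"

text \<open>The forms are functions on \<open>\<bbbH>\<close>, made unique off \<open>\<bbbH>\<close> by \<^const>\<open>extensional\<close>.\<close>

definition automorphic_forms :: "'v::ab_group_add qvoa \<Rightarrow> mat2 set set \<Rightarrow> int \<Rightarrow> (complex \<Rightarrow> 'v) set" where
  "automorphic_forms A \<Gamma> k = {f \<in> extensional \<bbbH>. \<exists>N.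
     holomorphic_into A (filt A N) \<bbbH> f \<and>
     (\<forall>\<gamma>\<in>lifts \<Gamma>. \<forall>\<tau>\<in>\<bbbH>. slash A k \<gamma> f \<tau> = f \<tau>) \<and>
     (\<forall>\<sigma>\<in>cusp_frames \<Gamma>. \<forall>\<omega>. cusp_width \<Gamma> \<sigma> \<omega> \<longrightarrow>
        q_expansion A (filt A N) \<omega> (slash A k \<sigma> f)) \<and>
     (\<forall>\<tau>\<in>elliptic_points \<Gamma>. \<forall>\<gamma>. stab \<Gamma> \<tau> = generate SL2 {\<gamma>, - mat 1} \<longrightarrow>
        smul A (jfac \<gamma> \<tau> powi k) (K A \<gamma> \<tau> (f \<tau>)) = f \<tau>)}"

end

theory Submission
  imports Defs "HOL-Complex_Analysis.Conformal_Mappings" "HOL-Algebra.Multiplicative_Group"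
begin

text \<open>The cocycle identity for \<open>K\<close> rests on one commutation rule. Since \<open>L(1)\<close> lowers the degree by 1,
  \<open>x\<^bsup>L(0)\<^esup> e\<^bsup>aL(1)\<^esup> = e\<^bsup>(a/x)L(1)\<^esup> x\<^bsup>L(0)\<^esup>\<close> (\<open>power_L0_exp_L1\<close>), and exponentials of multiples of the
  locally nilpotent operator \<open>L(1)\<close> multiply by adding exponents (\<open>exp_L1_exp_L1\<close>). Hence
  \<open>K(\<gamma>,\<beta>\<tau>) K(\<beta>,\<tau>)\<close> is again an exponential times a power of \<open>L(0)\<close>. The two powers agree because
  \<open>j\<close> and the determinant are multiplicative, and the two exponents agree by an identity between
  the lower left entries and \<open>j\<close> (\<open>K_cocycle\<close>).

  The bundles are constructed for an arbitrary automorphy factor \<open>J\<close> on a finite-dimensional space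
  \<open>W\<close>, subject to the axioms of the locale \<open>automorphy\<close>; both \<open>K\<close> and its twists \<open>j\<^sup>kK\<close> on each step
  of the filtration by degree are instances. The geometry of \<open>\<Gamma>\<close> comes from its
  discreteness. Away from the cusps: only finitely many elements of \<open>\<Gamma>\<close> map some point of a bounded
  region, bounded away from the real axis, into that region (\<open>finite_returns\<close>). So every point has a
  neighbourhood that meets its translates only under the stabilizer, the finite stabilizer is the
  local group of an orbifold chart, and distinct orbits are separated. At a cusp moved to \<open>\<infinity>\<close>:
  an element of the stabilizer that is not a translation up to sign would, or its inverse would,
  contract the translations in it to arbitrarily small ones, so the stabilizer is generated by one
  translation \<open>T\<close> up to sign
  (\<open>conj_stab_no_hyperbolic\<close>, \<open>cusp_width_exists\<close>). An element \<open>\<gamma>\<close> with small lower left entry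
  \<open>c \<noteq> 0\<close> can be normalized by translations so that \<open>\<gamma>T\<gamma>\<^sup>-\<^sup>1\<close> is close to 1, so \<open>|c|\<close> is bounded below
  (\<open>cusp_lower_left_gap\<close>). As \<open>Im \<tau> \<sqdot> Im \<gamma>\<tau> \<le> 1/c\<^sup>2\<close>, a small enough disc in the parameter \<open>q\<close> embeds
  into the quotient, and discs at inequivalent cusps can be chosen disjoint.

  Away from the cusps each chart is a pullback of the quotient map along an injective holomorphic map
  into the upper half plane (\<open>uniformized\<close>), and all changes of charts are given by elements of
  \<open>SL\<^sub>2(\<real>)\<close> (\<open>uniformized_compatible\<close>). Two frames of the same cusp differ by an upper triangular
  matrix \<open>\<beta>\<close>, for which \<open>J(\<beta>,\<tau>)\<close> is constant in \<open>\<tau>\<close>, and their parameters differ by a rotation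
  (\<open>compatible_at_cusp\<close>).

  A section over the upper half plane is an invariant function \<open>f\<close>. In the trivialization at the
  cusp \<open>\<sigma>\<infinity>\<close> it becomes \<open>f\<parallel>\<sigma>\<close> as a function of \<open>q\<close>. That function is holomorphic on the whole
  punctured unit disc, so it extends holomorphically to \<open>q = 0\<close> exactly if \<open>f\<parallel>\<sigma>\<close> is a power series
  in \<open>q\<close> (\<open>q_expansion_iff\<close>). The value of the section at the cusp is the constant term, and the
  constant terms in different frames match in the fibre (\<open>cusp_value_change_frame\<close>). The condition
  at an elliptic point is invariance under its stabilizer. Thus sections and automorphic forms
  determine each other (\<open>form_of_section\<close>, \<open>section_of_form\<close>).\<close>

section \<open>Two-by-two matrices\<close>

definition mat22 :: "real \<Rightarrow> real \<Rightarrow> real \<Rightarrow> real \<Rightarrow> mat2" where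
  "mat22 a b c d = vector [vector [a, b], vector [c, d]]"

lemma mat22_nth [simp]:
  "mat22 a b c d $ 1 $ 1 = a" "mat22 a b c d $ 1 $ 2 = b"
  "mat22 a b c d $ 2 $ 1 = c" "mat22 a b c d $ 2 $ 2 = d"
  by (simp_all add: mat22_def)

lemma translation_mat22: "translation t = mat22 1 t 0 1"
  by (simp add: translation_def mat22_def)

lemma mat2_eq_iff:
  fixes A B :: mat2
  shows "A = B \<longleftrightarrow> A$1$1 = B$1$1 \<and> A$1$2 = B$1$2 \<and> A$2$1 = B$2$1 \<and> A$2$2 = B$2$2"
  by (auto simp: vec_eq_iff forall_2)

lemma mat2_mult_nth [simp]:
  fixes A B :: mat2
  shows "(A ** B)$1$1 = A$1$1 * B$1$1 + A$1$2 * B$2$1" "(A ** B)$1$2 = A$1$1 * B$1$2 + A$1$2 * B$2$2"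
    "(A ** B)$2$1 = A$2$1 * B$1$1 + A$2$2 * B$2$1" "(A ** B)$2$2 = A$2$1 * B$1$2 + A$2$2 * B$2$2"
  by (simp_all add: matrix_matrix_mult_def sum_2)

lemma mat_one_nth [simp]:
  "(mat 1 :: mat2)$1$1 = 1" "(mat 1 :: mat2)$1$2 = 0" "(mat 1 :: mat2)$2$1 = 0" "(mat 1 :: mat2)$2$2 = 1"
  by (simp_all add: mat_def)

lemma det_mat22 [simp]: "det (mat22 a b c d) = a * d - b * c"
  by (simp add: det_2)

lemma det_translation [simp]: "det (translation t) = 1"
  by (simp add: translation_mat22)

lemma det_minus_mat2 [simp]: "det (- A :: mat2) = det A"
  by (simp add: det_2)

lemma matrix_mult_minus_left [simp]: "(- A :: mat2) ** (B :: mat2) = - (A ** B)"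
  unfolding mat2_eq_iff mat2_mult_nth vector_uminus_component by simp

lemma matrix_mult_minus_right [simp]: "(A :: mat2) ** (- B :: mat2) = - (A ** B)"
  unfolding mat2_eq_iff mat2_mult_nth vector_uminus_component by simp

lemma mat2_diff_distrib:
  "(A :: mat2) ** (B - C :: mat2) = A ** B - A ** C" "((B - C) :: mat2) ** (A :: mat2) = B ** A - C ** A"
  by (simp_all add: mat2_eq_iff algebra_simps)

lemma minus_mat_one_neq [simp]: "mat 1 \<noteq> - (mat 1 :: mat2)" "- (mat 1 :: mat2) \<noteq> mat 1"
  by (auto simp: mat2_eq_iff)

lemma matrix_inv_props:
  assumes "det (\<gamma> :: mat2) \<noteq> 0"
  shows "\<gamma> ** matrix_inv \<gamma> = mat 1" "matrix_inv \<gamma> ** \<gamma> = mat 1"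
proof -
  have "invertible \<gamma>" using assms by (simp add: invertible_det_nz)
  then have "\<exists>B. \<gamma> ** B = mat 1 \<and> B ** \<gamma> = mat 1" by (simp add: invertible_def)
  from someI_ex[OF this] show "\<gamma> ** matrix_inv \<gamma> = mat 1" "matrix_inv \<gamma> ** \<gamma> = mat 1"
    by (simp_all add: matrix_inv_def)
qed

lemma det_matrix_inv: "det (\<gamma> :: mat2) \<noteq> 0 \<Longrightarrow> det (matrix_inv \<gamma>) = inverse (det \<gamma>)"
  by (metis det_I det_mul inverse_unique matrix_inv_props(1))

lemma mat2_cancel:
  assumes "det (\<gamma> :: mat2) \<noteq> 0"
  shows "matrix_inv \<gamma> ** (\<gamma> ** \<beta>) = \<beta>" "\<gamma> ** (matrix_inv \<gamma> ** \<beta>) = \<beta>"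
    "(\<beta> ** \<gamma>) ** matrix_inv \<gamma> = \<beta>" "(\<beta> ** matrix_inv \<gamma>) ** \<gamma> = \<beta>"
  by (metis assms matrix_inv_props matrix_mul_assoc matrix_mul_lid matrix_mul_rid)+

lemma matrix_inv_unique2:
  assumes "(\<gamma> :: mat2) ** \<beta> = mat 1" shows "matrix_inv \<gamma> = \<beta>"
proof -
  have "det \<gamma> * det \<beta> = 1" using assms by (metis det_I det_mul)
  then have "det \<gamma> \<noteq> 0" by auto
  then show ?thesis by (metis assms mat2_cancel(1) matrix_mul_rid)
qed

lemma matrix_inv_mult2:
  assumes "det (\<gamma> :: mat2) \<noteq> 0" "det (\<beta> :: mat2) \<noteq> 0"
  shows "matrix_inv (\<gamma> ** \<beta>) = matrix_inv \<beta> ** matrix_inv \<gamma>"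
  by (rule matrix_inv_unique2) (metis assms mat2_cancel(3) matrix_inv_props(1) matrix_mul_assoc)

lemma matrix_inv_inv2: "det (\<gamma> :: mat2) \<noteq> 0 \<Longrightarrow> matrix_inv (matrix_inv \<gamma>) = \<gamma>"
  by (rule matrix_inv_unique2) (simp add: matrix_inv_props)

lemma matrix_inv_one2 [simp]: "matrix_inv (mat 1 :: mat2) = mat 1"
  by (rule matrix_inv_unique2) simp

lemma matrix_inv_SL2:
  assumes "det (\<gamma> :: mat2) = 1"
  shows "matrix_inv \<gamma> = mat22 (\<gamma>$2$2) (- \<gamma>$1$2) (- \<gamma>$2$1) (\<gamma>$1$1)"
  by (rule matrix_inv_unique2) (use assms in \<open>auto simp: mat2_eq_iff det_2 algebra_simps\<close>)

lemma translation_add: "translation s ** translation t = translation (s + t)"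
  by (simp add: translation_mat22 mat2_eq_iff)

lemma translation_zero [simp]: "translation 0 = mat 1"
  by (simp add: translation_mat22 mat2_eq_iff)

lemma matrix_inv_translation: "matrix_inv (translation t) = translation (- t)"
  by (rule matrix_inv_unique2) (simp add: translation_add)

lemma SL2_iff [simp]: "\<gamma> \<in> carrier SL2 \<longleftrightarrow> det \<gamma> = 1"
  by (simp add: SL2_def)

lemma GL2p_iff [simp]: "\<gamma> \<in> carrier GL2p \<longleftrightarrow> det \<gamma> > 0"
  by (simp add: GL2p_def)

lemma SL2_mult [simp]: "\<gamma> \<otimes>\<^bsub>SL2\<^esub> \<beta> = \<gamma> ** \<beta>" and SL2_one [simp]: "\<one>\<^bsub>SL2\<^esub> = mat 1"
  by (simp_all add: SL2_def)

lemma group_GL2p: "group GL2p"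
proof (rule groupI)
  fix x assume "x \<in> carrier GL2p"
  then have "det x > 0" by simp
  then show "\<exists>y\<in>carrier GL2p. y \<otimes>\<^bsub>GL2p\<^esub> x = \<one>\<^bsub>GL2p\<^esub>"
    by (intro bexI[of _ "matrix_inv x"]) (auto simp: GL2p_def matrix_inv_props det_matrix_inv)
qed (auto simp: GL2p_def det_mul matrix_mul_assoc)

lemma group_SL2: "group SL2"
proof (rule groupI)
  fix x assume "x \<in> carrier SL2"
  then have "det x = 1" by simp
  then show "\<exists>y\<in>carrier SL2. y \<otimes>\<^bsub>SL2\<^esub> x = \<one>\<^bsub>SL2\<^esub>"
    by (intro bexI[of _ "matrix_inv x"]) (auto simp: matrix_inv_props det_matrix_inv)
qed (auto simp: det_mul matrix_mul_assoc)

lemma SL2_inv: "det \<gamma> = 1 \<Longrightarrow> inv\<^bsub>SL2\<^esub> \<gamma> = matrix_inv \<gamma>"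
  by (rule group.inv_equality[OF group_SL2]) (auto simp: matrix_inv_props det_matrix_inv)

section \<open>Moebius transformations\<close>

lemma upper_half_iff: "\<tau> \<in> \<bbbH> \<longleftrightarrow> Im \<tau> > 0"
  by (simp add: upper_half_def)

lemma i_in_upper_half [simp]: "\<i> \<in> \<bbbH>"
  by (simp add: upper_half_iff)

lemma open_upper_half [simp]: "open \<bbbH>"
  unfolding upper_half_def by (rule open_halfspace_Im_gt)

lemma jfac_nonzero:
  assumes "det \<gamma> \<noteq> 0" "\<tau> \<in> \<bbbH>" shows "jfac \<gamma> \<tau> \<noteq> 0"
proof
  assume *: "jfac \<gamma> \<tau> = 0"
  then have "Im (jfac \<gamma> \<tau>) = 0" by simp
  then have c: "\<gamma>$2$1 = 0" using assms(2) by (simp add: jfac_def upper_half_iff)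
  with * have "\<gamma>$2$2 = 0" by (simp add: jfac_def)
  with c assms(1) show False by (simp add: det_2)
qed

lemma jfac_mult_aux:
  assumes "jfac \<beta> \<tau> \<noteq> 0"
  shows "jfac (\<gamma> ** \<beta>) \<tau> = jfac \<gamma> (moeb \<beta> \<tau>) * jfac \<beta> \<tau>"
  using assms by (simp add: moeb_def jfac_def field_simps)

lemma jfac_mult:
  assumes "det \<beta> \<noteq> 0" "\<tau> \<in> \<bbbH>"
  shows "jfac (\<gamma> ** \<beta>) \<tau> = jfac \<gamma> (moeb \<beta> \<tau>) * jfac \<beta> \<tau>"
  using jfac_mult_aux[OF jfac_nonzero[OF assms]] .

lemma Im_moeb:
  assumes "det \<gamma> \<noteq> 0" "\<tau> \<in> \<bbbH>"
  shows "Im (moeb \<gamma> \<tau>) = det \<gamma> * Im \<tau> / (norm (jfac \<gamma> \<tau>))\<^sup>2"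
  by (simp add: moeb_def Im_divide jfac_def cmod_power2 det_2 algebra_simps)

lemma moeb_in_upper_half:
  assumes "det \<gamma> > 0" "\<tau> \<in> \<bbbH>" shows "moeb \<gamma> \<tau> \<in> \<bbbH>"
proof -
  have "norm (jfac \<gamma> \<tau>) > 0" using jfac_nonzero[of \<gamma> \<tau>] assms by simp
  then show ?thesis using Im_moeb[of \<gamma> \<tau>] assms by (simp add: upper_half_iff)
qed

lemma moeb_mult:
  assumes "det \<gamma> > 0" "det \<beta> > 0" "\<tau> \<in> \<bbbH>"
  shows "moeb (\<gamma> ** \<beta>) \<tau> = moeb \<gamma> (moeb \<beta> \<tau>)"
proof -
  have j: "jfac \<beta> \<tau> \<noteq> 0" using jfac_nonzero[of \<beta> \<tau>] assms by simp
  have "jfac \<gamma> (moeb \<beta> \<tau>) \<noteq> 0"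
    using jfac_nonzero[of \<gamma> "moeb \<beta> \<tau>"] moeb_in_upper_half assms by auto
  moreover have "(\<gamma>$1$1 * moeb \<beta> \<tau> + \<gamma>$1$2) * jfac \<beta> \<tau> = (\<gamma> ** \<beta>)$1$1 * \<tau> + (\<gamma> ** \<beta>)$1$2"
    using j by (simp add: moeb_def jfac_def field_simps)
  ultimately show ?thesis
    using j jfac_mult_aux[OF j, of \<gamma>] unfolding moeb_def[of "\<gamma> ** \<beta>"] moeb_def[of \<gamma>]
    by (metis mult_divide_mult_cancel_right)
qed

lemma moeb_one [simp]: "moeb (mat 1) \<tau> = \<tau>" and moeb_minus_one [simp]: "moeb (- mat 1) \<tau> = \<tau>"
  by (simp_all add: moeb_def jfac_def)

lemma jfac_one [simp]: "jfac (mat 1) \<tau> = 1" and jfac_minus_one [simp]: "jfac (- mat 1) \<tau> = -1"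
  by (simp_all add: jfac_def)

lemma jfac_minus: "jfac (- \<gamma>) \<tau> = - jfac \<gamma> \<tau>"
  by (simp add: jfac_def)

lemma moeb_minus: "moeb (- \<gamma>) \<tau> = moeb \<gamma> \<tau>"
  unfolding moeb_def jfac_minus by (simp add: divide_simps)

lemma moeb_translation [simp]: "moeb (translation t) \<tau> = \<tau> + of_real t"
  by (simp add: moeb_def jfac_def translation_mat22)

lemma jfac_translation [simp]: "jfac (translation t) \<tau> = 1"
  by (simp add: jfac_def translation_mat22)

lemma moeb_inverse:
  assumes "det \<gamma> = 1" "\<tau> \<in> \<bbbH>"
  shows "moeb (matrix_inv \<gamma>) (moeb \<gamma> \<tau>) = \<tau>" "moeb \<gamma> (moeb (matrix_inv \<gamma>) \<tau>) = \<tau>"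
  using assms moeb_mult[of "matrix_inv \<gamma>" \<gamma> \<tau>] moeb_mult[of \<gamma> "matrix_inv \<gamma>" \<tau>]
  by (simp_all add: det_matrix_inv matrix_inv_props)

lemma det1_matrix_inv [simp]: "det (\<gamma>::mat2) = 1 \<Longrightarrow> det (matrix_inv \<gamma>) = 1"
  by (simp add: det_matrix_inv)

lemma holomorphic_jfac [holomorphic_intros]:
  "f holomorphic_on S \<Longrightarrow> (\<lambda>z. jfac \<gamma> (f z)) holomorphic_on S"
  unfolding jfac_def by (intro holomorphic_intros)

lemma holomorphic_moeb [holomorphic_intros]:
  assumes "f holomorphic_on S" "f ` S \<subseteq> \<bbbH>" "det \<gamma> \<noteq> 0"
  shows "(\<lambda>z. moeb \<gamma> (f z)) holomorphic_on S"
  unfolding moeb_def using assms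
  by (intro holomorphic_intros) (use jfac_nonzero in auto)

lemma inj_on_moeb: assumes "det \<gamma> = 1" shows "inj_on (moeb \<gamma>) \<bbbH>"
  by (metis assms inj_on_def moeb_inverse(1))

lemma real_upper_triangular_moeb:
  assumes "\<gamma>$2$1 = 0" "det \<gamma> = 1"
  shows "moeb \<gamma> \<tau> = of_real ((\<gamma>$1$1)\<^sup>2) * \<tau> + of_real (\<gamma>$1$1 * \<gamma>$1$2)"
proof -
  have ad: "\<gamma>$1$1 * \<gamma>$2$2 = 1" using assms by (simp add: det_2)
  then have "\<gamma>$2$2 \<noteq> 0" by auto
  moreover have "complex_of_real (\<gamma>$1$1) * of_real (\<gamma>$2$2) = 1" using ad by (metis of_real_1 of_real_mult)
  ultimately show ?thesis using assms(1)
    by (simp add: moeb_def jfac_def field_simps power2_eq_square)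
qed

lemma moeb_sphere_Some: "\<tau> \<in> \<bbbH> \<Longrightarrow> det \<gamma> \<noteq> 0 \<Longrightarrow> moeb_sphere \<gamma> (Some \<tau>) = Some (moeb \<gamma> \<tau>)"
  by (simp add: moeb_sphere_def jfac_nonzero)

lemma moeb_sphere_None_iff: "moeb_sphere \<gamma> None = None \<longleftrightarrow> \<gamma>$2$1 = 0"
  by (simp add: moeb_sphere_def)

lemma moeb_sphere_mult:
  assumes "det \<gamma> \<noteq> 0" "det \<beta> \<noteq> 0"
  shows "moeb_sphere (\<gamma> ** \<beta>) s = moeb_sphere \<gamma> (moeb_sphere \<beta> s)"
proof (cases s)
  case None
  show ?thesis
  proof (cases "\<beta>$2$1 = 0")
    case True
    then have "\<beta>$1$1 \<noteq> 0" using assms by (auto simp: det_2)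
    with True None show ?thesis by (auto simp: moeb_sphere_def)
  next
    case c: False
    have j: "jfac \<gamma> (of_real (\<beta>$1$1 / \<beta>$2$1)) = of_real ((\<gamma> ** \<beta>)$2$1 / \<beta>$2$1)"
      using c by (simp add: jfac_def field_simps)
    show ?thesis
    proof (cases "(\<gamma> ** \<beta>)$2$1 = 0")
      case True
      then show ?thesis using c j None by (simp add: moeb_sphere_def)
    next
      case False
      have "moeb \<gamma> (of_real (\<beta>$1$1 / \<beta>$2$1)) = of_real ((\<gamma> ** \<beta>)$1$1 / (\<gamma> ** \<beta>)$2$1)"
        unfolding moeb_def j using c by (simp add: add_divide_distrib[symmetric] divide_add_eq_iff mult.commute)
      moreover have "jfac \<gamma> (of_real (\<beta>$1$1 / \<beta>$2$1)) \<noteq> 0"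
        unfolding j using c False by (simp del: mat2_mult_nth of_real_add)
      ultimately show ?thesis using c None False by (simp add: moeb_sphere_def del: mat2_mult_nth)
    qed
  qed
next
  case (Some z)
  define n where "n = of_real (\<beta>$1$1) * z + of_real (\<beta>$1$2)"
  have jn: "jfac (\<gamma> ** \<beta>) z = of_real (\<gamma>$2$1) * n + of_real (\<gamma>$2$2) * jfac \<beta> z"
    by (simp add: jfac_def n_def algebra_simps)
  have nn: "of_real ((\<gamma> ** \<beta>)$1$1) * z + of_real ((\<gamma> ** \<beta>)$1$2) = of_real (\<gamma>$1$1) * n + of_real (\<gamma>$1$2) * jfac \<beta> z"
    by (simp add: jfac_def n_def algebra_simps)
  show ?thesis
  proof (cases "jfac \<beta> z = 0")
    case True
    have "n \<noteq> 0"
    proof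
      assume "n = 0"
      have "complex_of_real (det \<beta>) = of_real (\<beta>$1$1) * jfac \<beta> z - of_real (\<beta>$2$1) * n"
        by (simp add: det_2 jfac_def n_def algebra_simps)
      with True \<open>n = 0\<close> assms show False by simp
    qed
    then show ?thesis using True Some jn nn
      by (auto simp: moeb_sphere_def moeb_def[of "\<gamma> ** \<beta>"] simp del: mat2_mult_nth)
  next
    case False
    have m: "moeb \<beta> z = n / jfac \<beta> z" by (simp add: moeb_def n_def)
    have j2: "jfac \<gamma> (moeb \<beta> z) = jfac (\<gamma> ** \<beta>) z / jfac \<beta> z"
      using jfac_mult_aux[OF False, of \<gamma>] False by simp
    have "moeb (\<gamma> ** \<beta>) z = moeb \<gamma> (moeb \<beta> z)" if "jfac (\<gamma> ** \<beta>) z \<noteq> 0"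
      unfolding moeb_def[of \<gamma>] j2 unfolding moeb_def[of "\<gamma> ** \<beta>"] nn m using False that by (simp add: field_simps)
    then show ?thesis using Some False j2 by (simp add: moeb_sphere_def)
  qed
qed

lemma moeb_sphere_one [simp]: "moeb_sphere (mat 1) s = s"
  by (simp add: moeb_sphere_def split: option.split)

lemma moeb_sphere_inverse:
  assumes "det \<gamma> = 1"
  shows "moeb_sphere (matrix_inv \<gamma>) (moeb_sphere \<gamma> s) = s" "moeb_sphere \<gamma> (moeb_sphere (matrix_inv \<gamma>) s) = s"
  using assms moeb_sphere_mult[of "matrix_inv \<gamma>" \<gamma> s] moeb_sphere_mult[of \<gamma> "matrix_inv \<gamma>" s]
  by (simp_all add: matrix_inv_props)

lemma moeb_sphere_real:
  assumes "s \<in> insert None (Some ` \<real>)"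
  shows "moeb_sphere \<gamma> s \<in> insert None (Some ` \<real>)"
proof (cases s)
  case None
  then show ?thesis by (simp add: moeb_sphere_def)
next
  case (Some z)
  with assms obtain x where "z = of_real x" by (auto elim!: Reals_cases)
  then have "moeb \<gamma> z = of_real ((\<gamma>$1$1 * x + \<gamma>$1$2) / (\<gamma>$2$1 * x + \<gamma>$2$2))"
    by (simp add: moeb_def jfac_def)
  then have "moeb \<gamma> z \<in> \<real>" by (metis Reals_of_real)
  then show ?thesis using Some by (simp add: moeb_sphere_def)
qed

section \<open>Discrete subgroups\<close>

lemma coset_pm_one: "{mat 1, - mat 1} #>\<^bsub>SL2\<^esub> \<gamma> = {\<gamma>, - \<gamma>}"
  by (auto simp: r_coset_def)

lemma normal_pm_one: "{mat 1, - mat 1} \<lhd> SL2"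
proof (rule group.normalI[OF group_SL2])
  show "subgroup {mat 1, - mat 1} SL2"
    by (rule group.subgroupI[OF group_SL2]) (auto simp: SL2_inv matrix_inv_unique2[of "- mat 1" "- mat 1"])
  show "\<forall>x\<in>carrier SL2. {mat 1, - mat 1} #>\<^bsub>SL2\<^esub> x = x <#\<^bsub>SL2\<^esub> {mat 1, - mat 1}"
    by (auto simp: r_coset_def l_coset_def)
qed

lemma group_PSL2: "group PSL2"
  unfolding PSL2_def by (rule normal.factorgroup_is_group[OF normal_pm_one])

lemma carrier_PSL2: "g \<in> carrier PSL2 \<longleftrightarrow> (\<exists>\<gamma>. det \<gamma> = 1 \<and> g = {\<gamma>, - \<gamma>})"
  by (auto simp: PSL2_def carrier_FactGroup coset_pm_one image_iff)

lemma PSL2_one: "\<one>\<^bsub>PSL2\<^esub> = {mat 1, - mat 1}"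
  by (simp add: PSL2_def)

lemma PSL2_mult: "{\<gamma>, - \<gamma>} \<otimes>\<^bsub>PSL2\<^esub> {\<beta>, - \<beta>} = {\<gamma> ** \<beta>, - (\<gamma> ** \<beta>)}"
  by (auto simp: PSL2_def set_mult_def)

locale fuchsian =
  fixes \<Gamma> :: "mat2 set set"
  assumes subgroup_PSL2: "subgroup \<Gamma> PSL2" and discrete_lifts: "discrete (lifts \<Gamma>)"
begin

lemma elementE:
  assumes "g \<in> \<Gamma>" "\<gamma> \<in> g" shows "det \<gamma> = 1 \<and> g = {\<gamma>, - \<gamma>}"
proof -
  have "g \<in> carrier PSL2" using assms(1) subgroup.subset[OF subgroup_PSL2] by blast
  then obtain \<delta> where "det \<delta> = 1" "g = {\<delta>, - \<delta>}" by (auto simp: carrier_PSL2)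
  with assms(2) show ?thesis by auto
qed

lemma lifts_iff: "\<gamma> \<in> lifts \<Gamma> \<longleftrightarrow> det \<gamma> = 1 \<and> {\<gamma>, - \<gamma>} \<in> \<Gamma>"
  unfolding lifts_def using elementE by (metis Union_iff insertI1)

lemma lifts_det [simp]: "\<gamma> \<in> lifts \<Gamma> \<Longrightarrow> det \<gamma> = 1"
  by (simp add: lifts_iff)

lemma lifts_one [simp]: "mat 1 \<in> lifts \<Gamma>"
  using subgroup.one_closed[OF subgroup_PSL2] by (simp add: lifts_iff PSL2_one)

lemma lifts_minus: assumes "\<gamma> \<in> lifts \<Gamma>" shows "- \<gamma> \<in> lifts \<Gamma>"
proof -
  have "{- \<gamma>, - (- \<gamma>)} = {\<gamma>, - \<gamma>}" by auto
  then show ?thesis using assms unfolding lifts_iff by simp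
qed

lemma lifts_minus_iff [simp]: "- \<gamma> \<in> lifts \<Gamma> \<longleftrightarrow> \<gamma> \<in> lifts \<Gamma>"
  using lifts_minus by fastforce

lemma lifts_mult: "\<gamma> \<in> lifts \<Gamma> \<Longrightarrow> \<beta> \<in> lifts \<Gamma> \<Longrightarrow> \<gamma> ** \<beta> \<in> lifts \<Gamma>"
  using subgroup.m_closed[OF subgroup_PSL2, of "{\<gamma>, - \<gamma>}" "{\<beta>, - \<beta>}"] by (simp add: lifts_iff det_mul PSL2_mult)

lemma lifts_inv: assumes "\<gamma> \<in> lifts \<Gamma>" shows "matrix_inv \<gamma> \<in> lifts \<Gamma>"
proof -
  let ?g = "{\<gamma>, - \<gamma>}"
  have g: "?g \<in> \<Gamma>" "det \<gamma> = 1" using assms by (auto simp: lifts_iff)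
  then have i: "inv\<^bsub>PSL2\<^esub> ?g \<in> \<Gamma>" using subgroup.m_inv_closed[OF subgroup_PSL2] by blast
  then have "inv\<^bsub>PSL2\<^esub> ?g \<in> carrier PSL2" using subgroup.subset[OF subgroup_PSL2] by blast
  then obtain \<delta> where d: "det \<delta> = 1" "inv\<^bsub>PSL2\<^esub> ?g = {\<delta>, - \<delta>}"
    using carrier_PSL2 by blast
  have "?g \<otimes>\<^bsub>PSL2\<^esub> inv\<^bsub>PSL2\<^esub> ?g = \<one>\<^bsub>PSL2\<^esub>"
    using g carrier_PSL2 by (intro group.r_inv[OF group_PSL2]) blast
  then have "{\<gamma> ** \<delta>, - (\<gamma> ** \<delta>)} = {mat 1, - mat 1}" by (simp add: d PSL2_mult PSL2_one)
  then have "\<gamma> ** \<delta> = mat 1 \<or> \<gamma> ** - \<delta> = mat 1" by (auto simp: doubleton_eq_iff)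
  then have "matrix_inv \<gamma> = \<delta> \<or> matrix_inv \<gamma> = - \<delta>" using matrix_inv_unique2 by blast
  moreover have "\<delta> \<in> lifts \<Gamma>" using i d by (simp add: lifts_iff)
  ultimately show ?thesis by auto
qed

end

lemma norm_mat2_le: "norm (A :: mat2) \<le> \<bar>A$1$1\<bar> + \<bar>A$1$2\<bar> + \<bar>A$2$1\<bar> + \<bar>A$2$2\<bar>"
proof -
  have r: "norm (x :: real^2) \<le> \<bar>x$1\<bar> + \<bar>x$2\<bar>" for x
    using norm_le_l1_cart[of x] by (simp add: sum_2)
  have "norm A \<le> (\<Sum>i\<in>UNIV. norm (A$i))" unfolding norm_vec_def by (rule L2_set_le_sum) simp
  also have "\<dots> = norm (A$1) + norm (A$2)" by (simp add: sum_2)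
  finally show ?thesis using r[of "A$1"] r[of "A$2"] by linarith
qed

lemma entry_le_norm_mat2: "\<bar>(A :: mat2)$i$j\<bar> \<le> norm A"
  by (metis Finite_Cartesian_Product.norm_nth_le order_trans real_norm_def)

text \<open>A bound on the maximum norm. On \<open>SL\<^sub>2(\<real>)\<close> it is preserved by inversion, which only permutes the entries up to
  sign.\<close>

definition entries_le :: "mat2 \<Rightarrow> real \<Rightarrow> bool" where
  "entries_le A e \<longleftrightarrow> \<bar>A$1$1\<bar> \<le> e \<and> \<bar>A$1$2\<bar> \<le> e \<and> \<bar>A$2$1\<bar> \<le> e \<and> \<bar>A$2$2\<bar> \<le> e"

lemma entries_le_mult:
  assumes "entries_le A a" "entries_le B b"
  shows "entries_le (A ** B) (2 * (a * b))"
proof -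
  have a: "0 \<le> a" using assms(1) unfolding entries_le_def by linarith
  have *: "\<bar>x * y + z * w\<bar> \<le> 2 * (a * b)" if "\<bar>x\<bar> \<le> a" "\<bar>z\<bar> \<le> a" "\<bar>y\<bar> \<le> b" "\<bar>w\<bar> \<le> b" for x y z w
  proof -
    have "\<bar>x * y\<bar> \<le> a * b" "\<bar>z * w\<bar> \<le> a * b" using that a by (auto simp: abs_mult intro!: mult_mono)
    then show ?thesis by linarith
  qed
  show ?thesis using assms unfolding entries_le_def by (auto intro!: *)
qed

lemma entries_le_inv: "det A = 1 \<Longrightarrow> entries_le A a \<Longrightarrow> entries_le (matrix_inv A) a"
  by (simp add: entries_le_def matrix_inv_SL2)

lemma entries_le_exists: "\<exists>m>0. entries_le A m"
  by (intro exI[of _ "1 + norm A"]) (auto simp: entries_le_def intro!: order_trans[OF entry_le_norm_mat2] add_pos_nonneg)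

lemma entries_le_mono: "entries_le A a \<Longrightarrow> a \<le> b \<Longrightarrow> entries_le A b"
  by (auto simp: entries_le_def)

text \<open>The imaginary part of \<open>cz + d\<close> controls \<open>c\<close>, and then \<open>d\<close> is a difference of bounded terms.\<close>

lemma linear_form_bound:
  assumes "norm (of_real c * z + of_real d) \<le> P" "y0 \<le> Im z" "norm z \<le> R" "0 < y0"
  shows "\<bar>c\<bar> \<le> P / y0" "\<bar>d\<bar> \<le> P + P / y0 * R"
proof -
  let ?w = "of_real c * z + of_real d"
  have P: "0 \<le> P" using assms(1) norm_ge_zero order_trans by blast
  have "\<bar>c\<bar> * Im z = \<bar>Im ?w\<bar>" using assms by (simp add: abs_mult)
  also have "\<dots> \<le> P" using abs_Im_le_cmod assms(1) order_trans by blast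
  finally have "\<bar>c\<bar> * y0 \<le> P" using assms(2) by (meson abs_ge_zero mult_left_mono order_trans)
  then show c: "\<bar>c\<bar> \<le> P / y0" using assms(4) by (simp add: field_simps)
  have "\<bar>d\<bar> = norm (?w - of_real c * z)" by simp
  also have "\<dots> \<le> norm ?w + \<bar>c\<bar> * norm z" by (metis norm_mult norm_of_real norm_triangle_ineq4)
  also have "\<dots> \<le> P + P / y0 * R"
    using assms c P by (intro add_mono mult_mono) auto
  finally show "\<bar>d\<bar> \<le> P + P / y0 * R" .
qed

context fuchsian begin

lemma discrete_at_one:
  obtains e where "e > 0" "\<And>\<gamma>. \<gamma> \<in> lifts \<Gamma> \<Longrightarrow> entries_le (\<gamma> - mat 1) e \<Longrightarrow> \<gamma> = mat 1"
proof -
  have "mat 1 isolated_in lifts \<Gamma>" using discrete_lifts by (auto simp: discrete_def)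
  then obtain e where e: "e > 0" "\<And>\<gamma>. \<gamma> \<in> lifts \<Gamma> \<Longrightarrow> dist (mat 1) \<gamma> < e \<Longrightarrow> \<gamma> = mat 1"
    unfolding isolated_in_dist_Ex_iff by blast
  \<comment> \<open>The norm is at most four times the largest entry, so \<open>e/5\<close> keeps the distance below \<open>e\<close>.\<close>
  have "\<gamma> = mat 1" if "\<gamma> \<in> lifts \<Gamma>" "entries_le (\<gamma> - mat 1) (e/5)" for \<gamma>
  proof -
    have "norm (\<gamma> - mat 1) \<le> 4 * (e/5)"
      using norm_mat2_le[of "\<gamma> - mat 1"] that(2) unfolding entries_le_def by linarith
    then show ?thesis using e that(1) by (simp add: dist_norm norm_minus_commute)
  qed
  with e(1) that[of "e/5"] show ?thesis by simp
qed

text \<open>If \<open>\<gamma>\<close> and \<open>\<delta>\<close> have bounded entries and are close, then \<open>\<gamma>\<^sup>-\<^sup>1\<delta>\<close> is close to 1, hence equal to 1. So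
  the set is uniformly discrete, and an infinite bounded set would have a limit point.\<close>

lemma finite_bounded_entries: "finite {\<gamma> \<in> lifts \<Gamma>. entries_le \<gamma> M}"
proof (rule ccontr)
  let ?S = "{\<gamma> \<in> lifts \<Gamma>. entries_le \<gamma> M}"
  assume inf: "infinite ?S"
  then have "?S \<noteq> {}" by (metis finite.emptyI)
  then have M: "M \<ge> 0" by (auto simp: entries_le_def)
  have "norm \<gamma> \<le> 4 * M" if "\<gamma> \<in> ?S" for \<gamma>
    using that norm_mat2_le[of \<gamma>] unfolding entries_le_def by auto
  then have "bounded ?S" by (rule boundedI)
  with inf obtain l where l: "l islimpt ?S" using bounded_infinite_imp_islimpt by blast
  obtain e where e: "e > 0" "\<And>\<gamma>. \<gamma> \<in> lifts \<Gamma> \<Longrightarrow> entries_le (\<gamma> - mat 1) e \<Longrightarrow> \<gamma> = mat 1"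
    using discrete_at_one by blast
  define d where "d = e / (2 * M + 1)"
  have d: "d > 0" using e M by (simp add: d_def)
  have d2: "2 * (M * d) \<le> e" using M e by (simp add: d_def field_simps)
  have "\<delta> = \<gamma>" if "\<gamma> \<in> ?S" "\<delta> \<in> ?S" "dist \<delta> \<gamma> < d" for \<gamma> \<delta>
  proof -
    have "entries_le (\<delta> - \<gamma>) d"
      using that(3) entry_le_norm_mat2[of "\<delta> - \<gamma>"] unfolding entries_le_def dist_norm by (meson less_imp_le order_trans)
    moreover have g: "det \<gamma> = 1" "\<gamma> \<in> lifts \<Gamma>" "entries_le (matrix_inv \<gamma>) M"
      using that entries_le_inv by auto
    ultimately have "entries_le (matrix_inv \<gamma> ** (\<delta> - \<gamma>)) e"
      using entries_le_mult entries_le_mono d2 by blast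
    moreover have "matrix_inv \<gamma> ** (\<delta> - \<gamma>) = matrix_inv \<gamma> ** \<delta> - mat 1"
      using g by (metis matrix_inv_props(2) mat2_diff_distrib(1) one_neq_zero)
    ultimately have "matrix_inv \<gamma> ** \<delta> = mat 1"
      using e(2) g that lifts_mult lifts_inv by auto
    then show ?thesis using g(1) by (metis mat2_cancel(2) matrix_mul_rid one_neq_zero)
  qed
  then have "\<not> l islimpt ?S" using discrete_imp_not_islimpt[OF d] by blast
  with l show False by blast
qed

text \<open>If \<open>z\<close> and \<open>\<gamma>z\<close> lie in the region, then \<open>|j(\<gamma>,z)|\<^sup>2 = Im z / Im \<gamma>z\<close> is bounded. This bounds the
  lower row of \<open>\<gamma>\<close>, and the upper row is bounded since \<open>az + b = \<gamma>z \<sqdot> j(\<gamma>,z)\<close>.\<close>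

lemma finite_returns:
  assumes "y0 > 0"
  shows "finite {\<gamma> \<in> lifts \<Gamma>. \<exists>z. y0 \<le> Im z \<and> norm z \<le> R \<and> y0 \<le> Im (moeb \<gamma> z) \<and> norm (moeb \<gamma> z) \<le> R}"
proof -
  define P where "P = R / y0 + 1"
  define M where "M = (P + P / y0 * R) + P / y0 + ((R * P) + (R * P) / y0 * R) + (R * P) / y0"
  have "entries_le \<gamma> M" if g: "\<gamma> \<in> lifts \<Gamma>" and z: "y0 \<le> Im z" "norm z \<le> R" "y0 \<le> Im (moeb \<gamma> z)" "norm (moeb \<gamma> z) \<le> R" for \<gamma> z
  proof -
    have zH: "z \<in> \<bbbH>" using z assms by (simp add: upper_half_iff)
    have R: "R > 0" using z assms abs_Im_le_cmod[of z] by linarith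
    have P1: "P \<ge> 1" using R assms by (simp add: P_def)
    have d: "det \<gamma> = 1" using g by simp
    have jn: "norm (jfac \<gamma> z) > 0" using jfac_nonzero[of \<gamma> z] d zH by simp
    have "Im (moeb \<gamma> z) = Im z / (norm (jfac \<gamma> z))\<^sup>2" using Im_moeb[of \<gamma> z] d zH by simp
    then have "y0 * (norm (jfac \<gamma> z))\<^sup>2 \<le> Im z" using z(3) jn by (simp add: field_simps)
    also have "\<dots> \<le> R" using z(2) abs_Im_le_cmod[of z] by linarith
    finally have "(norm (jfac \<gamma> z))\<^sup>2 \<le> R / y0" using assms by (simp add: field_simps)
    also have "\<dots> \<le> P" by (simp add: P_def)
    also have "\<dots> \<le> P\<^sup>2" using P1 by (simp add: power2_eq_square)
    finally have j: "norm (jfac \<gamma> z) \<le> P" using P1 power2_le_imp_le by force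
    have "of_real (\<gamma>$1$1) * z + of_real (\<gamma>$1$2) = moeb \<gamma> z * jfac \<gamma> z" using jn by (simp add: moeb_def)
    then have "norm (of_real (\<gamma>$1$1) * z + of_real (\<gamma>$1$2)) = norm (moeb \<gamma> z) * norm (jfac \<gamma> z)" by (simp add: norm_mult)
    also have "\<dots> \<le> R * P" using j z P1 R by (intro mult_mono) auto
    finally have n: "norm (of_real (\<gamma>$1$1) * z + of_real (\<gamma>$1$2)) \<le> R * P" .
    note b = linear_form_bound[OF j[unfolded jfac_def] z(1,2) assms] linear_form_bound[OF n z(1,2) assms]
    have "0 \<le> P + P / y0 * R" "0 \<le> P / y0" "0 \<le> (R * P) + (R * P) / y0 * R" "0 \<le> (R * P) / y0"
      using P1 R assms by auto
    with b show ?thesis unfolding entries_le_def M_def by linarith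
  qed
  then have "{\<gamma> \<in> lifts \<Gamma>. \<exists>z. y0 \<le> Im z \<and> norm z \<le> R \<and> y0 \<le> Im (moeb \<gamma> z) \<and> norm (moeb \<gamma> z) \<le> R}
      \<subseteq> {\<gamma> \<in> lifts \<Gamma>. entries_le \<gamma> M}" by blast
  then show ?thesis using finite_bounded_entries finite_subset by blast
qed

text \<open>Up to finitely many, the elements of \<open>\<Gamma>\<close> do not map a fixed disc at \<open>\<tau>\<close> to a fixed disc at \<open>\<tau>'\<close>.
  Each of the remaining ones with \<open>\<gamma>\<tau> \<noteq> \<tau>'\<close> is excluded by continuity after shrinking the discs. The
  case \<open>\<tau> = \<tau>'\<close> gives the charts, and that of distinct orbits the Hausdorff property.\<close>

lemma orbit_separation:
  assumes "\<tau> \<in> \<bbbH>" "\<tau>' \<in> \<bbbH>"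
  obtains r where "r > 0"
    "\<And>\<gamma> z. \<gamma> \<in> lifts \<Gamma> \<Longrightarrow> moeb \<gamma> \<tau> \<noteq> \<tau>' \<Longrightarrow> z \<in> ball \<tau> r \<Longrightarrow> moeb \<gamma> z \<notin> ball \<tau>' r"
proof -
  define y0 where "y0 = min (Im \<tau>) (Im \<tau>') / 2"
  define R where "R = max (norm \<tau>) (norm \<tau>') + y0"
  have y0: "y0 > 0" using assms by (simp add: y0_def upper_half_iff)
  define F where "F = {\<gamma> \<in> lifts \<Gamma>. \<exists>z. y0 \<le> Im z \<and> norm z \<le> R \<and> y0 \<le> Im (moeb \<gamma> z) \<and> norm (moeb \<gamma> z) \<le> R}"
  have F: "finite F" unfolding F_def by (rule finite_returns[OF y0])
  have inb: "y0 \<le> Im z \<and> norm z \<le> R" if "z \<in> ball \<tau> y0 \<union> ball \<tau>' y0" for z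
  proof -
    have "norm (\<tau> - z) < y0 \<or> norm (\<tau>' - z) < y0" using that by (simp add: dist_norm)
    then obtain t where t: "t \<in> {\<tau>, \<tau>'}" "norm (t - z) < y0" by (metis insertCI)
    have "\<bar>Im (t - z)\<bar> < y0" using t(2) abs_Im_le_cmod le_less_trans by blast
    moreover have "norm z \<le> norm t + norm (t - z)" by (metis norm_minus_commute norm_triangle_sub)
    moreover have "2 * y0 \<le> Im t" "norm t + y0 \<le> R" using t(1) by (auto simp: y0_def R_def)
    ultimately show ?thesis using t(2) by simp
  qed
  have ev: "\<forall>\<^sub>F r in at_right 0. \<forall>\<gamma>\<in>F. moeb \<gamma> \<tau> \<noteq> \<tau>' \<longrightarrow> (\<forall>z\<in>ball \<tau> r. moeb \<gamma> z \<notin> ball \<tau>' r)"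
  proof (rule eventually_ball_finite[OF F], intro ballI)
    fix \<gamma> assume "\<gamma> \<in> F"
    then have d: "det \<gamma> = 1" by (simp add: F_def)
    show "\<forall>\<^sub>F r in at_right 0. moeb \<gamma> \<tau> \<noteq> \<tau>' \<longrightarrow> (\<forall>z\<in>ball \<tau> r. moeb \<gamma> z \<notin> ball \<tau>' r)"
    proof (cases "moeb \<gamma> \<tau> = \<tau>'")
      case False
      define e where "e = dist (moeb \<gamma> \<tau>) \<tau>' / 2"
      have e: "e > 0" using False by (simp add: e_def)
      have "continuous_on \<bbbH> (moeb \<gamma>)"
        using holomorphic_moeb[of "\<lambda>z. z" \<bbbH> \<gamma>] d by (auto intro: holomorphic_on_imp_continuous_on)
      then obtain \<delta> where \<delta>: "\<delta> > 0" "\<And>z. z \<in> \<bbbH> \<Longrightarrow> dist z \<tau> < \<delta> \<Longrightarrow> dist (moeb \<gamma> z) (moeb \<gamma> \<tau>) < e"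
        using assms(1) e unfolding continuous_on_iff by metis
      have "moeb \<gamma> z \<notin> ball \<tau>' r" if "0 < r" "r < Min {\<delta>, e, y0}" "z \<in> ball \<tau> r" for r z
      proof
        assume m: "moeb \<gamma> z \<in> ball \<tau>' r"
        have "z \<in> \<bbbH>" using inb[of z] that y0 by (auto simp: upper_half_iff)
        moreover have "dist z \<tau> < \<delta>" using that by (simp add: dist_commute)
        ultimately have "dist (moeb \<gamma> z) (moeb \<gamma> \<tau>) < e" by (rule \<delta>(2))
        moreover have "dist (moeb \<gamma> z) \<tau>' < e" using m that by (auto simp: dist_commute)
        ultimately show False using dist_triangle2[of "moeb \<gamma> \<tau>" \<tau>' "moeb \<gamma> z"] unfolding e_def
          by (simp add: dist_commute)
      qed
      then show ?thesis using \<delta>(1) e y0 unfolding eventually_at_right_field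
        by (intro exI[of _ "Min {\<delta>, e, y0}"]) auto
    qed simp
  qed
  obtain r0 where r0: "r0 > 0" "\<And>r. 0 < r \<Longrightarrow> r < r0 \<Longrightarrow> \<forall>\<gamma>\<in>F. moeb \<gamma> \<tau> \<noteq> \<tau>' \<longrightarrow> (\<forall>z\<in>ball \<tau> r. moeb \<gamma> z \<notin> ball \<tau>' r)"
    using ev unfolding eventually_at_right_field by auto
  define r where "r = min y0 (r0/2)"
  have r: "0 < r" "r < r0" "r \<le> y0" using r0(1) y0 by (auto simp: r_def)
  show ?thesis
  proof (rule that[of r])
    fix \<gamma> z assume *: "\<gamma> \<in> lifts \<Gamma>" "moeb \<gamma> \<tau> \<noteq> \<tau>'" "z \<in> ball \<tau> r"
    show "moeb \<gamma> z \<notin> ball \<tau>' r"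
    proof
      assume m: "moeb \<gamma> z \<in> ball \<tau>' r"
      have "z \<in> ball \<tau> y0 \<union> ball \<tau>' y0" "moeb \<gamma> z \<in> ball \<tau> y0 \<union> ball \<tau>' y0"
        using m * r(3) by auto
      then have "\<gamma> \<in> F" using inb[of z] inb[of "moeb \<gamma> z"] *(1) unfolding F_def by blast
      then show False using r0(2)[OF r(1,2)] * m by blast
    qed
  qed (rule r)
qed

lemma stab_iff: "\<gamma> \<in> stab \<Gamma> \<tau> \<longleftrightarrow> \<gamma> \<in> lifts \<Gamma> \<and> moeb \<gamma> \<tau> = \<tau>"
  by (simp add: stab_def)

lemma stab_mult: "\<tau> \<in> \<bbbH> \<Longrightarrow> \<gamma> \<in> stab \<Gamma> \<tau> \<Longrightarrow> \<beta> \<in> stab \<Gamma> \<tau> \<Longrightarrow> \<gamma> ** \<beta> \<in> stab \<Gamma> \<tau>"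
  by (simp add: stab_iff lifts_mult moeb_mult)

lemma stab_inv: "\<tau> \<in> \<bbbH> \<Longrightarrow> \<gamma> \<in> stab \<Gamma> \<tau> \<Longrightarrow> matrix_inv \<gamma> \<in> stab \<Gamma> \<tau>"
  by (simp add: stab_iff lifts_inv) (metis lifts_det moeb_inverse(1))

lemma finite_stab: assumes "\<tau> \<in> \<bbbH>" shows "finite (stab \<Gamma> \<tau>)"
  by (rule finite_subset[OF _ finite_returns[of "Im \<tau>" "norm \<tau>"]])
     (use assms in \<open>auto simp: stab_iff upper_half_iff intro!: exI[of _ \<tau>]\<close>)

text \<open>The stabilizer is finite, so the points whose translates under it all lie in a given small disc
  form a neighbourhood, and it is invariant by construction.\<close>

lemma precisely_invariant_nbhd:
  assumes "\<tau> \<in> \<bbbH>" "open N" "\<tau> \<in> N"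
  obtains U where "precisely_invariant \<Gamma> U" "\<tau> \<in> U" "U \<subseteq> N"
proof -
  obtain r where r: "r > 0"
    "\<And>\<gamma> z. \<gamma> \<in> lifts \<Gamma> \<Longrightarrow> moeb \<gamma> \<tau> \<noteq> \<tau> \<Longrightarrow> z \<in> ball \<tau> r \<Longrightarrow> moeb \<gamma> z \<notin> ball \<tau> r"
    using orbit_separation[OF assms(1,1)] by metis
  define V where "V = ball \<tau> r \<inter> N"
  define U where "U = {z \<in> \<bbbH>. \<forall>\<gamma>\<in>stab \<Gamma> \<tau>. moeb \<gamma> z \<in> V}"
  have "U = \<bbbH> \<inter> (\<Inter>\<gamma>\<in>stab \<Gamma> \<tau>. moeb \<gamma> -` V \<inter> \<bbbH>)" by (auto simp: U_def)
  moreover have "open (moeb \<gamma> -` V \<inter> \<bbbH>)" if "\<gamma> \<in> stab \<Gamma> \<tau>" for \<gamma>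
  proof -
    have d: "det \<gamma> = 1" using that by (simp add: stab_iff)
    have "continuous_on \<bbbH> (moeb \<gamma>)"
      using holomorphic_moeb[of "\<lambda>z. z" \<bbbH> \<gamma>] d by (auto intro: holomorphic_on_imp_continuous_on)
    moreover have "open V" using assms(2) unfolding V_def by (intro open_Int open_ball)
    ultimately show ?thesis using continuous_open_preimage[OF _ open_upper_half] by (metis Int_commute)
  qed
  ultimately have oU: "open U"
    using finite_stab[OF assms(1)] by (metis (no_types, lifting) open_INT open_Int open_upper_half)
  have one: "mat 1 \<in> stab \<Gamma> \<tau>" by (simp add: stab_iff)
  have UV: "U \<subseteq> V" using one unfolding U_def by (metis (no_types, lifting) mem_Collect_eq moeb_one subsetI)
  have tU: "\<tau> \<in> U" using assms r(1) by (auto simp: U_def stab_iff V_def)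
  have sub: "moeb \<gamma> ` U \<subseteq> U" if "\<gamma> \<in> stab \<Gamma> \<tau>" for \<gamma>
  proof clarify
    fix z assume z: "z \<in> U"
    have d: "det \<gamma> = 1" using that by (simp add: stab_iff)
    have "moeb \<beta> (moeb \<gamma> z) \<in> V" if "\<beta> \<in> stab \<Gamma> \<tau>" for \<beta>
    proof -
      have "moeb (\<beta> ** \<gamma>) z \<in> V"
        using z stab_mult[OF assms(1) that \<open>\<gamma> \<in> stab \<Gamma> \<tau>\<close>] unfolding U_def by blast
      then show ?thesis using that d z by (simp add: U_def moeb_mult stab_iff)
    qed
    then show "moeb \<gamma> z \<in> U" using z d by (auto simp: U_def moeb_in_upper_half)
  qed
  show ?thesis
  proof (rule that[of U])
    show "U \<subseteq> N" using UV by (auto simp: V_def)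
    show "precisely_invariant \<Gamma> U" unfolding precisely_invariant_def
    proof (intro conjI bexI[of _ \<tau>] ballI oU tU)
      show "U \<subseteq> \<bbbH>" by (auto simp: U_def)
      fix \<gamma> assume g: "\<gamma> \<in> lifts \<Gamma>"
      show "if moeb \<gamma> \<tau> = \<tau> then moeb \<gamma> ` U = U else moeb \<gamma> ` U \<inter> U = {}"
      proof (cases "moeb \<gamma> \<tau> = \<tau>")
        case True
        then have s: "\<gamma> \<in> stab \<Gamma> \<tau>" using g by (simp add: stab_iff)
        have "z \<in> moeb \<gamma> ` U" if z: "z \<in> U" for z
        proof
          show "moeb (matrix_inv \<gamma>) z \<in> U" using sub[OF stab_inv[OF assms(1) s]] z by blast
          show "z = moeb \<gamma> (moeb (matrix_inv \<gamma>) z)" using g z by (simp add: U_def moeb_inverse)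
        qed
        then show ?thesis using True sub[OF s] by auto
      next
        case False
        have "moeb \<gamma> z \<notin> U" if "z \<in> U" for z using r(2)[OF g False, of z] that UV unfolding V_def by blast
        then show ?thesis using False by auto
      qed
    qed
  qed (rule tU)
qed

end

section \<open>Cusps\<close>

lemma generate_translation:
  "generate SL2 {translation \<omega>, - mat 1} =
     {\<beta>. \<exists>n::int. \<beta> = translation (of_int n * \<omega>) \<or> \<beta> = - translation (of_int n * \<omega>)}" (is "?G = ?T")
proof
  have t: "translation \<omega> = translation (of_int 1 * \<omega>)" "translation (- \<omega>) = translation (of_int (-1) * \<omega>)"
    "- mat 1 = - translation (of_int 0 * \<omega>)" "mat 1 = translation (of_int 0 * \<omega>)" by simp_all
  have m: "matrix_inv (- mat 1 :: mat2) = - mat 1" by (rule matrix_inv_unique2) simp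
  show "?G \<subseteq> ?T"
  proof
    fix \<beta> assume "\<beta> \<in> ?G"
    then show "\<beta> \<in> ?T"
    proof (induction rule: generate.induct)
      case one
      then show ?case using t(4) by (metis (mono_tags) SL2_one mem_Collect_eq)
    next
      case (incl h)
      then show ?case using t(1,3) by (metis (mono_tags) empty_iff insert_iff mem_Collect_eq)
    next
      case (inv h)
      then consider "h = translation \<omega>" | "h = - mat 1" by blast
      then show ?case
      proof cases
        case 1
        then have "inv\<^bsub>SL2\<^esub> h = translation (of_int (-1) * \<omega>)" by (simp add: SL2_inv matrix_inv_translation)
        then show ?thesis by blast
      next
        case 2
        then have "inv\<^bsub>SL2\<^esub> h = - translation (of_int 0 * \<omega>)" by (simp add: SL2_inv m)
        then show ?thesis by blast
      qed
    next
      case (eng a b)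
      then obtain n m :: int where "a = translation (of_int n * \<omega>) \<or> a = - translation (of_int n * \<omega>)"
        "b = translation (of_int m * \<omega>) \<or> b = - translation (of_int m * \<omega>)" by blast
      then have "a ** b = translation (of_int (n + m) * \<omega>) \<or> a ** b = - translation (of_int (n + m) * \<omega>)"
        by (auto simp: translation_add algebra_simps)
      then show ?case by (simp only: SL2_mult) blast
    qed
  qed
  have nat: "translation (of_nat n * \<omega>) \<in> ?G \<and> translation (- of_nat n * \<omega>) \<in> ?G" for n
  proof (induction n)
    case 0
    then show ?case using generate.one[of SL2 "{translation \<omega>, - mat 1}"] by simp
  next
    case (Suc n)
    have i: "translation \<omega> \<in> ?G" "translation (- \<omega>) \<in> ?G"
      using generate.incl[of "translation \<omega>" "{translation \<omega>, - mat 1}" SL2]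
        generate.inv[of "translation \<omega>" "{translation \<omega>, - mat 1}" SL2]
      by (simp_all add: SL2_inv matrix_inv_translation)
    have "translation (of_nat n * \<omega>) ** translation \<omega> \<in> ?G" "translation (- of_nat n * \<omega>) ** translation (- \<omega>) \<in> ?G"
      using generate.eng[of _ SL2] i Suc by (metis SL2_mult)+
    then show ?case by (simp add: translation_add algebra_simps)
  qed
  have int: "translation (of_int n * \<omega>) \<in> ?G" for n :: int
    using nat by (cases n rule: int_cases2) auto
  have "- translation (of_int n * \<omega>) \<in> ?G" for n :: int
    using generate.eng[OF generate.incl[of "- mat 1" "{translation \<omega>, - mat 1}" SL2] int[of n]] by simp
  with int show "?T \<subseteq> ?G" by blast
qed

text \<open>Distinct elements are at least \<open>\<epsilon>\<close> apart, so \<open>x \<mapsto> \<lfloor>x/\<epsilon>\<rfloor>\<close> is strictly increasing on the positive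
  elements and there is a least one. Division with remainder by it shows that it generates.\<close>

lemma real_additive_subgroup_cyclic:
  fixes A :: "real set"
  assumes zero: "0 \<in> A" and diff: "\<And>x y. x \<in> A \<Longrightarrow> y \<in> A \<Longrightarrow> x - y \<in> A"
    and gap: "\<epsilon> > 0" "\<And>x. x \<in> A \<Longrightarrow> \<bar>x\<bar> < \<epsilon> \<Longrightarrow> x = 0" and nontrivial: "a \<in> A" "a \<noteq> 0"
  obtains \<omega> where "\<omega> > 0" "A = range (\<lambda>n::int. of_int n * \<omega>)"
proof -
  have neg: "- x \<in> A" if "x \<in> A" for x using diff[OF zero that] by simp
  have add: "x + y \<in> A" if "x \<in> A" "y \<in> A" for x y using diff[OF that(1) neg[OF that(2)]] by simp
  have "\<exists>x. x \<in> A \<and> 0 < x"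
    using nontrivial neg[OF nontrivial(1)] by (cases "a > 0") (auto intro: exI[of _ "- a"])
  then obtain \<omega> where w: "\<omega> \<in> A" "0 < \<omega>" and least: "\<And>y. y \<in> A \<Longrightarrow> 0 < y \<Longrightarrow> nat \<lfloor>\<omega> / \<epsilon>\<rfloor> \<le> nat \<lfloor>y / \<epsilon>\<rfloor>"
    using ex_has_least_nat[of "\<lambda>x. x \<in> A \<and> 0 < x" _ "\<lambda>x. nat \<lfloor>x / \<epsilon>\<rfloor>"] by blast
  have minimal: "\<omega> \<le> y" if y: "y \<in> A" "0 < y" for y
  proof (rule ccontr)
    assume "\<not> \<omega> \<le> y"
    then have "\<omega> - y \<ge> \<epsilon>" using gap(2)[OF diff[OF w(1) y(1)]] by linarith
    then have "y / \<epsilon> \<le> \<omega> / \<epsilon> - 1" using gap(1) by (simp add: field_simps)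
    moreover have "0 \<le> y / \<epsilon>" using y gap(1) by simp
    ultimately have "nat \<lfloor>y / \<epsilon>\<rfloor> < nat \<lfloor>\<omega> / \<epsilon>\<rfloor>" by linarith
    then show False using least[OF y] by linarith
  qed
  have nat: "of_nat n * \<omega> \<in> A" for n by (induction n) (use zero w(1) add in \<open>auto simp: distrib_right\<close>)
  have int: "of_int n * \<omega> \<in> A" for n :: int
    by (cases n rule: int_cases2) (use nat neg[OF nat] in auto)
  have "x \<in> range (\<lambda>n::int. of_int n * \<omega>)" if x: "x \<in> A" for x
  proof -
    define n where "n = \<lfloor>x / \<omega>\<rfloor>"
    have "x - of_int n * \<omega> \<in> A" by (rule diff[OF x int])
    moreover have "of_int n \<le> x / \<omega>" "x / \<omega> < of_int n + 1" unfolding n_def by linarith+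
    then have "0 \<le> x - of_int n * \<omega>" "x - of_int n * \<omega> < \<omega>" using w(2) by (simp_all add: field_simps)
    ultimately have "x - of_int n * \<omega> = 0" using minimal by force
    then show ?thesis by auto
  qed
  with int w(2) that show thesis by blast
qed

lemma qpar_norm: "norm (qpar \<omega> \<tau>) = exp (- 2 * pi * Im \<tau> / \<omega>)"
proof -
  have "Re (2 * of_real pi * \<i> * \<tau> / of_real \<omega>) = - 2 * pi * Im \<tau> / \<omega>"
    by (simp add: Re_divide_of_real)
  then show ?thesis by (simp add: qpar_def)
qed

lemma qpar_norm_less_iff:
  assumes "\<omega> > 0"
  shows "norm (qpar \<omega> \<tau>) < exp (- 2 * pi * h / \<omega>) \<longleftrightarrow> h < Im \<tau>"
  using assms unfolding qpar_norm by (simp add: divide_less_cancel)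

text \<open>From \<open>Im \<beta>\<tau> = Im \<tau> / |c\<tau> + d|\<^sup>2\<close> and \<open>|c\<tau> + d| \<ge> |c| Im \<tau>\<close>: points high in the half plane are
  mapped low unless \<open>\<beta>\<close> fixes \<open>\<infinity>\<close>.\<close>

lemma Im_mult_Im_moeb_le:
  assumes "det \<beta> = 1" "\<bar>\<beta>$2$1\<bar> \<ge> c0" "c0 > 0" "\<tau> \<in> \<bbbH>"
  shows "Im \<tau> * Im (moeb \<beta> \<tau>) \<le> 1 / c0\<^sup>2"
proof -
  have t: "Im \<tau> > 0" using assms(4) by (simp add: upper_half_iff)
  have "c0 * Im \<tau> \<le> \<bar>Im (jfac \<beta> \<tau>)\<bar>" using assms t by (simp add: jfac_def abs_mult)
  then have "c0 * Im \<tau> \<le> norm (jfac \<beta> \<tau>)" using abs_Im_le_cmod order_trans by blast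
  then have "(c0 * Im \<tau>)\<^sup>2 \<le> (norm (jfac \<beta> \<tau>))\<^sup>2" using t assms(3) by (intro power_mono) auto
  moreover have "0 < norm (jfac \<beta> \<tau>)" using jfac_nonzero[of \<beta> \<tau>] assms by simp
  ultimately have "(Im \<tau>)\<^sup>2 / (norm (jfac \<beta> \<tau>))\<^sup>2 \<le> 1 / c0\<^sup>2"
    using assms(3) by (simp add: divide_simps power_mult_distrib mult.commute)
  then show ?thesis using assms Im_moeb[of \<beta> \<tau>] by (simp add: power2_eq_square)
qed

lemma upper_triangular_SL2_cases:
  assumes "det \<beta> = 1" "\<beta>$2$1 = 0" "(\<beta>$1$1)\<^sup>2 = 1"
  obtains t where "\<beta> = translation t \<or> \<beta> = - translation t"
proof -
  have ad: "\<beta>$1$1 * \<beta>$2$2 = 1" using assms by (simp add: det_2)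
  from assms(3) have "\<beta>$1$1 = 1 \<or> \<beta>$1$1 = -1" by (simp add: power2_eq_1_iff)
  then show thesis
  proof
    assume "\<beta>$1$1 = 1"
    then have "\<beta> = translation (\<beta>$1$2)" using ad assms(2) by (simp add: mat2_eq_iff translation_mat22)
    then show thesis using that by blast
  next
    assume "\<beta>$1$1 = -1"
    then have "\<beta> = - translation (- \<beta>$1$2)" using ad assms(2) by (auto simp: mat2_eq_iff translation_mat22)
    then show thesis using that by blast
  qed
qed

text \<open>The entries tend to those of the identity as \<open>c \<rightarrow> 0\<close> if \<open>a = O(c)\<close>, and for \<open>c = 0\<close> the translation
  length is scaled by \<open>a\<^sup>2\<close>. Both facts are used against discreteness.\<close>

lemma conjugate_translation:
  assumes "det \<beta> = 1"
  shows "\<beta> ** translation t ** matrix_inv \<beta> =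
    mat22 (1 - \<beta>$1$1 * \<beta>$2$1 * t) ((\<beta>$1$1)\<^sup>2 * t) (- (\<beta>$2$1)\<^sup>2 * t) (1 + \<beta>$1$1 * \<beta>$2$1 * t)"
proof -
  have "\<beta>$1$1 * \<beta>$2$2 - \<beta>$1$2 * \<beta>$2$1 = 1" using assms by (simp add: det_2)
  then show ?thesis
    unfolding matrix_inv_SL2[OF assms] translation_mat22
    by (simp add: mat2_eq_iff algebra_simps power2_eq_square)
qed

context fuchsian begin

lemma frame_det [simp]: "\<sigma> \<in> cusp_frames \<Gamma> \<Longrightarrow> det \<sigma> = 1"
  by (simp add: cusp_frames_def)

lemma frame_cusp: "\<sigma> \<in> cusp_frames \<Gamma> \<Longrightarrow> moeb_sphere \<sigma> None \<in> cusps \<Gamma>"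
  unfolding cusp_frames_def by blast

lemma frameI: "det \<sigma> = 1 \<Longrightarrow> moeb_sphere \<sigma> None \<in> cusps \<Gamma> \<Longrightarrow> \<sigma> \<in> cusp_frames \<Gamma>"
  unfolding cusp_frames_def by simp

lemma conj_stab_iff:
  assumes "det \<sigma> = 1"
  shows "\<beta> \<in> conj_stab \<Gamma> \<sigma> \<longleftrightarrow> \<sigma> ** \<beta> ** matrix_inv \<sigma> \<in> lifts \<Gamma> \<and> \<beta>$2$1 = 0"
proof -
  have "\<beta> = matrix_inv \<sigma> ** \<gamma> ** \<sigma> \<longleftrightarrow> \<gamma> = \<sigma> ** \<beta> ** matrix_inv \<sigma>" for \<gamma>
    using assms mat2_cancel by (metis matrix_mul_assoc one_neq_zero)
  moreover have "\<beta> \<in> conj_stab \<Gamma> \<sigma> \<longleftrightarrow> (\<exists>\<gamma>\<in>lifts \<Gamma>. \<beta> = matrix_inv \<sigma> ** \<gamma> ** \<sigma>) \<and> \<beta>$2$1 = 0"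
    unfolding conj_stab_def moeb_sphere_None_iff by blast
  ultimately show ?thesis by simp
qed

lemma conj_stab_det: "det \<sigma> = 1 \<Longrightarrow> \<beta> \<in> conj_stab \<Gamma> \<sigma> \<Longrightarrow> det \<beta> = 1"
  by (auto simp: conj_stab_def det_mul)

lemma conj_stab_mult:
  assumes "det \<sigma> = 1" "\<beta> \<in> conj_stab \<Gamma> \<sigma>" "\<beta>' \<in> conj_stab \<Gamma> \<sigma>"
  shows "\<beta> ** \<beta>' \<in> conj_stab \<Gamma> \<sigma>"
proof -
  have "\<sigma> ** (\<beta> ** \<beta>') ** matrix_inv \<sigma> = (\<sigma> ** \<beta> ** matrix_inv \<sigma>) ** (\<sigma> ** \<beta>' ** matrix_inv \<sigma>)"
    using assms(1) mat2_cancel by (metis matrix_mul_assoc one_neq_zero)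
  then show ?thesis using assms lifts_mult by (simp add: conj_stab_iff)
qed

lemma conj_stab_inv:
  assumes "det \<sigma> = 1" "\<beta> \<in> conj_stab \<Gamma> \<sigma>"
  shows "matrix_inv \<beta> \<in> conj_stab \<Gamma> \<sigma>"
proof -
  have d: "det \<beta> = 1" using conj_stab_det assms by blast
  have "\<sigma> ** matrix_inv \<beta> ** matrix_inv \<sigma> = matrix_inv (\<sigma> ** \<beta> ** matrix_inv \<sigma>)"
    using assms(1) d by (simp add: matrix_inv_mult2 det_mul matrix_inv_inv2 matrix_mul_assoc)
  moreover have "matrix_inv \<beta> $ 2 $ 1 = 0" using assms d by (simp add: matrix_inv_SL2 conj_stab_iff)
  ultimately show ?thesis using assms lifts_inv by (simp add: conj_stab_iff)
qed

lemma conj_stab_minus: "det \<sigma> = 1 \<Longrightarrow> - \<beta> \<in> conj_stab \<Gamma> \<sigma> \<longleftrightarrow> \<beta> \<in> conj_stab \<Gamma> \<sigma>"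
  by (simp add: conj_stab_iff)

text \<open>Conjugation by \<open>\<sigma>\<close> is a homeomorphism, so a conjugate of \<open>\<Gamma>\<close> is discrete at 1 as well.\<close>

lemma discrete_conjugate:
  assumes "det \<sigma> = 1"
  obtains e where "e > 0"
    "\<And>X. \<sigma> ** X ** matrix_inv \<sigma> \<in> lifts \<Gamma> \<Longrightarrow> entries_le (X - mat 1) e \<Longrightarrow> X = mat 1"
proof -
  obtain e where e: "e > 0" "\<And>\<gamma>. \<gamma> \<in> lifts \<Gamma> \<Longrightarrow> entries_le (\<gamma> - mat 1) e \<Longrightarrow> \<gamma> = mat 1"
    using discrete_at_one by blast
  obtain m where m: "m > 0" "entries_le \<sigma> m" using entries_le_exists by blast
  have mi: "entries_le (matrix_inv \<sigma>) m" by (rule entries_le_inv[OF assms m(2)])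
  define e' where "e' = e / (4 * m * m)"
  have e': "e' > 0" "2 * ((2 * (m * e')) * m) = e" using e m by (simp_all add: e'_def field_simps)
  have "X = mat 1" if "\<sigma> ** X ** matrix_inv \<sigma> \<in> lifts \<Gamma>" "entries_le (X - mat 1) e'" for X
  proof -
    have "entries_le (\<sigma> ** (X - mat 1) ** matrix_inv \<sigma>) e"
      using entries_le_mult[OF entries_le_mult[OF m(2) that(2)] mi] e'(2) by simp
    moreover have "\<sigma> ** (X - mat 1) ** matrix_inv \<sigma> = \<sigma> ** X ** matrix_inv \<sigma> - mat 1"
      using assms by (simp add: mat2_diff_distrib matrix_inv_props)
    ultimately have "\<sigma> ** X ** matrix_inv \<sigma> = mat 1" using e(2) that(1) by simp
    then show "X = mat 1" using assms mat2_cancel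
      by (metis matrix_inv_props(2) matrix_mul_assoc matrix_mul_rid one_neq_zero)
  qed
  with e'(1) that show thesis by blast
qed

text \<open>Moving the cusp to \<open>\<infinity>\<close>, the parabolic element becomes upper triangular with diagonal entries
  \<open>a, 1/a\<close>. That its trace is \<open>\<plusminus>2\<close> forces \<open>a = 1/a = \<plusminus>1\<close>.\<close>

lemma cusp_parabolic:
  assumes "\<sigma> \<in> cusp_frames \<Gamma>"
  obtains t where "translation t \<in> conj_stab \<Gamma> \<sigma>" "t \<noteq> 0"
proof -
  have d: "det \<sigma> = 1" using assms by simp
  obtain \<gamma> where g: "\<gamma> \<in> lifts \<Gamma>" "\<gamma> \<noteq> mat 1" "\<gamma> \<noteq> - mat 1" "(trace \<gamma>)\<^sup>2 = 4"
    "moeb_sphere \<gamma> (moeb_sphere \<sigma> None) = moeb_sphere \<sigma> None"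
    using assms unfolding cusp_frames_def cusps_def by auto
  define \<beta> where "\<beta> = matrix_inv \<sigma> ** \<gamma> ** \<sigma>"
  have dg: "det \<gamma> = 1" using g(1) by simp
  have db: "det \<beta> = 1" using d dg by (simp add: \<beta>_def det_mul)
  have "moeb_sphere \<beta> None = None"
    using d dg g(5) moeb_sphere_inverse(1)[OF d, of None]
    by (simp add: \<beta>_def moeb_sphere_mult det_mul)
  then have b21: "\<beta>$2$1 = 0" by (simp add: moeb_sphere_None_iff)
  have conj_back: "\<sigma> ** \<beta> ** matrix_inv \<sigma> = \<gamma>"
    unfolding \<beta>_def using d mat2_cancel by (metis matrix_mul_assoc one_neq_zero)
  have bc: "\<beta> \<in> conj_stab \<Gamma> \<sigma>" using b21 d conj_back g(1) by (simp add: conj_stab_iff)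
  have ad: "\<beta>$1$1 * \<beta>$2$2 = 1" using db b21 by (simp add: det_2)
  have "trace \<beta> = trace \<gamma>" unfolding \<beta>_def
    using d by (metis mat2_cancel(2) matrix_mul_assoc one_neq_zero trace_mul_sym)
  then have "(\<beta>$1$1 + \<beta>$2$2)\<^sup>2 = 4" using g(4) by (simp add: trace_def sum_2)
  then have "(\<beta>$1$1 - \<beta>$2$2)\<^sup>2 = 0" using ad by (simp add: power2_eq_square algebra_simps)
  then have "(\<beta>$1$1)\<^sup>2 = 1" using ad by (simp add: power2_eq_square)
  then obtain t where t: "\<beta> = translation t \<or> \<beta> = - translation t"
    using upper_triangular_SL2_cases[OF db b21] by blast
  have "t \<noteq> 0"
  proof
    assume "t = 0"
    with t have "\<gamma> = mat 1 \<or> \<gamma> = - mat 1" using conj_back d by (auto simp: matrix_inv_props)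
    with g show False by blast
  qed
  moreover have "translation t \<in> conj_stab \<Gamma> \<sigma>" using t bc conj_stab_minus[OF d] by auto
  ultimately show thesis using that by blast
qed

lemma translation_gap:
  assumes "det \<sigma> = 1"
  obtains \<epsilon> where "\<epsilon> > 0" "\<And>s. translation s \<in> conj_stab \<Gamma> \<sigma> \<Longrightarrow> \<bar>s\<bar> < \<epsilon> \<Longrightarrow> s = 0"
proof -
  obtain e where e: "e > 0"
    "\<And>X. \<sigma> ** X ** matrix_inv \<sigma> \<in> lifts \<Gamma> \<Longrightarrow> entries_le (X - mat 1) e \<Longrightarrow> X = mat 1"
    using discrete_conjugate[OF assms] by blast
  have "s = 0" if "translation s \<in> conj_stab \<Gamma> \<sigma>" "\<bar>s\<bar> < e" for s
  proof -
    have "entries_le (translation s - mat 1) e" using that(2) e(1)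
      by (simp add: entries_le_def translation_mat22)
    then have "translation s = mat 1" using e(2) that(1) conj_stab_iff[OF assms] by blast
    then show ?thesis by (simp add: translation_mat22 mat2_eq_iff)
  qed
  with e(1) that show thesis by blast
qed

text \<open>Conjugation by \<open>\<beta>\<close> scales translations by \<open>a\<^sup>2\<close>. If \<open>a\<^sup>2 < 1\<close>, iterating it gives translations that
  are arbitrarily small but not 0; if \<open>a\<^sup>2 > 1\<close>, this applies to \<open>\<beta>\<^sup>-\<^sup>1\<close>.\<close>

lemma conj_stab_no_hyperbolic:
  assumes "\<sigma> \<in> cusp_frames \<Gamma>" "\<beta> \<in> conj_stab \<Gamma> \<sigma>"
  shows "(\<beta>$1$1)\<^sup>2 = 1"
proof -
  have d: "det \<sigma> = 1" using assms by simp
  obtain t where t: "translation t \<in> conj_stab \<Gamma> \<sigma>" "t \<noteq> 0" using cusp_parabolic[OF assms(1)] by blast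
  obtain \<epsilon> where eps: "\<epsilon> > 0" "\<And>s. translation s \<in> conj_stab \<Gamma> \<sigma> \<Longrightarrow> \<bar>s\<bar> < \<epsilon> \<Longrightarrow> s = 0"
    using translation_gap[OF d] by blast
  have no_contraction: "\<not> (\<beta>$1$1)\<^sup>2 < 1" if b: "\<beta> \<in> conj_stab \<Gamma> \<sigma>" for \<beta>
  proof
    assume lt: "(\<beta>$1$1)\<^sup>2 < 1"
    have db: "det \<beta> = 1" and b21: "\<beta>$2$1 = 0" using conj_stab_det[OF d b] b d by (auto simp: conj_stab_iff)
    have a0: "\<beta>$1$1 \<noteq> 0" using db b21 by (auto simp: det_2)
    have mem: "translation (((\<beta>$1$1)\<^sup>2)^n * t) \<in> conj_stab \<Gamma> \<sigma>" for n
    proof (induction n)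
      case 0
      then show ?case using t by simp
    next
      case (Suc n)
      have "\<beta> ** translation (((\<beta>$1$1)\<^sup>2)^n * t) ** matrix_inv \<beta> = translation (((\<beta>$1$1)\<^sup>2)^Suc n * t)"
        unfolding conjugate_translation[OF db] by (simp add: b21 translation_mat22 mult.assoc)
      then show ?case using conj_stab_mult[OF d conj_stab_mult[OF d b Suc.IH] conj_stab_inv[OF d b]] by simp
    qed
    have "(\<lambda>n. ((\<beta>$1$1)\<^sup>2)^n * t) \<longlonglongrightarrow> 0 * t"
      using lt by (intro tendsto_mult LIMSEQ_power_zero tendsto_const) simp
    then have "\<forall>\<^sub>F n in sequentially. \<bar>((\<beta>$1$1)\<^sup>2)^n * t\<bar> < \<epsilon>"
      using eps(1) by (auto simp: tendsto_iff dist_norm)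
    then obtain n where "\<bar>((\<beta>$1$1)\<^sup>2)^n * t\<bar> < \<epsilon>" by (auto simp: eventually_sequentially)
    then have "((\<beta>$1$1)\<^sup>2)^n * t = 0" using eps(2)[OF mem] by blast
    then show False using a0 t(2) by simp
  qed
  have db: "det \<beta> = 1" and b21: "\<beta>$2$1 = 0"
    using conj_stab_det[OF d assms(2)] assms(2) d by (auto simp: conj_stab_iff)
  have "\<beta>$1$1 * \<beta>$2$2 = 1" using db b21 by (simp add: det_2)
  then have "(\<beta>$1$1)\<^sup>2 * (\<beta>$2$2)\<^sup>2 = 1" by (simp flip: power_mult_distrib)
  moreover have "\<not> (\<beta>$1$1)\<^sup>2 < 1" using no_contraction[OF assms(2)] .
  moreover have "\<not> (\<beta>$2$2)\<^sup>2 < 1"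
    using no_contraction[OF conj_stab_inv[OF d assms(2)]] by (simp add: matrix_inv_SL2[OF db])
  ultimately have ge: "(\<beta>$1$1)\<^sup>2 * (\<beta>$2$2)\<^sup>2 = 1" "1 \<le> (\<beta>$1$1)\<^sup>2" "1 \<le> (\<beta>$2$2)\<^sup>2"
    by linarith+
  have "(\<beta>$1$1)\<^sup>2 * 1 \<le> (\<beta>$1$1)\<^sup>2 * (\<beta>$2$2)\<^sup>2" using ge(3) by (intro mult_left_mono) auto
  then show ?thesis using ge by linarith
qed

lemma cusp_width_exists:
  assumes "\<sigma> \<in> cusp_frames \<Gamma>"
  shows "\<exists>\<omega>. cusp_width \<Gamma> \<sigma> \<omega>"
proof -
  have d: "det \<sigma> = 1" using assms by simp
  define A where "A = {s. translation s \<in> conj_stab \<Gamma> \<sigma>}"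
  obtain t where t: "t \<in> A" "t \<noteq> 0" using cusp_parabolic[OF assms] unfolding A_def by blast
  obtain \<epsilon> where e: "\<epsilon> > 0" "\<And>s. translation s \<in> conj_stab \<Gamma> \<sigma> \<Longrightarrow> \<bar>s\<bar> < \<epsilon> \<Longrightarrow> s = 0"
    using translation_gap[OF d] by blast
  have gap: "s = 0" if "s \<in> A" "\<bar>s\<bar> < \<epsilon>" for s using e(2) that by (simp add: A_def)
  have "0 \<in> A" using d by (simp add: A_def conj_stab_iff matrix_inv_props)
  moreover have "x - y \<in> A" if "x \<in> A" "y \<in> A" for x y
    using conj_stab_mult[OF d _ conj_stab_inv[OF d], of "translation x" "translation y"] that
    by (simp add: A_def matrix_inv_translation translation_add)
  ultimately obtain \<omega> where w: "\<omega> > 0" "A = range (\<lambda>n::int. of_int n * \<omega>)"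
    using real_additive_subgroup_cyclic[of A \<epsilon> t, OF _ _ e(1) gap t] by metis
  have "conj_stab \<Gamma> \<sigma> = generate SL2 {translation \<omega>, - mat 1}"
  proof
    show "conj_stab \<Gamma> \<sigma> \<subseteq> generate SL2 {translation \<omega>, - mat 1}"
    proof
      fix \<beta> assume b: "\<beta> \<in> conj_stab \<Gamma> \<sigma>"
      have "det \<beta> = 1" "\<beta>$2$1 = 0" using conj_stab_det[OF d b] b d by (auto simp: conj_stab_iff)
      then obtain s where s: "\<beta> = translation s \<or> \<beta> = - translation s"
        using upper_triangular_SL2_cases conj_stab_no_hyperbolic[OF assms b] by metis
      then have "s \<in> A" using b conj_stab_minus[OF d] by (auto simp: A_def)
      then show "\<beta> \<in> generate SL2 {translation \<omega>, - mat 1}"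
        using s w(2) unfolding generate_translation by auto
    qed
    have "translation (of_int n * \<omega>) \<in> conj_stab \<Gamma> \<sigma>" for n :: int
      using w(2) unfolding A_def by blast
    then show "generate SL2 {translation \<omega>, - mat 1} \<subseteq> conj_stab \<Gamma> \<sigma>"
      unfolding generate_translation using conj_stab_minus[OF d] by blast
  qed
  with w(1) show ?thesis unfolding cusp_width_def by blast
qed

lemma cusp_width_pos: "cusp_width \<Gamma> \<sigma> \<omega> \<Longrightarrow> \<omega> > 0"
  by (simp add: cusp_width_def)

lemma cusp_width_iff:
  assumes "cusp_width \<Gamma> \<sigma> \<omega>"
  shows "\<beta> \<in> conj_stab \<Gamma> \<sigma> \<longleftrightarrow>
    (\<exists>n::int. \<beta> = translation (of_int n * \<omega>) \<or> \<beta> = - translation (of_int n * \<omega>))"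
  using assms unfolding cusp_width_def generate_translation by auto

lemma cusp_width_translation:
  assumes "cusp_width \<Gamma> \<sigma> \<omega>" "det \<sigma> = 1"
  shows "\<sigma> ** translation (of_int n * \<omega>) ** matrix_inv \<sigma> \<in> lifts \<Gamma>"
  using cusp_width_iff[OF assms(1)] conj_stab_iff[OF assms(2)] by blast

lemma translation_eq_iff: "translation s = translation t \<longleftrightarrow> s = t"
  by (simp add: translation_mat22 mat2_eq_iff)

lemma translation_neq_minus: "translation s \<noteq> - translation t"
proof
  assume "translation s = - translation t"
  then have "translation s $ 1 $ 1 = (- translation t) $ 1 $ 1" by simp
  then show False by (simp add: translation_mat22)
qed

lemma cusp_width_unique:
  assumes "cusp_width \<Gamma> \<sigma> \<omega>" "cusp_width \<Gamma> \<sigma> \<omega>'"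
  shows "\<omega> = \<omega>'"
proof -
  have *: "\<exists>n::int. \<omega> = of_int n * \<omega>'" if "cusp_width \<Gamma> \<sigma> \<omega>" "cusp_width \<Gamma> \<sigma> \<omega>'" for \<omega> \<omega>'
  proof -
    have "translation \<omega> \<in> conj_stab \<Gamma> \<sigma>"
      using cusp_width_iff[OF that(1)] by (metis mult_1 of_int_1)
    then show ?thesis using cusp_width_iff[OF that(2)] translation_eq_iff translation_neq_minus by metis
  qed
  obtain n m :: int where nm: "\<omega> = of_int n * \<omega>'" "\<omega>' = of_int m * \<omega>" using * assms by blast
  have pos: "\<omega> > 0" "\<omega>' > 0" using assms cusp_width_pos by auto
  have "n > 0" "m > 0" using nm pos by (metis of_int_0_less_iff zero_less_mult_pos2)+
  then have "1 * \<omega>' \<le> of_int n * \<omega>'" "1 * \<omega> \<le> of_int m * \<omega>"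
    using pos by (intro mult_right_mono; simp)+
  then show ?thesis using nm by linarith
qed

lemma ex1_cusp_width: "\<sigma> \<in> cusp_frames \<Gamma> \<Longrightarrow> \<exists>!\<omega>. cusp_width \<Gamma> \<sigma> \<omega>"
  using cusp_width_exists cusp_width_unique by blast

text \<open>Let \<open>\<beta> = \<sigma>\<^sub>2\<^sup>-\<^sup>1\<gamma>\<sigma>\<^sub>1\<close> have lower left entry \<open>c \<noteq> 0\<close>. Multiplying from the left by translations in
  the second stabilizer achieves \<open>|a| \<le> \<omega>\<^sub>2|c|\<close> without changing \<open>c\<close>. With the generating translation
  \<open>T\<close> of the first stabilizer, \<open>\<beta>T\<beta>\<^sup>-\<^sup>1\<close> then differs from 1 by \<open>O(c\<^sup>2)\<close>, while it lies in a discrete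
  group and is not 1. The two frames may belong to inequivalent cusps, which gives their separation,
  or be equal, which gives the injectivity of the charts.\<close>

lemma cusp_lower_left_gap:
  assumes "\<sigma>1 \<in> cusp_frames \<Gamma>" "\<sigma>2 \<in> cusp_frames \<Gamma>"
  obtains c0 where "c0 > 0"
    "\<And>\<gamma>. \<gamma> \<in> lifts \<Gamma> \<Longrightarrow> (matrix_inv \<sigma>2 ** \<gamma> ** \<sigma>1)$2$1 = 0 \<or> \<bar>(matrix_inv \<sigma>2 ** \<gamma> ** \<sigma>1)$2$1\<bar> \<ge> c0"
proof -
  have d: "det \<sigma>1 = 1" "det \<sigma>2 = 1" using assms by simp_all
  obtain \<omega>1 \<omega>2 where w: "cusp_width \<Gamma> \<sigma>1 \<omega>1" "cusp_width \<Gamma> \<sigma>2 \<omega>2"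
    using cusp_width_exists assms by blast
  have wp: "\<omega>1 > 0" "\<omega>2 > 0" using w cusp_width_pos by auto
  obtain e where e: "e > 0"
    "\<And>X. \<sigma>2 ** X ** matrix_inv \<sigma>2 \<in> lifts \<Gamma> \<Longrightarrow> entries_le (X - mat 1) e \<Longrightarrow> X = mat 1"
    using discrete_conjugate[OF d(2)] by blast
  \<comment> \<open>Every entry of the conjugated translation minus 1 is at most \<open>c\<^sup>2k\<close> in absolute value.\<close>
  define k where "k = \<omega>1 * (1 + \<omega>2 + \<omega>2\<^sup>2)"
  have k: "k > 0" using wp unfolding k_def by (intro mult_pos_pos add_pos_nonneg add_pos_pos) auto
  define c0 where "c0 = sqrt (e / k)"
  have c0: "c0 > 0" "c0\<^sup>2 = e / k" using e(1) k by (simp_all add: c0_def)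
  have "c = 0 \<or> \<bar>c\<bar> \<ge> c0" if g: "\<gamma> \<in> lifts \<Gamma>" and c: "c = (matrix_inv \<sigma>2 ** \<gamma> ** \<sigma>1)$2$1" for \<gamma> c
  proof (rule ccontr)
    assume "\<not> ?thesis"
    then have cn: "c \<noteq> 0" "\<bar>c\<bar> < c0" by auto
    define \<beta> where "\<beta> = matrix_inv \<sigma>2 ** \<gamma> ** \<sigma>1"
    have db: "det \<beta> = 1" using d g by (simp add: \<beta>_def det_mul)
    \<comment> \<open>Left translation in the stabilizer of the second cusp reduces the upper left entry modulo \<open>\<omega>2 c\<close>.\<close>
    define n where "n = - \<lfloor>\<beta>$1$1 / (\<omega>2 * c)\<rfloor>"
    define T where "T = translation (of_int n * \<omega>2)"
    define \<beta>' where "\<beta>' = T ** \<beta>"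
    have db': "det \<beta>' = 1" using db by (simp add: \<beta>'_def T_def det_mul)
    have c': "\<beta>'$2$1 = c" by (simp add: \<beta>'_def T_def translation_mat22 c \<beta>_def)
    have "\<beta>'$1$1 = frac (\<beta>$1$1 / (\<omega>2 * c)) * (\<omega>2 * c)"
      using cn wp c unfolding \<beta>_def[symmetric]
      by (simp add: \<beta>'_def T_def translation_mat22 frac_def n_def field_simps)
    then have a: "\<bar>\<beta>'$1$1\<bar> \<le> \<omega>2 * \<bar>c\<bar>"
      using frac_lt_1[of "\<beta>$1$1 / (\<omega>2 * c)"] wp by (simp add: abs_mult mult_left_le_one_le less_imp_le)
    define X where "X = \<beta>' ** translation \<omega>1 ** matrix_inv \<beta>'"
    have X: "X = mat22 (1 - \<beta>'$1$1 * c * \<omega>1) ((\<beta>'$1$1)\<^sup>2 * \<omega>1) (- c\<^sup>2 * \<omega>1) (1 + \<beta>'$1$1 * c * \<omega>1)"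
      unfolding X_def conjugate_translation[OF db'] c' ..
    have c2: "c\<^sup>2 * k < e"
    proof -
      have "c\<^sup>2 < c0\<^sup>2" using cn(2) c0(1) by (metis abs_ge_zero power2_abs power_strict_mono zero_less_numeral)
      then show ?thesis using c0(2) k by (simp add: field_simps)
    qed
    have e1: "\<bar>\<beta>'$1$1 * c * \<omega>1\<bar> \<le> e"
    proof -
      have "\<bar>\<beta>'$1$1 * c * \<omega>1\<bar> \<le> (\<omega>2 * \<bar>c\<bar>) * \<bar>c\<bar> * \<omega>1"
        using a wp by (simp add: abs_mult mult_right_mono)
      also have "\<dots> = c\<^sup>2 * (\<omega>1 * \<omega>2)" by (simp add: power2_eq_square)
      also have "\<dots> \<le> c\<^sup>2 * k" using wp by (intro mult_left_mono) (auto simp: k_def distrib_left)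
      finally show ?thesis using c2 by simp
    qed
    have e2: "\<bar>(\<beta>'$1$1)\<^sup>2 * \<omega>1\<bar> \<le> e"
    proof -
      have "(\<beta>'$1$1)\<^sup>2 \<le> (\<omega>2 * \<bar>c\<bar>)\<^sup>2" using a by (metis abs_ge_zero power2_abs power_mono)
      then have "\<bar>(\<beta>'$1$1)\<^sup>2 * \<omega>1\<bar> \<le> (\<omega>2 * \<bar>c\<bar>)\<^sup>2 * \<omega>1"
        using wp by (simp add: abs_mult mult_right_mono)
      also have "\<dots> = c\<^sup>2 * (\<omega>1 * \<omega>2\<^sup>2)" by (simp add: power_mult_distrib)
      also have "\<dots> \<le> c\<^sup>2 * k" using wp by (intro mult_left_mono) (auto simp: k_def distrib_left)
      finally show ?thesis using c2 by simp
    qed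
    have e3: "\<bar>c\<^sup>2 * \<omega>1\<bar> \<le> e"
    proof -
      have "c\<^sup>2 * \<omega>1 \<le> c\<^sup>2 * k" using wp by (intro mult_left_mono) (auto simp: k_def distrib_left)
      then show ?thesis using c2 wp by simp
    qed
    have small: "entries_le (X - mat 1) e" using e1 e2 e3 by (simp add: entries_le_def X)
    have P: "\<sigma>2 ** T ** matrix_inv \<sigma>2 \<in> lifts \<Gamma>" and Q: "\<sigma>1 ** translation \<omega>1 ** matrix_inv \<sigma>1 \<in> lifts \<Gamma>"
      using cusp_width_translation[OF w(2) d(2), of n] cusp_width_translation[OF w(1) d(1), of 1]
      by (simp_all add: T_def)
    have "\<sigma>2 ** X ** matrix_inv \<sigma>2 =
      (\<sigma>2 ** T ** matrix_inv \<sigma>2) ** \<gamma> ** (\<sigma>1 ** translation \<omega>1 ** matrix_inv \<sigma>1) **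
        matrix_inv \<gamma> ** matrix_inv (\<sigma>2 ** T ** matrix_inv \<sigma>2)"
      using d g by (simp add: X_def \<beta>'_def \<beta>_def T_def matrix_inv_mult2 det_mul matrix_inv_inv2 matrix_mul_assoc)
    also have "\<dots> \<in> lifts \<Gamma>"
      by (rule lifts_mult[OF lifts_mult[OF lifts_mult[OF lifts_mult[OF P g] Q] lifts_inv[OF g]] lifts_inv[OF P]])
    finally have "X = mat 1" using e(2) small by blast
    then have "X $ 2 $ 1 = 0" by simp
    then show False using X cn(1) wp by simp
  qed
  with c0(1) that show thesis by blast
qed

text \<open>With \<open>c\<^sub>0\<close> from \<open>cusp_lower_left_gap\<close>: two points higher than \<open>1/c\<^sub>0\<close>, in the coordinates of the two frames, are equivalent only under an
  element with \<open>c = 0\<close>, that is one mapping the first cusp to the second.\<close>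

lemma frames_height_gap:
  assumes "\<sigma>1 \<in> cusp_frames \<Gamma>" "\<sigma>2 \<in> cusp_frames \<Gamma>"
  obtains h where "h > 0" "\<And>\<gamma> \<tau> \<tau>'. \<gamma> \<in> lifts \<Gamma> \<Longrightarrow> \<tau> \<in> \<bbbH> \<Longrightarrow> h < Im \<tau> \<Longrightarrow> h < Im \<tau>' \<Longrightarrow>
      moeb \<gamma> (moeb \<sigma>1 \<tau>) = moeb \<sigma>2 \<tau>' \<Longrightarrow> moeb_sphere \<gamma> (moeb_sphere \<sigma>1 None) = moeb_sphere \<sigma>2 None"
proof -
  have d: "det \<sigma>1 = 1" "det \<sigma>2 = 1" using assms by simp_all
  obtain c0 where c0: "c0 > 0"
    "\<And>\<gamma>. \<gamma> \<in> lifts \<Gamma> \<Longrightarrow> (matrix_inv \<sigma>2 ** \<gamma> ** \<sigma>1)$2$1 = 0 \<or> \<bar>(matrix_inv \<sigma>2 ** \<gamma> ** \<sigma>1)$2$1\<bar> \<ge> c0"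
    using cusp_lower_left_gap[OF assms] by blast
  have "moeb_sphere \<gamma> (moeb_sphere \<sigma>1 None) = moeb_sphere \<sigma>2 None"
    if g: "\<gamma> \<in> lifts \<Gamma>" "\<tau> \<in> \<bbbH>" "1 / c0 < Im \<tau>" "1 / c0 < Im \<tau>'" "moeb \<gamma> (moeb \<sigma>1 \<tau>) = moeb \<sigma>2 \<tau>'" for \<gamma> \<tau> \<tau>'
  proof -
    define \<beta> where "\<beta> = matrix_inv \<sigma>2 ** \<gamma> ** \<sigma>1"
    have db: "det \<beta> = 1" and dg: "det \<gamma> = 1" using d g by (simp_all add: \<beta>_def det_mul)
    have "\<tau>' \<in> \<bbbH>" using g(4) c0(1) unfolding upper_half_iff by (smt (verit) zero_less_divide_1_iff)
    then have "moeb \<beta> \<tau> = \<tau>'" using g d dg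
      by (simp add: \<beta>_def moeb_mult det_mul moeb_in_upper_half moeb_inverse)
    moreover have "1 / c0 * (1 / c0) < Im \<tau> * Im \<tau>'"
      using g c0(1) by (intro mult_strict_mono) (auto simp: upper_half_iff)
    ultimately have "\<not> \<bar>\<beta>$2$1\<bar> \<ge> c0"
      using Im_mult_Im_moeb_le[OF db _ c0(1) g(2)] by (auto simp: power2_eq_square)
    then have "\<beta>$2$1 = 0" using c0(2)[OF g(1)] unfolding \<beta>_def by blast
    then have "moeb_sphere \<beta> None = None" by (simp add: moeb_sphere_None_iff)
    then have "moeb_sphere (\<sigma>2 ** \<beta>) None = moeb_sphere \<sigma>2 None" using d db by (simp add: moeb_sphere_mult)
    moreover have "\<sigma>2 ** \<beta> = \<gamma> ** \<sigma>1" unfolding \<beta>_def using d by (metis mat2_cancel(2) matrix_mul_assoc one_neq_zero)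
    ultimately show ?thesis using d dg by (simp add: moeb_sphere_mult)
  qed
  with c0(1) that[of "1 / c0"] show thesis by simp
qed

lemma cusp_radius_exists:
  assumes "\<sigma> \<in> cusp_frames \<Gamma>" "cusp_width \<Gamma> \<sigma> \<omega>"
  shows "\<exists>r. cusp_radius \<Gamma> \<sigma> \<omega> r"
proof -
  have w: "\<omega> > 0" using assms(2) cusp_width_pos by blast
  obtain h where h: "h > 0" "\<And>\<gamma> \<tau> \<tau>'. \<gamma> \<in> lifts \<Gamma> \<Longrightarrow> \<tau> \<in> \<bbbH> \<Longrightarrow> h < Im \<tau> \<Longrightarrow> h < Im \<tau>' \<Longrightarrow>
      moeb \<gamma> (moeb \<sigma> \<tau>) = moeb \<sigma> \<tau>' \<Longrightarrow> moeb_sphere \<gamma> (moeb_sphere \<sigma> None) = moeb_sphere \<sigma> None"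
    using frames_height_gap[OF assms(1,1)] by metis
  have "cusp_radius \<Gamma> \<sigma> \<omega> (exp (- 2 * pi * h / \<omega>))"
    unfolding cusp_radius_def qpar_norm_less_iff[OF w] using h w by auto
  then show ?thesis by blast
qed

lemma cusp_radius_mono:
  "cusp_radius \<Gamma> \<sigma> \<omega> r \<Longrightarrow> 0 < r' \<Longrightarrow> r' \<le> r \<Longrightarrow> cusp_radius \<Gamma> \<sigma> \<omega> r'"
  unfolding cusp_radius_def by (meson less_le_trans order_trans)

end

section \<open>Exponentials and powers on a quasi-vertex operator algebra\<close>

context quasi_VOA begin

lemma decomp: "homogeneous_decomp A v (component A v)"
  unfolding component_def by (rule theI'[OF grade_direct_sum])

lemma component_in_grade: "component A v n \<in> grade A n"
  using decomp by (simp add: homogeneous_decomp_def)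

lemma finite_component: "finite {n. component A v n \<noteq> 0}"
  using decomp by (simp add: homogeneous_decomp_def)

lemma zero_in_grade: "0 \<in> grade A n"
  using grade_subspace subspace_0 by blast

lemma component_unique: "homogeneous_decomp A v c \<Longrightarrow> component A v = c"
  using grade_direct_sum[of v] decomp[of v] by auto

lemma decompI:
  assumes "\<And>n. c n \<in> grade A n" "finite S" "\<And>n. n \<notin> S \<Longrightarrow> c n = 0" "v = sum c S"
  shows "component A v = c"
proof (rule component_unique)
  have sub: "{n. c n \<noteq> 0} \<subseteq> S" using assms(3) by blast
  then show "homogeneous_decomp A v c"
    unfolding homogeneous_decomp_def using assms finite_subset[OF sub assms(2)]
      Sum_any.expand_superset[OF assms(2) sub] by simp
qed

lemma sum_component:
  assumes "finite S" "\<And>n. n \<notin> S \<Longrightarrow> component A v n = 0"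
  shows "sum (component A v) S = v"
proof -
  have "v = Sum_any (component A v)" using decomp by (simp add: homogeneous_decomp_def)
  also have "\<dots> = sum (component A v) S" using assms by (intro Sum_any.expand_superset) auto
  finally show ?thesis ..
qed

lemma component_support: obtains S where "finite S" "\<And>n. n \<notin> S \<Longrightarrow> component A v n = 0"
  using finite_component by blast

lemma component_eqI: assumes "component A v = component A w" shows "v = w"
proof -
  obtain S where "finite S" "\<And>n. n \<notin> S \<Longrightarrow> component A v n = 0" using component_support[of v] by blast
  note S = this
  have "v = sum (component A v) S" by (rule sum_component[OF S, symmetric])
  also have "\<dots> = sum (component A w) S" by (simp only: assms)
  also have "\<dots> = w" using S unfolding assms by (rule sum_component)
  finally show ?thesis .
qed

lemma component_add: "component A (u + v) n = component A u n + component A v n"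
proof -
  define S where "S = {n. component A u n \<noteq> 0} \<union> {n. component A v n \<noteq> 0}"
  have S: "finite S" by (simp add: S_def finite_component)
  have u: "sum (component A u) S = u" and v: "sum (component A v) S = v"
    by (rule sum_component[OF S]; simp add: S_def)+
  have "component A (u + v) = (\<lambda>n. component A u n + component A v n)"
  proof (rule decompI[OF _ S])
    show "component A u n + component A v n \<in> grade A n" for n
      by (intro subspace_add[OF grade_subspace] component_in_grade)
    show "u + v = (\<Sum>n\<in>S. component A u n + component A v n)" unfolding sum.distrib u v ..
  qed (simp add: S_def)
  then show ?thesis by simp
qed

lemma component_scale: "component A (smul A a v) n = smul A a (component A v n)"
proof -
  obtain S where S: "finite S" "\<And>n. n \<notin> S \<Longrightarrow> component A v n = 0" using component_support[of v] by blast
  have "component A (smul A a v) = (\<lambda>n. smul A a (component A v n))"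
  proof (rule decompI[OF _ S(1)])
    show "smul A a (component A v n) \<in> grade A n" for n
      by (intro subspace_scale[OF grade_subspace] component_in_grade)
    show "smul A a v = (\<Sum>n\<in>S. smul A a (component A v n))"
      using sum_component[OF S] by (simp flip: scale_sum_right)
  qed (simp add: S(2))
  then show ?thesis by simp
qed

lemma component_zero [simp]: "component A 0 n = 0"
  using component_scale[of 0 0 n] by simp

lemma component_homogeneous:
  assumes "v \<in> grade A n" shows "component A v m = (if m = n then v else 0)"
proof -
  have "component A v = (\<lambda>m. if m = n then v else 0)"
    by (rule decompI[of _ "{n}"]) (use assms zero_in_grade in auto)
  then show ?thesis by simp
qed

lemma grade_iff: "v \<in> grade A n \<longleftrightarrow> (\<forall>m. m \<noteq> n \<longrightarrow> component A v m = 0)"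
proof
  assume *: "\<forall>m. m \<noteq> n \<longrightarrow> component A v m = 0"
  have "sum (component A v) {n} = v" using * by (intro sum_component) auto
  then show "v \<in> grade A n" using component_in_grade[of v n] by simp
qed (simp add: component_homogeneous)

subsection \<open>Powers of the grading operator\<close>

lemma power_L0_sum:
  assumes "finite S" "\<And>n. n \<notin> S \<Longrightarrow> component A v n = 0"
  shows "power_L0 A x v = (\<Sum>n\<in>S. smul A (x powi n) (component A v n))"
  unfolding power_L0_def using assms by (intro Sum_any.expand_superset) (auto intro!: assms(2))

lemma component_power_L0: "component A (power_L0 A x v) n = smul A (x powi n) (component A v n)"
proof -
  obtain S where S: "finite S" "\<And>n. n \<notin> S \<Longrightarrow> component A v n = 0" using component_support[of v] by blast
  have "component A (power_L0 A x v) = (\<lambda>n. smul A (x powi n) (component A v n))"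
    by (rule decompI[of _ S])
      (use S power_L0_sum[OF S] in \<open>auto intro!: subspace_scale[OF grade_subspace] component_in_grade\<close>)
  then show ?thesis by simp
qed

lemma power_L0_add: "power_L0 A x (u + v) = power_L0 A x u + power_L0 A x v"
  by (rule component_eqI) (auto simp: component_power_L0 component_add scale_right_distrib)

lemma power_L0_scale: "power_L0 A x (smul A a v) = smul A a (power_L0 A x v)"
  by (rule component_eqI) (auto simp: component_power_L0 component_scale mult.commute)

lemma power_L0_mult: "power_L0 A x (power_L0 A y v) = power_L0 A (x * y) v"
  by (rule component_eqI) (auto simp: component_power_L0 power_int_mult_distrib)

lemma power_L0_one [simp]: "power_L0 A 1 v = v"
  by (rule component_eqI) (auto simp: component_power_L0)

subsection \<open>The lowering operator\<close>

lemma Lop_add: "m \<in> {-1, 0, 1} \<Longrightarrow> Lop A m (u + v) = Lop A m u + Lop A m v"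
  and Lop_scale: "m \<in> {-1, 0, 1} \<Longrightarrow> Lop A m (smul A a v) = smul A a (Lop A m v)"
  using L_linear[of m] unfolding Vector_Spaces.linear_iff by blast+

lemma Lop_zero: "m \<in> {-1, 0, 1} \<Longrightarrow> Lop A m 0 = 0"
  using Lop_scale[of m 0 0] by simp

lemma Lop_sum: "m \<in> {-1, 0, 1} \<Longrightarrow> Lop A m (sum f I) = (\<Sum>i\<in>I. Lop A m (f i))"
  by (induction I rule: infinite_finite_induct) (auto simp: Lop_add Lop_zero)

lemma component_L0: "component A (Lop A 0 v) n = smul A (of_int n) (component A v n)"
proof -
  obtain S where S: "finite S" "\<And>n. n \<notin> S \<Longrightarrow> component A v n = 0" using component_support[of v] by blast
  have "Lop A 0 v = Lop A 0 (sum (component A v) S)" using sum_component[OF S] by simp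
  also have "\<dots> = (\<Sum>n\<in>S. smul A (of_int n) (component A v n))"
    by (simp add: Lop_sum L_0[OF component_in_grade])
  finally have "component A (Lop A 0 v) = (\<lambda>n. smul A (of_int n) (component A v n))"
    by (intro decompI[of _ S])
      (use S in \<open>auto intro!: subspace_scale[OF grade_subspace] component_in_grade\<close>)
  then show ?thesis by simp
qed

text \<open>By \<open>[L(1), L(0)] = L(1)\<close>, the vector \<open>L(1)v\<close> is an eigenvector of \<open>L(0)\<close> with eigenvalue \<open>n - 1\<close>. Its
  components in all other degrees vanish, as \<open>L(0)\<close> has different eigenvalues there.\<close>

lemma L1_grade:
  assumes "v \<in> grade A n" shows "Lop A 1 v \<in> grade A (n - 1)"
proof -
  define w where "w = Lop A 1 v"
  have "Lop A 1 (Lop A 0 v) - Lop A 0 w = w"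
    using L_bracket[of 1 0 v] by (simp add: w_def)
  then have "Lop A 0 w = smul A (of_int n) w - w"
    using L_0[OF assms] by (simp add: Lop_scale w_def algebra_simps)
  then have e: "Lop A 0 w + w = smul A (of_int n) w" by simp
  have "component A w m = 0" if "m \<noteq> n - 1" for m
  proof -
    have "smul A (of_int m) (component A w m) + component A w m = smul A (of_int n) (component A w m)"
      using arg_cong[OF e, of "\<lambda>v. component A v m"] by (simp add: component_add component_scale component_L0)
    then have "smul A (of_int (m + 1 - n)) (component A w m) = 0"
      by (simp add: scale_left_distrib scale_left_diff_distrib)
    moreover have "complex_of_int (m + 1 - n) \<noteq> 0" using that unfolding of_int_eq_0_iff by linarith
    ultimately show ?thesis using scale_eq_0_iff by blast
  qed
  then show ?thesis by (simp add: grade_iff w_def)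
qed

lemma component_L1: "component A (Lop A 1 v) n = Lop A 1 (component A v (n + 1))"
proof -
  obtain S where S: "finite S" "\<And>n. n \<notin> S \<Longrightarrow> component A v n = 0" using component_support[of v] by blast
  have "Lop A 1 v = Lop A 1 (sum (component A v) S)" using sum_component[OF S] by simp
  also have "\<dots> = (\<Sum>n\<in>S. Lop A 1 (component A v n))" by (simp add: Lop_sum)
  also have "\<dots> = (\<Sum>n\<in>(\<lambda>n. n - 1) ` S. Lop A 1 (component A v (n + 1)))"
    by (subst sum.reindex) (auto simp: inj_on_def)
  finally have "component A (Lop A 1 v) = (\<lambda>n. Lop A 1 (component A v (n + 1)))"
  proof (intro decompI[of _ "(\<lambda>n. n - 1) ` S"])
    show "Lop A 1 (component A v (n + 1)) \<in> grade A n" for n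
      using L1_grade[OF component_in_grade[of v "n + 1"]] by simp
    show "Lop A 1 (component A v (n + 1)) = 0" if "n \<notin> (\<lambda>n. n - 1) ` S" for n
    proof -
      have "n + 1 \<notin> S" using that by force
      then show ?thesis using S(2) Lop_zero by simp
    qed
  qed (use S in auto)
  then show ?thesis by simp
qed

lemma L1_pow_add: "(Lop A 1 ^^ k) (u + v) = (Lop A 1 ^^ k) u + (Lop A 1 ^^ k) v"
  by (induction k) (auto simp: Lop_add)

lemma L1_pow_scale: "(Lop A 1 ^^ k) (smul A a v) = smul A a ((Lop A 1 ^^ k) v)"
  by (induction k) (auto simp: Lop_scale)

lemma L1_pow_zero [simp]: "(Lop A 1 ^^ k) 0 = 0"
  by (induction k) (auto simp: Lop_zero)

lemma L1_pow_sum: "(Lop A 1 ^^ k) (sum f I) = (\<Sum>i\<in>I. (Lop A 1 ^^ k) (f i))"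
  by (induction I rule: infinite_finite_induct) (auto simp: L1_pow_add)

lemma component_L1_pow: "component A ((Lop A 1 ^^ k) v) n = (Lop A 1 ^^ k) (component A v (n + int k))"
  by (induction k arbitrary: n) (auto simp: component_L1 algebra_simps)

text \<open>Only finitely many degrees occur in \<open>v\<close>, and the grading is bounded below.\<close>

lemma L1_locally_nilpotent: obtains m where "(Lop A 1 ^^ m) v = 0"
proof -
  obtain S where S: "finite S" "\<And>n. n \<notin> S \<Longrightarrow> component A v n = 0" using component_support[of v] by blast
  obtain n0 where n0: "\<And>n. n < n0 \<Longrightarrow> grade A n = {0}" using grade_bounded_below by blast
  obtain b where b: "\<And>n. n \<in> S \<Longrightarrow> n \<le> b" using S(1) by (meson finite_set_of_finite_maps bdd_above_finite bdd_above_def)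
  define m where "m = nat (b - n0 + 1)"
  have "component A ((Lop A 1 ^^ m) v) n = component A 0 n" for n
  proof (cases "n < n0")
    case True
    then show ?thesis using component_in_grade[of "(Lop A 1 ^^ m) v" n] n0 by auto
  next
    case False
    then have "n + int m > b" unfolding m_def by linarith
    then have "n + int m \<notin> S" using b by force
    then show ?thesis using S(2) by (simp add: component_L1_pow)
  qed
  then have "(Lop A 1 ^^ m) v = 0" by (intro component_eqI) auto
  then show thesis using that by blast
qed

lemma L1_pow_vanish: assumes "(Lop A 1 ^^ m) v = 0" "m \<le> k" shows "(Lop A 1 ^^ k) v = 0"
proof -
  have "(Lop A 1 ^^ k) v = (Lop A 1 ^^ (k - m)) ((Lop A 1 ^^ m) v)"
    using assms(2) by (metis comp_apply funpow_add le_add_diff_inverse2)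
  then show ?thesis using assms(1) by simp
qed

subsection \<open>The exponential of a multiple of the lowering operator\<close>

definition exp_L1 :: "complex \<Rightarrow> 'v \<Rightarrow> 'v" where
  "exp_L1 a = op_exp A (\<lambda>w. smul A a (Lop A 1 w))"

text \<open>Any \<open>m\<close> with \<open>L(1)\<^sup>mv = 0\<close> serves as a bound, so that several exponentials can be summed over the same
  range.\<close>

lemma exp_L1_sum:
  assumes "(Lop A 1 ^^ m) v = 0"
  shows "exp_L1 a v = (\<Sum>k<m. smul A (a ^ k / fact k) ((Lop A 1 ^^ k) v))"
proof -
  have pow: "((\<lambda>w. smul A a (Lop A 1 w)) ^^ k) v = smul A (a ^ k) ((Lop A 1 ^^ k) v)" for k
    by (induction k) (auto simp: Lop_scale)
  have z: "(Lop A 1 ^^ k) v = 0" if "k \<notin> {..<m}" for k using L1_pow_vanish[OF assms] that by simp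
  have "exp_L1 a v = Sum_any (\<lambda>k. smul A (a ^ k / fact k) ((Lop A 1 ^^ k) v))"
    by (simp add: exp_L1_def op_exp_def pow)
  also have "\<dots> = (\<Sum>k<m. smul A (a ^ k / fact k) ((Lop A 1 ^^ k) v))"
  proof (intro Sum_any.expand_superset subsetI)
    fix k assume "k \<in> {k. smul A (a ^ k / fact k) ((Lop A 1 ^^ k) v) \<noteq> 0}"
    then show "k \<in> {..<m}" using z[of k] by (metis (mono_tags) mem_Collect_eq scale_zero_right)
  qed simp
  finally show ?thesis .
qed

lemma exp_L1_add: "exp_L1 a (u + v) = exp_L1 a u + exp_L1 a v"
proof -
  obtain m1 m2 where m: "(Lop A 1 ^^ m1) u = 0" "(Lop A 1 ^^ m2) v = 0" using L1_locally_nilpotent by metis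
  let ?m = "max m1 m2"
  have "(Lop A 1 ^^ ?m) u = 0" "(Lop A 1 ^^ ?m) v = 0" using L1_pow_vanish m by (metis max.cobounded1 max.cobounded2)+
  then show ?thesis using exp_L1_sum[of ?m] by (simp add: L1_pow_add scale_right_distrib sum.distrib)
qed

lemma exp_L1_scale: "exp_L1 a (smul A b v) = smul A b (exp_L1 a v)"
proof -
  obtain m where m: "(Lop A 1 ^^ m) v = 0" using L1_locally_nilpotent by metis
  then show ?thesis using exp_L1_sum[of m] by (simp add: L1_pow_scale scale_sum_right mult.commute)
qed

lemma exp_L1_zero [simp]: "exp_L1 0 v = v"
proof -
  obtain m where "(Lop A 1 ^^ m) v = 0" using L1_locally_nilpotent by metis
  then have m: "(Lop A 1 ^^ (Suc m)) v = 0" using L1_pow_vanish by (metis le_SucI order_refl)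
  show ?thesis unfolding exp_L1_sum[OF m] sum.lessThan_Suc_shift by simp
qed

lemma binomial_exp_coefficients:
  "(\<Sum>i\<le>n. (a ^ i / fact i) * (b ^ (n - i) / fact (n - i))) = ((a + b) ^ n / fact n :: complex)"
proof -
  have "(a + b) ^ n / fact n = (\<Sum>i\<le>n. of_nat (n choose i) * a ^ i * b ^ (n - i) / fact n)"
    by (simp add: binomial_ring sum_divide_distrib)
  also have "\<dots> = (\<Sum>i\<le>n. (a ^ i / fact i) * (b ^ (n - i) / fact (n - i)))"
    by (intro sum.cong refl) (simp add: binomial_fact field_simps)
  finally show ?thesis ..
qed

text \<open>The double sum has no terms with \<open>k + l \<ge> m\<close>. Summing over \<open>k + l = n\<close> first, the coefficients are
  those of the binomial theorem.\<close>

lemma exp_L1_exp_L1: "exp_L1 a (exp_L1 b v) = exp_L1 (a + b) v"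
proof -
  obtain m where m: "(Lop A 1 ^^ m) v = 0" using L1_locally_nilpotent by metis
  let ?L = "\<lambda>k. (Lop A 1 ^^ k) v"
  let ?c = "\<lambda>k l. (a ^ k / fact k) * (b ^ l / fact l)"
  have z: "?L k = 0" if "m \<le> k" for k using L1_pow_vanish[OF m that] .
  have lb: "(Lop A 1 ^^ k) (exp_L1 b v) = (\<Sum>l<m. smul A (b ^ l / fact l) (?L (k + l)))" for k
    by (simp add: exp_L1_sum[OF m] L1_pow_sum L1_pow_scale funpow_add)
  have "(Lop A 1 ^^ m) (exp_L1 b v) = 0" unfolding lb by (simp add: z)
  then have "exp_L1 a (exp_L1 b v) = (\<Sum>k<m. \<Sum>l<m. smul A (?c k l) (?L (k + l)))"
    by (simp add: exp_L1_sum lb scale_sum_right)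
  also have "\<dots> = (\<Sum>(k, l)\<in>{..<m} \<times> {..<m}. smul A (?c k l) (?L (k + l)))"
    by (rule sum.cartesian_product)
  also have "\<dots> = (\<Sum>(k, l)\<in>{(k, l). k + l < m}. smul A (?c k l) (?L (k + l)))"
    by (rule sum.mono_neutral_right) (auto intro!: z simp: scale_eq_0_iff)
  also have "\<dots> = (\<Sum>n<m. \<Sum>i\<le>n. smul A (?c i (n - i)) (?L (i + (n - i))))"
    by (rule sum.triangle_reindex)
  also have "\<dots> = (\<Sum>n<m. smul A (\<Sum>i\<le>n. ?c i (n - i)) (?L n))"
    by (simp add: scale_sum_left)
  also have "\<dots> = exp_L1 (a + b) v"
    unfolding binomial_exp_coefficients exp_L1_sum[OF m] ..
  finally show ?thesis .
qed

text \<open>Each application of \<open>L(1)\<close> lowers the degree by 1 and so costs a factor \<open>x\<^sup>-\<^sup>1\<close>.\<close>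

lemma power_L0_L1_pow:
  assumes "x \<noteq> 0"
  shows "power_L0 A x ((Lop A 1 ^^ k) v) = smul A (inverse x ^ k) ((Lop A 1 ^^ k) (power_L0 A x v))"
proof (rule component_eqI, rule ext)
  fix n
  have "x powi n = inverse x ^ k * x powi (n + int k)"
    using assms by (simp add: power_int_add power_inverse)
  then show "component A (power_L0 A x ((Lop A 1 ^^ k) v)) n =
      component A (smul A (inverse x ^ k) ((Lop A 1 ^^ k) (power_L0 A x v))) n"
    by (simp add: component_power_L0 component_L1_pow component_scale L1_pow_scale)
qed

lemma power_L0_zero_vec [simp]: "power_L0 A x 0 = 0"
  using power_L0_scale[of x 0 0] by simp

lemma power_L0_sum_vec: "power_L0 A x (sum f I) = (\<Sum>i\<in>I. power_L0 A x (f i))"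
  by (induction I rule: infinite_finite_induct) (auto simp: power_L0_add)

lemma power_L0_exp_L1:
  assumes "x \<noteq> 0"
  shows "power_L0 A x (exp_L1 a v) = exp_L1 (a * inverse x) (power_L0 A x v)"
proof -
  obtain m where m: "(Lop A 1 ^^ m) v = 0" using L1_locally_nilpotent by metis
  have "smul A (inverse x ^ m) ((Lop A 1 ^^ m) (power_L0 A x v)) = 0"
    using power_L0_L1_pow[OF assms, of m v] m by simp
  then have m': "(Lop A 1 ^^ m) (power_L0 A x v) = 0" using assms by simp
  show ?thesis unfolding exp_L1_sum[OF m] exp_L1_sum[OF m']
    by (simp add: power_L0_sum_vec power_L0_scale power_L0_L1_pow[OF assms] power_mult_distrib)
qed

subsection \<open>The automorphy factor \<open>K\<close>\<close>

lemma K_exp_L1: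
  "K A \<gamma> \<tau> v = exp_L1 (- (of_real (inverse (det \<gamma>)) * of_real (\<gamma>$2$1) * jfac \<gamma> \<tau>))
     (power_L0 A (jfac \<gamma> \<tau> powi (-2) * of_real (det \<gamma>)) v)"
  by (simp add: K_def exp_L1_def power_L0_mult)

lemma K_add: "K A \<gamma> \<tau> (u + v) = K A \<gamma> \<tau> u + K A \<gamma> \<tau> v"
  by (simp add: K_exp_L1 power_L0_add exp_L1_add)

lemma K_scale: "K A \<gamma> \<tau> (smul A a v) = smul A a (K A \<gamma> \<tau> v)"
  by (simp add: K_exp_L1 power_L0_scale exp_L1_scale)

lemma K_linear: "Vector_Spaces.linear (smul A) (smul A) (K A \<gamma> \<tau>)"
  unfolding Vector_Spaces.linear_iff using vector_space_axioms by (auto simp: K_add K_scale)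

text \<open>Moving \<open>j(\<gamma>,\<beta>\<tau>)\<^bsup>-2L(0)\<^esup>(det \<gamma>)\<^bsup>L(0)\<^esup>\<close> past the exponential in \<open>K(\<beta>,\<tau>)\<close> multiplies its exponent by
  \<open>j(\<gamma>,\<beta>\<tau>)\<^sup>2/det \<gamma>\<close>. The sum of both exponents is the one of \<open>K(\<gamma>\<beta>,\<tau>)\<close> by the identity
  \<open>c\<^sub>\<gamma>\<^sub>\<beta> j(\<beta>,\<tau>) = c\<^sub>\<gamma> det \<beta> + j(\<gamma>\<beta>,\<tau>) c\<^sub>\<beta>\<close>.\<close>

lemma K_cocycle:
  assumes "det \<gamma> > 0" "det \<beta> > 0" "\<tau> \<in> \<bbbH>"
  shows "K A (\<gamma> ** \<beta>) \<tau> v = K A \<gamma> (moeb \<beta> \<tau>) (K A \<beta> \<tau> v)"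
proof -
  define D d j1 j2 where "D = complex_of_real (det \<gamma>)" and "d = complex_of_real (det \<beta>)"
    and "j1 = jfac \<gamma> (moeb \<beta> \<tau>)" and "j2 = jfac \<beta> \<tau>"
  define c c' where "c = complex_of_real (\<gamma>$2$1)" and "c' = complex_of_real (\<beta>$2$1)"
  have nz: "D \<noteq> 0" "d \<noteq> 0" "j2 \<noteq> 0" "j1 \<noteq> 0"
    using assms jfac_nonzero[of \<beta> \<tau>] jfac_nonzero[of \<gamma> "moeb \<beta> \<tau>"] moeb_in_upper_half[of \<beta> \<tau>]
    by (auto simp: D_def d_def j1_def j2_def)
  have j: "jfac (\<gamma> ** \<beta>) \<tau> = j1 * j2" using jfac_mult[of \<beta> \<tau> \<gamma>] assms by (simp add: j1_def j2_def)
  have dd: "complex_of_real (det (\<gamma> ** \<beta>)) = D * d" by (simp add: det_mul D_def d_def)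
  define x where "x = j1 powi (-2) * D"
  have x: "x \<noteq> 0" using nz by (simp add: x_def)
  have xi: "inverse x = j1\<^sup>2 * inverse D" using nz by (simp add: x_def power_int_minus)
  have key: "of_real ((\<gamma> ** \<beta>)$2$1) * j2 = c * d + j1 * j2 * c'"
  proof -
    have "j1 * j2 = jfac (\<gamma> ** \<beta>) \<tau>" using j by simp
    then show ?thesis by (simp add: jfac_def j2_def c_def c'_def d_def det_2 algebra_simps)
  qed
  have "K A \<gamma> (moeb \<beta> \<tau>) (K A \<beta> \<tau> v) =
      exp_L1 (- (inverse D * c * j1)) (power_L0 A x (exp_L1 (- (inverse d * c' * j2)) (power_L0 A (j2 powi (-2) * d) v)))"
    by (simp add: K_exp_L1 D_def d_def j1_def j2_def c_def c'_def x_def)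
  also have "\<dots> = exp_L1 (- (inverse D * c * j1) + - (inverse d * c' * j2) * inverse x) (power_L0 A (x * (j2 powi (-2) * d)) v)"
    by (simp add: power_L0_exp_L1[OF x] exp_L1_exp_L1 power_L0_mult)
  also have "x * (j2 powi (-2) * d) = (j1 * j2) powi (-2) * (D * d)"
    by (simp add: x_def power_int_mult_distrib)
  also have "- (inverse D * c * j1) + - (inverse d * c' * j2) * inverse x
      = - (inverse (D * d) * j1 * (c * d + j1 * j2 * c'))"
    unfolding xi using nz by (simp add: field_simps power2_eq_square)
  also have "\<dots> = - (inverse (D * d) * of_real ((\<gamma> ** \<beta>)$2$1) * (j1 * j2))"
    unfolding key[symmetric] by (simp add: ac_simps)
  also have "exp_L1 \<dots> (power_L0 A ((j1 * j2) powi (-2) * (D * d)) v) = K A (\<gamma> ** \<beta>) \<tau> v"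
    unfolding K_exp_L1 j by (simp add: dd[symmetric] del: mat2_mult_nth)
  finally show ?thesis ..
qed

lemma K_one: "K A (mat 1) \<tau> v = v"
  by (simp add: K_exp_L1)

lemma K_minus: "K A (- \<gamma>) \<tau> v = K A \<gamma> \<tau> v"
  by (simp add: K_exp_L1 jfac_minus power_int_minus)

text \<open>This is why the bundle extends across the cusps: it is trivial along the stabilizer of a cusp.\<close>

lemma K_translation: "K A (translation t) \<tau> v = v"
  by (simp add: K_exp_L1) (simp add: translation_mat22)

lemma K_upper_triangular:
  assumes "\<beta>$2$1 = 0" shows "K A \<beta> \<tau> v = K A \<beta> \<tau>' v"
  using assms by (simp add: K_exp_L1 jfac_def)

subsection \<open>The filtration by conformal degree\<close>

lemma subspace_filt: "subspace (filt A N)"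
  by (simp add: filt_def)

lemma filt_iff: "v \<in> filt A N \<longleftrightarrow> (\<forall>n>N. component A v n = 0)"
proof
  assume "v \<in> filt A N"
  then show "\<forall>n>N. component A v n = 0" unfolding filt_def
    by (induction rule: span_induct_alt) (auto simp: component_add component_scale component_homogeneous)
next
  assume *: "\<forall>n>N. component A v n = 0"
  obtain S where S: "finite S" "\<And>n. n \<notin> S \<Longrightarrow> component A v n = 0" using component_support[of v] by blast
  have "component A v n \<in> filt A N" for n
  proof (cases "n \<le> N")
    case True
    then show ?thesis unfolding filt_def using component_in_grade[of v n] by (intro span_base) auto
  next
    case False
    then show ?thesis using * subspace_0[OF subspace_filt] by simp
  qed
  then have "sum (component A v) S \<in> filt A N" by (intro subspace_sum[OF subspace_filt]) auto
  then show "v \<in> filt A N" using sum_component[OF S] by simp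
qed

lemma filt_exhaust: obtains N where "v \<in> filt A N"
proof -
  obtain S where S: "finite S" "\<And>n. n \<notin> S \<Longrightarrow> component A v n = 0" using component_support[of v] by blast
  have "v \<in> filt A (Max (insert 0 S))"
    unfolding filt_iff using S by (metis Max_ge finite_insert insertCI not_less)
  then show thesis using that by blast
qed

lemma filt_L1_pow: "v \<in> filt A N \<Longrightarrow> (Lop A 1 ^^ k) v \<in> filt A N"
  by (simp add: filt_iff component_L1_pow)

lemma filt_power_L0: "v \<in> filt A N \<Longrightarrow> power_L0 A x v \<in> filt A N"
  by (simp add: filt_iff component_power_L0)

lemma filt_exp_L1:
  assumes "v \<in> filt A N" shows "exp_L1 a v \<in> filt A N"
proof -
  obtain m where m: "(Lop A 1 ^^ m) v = 0" using L1_locally_nilpotent by metis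
  show ?thesis unfolding exp_L1_sum[OF m]
    by (intro subspace_sum[OF subspace_filt] subspace_scale[OF subspace_filt] filt_L1_pow assms)
qed

lemma filt_K: "v \<in> filt A N \<Longrightarrow> K A \<gamma> \<tau> v \<in> filt A N"
  by (simp add: K_exp_L1 filt_exp_L1 filt_power_L0)

lemma filt_finite_basis: "\<exists>B. finite B \<and> basis_of A (filt A N) B"
proof -
  obtain n0 where n0: "\<And>n. n < n0 \<Longrightarrow> grade A n = {0}" using grade_bounded_below by blast
  obtain C where C: "\<And>n. finite (C n)" "\<And>n. grade A n = span (C n)" using grade_finite_dim by metis
  define D where "D = (\<Union>n\<in>{n0..N}. C n)"
  have D: "finite D" using C by (simp add: D_def)
  have "filt A N = span D"
  proof
    have "grade A n \<subseteq> span D" if "n \<le> N" for n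
    proof (cases "n < n0")
      case True
      then show ?thesis using n0 span_zero by auto
    next
      case False
      then have "n \<in> {n0..N}" using that by simp
      then have "C n \<subseteq> D" unfolding D_def by blast
      then show ?thesis using C(2) span_mono by auto
    qed
    then have "(\<Union>n\<in>{..N}. grade A n) \<subseteq> span D" by auto
    then show "filt A N \<subseteq> span D" unfolding filt_def by (rule span_minimal) simp
    have "C n \<subseteq> grade A n" for n using C(2) span_superset by auto
    then have "D \<subseteq> (\<Union>n\<in>{..N}. grade A n)" unfolding D_def by fastforce
    then show "span D \<subseteq> filt A N" unfolding filt_def by (rule span_mono)
  qed
  moreover obtain B where B: "B \<subseteq> D" "independent B" "D \<subseteq> span B" using maximal_independent_subset[of D] by blast
  moreover have "span B = span D" using B by (metis span_eq span_superset subset_trans)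
  ultimately show ?thesis unfolding basis_of_def using finite_subset[OF B(1) D] by auto
qed

section \<open>Holomorphic maps into a finite-dimensional space\<close>

lemma basis_of_subspace: "basis_of A W B \<Longrightarrow> subspace W"
  unfolding basis_of_def using subspace_span by blast

text \<open>An expansion in finitely many arbitrary vectors of \<open>W\<close> is enough, since coordinates are linear. In
  particular holomorphy does not depend on the basis (\<open>holomorphic_into_basis\<close>).\<close>

lemma holomorphic_into_sumI:
  assumes "finite B" "basis_of A W B" "finite I" "\<And>i. i \<in> I \<Longrightarrow> c i holomorphic_on U"
    "\<And>i. i \<in> I \<Longrightarrow> w i \<in> W" "\<And>z. z \<in> U \<Longrightarrow> f z = (\<Sum>i\<in>I. smul A (c i z) (w i))"
  shows "holomorphic_into A W U f" "\<And>b. (\<lambda>z. representation B (f z) b) holomorphic_on U"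
proof -
  have B: "independent B" "span B = W" using assms(2) by (auto simp: basis_of_def)
  have sub: "subspace W" by (rule basis_of_subspace[OF assms(2)])
  have fW: "f ` U \<subseteq> W"
    using assms(5,6) by (auto intro!: subspace_sum[OF sub] subspace_scale[OF sub])
  have "representation B (f z) b = (\<Sum>i\<in>I. c i z * representation B (w i) b)" if "z \<in> U" for z b
  proof -
    have w: "w i \<in> span B" if "i \<in> I" for i using assms(5) B(2) that by simp
    have "representation B (f z) b = (\<Sum>i\<in>I. representation B (smul A (c i z) (w i)) b)"
      unfolding assms(6)[OF that] using w by (subst representation_sum[OF B(1)]) (auto intro: span_scale)
    also have "\<dots> = (\<Sum>i\<in>I. c i z * representation B (w i) b)"
      using w by (intro sum.cong refl) (simp add: representation_scale[OF B(1)])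
    finally show ?thesis .
  qed
  moreover have "(\<lambda>z. \<Sum>i\<in>I. c i z * representation B (w i) b) holomorphic_on U" for b
    using assms(4) by (intro holomorphic_intros) auto
  ultimately show h: "\<And>b. (\<lambda>z. representation B (f z) b) holomorphic_on U"
    by (metis (no_types, lifting) holomorphic_transform)
  show "holomorphic_into A W U f"
    unfolding holomorphic_into_def using fW h assms(1,2) by blast
qed

lemma holomorphic_into_expansion:
  assumes "holomorphic_into A W U f"
  obtains B c where "finite B" "basis_of A W B" "\<And>b. b \<in> B \<Longrightarrow> b \<in> W"
    "\<And>b. b \<in> B \<Longrightarrow> c b holomorphic_on U" "\<And>z. z \<in> U \<Longrightarrow> f z = (\<Sum>b\<in>B. smul A (c b z) b)"
proof -
  obtain B where B: "finite B" "basis_of A W B" "\<And>b. b \<in> B \<Longrightarrow> (\<lambda>z. representation B (f z) b) holomorphic_on U"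
    and fW: "f ` U \<subseteq> W" using assms unfolding holomorphic_into_def by blast
  have B': "independent B" "span B = W" using B(2) by (auto simp: basis_of_def)
  show thesis
  proof (rule that[of B "\<lambda>b z. representation B (f z) b"])
    show "b \<in> W" if "b \<in> B" for b using B' that span_base by blast
    show "f z = (\<Sum>b\<in>B. smul A (representation B (f z) b) b)" if "z \<in> U" for z
      using sum_representation_eq[of B "f z" B] B' B(1) fW that by auto
  qed (use B in auto)
qed

lemma holomorphic_into_basis:
  assumes "finite B" "basis_of A W B"
  shows "holomorphic_into A W U f \<longleftrightarrow>
    f ` U \<subseteq> W \<and> (\<forall>b\<in>B. (\<lambda>z. representation B (f z) b) holomorphic_on U)"
proof
  assume h: "holomorphic_into A W U f"
  obtain B' c where "finite B'" "basis_of A W B'" "\<And>b. b \<in> B' \<Longrightarrow> b \<in> W"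
    "\<And>b. b \<in> B' \<Longrightarrow> c b holomorphic_on U" "\<And>z. z \<in> U \<Longrightarrow> f z = (\<Sum>b\<in>B'. smul A (c b z) b)"
    by (rule holomorphic_into_expansion[OF h]) (rule that)
  note e = this
  show "f ` U \<subseteq> W \<and> (\<forall>b\<in>B. (\<lambda>z. representation B (f z) b) holomorphic_on U)"
    using holomorphic_into_sumI(2)[OF assms e(1,4,3,5)] h unfolding holomorphic_into_def by blast
qed (use assms in \<open>auto simp: holomorphic_into_def\<close>)

lemma holomorphic_into_compose:
  assumes "holomorphic_into A W U f" "h holomorphic_on D" "h ` D \<subseteq> U"
  shows "holomorphic_into A W D (\<lambda>z. f (h z))"
proof -
  obtain B where B: "finite B" "basis_of A W B" "\<And>b. b \<in> B \<Longrightarrow> (\<lambda>z. representation B (f z) b) holomorphic_on U"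
    and fW: "f ` U \<subseteq> W" using assms unfolding holomorphic_into_def by blast
  have "(\<lambda>z. representation B (f (h z)) b) holomorphic_on D" if "b \<in> B" for b
    using holomorphic_on_compose_gen[OF assms(2) B(3)[OF that] assms(3)] by (simp add: o_def)
  then show ?thesis using B fW assms(3) unfolding holomorphic_into_def by blast
qed

lemma holomorphic_into_subset: "holomorphic_into A W U f \<Longrightarrow> D \<subseteq> U \<Longrightarrow> holomorphic_into A W D f"
  using holomorphic_into_compose[of W U f "\<lambda>z. z" D] by auto

lemma holomorphic_into_cong:
  assumes "\<And>z. z \<in> U \<Longrightarrow> f z = g z" shows "holomorphic_into A W U f \<longleftrightarrow> holomorphic_into A W U g"
proof -
  have *: "holomorphic_into A W U g" if h: "holomorphic_into A W U f" "\<And>z. z \<in> U \<Longrightarrow> f z = g z" for f g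
  proof -
    obtain B c where "finite B" "basis_of A W B" "\<And>b. b \<in> B \<Longrightarrow> b \<in> W"
      "\<And>b. b \<in> B \<Longrightarrow> c b holomorphic_on U" "\<And>z. z \<in> U \<Longrightarrow> f z = (\<Sum>b\<in>B. smul A (c b z) b)"
      by (rule holomorphic_into_expansion[OF h(1)]) (rule that)
    note e = this
    show ?thesis by (rule holomorphic_into_sumI(1)[OF e(1,2,1,4,3)]) (use e(5) h(2) in auto)
  qed
  show ?thesis using *[of f g] *[of g f] assms by auto
qed

lemma holomorphic_into_lincomb:
  assumes "finite B" "basis_of A W B" "finite I" "\<And>i. i \<in> I \<Longrightarrow> c i holomorphic_on U"
    "\<And>i. i \<in> I \<Longrightarrow> holomorphic_into A W U (f i)"
  shows "holomorphic_into A W U (\<lambda>z. \<Sum>i\<in>I. smul A (c i z) (f i z))"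
proof -
  have B: "independent B" "span B = W" using assms(2) by (auto simp: basis_of_def)
  have fW: "f i z \<in> W" if "i \<in> I" "z \<in> U" for i z using assms(5) that unfolding holomorphic_into_def by blast
  have h: "(\<lambda>z. representation B (f i z) b) holomorphic_on U" if "i \<in> I" "b \<in> B" for i b
    using assms(5)[OF that(1)] that(2) unfolding holomorphic_into_basis[OF assms(1,2)] by blast
  have eq: "(\<Sum>i\<in>I. smul A (c i z) (f i z)) =
      (\<Sum>b\<in>B. smul A (\<Sum>i\<in>I. c i z * representation B (f i z) b) b)" if z: "z \<in> U" for z
  proof -
    have "(\<Sum>i\<in>I. smul A (c i z) (f i z)) = (\<Sum>i\<in>I. smul A (c i z) (\<Sum>b\<in>B. smul A (representation B (f i z) b) b))"
      by (intro sum.cong refl) (use sum_representation_eq[of B _ B] B assms(1) fW z in auto)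
    also have "\<dots> = (\<Sum>b\<in>B. \<Sum>i\<in>I. smul A (c i z * representation B (f i z) b) b)"
      by (simp add: scale_sum_right) (rule sum.swap)
    finally show ?thesis by (simp add: scale_sum_left)
  qed
  show ?thesis
    by (rule holomorphic_into_sumI(1)[OF assms(1,2,1), of "\<lambda>b z. \<Sum>i\<in>I. c i z * representation B (f i z) b" _ "\<lambda>b. b"])
      (use assms(4) h B span_base eq in \<open>auto intro!: holomorphic_intros\<close>)
qed

lemma holomorphic_GL_linear_sum:
  assumes "holomorphic_GL A W U g" "subspace W" "z \<in> U" "finite I" "\<And>i. i \<in> I \<Longrightarrow> w i \<in> W"
  shows "g z (\<Sum>i\<in>I. smul A (c i) (w i)) = (\<Sum>i\<in>I. smul A (c i) (g z (w i)))"
proof -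
  have add: "g z (v + w) = g z v + g z w" if "v \<in> W" "w \<in> W" for v w
    using assms(1,3) that unfolding holomorphic_GL_def by blast
  have sc: "g z (smul A a v) = smul A a (g z v)" if "v \<in> W" for a v
    using assms(1,3) that unfolding holomorphic_GL_def by blast
  have zero: "g z 0 = 0" using sc[of 0 0] subspace_0[OF assms(2)] by simp
  show ?thesis using assms(4,5)
  proof (induction I rule: finite_induct)
    case (insert i I)
    have "(\<Sum>i\<in>I. smul A (c i) (w i)) \<in> W" "smul A (c i) (w i) \<in> W"
      using insert.prems by (auto intro!: subspace_sum[OF assms(2)] subspace_scale[OF assms(2)])
    then show ?case using insert by (simp add: add sc)
  qed (simp add: zero)
qed

lemma holomorphic_GL_apply:
  assumes "holomorphic_GL A W U g" "holomorphic_into A W U f"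
  shows "holomorphic_into A W U (\<lambda>z. g z (f z))"
proof -
  obtain B c where "finite B" "basis_of A W B" "\<And>b. b \<in> B \<Longrightarrow> b \<in> W"
    "\<And>b. b \<in> B \<Longrightarrow> c b holomorphic_on U" "\<And>z. z \<in> U \<Longrightarrow> f z = (\<Sum>b\<in>B. smul A (c b z) b)"
    by (rule holomorphic_into_expansion[OF assms(2)]) (rule that)
  note e = this
  have "holomorphic_into A W U (\<lambda>z. \<Sum>b\<in>B. smul A (c b z) (g z b))"
    by (rule holomorphic_into_lincomb[OF e(1,2,1,4)])
      (use assms(1) e(3) in \<open>auto simp: holomorphic_GL_def\<close>)
  moreover have "g z (f z) = (\<Sum>b\<in>B. smul A (c b z) (g z b))" if "z \<in> U" for z
    using e(5)[OF that] holomorphic_GL_linear_sum[OF assms(1) basis_of_subspace[OF e(2)] that e(1,3)] by simp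
  ultimately show ?thesis using holomorphic_into_cong by (metis (no_types, lifting))
qed

lemma holomorphic_GL_compose:
  assumes "holomorphic_GL A W U g" "h holomorphic_on D" "h ` D \<subseteq> U"
  shows "holomorphic_GL A W D (\<lambda>z. g (h z))"
proof -
  have "holomorphic_into A W D (\<lambda>z. g (h z) v)" if "v \<in> W" for v
    using holomorphic_into_compose[OF _ assms(2,3), of W "\<lambda>z. g z v"] assms(1) that
    unfolding holomorphic_GL_def by blast
  then show ?thesis using assms(1,3) unfolding holomorphic_GL_def by blast
qed

text \<open>On the finitely many components of a fixed \<open>v\<close>, both factors of \<open>K\<close> expand into a finite sum of
  fixed vectors whose coefficients are polynomials in \<open>j\<close> and \<open>j\<^sup>-\<^sup>1\<close>.\<close>

lemma K_holomorphic:
  assumes "det \<gamma> > 0" "v \<in> filt A N"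
  shows "holomorphic_into A (filt A N) \<bbbH> (\<lambda>\<tau>. K A \<gamma> \<tau> v)"
proof -
  obtain B where B: "finite B" "basis_of A (filt A N) B" using filt_finite_basis by blast
  obtain S where S: "finite S" "\<And>n. n \<notin> S \<Longrightarrow> component A v n = 0" using component_support[of v] by blast
  have "\<exists>m. \<forall>n\<in>S. (Lop A 1 ^^ m) (component A v n) = 0"
  proof -
    obtain m where m: "\<And>n. (Lop A 1 ^^ (m n)) (component A v n) = 0"
      using L1_locally_nilpotent choice[of "\<lambda>n m. (Lop A 1 ^^ m) (component A v n) = 0"] by blast
    have "(Lop A 1 ^^ (Max (m ` S))) (component A v n) = 0" if "n \<in> S" for n
      using L1_pow_vanish[OF m] S(1) that by simp
    then show ?thesis by blast
  qed
  then obtain m where m: "\<And>n. n \<in> S \<Longrightarrow> (Lop A 1 ^^ m) (component A v n) = 0" by blast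
  define a where "a = (\<lambda>\<tau>. - (of_real (inverse (det \<gamma>)) * of_real (\<gamma>$2$1) * jfac \<gamma> \<tau>))"
  define x where "x = (\<lambda>\<tau>. jfac \<gamma> \<tau> powi (-2) * of_real (det \<gamma>))"
  have jz: "jfac \<gamma> \<tau> \<noteq> 0" if "\<tau> \<in> \<bbbH>" for \<tau> using jfac_nonzero[of \<gamma> \<tau>] assms(1) that by simp
  have x0: "x \<tau> \<noteq> 0" if "\<tau> \<in> \<bbbH>" for \<tau> using jz[OF that] assms(1) by (simp add: x_def)
  have eq: "K A \<gamma> \<tau> v = (\<Sum>(n, k)\<in>S \<times> {..<m}. smul A (x \<tau> powi n * (a \<tau> ^ k / fact k)) ((Lop A 1 ^^ k) (component A v n)))" for \<tau>
  proof -
    have sum: "exp_L1 c (sum f S) = (\<Sum>n\<in>S. exp_L1 c (f n))" for c f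
      using S(1) exp_L1_scale[of c 0 0] by (induction S rule: finite_induct) (auto simp: exp_L1_add)
    have "K A \<gamma> \<tau> v = (\<Sum>n\<in>S. smul A (x \<tau> powi n) (exp_L1 (a \<tau>) (component A v n)))"
    proof -
      have "K A \<gamma> \<tau> v = exp_L1 (a \<tau>) (power_L0 A (x \<tau>) v)" by (simp add: K_exp_L1 a_def x_def)
      then show ?thesis by (simp add: power_L0_sum[OF S] sum exp_L1_scale)
    qed
    also have "\<dots> = (\<Sum>n\<in>S. \<Sum>k<m. smul A (x \<tau> powi n * (a \<tau> ^ k / fact k)) ((Lop A 1 ^^ k) (component A v n)))"
      by (intro sum.cong refl) (simp add: exp_L1_sum[OF m] scale_sum_right)
    finally show ?thesis by (simp add: sum.cartesian_product)
  qed
  have cf: "component A v n \<in> filt A N" for n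
    using assms(2) component_homogeneous[OF component_in_grade[of v n]] by (auto simp: filt_iff)
  have xh: "x holomorphic_on \<bbbH>" unfolding x_def
    by (intro holomorphic_intros) (simp_all add: jz)
  have ah: "a holomorphic_on \<bbbH>" unfolding a_def by (intro holomorphic_intros)
  show ?thesis
  proof (rule holomorphic_into_sumI(1)[OF B, of "S \<times> {..<m}"
      "\<lambda>p \<tau>. x \<tau> powi (fst p) * (a \<tau> ^ snd p / fact (snd p))" _ "\<lambda>p. (Lop A 1 ^^ snd p) (component A v (fst p))"])
    show "(\<lambda>\<tau>. x \<tau> powi fst p * (a \<tau> ^ snd p / fact (snd p))) holomorphic_on \<bbbH>" for p
      using x0 by (intro holomorphic_intros xh ah) auto
  qed (use S(1) filt_L1_pow[OF cf] eq in \<open>auto simp: case_prod_unfold\<close>)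
qed

lemma K_bij_filt:
  assumes "det \<gamma> = 1" "\<tau> \<in> \<bbbH>"
  shows "bij_betw (K A \<gamma> \<tau>) (filt A N) (filt A N)" "bij (K A \<gamma> \<tau>)"
proof -
  let ?\<gamma>' = "matrix_inv \<gamma>"
  have i: "K A ?\<gamma>' (moeb \<gamma> \<tau>) (K A \<gamma> \<tau> v) = v" for v
    using K_cocycle[of ?\<gamma>' \<gamma> \<tau> v] assms by (simp add: matrix_inv_props K_one)
  have i2: "K A \<gamma> \<tau> (K A ?\<gamma>' (moeb \<gamma> \<tau>) v) = v" for v
    using K_cocycle[of \<gamma> ?\<gamma>' "moeb \<gamma> \<tau>" v] assms
    by (simp add: matrix_inv_props K_one moeb_in_upper_half moeb_inverse)
  show "bij_betw (K A \<gamma> \<tau>) (filt A N) (filt A N)"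
    by (rule bij_betw_byWitness[of _ "K A ?\<gamma>' (moeb \<gamma> \<tau>)"]) (use i i2 filt_K in auto)
  show "bij (K A \<gamma> \<tau>)" by (rule o_bij[of "K A ?\<gamma>' (moeb \<gamma> \<tau>)"]) (use i i2 in auto)
qed

lemma K_holomorphic_GL:
  assumes "det \<gamma> = 1" shows "holomorphic_GL A (filt A N) \<bbbH> (K A \<gamma>)"
  unfolding holomorphic_GL_def using K_bij_filt(1)[OF assms] K_holomorphic[of \<gamma>] assms
  by (auto simp: K_add K_scale)

lemma twisted_K_cocycle:
  assumes "det \<gamma> > 0" "det \<beta> > 0" "\<tau> \<in> \<bbbH>"
  shows "twisted_K A k (\<gamma> ** \<beta>) \<tau> v = twisted_K A k \<gamma> (moeb \<beta> \<tau>) (twisted_K A k \<beta> \<tau> v)"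
  using assms by (simp add: twisted_K_def K_cocycle K_scale jfac_mult power_int_mult_distrib)

lemma twisted_K_bij:
  assumes "det \<gamma> = 1" "\<tau> \<in> \<bbbH>"
  shows "bij_betw (twisted_K A k \<gamma> \<tau>) (filt A N) (filt A N)"
proof -
  let ?\<gamma>' = "matrix_inv \<gamma>"
  have one: "twisted_K A k (mat 1) \<tau> v = v" for v \<tau> by (simp add: twisted_K_def K_one)
  have i: "twisted_K A k ?\<gamma>' (moeb \<gamma> \<tau>) (twisted_K A k \<gamma> \<tau> v) = v" for v
    using twisted_K_cocycle[of ?\<gamma>' \<gamma> \<tau> k v] assms by (simp add: matrix_inv_props one)
  have i2: "twisted_K A k \<gamma> \<tau> (twisted_K A k ?\<gamma>' (moeb \<gamma> \<tau>) v) = v" for v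
    using twisted_K_cocycle[of \<gamma> ?\<gamma>' "moeb \<gamma> \<tau>" k v] assms
    by (simp add: matrix_inv_props one moeb_in_upper_half moeb_inverse)
  have W: "twisted_K A k \<gamma> \<tau> v \<in> filt A N" if "v \<in> filt A N" for v \<gamma> \<tau>
    unfolding twisted_K_def using that by (intro subspace_scale[OF subspace_filt] filt_K)
  show ?thesis
    by (rule bij_betw_byWitness[of _ "twisted_K A k ?\<gamma>' (moeb \<gamma> \<tau>)"]) (use i i2 W in auto)
qed

lemma twisted_K_holomorphic_GL:
  assumes "det \<gamma> = 1" shows "holomorphic_GL A (filt A N) \<bbbH> (twisted_K A k \<gamma>)"
proof -
  obtain B where B: "finite B" "basis_of A (filt A N) B" using filt_finite_basis by blast
  have "holomorphic_into A (filt A N) \<bbbH> (\<lambda>\<tau>. twisted_K A k \<gamma> \<tau> v)" if "v \<in> filt A N" for v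
  proof -
    have "jfac \<gamma> \<tau> \<noteq> 0" if "\<tau> \<in> \<bbbH>" for \<tau> using jfac_nonzero[of \<gamma> \<tau>] assms that by simp
    then have "(\<lambda>\<tau>. jfac \<gamma> \<tau> powi k) holomorphic_on \<bbbH>" by (intro holomorphic_intros) auto
    then have "holomorphic_into A (filt A N) \<bbbH> (\<lambda>\<tau>. \<Sum>i\<in>{()}. smul A (jfac \<gamma> \<tau> powi k) (K A \<gamma> \<tau> v))"
      using K_holomorphic[of \<gamma> v N] assms that by (intro holomorphic_into_lincomb[OF B]) auto
    then show ?thesis by (simp add: twisted_K_def)
  qed
  then show ?thesis unfolding holomorphic_GL_def using twisted_K_bij[OF assms]
    by (auto simp: twisted_K_def K_add K_scale scale_right_distrib mult.commute)
qed

end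

section \<open>Group actions from automorphy factors\<close>

lemma group_action_restrict:
  assumes "group G" "\<And>g x. g \<in> carrier G \<Longrightarrow> x \<in> E \<Longrightarrow> a g x \<in> E"
    "\<And>g h x. g \<in> carrier G \<Longrightarrow> h \<in> carrier G \<Longrightarrow> x \<in> E \<Longrightarrow> a (g \<otimes>\<^bsub>G\<^esub> h) x = a g (a h x)"
    "\<And>x. x \<in> E \<Longrightarrow> a \<one>\<^bsub>G\<^esub> x = x"
  shows "group_action G E (\<lambda>g. restrict (a g) E)"
proof -
  interpret group G by fact
  have inv: "a (inv\<^bsub>G\<^esub> g) (a g x) = x" "a g (a (inv\<^bsub>G\<^esub> g) x) = x" if "g \<in> carrier G" "x \<in> E" for g x
    using assms(3)[of "inv\<^bsub>G\<^esub> g" g x] assms(3)[of g "inv\<^bsub>G\<^esub> g" x] assms(4) that by auto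
  have Bij: "restrict (a g) E \<in> Bij E" if "g \<in> carrier G" for g
  proof -
    have "bij_betw (a g) E E"
      by (rule bij_betw_byWitness[of _ "a (inv\<^bsub>G\<^esub> g)"]) (use assms(2) inv that in auto)
    then show ?thesis by (simp add: Bij_def cong: bij_betw_cong)
  qed
  show ?thesis
  proof (intro group_action.intro group_hom.intro group_hom_axioms.intro homI)
    fix g h assume gh: "g \<in> carrier G" "h \<in> carrier G"
    then have "restrict (a g) E \<otimes>\<^bsub>BijGroup E\<^esub> restrict (a h) E = compose E (restrict (a g) E) (restrict (a h) E)"
      using Bij by (simp add: BijGroup_def)
    also have "\<dots> = restrict (a (g \<otimes>\<^bsub>G\<^esub> h)) E"
      using gh assms(2,3) by (auto simp: compose_def fun_eq_iff restrict_def)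
    finally show "restrict (a (g \<otimes>\<^bsub>G\<^esub> h)) E = restrict (a g) E \<otimes>\<^bsub>BijGroup E\<^esub> restrict (a h) E" ..
  qed (use Bij in \<open>auto simp: BijGroup_def group_BijGroup[unfolded BijGroup_def] intro: assms(1)\<close>)
qed

lemma (in group_action) image_subgroup: "subgroup (\<phi> ` carrier G) (BijGroup E)"
  using group_hom.img_is_subgroup[OF group_hom] .

section \<open>The bundle on the open curve\<close>

context fuchsian begin

lemma orb_self: "s \<in> orb \<Gamma> s"
  unfolding orb_def using lifts_one by (metis image_eqI moeb_sphere_one)

lemma orb_eq_iff: "orb \<Gamma> s = orb \<Gamma> t \<longleftrightarrow> (\<exists>\<gamma>\<in>lifts \<Gamma>. moeb_sphere \<gamma> s = t)"
proof
  assume "orb \<Gamma> s = orb \<Gamma> t"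
  then have "t \<in> orb \<Gamma> s" using orb_self by simp
  then show "\<exists>\<gamma>\<in>lifts \<Gamma>. moeb_sphere \<gamma> s = t" by (auto simp: orb_def)
next
  have sub: "orb \<Gamma> (moeb_sphere \<gamma> s) \<subseteq> orb \<Gamma> s" if "\<gamma> \<in> lifts \<Gamma>" for \<gamma> s
  proof
    fix u assume "u \<in> orb \<Gamma> (moeb_sphere \<gamma> s)"
    then obtain \<beta> where b: "\<beta> \<in> lifts \<Gamma>" "u = moeb_sphere \<beta> (moeb_sphere \<gamma> s)" by (auto simp: orb_def)
    then have "u = moeb_sphere (\<beta> ** \<gamma>) s" using that by (simp add: moeb_sphere_mult)
    then show "u \<in> orb \<Gamma> s" unfolding orb_def using lifts_mult[OF b(1) that] by blast
  qed
  assume "\<exists>\<gamma>\<in>lifts \<Gamma>. moeb_sphere \<gamma> s = t"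
  then obtain \<gamma> where g: "\<gamma> \<in> lifts \<Gamma>" "moeb_sphere \<gamma> s = t" by blast
  then have "moeb_sphere (matrix_inv \<gamma>) t = s" using moeb_sphere_inverse(1) lifts_det by blast
  then show "orb \<Gamma> s = orb \<Gamma> t" using sub[OF g(1), of s] sub[OF lifts_inv[OF g(1)], of t] g(2) by auto
qed

lemma orb_Some_eq_iff:
  assumes "\<tau> \<in> \<bbbH>"
  shows "orb \<Gamma> (Some \<tau>) = orb \<Gamma> (Some \<tau>') \<longleftrightarrow> (\<exists>\<gamma>\<in>lifts \<Gamma>. moeb \<gamma> \<tau> = \<tau>')"
  unfolding orb_eq_iff using assms by (simp add: moeb_sphere_Some cong: bex_cong)

lemma subgroup_stab: assumes "\<tau> \<in> \<bbbH>" shows "subgroup (stab \<Gamma> \<tau>) SL2"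
proof (rule group.subgroupI[OF group_SL2])
  show "stab \<Gamma> \<tau> \<subseteq> carrier SL2" by (auto simp: stab_iff)
  show "stab \<Gamma> \<tau> \<noteq> {}" using lifts_one stab_iff moeb_one by blast
  show "inv\<^bsub>SL2\<^esub> \<gamma> \<in> stab \<Gamma> \<tau>" if "\<gamma> \<in> stab \<Gamma> \<tau>" for \<gamma>
    using stab_inv[OF assms that] that by (simp add: SL2_inv stab_iff)
  show "\<gamma> \<otimes>\<^bsub>SL2\<^esub> \<beta> \<in> stab \<Gamma> \<tau>" if "\<gamma> \<in> stab \<Gamma> \<tau>" "\<beta> \<in> stab \<Gamma> \<tau>" for \<gamma> \<beta>
    using stab_mult[OF assms that] by simp
qed

text \<open>The stabilizer is finite, so its elements have finite order.\<close>

lemma torsion_free_stab: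
  assumes "torsion_free \<Gamma>" "\<tau> \<in> \<bbbH>" "\<gamma> \<in> stab \<Gamma> \<tau>"
  shows "\<gamma> = mat 1 \<or> \<gamma> = - mat 1"
proof -
  let ?S = "SL2\<lparr>carrier := stab \<Gamma> \<tau>\<rparr>"
  have S: "group ?S" using subgroup.subgroup_is_group[OF subgroup_stab[OF assms(2)] group_SL2] .
  have fin: "finite (carrier ?S)" using finite_stab[OF assms(2)] by simp
  let ?n = "order ?S"
  have pos: "?n > 0" using fin monoid.one_closed[OF group.is_monoid[OF S]] by (simp add: order_def card_gt_0_iff) blast
  have "\<gamma> [^]\<^bsub>?S\<^esub> ?n = \<one>\<^bsub>?S\<^esub>" using group.pow_order_eq_1[OF S] assms(3) by simp
  moreover have "\<gamma> [^]\<^bsub>?S\<^esub> n = \<gamma> [^]\<^bsub>SL2\<^esub> n" for n :: nat by (simp add: nat_pow_def)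
  ultimately have one: "\<gamma> [^]\<^bsub>SL2\<^esub> ?n = mat 1" by simp
  have pw: "{\<gamma>, - \<gamma>} [^]\<^bsub>PSL2\<^esub> n = {\<gamma> [^]\<^bsub>SL2\<^esub> n, - (\<gamma> [^]\<^bsub>SL2\<^esub> n)}" for n :: nat
    by (induction n) (auto simp: nat_pow_def PSL2_one PSL2_mult)
  have "{\<gamma>, - \<gamma>} \<in> \<Gamma>" using assms(3) by (simp add: stab_iff lifts_iff)
  moreover have "{\<gamma>, - \<gamma>} [^]\<^bsub>PSL2\<^esub> ?n = \<one>\<^bsub>PSL2\<^esub>" unfolding pw one PSL2_one ..
  ultimately have "{\<gamma>, - \<gamma>} = \<one>\<^bsub>PSL2\<^esub>" using assms(1) pos unfolding torsion_free_def by blast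
  then show ?thesis unfolding PSL2_one by (auto simp: doubleton_eq_iff)
qed

end

text \<open>The properties shared by \<open>K\<close> and \<open>j\<^sup>kK\<close> on the steps of the filtration. The last two concern the
  cusps: by \<open>J_translation\<close> the bundle descends to the punctured disc in the parameter \<open>q\<close>, and by
  \<open>J_upper_triangular\<close> a change of frame at a cusp acts on the fibre there.\<close>

locale automorphy = quasi_VOA A + fuchsian \<Gamma>
  for A :: "'v::ab_group_add qvoa" and \<Gamma> :: "mat2 set set" +
  fixes W :: "'v set" and J :: "mat2 \<Rightarrow> complex \<Rightarrow> 'v \<Rightarrow> 'v"
  assumes finite_basis: "\<exists>B. finite B \<and> basis_of A W B"
    and J_cocycle: "det \<gamma> = 1 \<Longrightarrow> det \<beta> = 1 \<Longrightarrow> \<tau> \<in> \<bbbH> \<Longrightarrow> v \<in> W \<Longrightarrow>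
      J (\<gamma> ** \<beta>) \<tau> v = J \<gamma> (moeb \<beta> \<tau>) (J \<beta> \<tau> v)"
    and J_GL: "det \<gamma> = 1 \<Longrightarrow> holomorphic_GL A W \<bbbH> (J \<gamma>)"
    and J_translation: "\<tau> \<in> \<bbbH> \<Longrightarrow> v \<in> W \<Longrightarrow> J (translation t) \<tau> v = v"
    and J_upper_triangular: "\<beta>$2$1 = 0 \<Longrightarrow> J \<beta> \<tau> v = J \<beta> \<tau>' v"
begin

lemma J_one: "\<tau> \<in> \<bbbH> \<Longrightarrow> v \<in> W \<Longrightarrow> J (mat 1) \<tau> v = v"
  using J_translation[of \<tau> v 0] by simp

lemma subspace_W: "subspace W"
  using finite_basis basis_of_subspace by blast

lemma zero_W [simp]: "0 \<in> W"
  using subspace_W subspace_0 by blast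

lemma J_bij: "det \<gamma> = 1 \<Longrightarrow> \<tau> \<in> \<bbbH> \<Longrightarrow> bij_betw (J \<gamma> \<tau>) W W"
  using J_GL unfolding holomorphic_GL_def by blast

lemma J_W: "det \<gamma> = 1 \<Longrightarrow> \<tau> \<in> \<bbbH> \<Longrightarrow> v \<in> W \<Longrightarrow> J \<gamma> \<tau> v \<in> W"
  using J_bij bij_betwE by blast

lemma J_inj: "det \<gamma> = 1 \<Longrightarrow> \<tau> \<in> \<bbbH> \<Longrightarrow> v \<in> W \<Longrightarrow> w \<in> W \<Longrightarrow> J \<gamma> \<tau> v = J \<gamma> \<tau> w \<longleftrightarrow> v = w"
  using J_bij[of \<gamma> \<tau>] unfolding bij_betw_def inj_on_def by blast

lemma J_inverse:
  assumes "det \<gamma> = 1" "\<tau> \<in> \<bbbH>" "v \<in> W"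
  shows "J (matrix_inv \<gamma>) (moeb \<gamma> \<tau>) (J \<gamma> \<tau> v) = v"
  using J_cocycle[of "matrix_inv \<gamma>" \<gamma> \<tau> v] assms by (simp add: matrix_inv_props J_one)

abbreviation act :: "mat2 \<Rightarrow> complex \<times> 'v \<Rightarrow> complex \<times> 'v" where "act \<equiv> bundle_act J"

lemma act_pair [simp]: "act \<gamma> (\<tau>, v) = (moeb \<gamma> \<tau>, J \<gamma> \<tau> v)"
  by (simp add: bundle_act_def)

lemma act_closed: "det \<gamma> = 1 \<Longrightarrow> x \<in> \<bbbH> \<times> W \<Longrightarrow> act \<gamma> x \<in> \<bbbH> \<times> W"
  by (auto simp: moeb_in_upper_half J_W)

lemma act_mult: "det \<gamma> = 1 \<Longrightarrow> det \<beta> = 1 \<Longrightarrow> x \<in> \<bbbH> \<times> W \<Longrightarrow> act (\<gamma> ** \<beta>) x = act \<gamma> (act \<beta> x)"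
  by (auto simp: moeb_mult J_cocycle)

lemma act_one: "x \<in> \<bbbH> \<times> W \<Longrightarrow> act (mat 1) x = x"
  by (auto simp: J_one)

lemma act_inverse: "det \<gamma> = 1 \<Longrightarrow> x \<in> \<bbbH> \<times> W \<Longrightarrow> act (matrix_inv \<gamma>) (act \<gamma> x) = x"
  using act_mult[of "matrix_inv \<gamma>" \<gamma> x] by (simp add: matrix_inv_props act_one)

lemma class_Y_self: "x \<in> \<bbbH> \<times> W \<Longrightarrow> x \<in> class_Y \<Gamma> J x"
  unfolding class_Y_def using lifts_one act_one by (metis image_eqI)

lemma class_Y_eq_iff:
  assumes "x \<in> \<bbbH> \<times> W" "y \<in> \<bbbH> \<times> W"
  shows "class_Y \<Gamma> J x = class_Y \<Gamma> J y \<longleftrightarrow> (\<exists>\<gamma>\<in>lifts \<Gamma>. act \<gamma> x = y)"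
proof
  assume "class_Y \<Gamma> J x = class_Y \<Gamma> J y"
  then have "y \<in> class_Y \<Gamma> J x" using class_Y_self[OF assms(2)] by simp
  then show "\<exists>\<gamma>\<in>lifts \<Gamma>. act \<gamma> x = y" by (auto simp: class_Y_def)
next
  have sub: "class_Y \<Gamma> J (act \<gamma> x) \<subseteq> class_Y \<Gamma> J x" if "\<gamma> \<in> lifts \<Gamma>" "x \<in> \<bbbH> \<times> W" for \<gamma> x
  proof
    fix u assume "u \<in> class_Y \<Gamma> J (act \<gamma> x)"
    then obtain \<beta> where b: "\<beta> \<in> lifts \<Gamma>" "u = act \<beta> (act \<gamma> x)" by (auto simp: class_Y_def)
    then have "u = act (\<beta> ** \<gamma>) x" using that by (simp add: act_mult)
    then show "u \<in> class_Y \<Gamma> J x" unfolding class_Y_def using lifts_mult[OF b(1) that(1)] by blast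
  qed
  assume "\<exists>\<gamma>\<in>lifts \<Gamma>. act \<gamma> x = y"
  then obtain \<gamma> where g: "\<gamma> \<in> lifts \<Gamma>" "act \<gamma> x = y" by blast
  then have "act (matrix_inv \<gamma>) y = x" using act_inverse assms lifts_det by blast
  then show "class_Y \<Gamma> J x = class_Y \<Gamma> J y"
    using sub[OF g(1) assms(1)] sub[OF lifts_inv[OF g(1)] assms(2)] g(2) by auto
qed

lemma class_Y_act: "\<gamma> \<in> lifts \<Gamma> \<Longrightarrow> x \<in> \<bbbH> \<times> W \<Longrightarrow> class_Y \<Gamma> J (act \<gamma> x) = class_Y \<Gamma> J x"
  using class_Y_eq_iff[of x "act \<gamma> x"] act_closed lifts_det by metis

lemma proj_class_Y: assumes "\<tau> \<in> \<bbbH>" shows "proj_Y (class_Y \<Gamma> J (\<tau>, v)) = orb \<Gamma> (Some \<tau>)"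
  unfolding proj_Y_def class_Y_def orb_def image_image
  by (rule image_cong) (use assms in \<open>auto simp: moeb_sphere_Some\<close>)

lemma orb_in_curve_Y: "\<tau> \<in> \<bbbH> \<Longrightarrow> orb \<Gamma> (Some \<tau>) \<in> curve_Y \<Gamma>"
  by (auto simp: curve_Y_def)

lemma fiber_over_chart:
  assumes "U \<subseteq> \<bbbH>"
  shows "class_Y \<Gamma> J ` (U \<times> W) = {e \<in> total_Y \<Gamma> J W. proj_Y e \<in> (\<lambda>\<tau>. orb \<Gamma> (Some \<tau>)) ` U}"
proof
  show "class_Y \<Gamma> J ` (U \<times> W) \<subseteq> {e \<in> total_Y \<Gamma> J W. proj_Y e \<in> (\<lambda>\<tau>. orb \<Gamma> (Some \<tau>)) ` U}"
    using assms by (auto simp: total_Y_def proj_class_Y subset_iff)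
  show "{e \<in> total_Y \<Gamma> J W. proj_Y e \<in> (\<lambda>\<tau>. orb \<Gamma> (Some \<tau>)) ` U} \<subseteq> class_Y \<Gamma> J ` (U \<times> W)"
  proof clarify
    fix e u assume e: "e \<in> total_Y \<Gamma> J W" "proj_Y e = orb \<Gamma> (Some u)" "u \<in> U"
    then obtain \<tau> v where t: "\<tau> \<in> \<bbbH>" "v \<in> W" "e = class_Y \<Gamma> J (\<tau>, v)" by (auto simp: total_Y_def)
    then obtain \<gamma> where g: "\<gamma> \<in> lifts \<Gamma>" "moeb \<gamma> \<tau> = u" using e proj_class_Y orb_Some_eq_iff by auto
    then have "e = class_Y \<Gamma> J (act \<gamma> (\<tau>, v))" using class_Y_act[OF g(1), of "(\<tau>, v)"] t by simp
    also have "act \<gamma> (\<tau>, v) = (u, J \<gamma> \<tau> v)" using g by simp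
    finally show "e \<in> class_Y \<Gamma> J ` (U \<times> W)" using J_W[of \<gamma> \<tau> v] g t e(3) by auto
  qed
qed

lemma preciselyE:
  assumes "precisely_invariant \<Gamma> U"
  obtains \<tau> where "\<tau> \<in> U" "\<tau> \<in> \<bbbH>" "open U" "U \<subseteq> \<bbbH>" "\<And>\<gamma>. \<gamma> \<in> stab \<Gamma> \<tau> \<Longrightarrow> moeb \<gamma> ` U = U"
    "\<And>\<gamma> z. \<gamma> \<in> lifts \<Gamma> \<Longrightarrow> z \<in> U \<Longrightarrow> moeb \<gamma> z \<in> U \<Longrightarrow> \<gamma> \<in> stab \<Gamma> \<tau>"
proof -
  obtain \<tau> where t: "\<tau> \<in> U" "\<forall>\<gamma>\<in>lifts \<Gamma>. if moeb \<gamma> \<tau> = \<tau> then moeb \<gamma> ` U = U else moeb \<gamma> ` U \<inter> U = {}"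
    and U: "open U" "U \<subseteq> \<bbbH>"
    using assms unfolding precisely_invariant_def by blast
  show thesis
  proof (rule that[OF t(1) _ U])
    show "moeb \<gamma> ` U = U" if "\<gamma> \<in> stab \<Gamma> \<tau>" for \<gamma> using t(2) that by (auto simp: stab_iff)
    show "\<gamma> \<in> stab \<Gamma> \<tau>" if "\<gamma> \<in> lifts \<Gamma>" "z \<in> U" "moeb \<gamma> z \<in> U" for \<gamma> z
    proof (rule ccontr)
      assume "\<gamma> \<notin> stab \<Gamma> \<tau>"
      then have "moeb \<gamma> ` U \<inter> U = {}" using t(2) that(1) by (auto simp: stab_iff)
      then show False using that by blast
    qed
  qed (use t U in auto)
qed

text \<open>The local group consists of the bundle maps of the stabilizer of the centre of \<open>U\<close>: any \<open>\<gamma>\<close> that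
  maps a point of \<open>U\<close> to a point of \<open>U\<close> belongs to this stabilizer.\<close>

lemma local_group_chart:
  assumes "precisely_invariant \<Gamma> U"
  shows "\<exists>G. finite G \<and> subgroup G (BijGroup (U \<times> W)) \<and> (\<forall>\<phi>\<in>G. bundle_automorphism A W U \<phi>) \<and>
    (\<forall>z\<in>U. \<forall>z'\<in>U. orb \<Gamma> (Some z) = orb \<Gamma> (Some z') \<longleftrightarrow> (\<exists>\<phi>\<in>G. fst (\<phi> (z, 0)) = z')) \<and>
    (\<forall>x\<in>U \<times> W. \<forall>y\<in>U \<times> W. class_Y \<Gamma> J x = class_Y \<Gamma> J y \<longleftrightarrow> (\<exists>\<phi>\<in>G. \<phi> x = y))"
proof -
  obtain \<tau> where t: "\<tau> \<in> U" "\<tau> \<in> \<bbbH>" and U: "open U" "U \<subseteq> \<bbbH>"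
    and inv: "\<And>\<gamma>. \<gamma> \<in> stab \<Gamma> \<tau> \<Longrightarrow> moeb \<gamma> ` U = U"
    and stab: "\<And>\<gamma> z. \<gamma> \<in> lifts \<Gamma> \<Longrightarrow> z \<in> U \<Longrightarrow> moeb \<gamma> z \<in> U \<Longrightarrow> \<gamma> \<in> stab \<Gamma> \<tau>"
    using preciselyE[OF assms] by metis
  let ?S = "SL2\<lparr>carrier := stab \<Gamma> \<tau>\<rparr>"
  let ?E = "U \<times> W"
  define G where "G = (\<lambda>\<gamma>. restrict (act \<gamma>) ?E) ` stab \<Gamma> \<tau>"
  have sd: "det \<gamma> = 1" "\<gamma> \<in> lifts \<Gamma>" if "\<gamma> \<in> stab \<Gamma> \<tau>" for \<gamma> using that by (auto simp: stab_iff)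
  have HW: "x \<in> \<bbbH> \<times> W" if "x \<in> ?E" for x using that U by auto
  have closed: "act \<gamma> x \<in> ?E" if g: "\<gamma> \<in> stab \<Gamma> \<tau>" and xE: "x \<in> ?E" for \<gamma> x
  proof -
    obtain z v where x: "x = (z, v)" "z \<in> U" "v \<in> W" using xE by (cases x) auto
    have "moeb \<gamma> z \<in> U" using inv[OF g] x(2) by blast
    then show ?thesis using J_W[of \<gamma> z v] sd(1)[OF g] x U by auto
  qed
  interpret S: group_action ?S ?E "\<lambda>\<gamma>. restrict (act \<gamma>) ?E"
  proof (rule group_action_restrict)
    show "group ?S" using subgroup.subgroup_is_group[OF subgroup_stab[OF t(2)] group_SL2] .
    show "act \<gamma> x \<in> ?E" if "\<gamma> \<in> carrier ?S" "x \<in> ?E" for \<gamma> x using closed that by simp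
    show "act (\<gamma> \<otimes>\<^bsub>?S\<^esub> \<beta>) x = act \<gamma> (act \<beta> x)" if "\<gamma> \<in> carrier ?S" "\<beta> \<in> carrier ?S" "x \<in> ?E" for \<gamma> \<beta> x
      using act_mult[of \<gamma> \<beta> x] sd HW that by simp
    show "act \<one>\<^bsub>?S\<^esub> x = x" if "x \<in> ?E" for x using act_one HW that by simp
  qed
  have sub: "subgroup G (BijGroup ?E)" using S.image_subgroup by (simp add: G_def)
  have aut: "bundle_automorphism A W U \<phi>" if phi: "\<phi> \<in> G" for \<phi>
  proof -
    obtain \<gamma> where g: "\<gamma> \<in> stab \<Gamma> \<tau>" "\<phi> = restrict (act \<gamma>) ?E" using phi by (auto simp: G_def)
    have "moeb \<gamma> holomorphic_on U" using holomorphic_moeb[of "\<lambda>z. z" U \<gamma>] U sd(1)[OF g(1)] by auto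
    moreover have "bij_betw (moeb \<gamma>) U U"
      unfolding bij_betw_def using inv[OF g(1)] inj_on_subset[OF inj_on_moeb[OF sd(1)[OF g(1)]] U(2)] by blast
    moreover have "holomorphic_GL A W U (J \<gamma>)"
      using holomorphic_GL_compose[OF J_GL[OF sd(1)[OF g(1)]], of "\<lambda>z. z" U] U by auto
    ultimately show ?thesis unfolding bundle_automorphism_def g(2) by (intro exI[of _ "moeb \<gamma>"] exI[of _ "J \<gamma>"]) auto
  qed
  have base: "orb \<Gamma> (Some z) = orb \<Gamma> (Some z') \<longleftrightarrow> (\<exists>\<phi>\<in>G. fst (\<phi> (z, 0)) = z')" if "z \<in> U" "z' \<in> U" for z z'
  proof -
    have "orb \<Gamma> (Some z) = orb \<Gamma> (Some z') \<longleftrightarrow> (\<exists>\<gamma>\<in>lifts \<Gamma>. moeb \<gamma> z = z')"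
      using orb_Some_eq_iff U that by blast
    also have "\<dots> \<longleftrightarrow> (\<exists>\<gamma>\<in>stab \<Gamma> \<tau>. moeb \<gamma> z = z')" using stab sd that by metis
    finally show ?thesis using that by (simp add: G_def)
  qed
  have total: "class_Y \<Gamma> J x = class_Y \<Gamma> J y \<longleftrightarrow> (\<exists>\<phi>\<in>G. \<phi> x = y)" if "x \<in> ?E" "y \<in> ?E" for x y
  proof -
    have "class_Y \<Gamma> J x = class_Y \<Gamma> J y \<longleftrightarrow> (\<exists>\<gamma>\<in>lifts \<Gamma>. act \<gamma> x = y)"
      by (rule class_Y_eq_iff[OF HW[OF that(1)] HW[OF that(2)]])
    also have "\<dots> \<longleftrightarrow> (\<exists>\<gamma>\<in>stab \<Gamma> \<tau>. act \<gamma> x = y)"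
    proof
      assume "\<exists>\<gamma>\<in>lifts \<Gamma>. act \<gamma> x = y"
      then obtain \<gamma> where g: "\<gamma> \<in> lifts \<Gamma>" "act \<gamma> x = y" by blast
      then have "moeb \<gamma> (fst x) = fst y" by (auto simp: bundle_act_def split: prod.splits)
      then have "\<gamma> \<in> stab \<Gamma> \<tau>" using stab[OF g(1), of "fst x"] that by auto
      then show "\<exists>\<gamma>\<in>stab \<Gamma> \<tau>. act \<gamma> x = y" using g by blast
    qed (use sd in blast)
    finally show ?thesis using that(1) by (simp only: G_def bex_simps image_iff restrict_apply if_True)
  qed
  have fin: "finite G" unfolding G_def using finite_stab[OF t(2)] by blast
  show ?thesis
    by (intro exI[of _ G] conjI ballI) (rule fin sub | erule aut | erule (1) base | erule (1) total)+
qed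

lemma orbifold_chart_Y:
  assumes "precisely_invariant \<Gamma> U"
  shows "orbifold_chart A W (curve_Y \<Gamma>) (total_Y \<Gamma> J W) proj_Y (U, \<lambda>\<tau>. orb \<Gamma> (Some \<tau>), class_Y \<Gamma> J)"
proof -
  have U: "open U" "U \<subseteq> \<bbbH>" using assms by (auto simp: precisely_invariant_def)
  then have "(\<lambda>\<tau>. orb \<Gamma> (Some \<tau>)) ` U \<subseteq> curve_Y \<Gamma>" using orb_in_curve_Y by auto
  moreover have "\<forall>z\<in>U. \<forall>v\<in>W. proj_Y (class_Y \<Gamma> J (z, v)) = orb \<Gamma> (Some z)" using U proj_class_Y by blast
  ultimately show ?thesis
    unfolding orbifold_chart_def prod.case
    using U(1) fiber_over_chart[OF U(2)] local_group_chart[OF assms] by blast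
qed

text \<open>The chart is, over \<open>D\<close>, the pullback under \<open>t : D \<rightarrow> \<bbbH>\<close> of the quotient map translated by \<open>\<alpha>\<close>.\<close>

definition uniformized ::
    "((complex \<times> 'v) set \<Rightarrow> 'e) \<Rightarrow> ('v, complex option set, 'e) bchart \<Rightarrow> complex set \<Rightarrow> (complex \<Rightarrow> complex) \<Rightarrow> mat2 \<Rightarrow> bool" where
  "uniformized f c D t \<alpha> = (case c of (U, p, P) \<Rightarrow>
     open D \<and> D \<subseteq> U \<and> t holomorphic_on D \<and> inj_on t D \<and> t ` D \<subseteq> \<bbbH> \<and> det \<alpha> = 1 \<and>
     (\<forall>w\<in>D. p w = orb \<Gamma> (Some (moeb \<alpha> (t w))) \<and>
        (\<forall>v\<in>W. P (w, v) = f (class_Y \<Gamma> J (act \<alpha> (t w, v))))))"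

text \<open>If \<open>\<gamma>\<alpha>t(z) = \<alpha>'t'(z')\<close> and \<open>\<beta> = \<alpha>'\<^sup>-\<^sup>1\<gamma>\<alpha>\<close>, then near \<open>z\<close> the change of charts is \<open>t'\<^sup>-\<^sup>1 \<circ> \<beta> \<circ> t\<close> on the base
  and \<open>J(\<beta>, t(w))\<close> on the fibre over \<open>w\<close>.\<close>

lemma uniformized_compatible:
  assumes c: "uniformized f (U, p, P) D t \<alpha>" and c': "uniformized f (U', p', P') D' t' \<alpha>'"
    and z: "z \<in> D" "z' \<in> D'" "p z = p' z'"
  shows "\<exists>D h g. open D \<and> z \<in> D \<and> D \<subseteq> U \<and>
          h holomorphic_on D \<and> inj_on h D \<and> h ` D \<subseteq> U' \<and> h z = z' \<and> holomorphic_GL A W D g \<and>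
          (\<forall>w\<in>D. p w = p' (h w) \<and> (\<forall>v\<in>W. P (w, v) = P' (h w, g w v)))"
proof -
  note C = c[unfolded uniformized_def prod.case] and C' = c'[unfolded uniformized_def prod.case]
  have dd: "det \<alpha> = 1" "det \<alpha>' = 1" using C C' by auto
  have tH: "t w \<in> \<bbbH>" if "w \<in> D" for w using C that by blast
  have tH': "t' w \<in> \<bbbH>" if "w \<in> D'" for w using C' that by blast
  have "orb \<Gamma> (Some (moeb \<alpha> (t z))) = orb \<Gamma> (Some (moeb \<alpha>' (t' z')))" using C C' z by metis
  then obtain \<gamma> where g: "\<gamma> \<in> lifts \<Gamma>" "moeb \<gamma> (moeb \<alpha> (t z)) = moeb \<alpha>' (t' z')"
    using orb_Some_eq_iff moeb_in_upper_half dd tH z by auto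
  define \<beta> where "\<beta> = matrix_inv \<alpha>' ** (\<gamma> ** \<alpha>)"
  have db: "det \<beta> = 1" using dd g(1) by (simp add: \<beta>_def det_mul)
  have ab: "\<alpha>' ** \<beta> = \<gamma> ** \<alpha>" unfolding \<beta>_def using mat2_cancel(2)[of \<alpha>'] dd by simp
  have bz: "moeb \<beta> (t z) = t' z'"
    using g dd tH tH' z by (simp add: \<beta>_def moeb_mult det_mul moeb_inverse)
  obtain s where s: "s holomorphic_on (t' ` D')" "\<And>w. w \<in> D' \<Longrightarrow> s (t' w) = w"
    using holomorphic_has_inverse[of t' D'] C' by metis
  have op: "open (t' ` D')" using open_mapping_thm3[of t' D'] C' by blast
  define h0 where "h0 = (\<lambda>w. moeb \<beta> (t w))"
  have h0: "h0 holomorphic_on D" unfolding h0_def using C db by (intro holomorphic_moeb) auto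
  define D0 where "D0 = D \<inter> h0 -` (t' ` D')"
  have oD0: "open D0" unfolding D0_def
    using continuous_open_preimage[OF holomorphic_on_imp_continuous_on[OF h0] _ op] C by blast
  define h where "h = (\<lambda>w. s (h0 w))"
  have th: "t' (h w) = moeb \<beta> (t w)" "h w \<in> D'" if "w \<in> D0" for w
    using that s(2) unfolding D0_def h_def h0_def by auto
  have hh: "h holomorphic_on D0" unfolding h_def
    using holomorphic_on_compose_gen[OF holomorphic_on_subset[OF h0] s(1), of D0] by (auto simp: D0_def o_def)
  have hinj: "inj_on h D0"
  proof (rule inj_onI)
    fix w w' assume w: "w \<in> D0" "w' \<in> D0" "h w = h w'"
    then have "moeb \<beta> (t w) = moeb \<beta> (t w')" using th by metis
    then have "t w = t w'" using inj_on_moeb[OF db] tH w unfolding inj_on_def D0_def by blast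
    then show "w = w'" using C w unfolding inj_on_def D0_def by blast
  qed
  have gl: "holomorphic_GL A W D0 (\<lambda>w. J \<beta> (t w))"
    by (rule holomorphic_GL_compose[OF J_GL[OF db]]) (use C in \<open>auto simp: D0_def intro: holomorphic_on_subset\<close>)
  have eq: "p w = p' (h w) \<and> (\<forall>v\<in>W. P (w, v) = P' (h w, J \<beta> (t w) v))" if w: "w \<in> D0" for w
  proof -
    have wD: "w \<in> D" using w by (simp add: D0_def)
    have "moeb \<alpha>' (t' (h w)) = moeb \<gamma> (moeb \<alpha> (t w))"
      using arg_cong[OF ab, of "\<lambda>x. moeb x (t w)"] db dd g(1) tH[OF wD] th[OF w] by (simp add: moeb_mult)
    then have "orb \<Gamma> (Some (moeb \<alpha> (t w))) = orb \<Gamma> (Some (moeb \<alpha>' (t' (h w))))"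
      using g(1) orb_Some_eq_iff moeb_in_upper_half dd tH[OF wD] by (metis zero_less_one)
    then have p: "p w = p' (h w)" using C C' wD th(2)[OF w] by metis
    have "P (w, v) = P' (h w, J \<beta> (t w) v)" if v: "v \<in> W" for v
    proof -
      have x: "(t w, v) \<in> \<bbbH> \<times> W" using tH[OF wD] v by simp
      have Jv: "J \<beta> (t w) v \<in> W" using J_W[OF db] tH[OF wD] v by blast
      have "act \<alpha>' (t' (h w), J \<beta> (t w) v) = act \<alpha>' (act \<beta> (t w, v))" using th[OF w] by simp
      also have "\<dots> = act \<gamma> (act \<alpha> (t w, v))"
        using act_mult[of \<alpha>' \<beta>, OF _ _ x] act_mult[of \<gamma> \<alpha>, OF _ _ x] ab dd db g(1) by simp
      finally have "class_Y \<Gamma> J (act \<alpha>' (t' (h w), J \<beta> (t w) v)) = class_Y \<Gamma> J (act \<alpha> (t w, v))"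
        using class_Y_act[OF g(1) act_closed[OF dd(1) x]] by simp
      then show ?thesis using C C' wD th(2)[OF w] v Jv by metis
    qed
    with p show ?thesis by blast
  qed
  have zD0: "z \<in> D0" using z bz by (auto simp: D0_def h0_def)
  have hz: "h z = z'" using s(2)[OF z(2)] bz by (simp add: h_def h0_def)
  show ?thesis
    by (rule exI[of _ D0], rule exI[of _ h], rule exI[of _ "\<lambda>w. J \<beta> (t w)"])
      (use oD0 zD0 hh hinj th hz gl eq C C' in \<open>auto simp: D0_def\<close>)
qed

lemma uniformized_Y:
  assumes "precisely_invariant \<Gamma> U"
  shows "uniformized f (U, \<lambda>\<tau>. orb \<Gamma> (Some \<tau>), f \<circ> class_Y \<Gamma> J) U (\<lambda>z. z) (mat 1)"
  using assms unfolding uniformized_def precisely_invariant_def by (auto simp: J_one)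

lemma separated_points:
  assumes "\<tau> \<in> \<bbbH>" "\<tau>' \<in> \<bbbH>" "orb \<Gamma> (Some \<tau>) \<noteq> orb \<Gamma> (Some \<tau>')"
  obtains U U' where "precisely_invariant \<Gamma> U" "precisely_invariant \<Gamma> U'" "\<tau> \<in> U" "\<tau>' \<in> U'"
    "(\<lambda>z. orb \<Gamma> (Some z)) ` U \<inter> (\<lambda>z. orb \<Gamma> (Some z)) ` U' = {}"
proof -
  obtain r where r: "r > 0"
    "\<And>\<gamma> z. \<gamma> \<in> lifts \<Gamma> \<Longrightarrow> moeb \<gamma> \<tau> \<noteq> \<tau>' \<Longrightarrow> z \<in> ball \<tau> r \<Longrightarrow> moeb \<gamma> z \<notin> ball \<tau>' r"
    using orbit_separation[OF assms(1,2)] by metis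
  obtain U where U: "precisely_invariant \<Gamma> U" "\<tau> \<in> U" "U \<subseteq> ball \<tau> r"
    using precisely_invariant_nbhd[OF assms(1), of "ball \<tau> r"] r(1) by auto
  obtain U' where U': "precisely_invariant \<Gamma> U'" "\<tau>' \<in> U'" "U' \<subseteq> ball \<tau>' r"
    using precisely_invariant_nbhd[OF assms(2), of "ball \<tau>' r"] r(1) by auto
  have "orb \<Gamma> (Some z) \<noteq> orb \<Gamma> (Some z')" if "z \<in> U" "z' \<in> U'" for z z'
  proof
    assume "orb \<Gamma> (Some z) = orb \<Gamma> (Some z')"
    moreover have "z \<in> \<bbbH>" using that U(1) by (auto simp: precisely_invariant_def)
    ultimately obtain \<gamma> where "\<gamma> \<in> lifts \<Gamma>" "moeb \<gamma> z = z'" using orb_Some_eq_iff by blast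
    then show False using r(2)[of \<gamma> z] that U(3) U'(3) assms(3) orb_Some_eq_iff[OF assms(1)] by blast
  qed
  then show thesis using that[OF U(1) U'(1) U(2) U'(2)] by blast
qed

theorem orbifold_bundle_Y: "orbifold_bundle A W (curve_Y \<Gamma>) (total_Y \<Gamma> J W) proj_Y (atlas_Y \<Gamma> J)"
  unfolding orbifold_bundle_def
proof (intro conjI ballI)
  fix c assume c: "c \<in> atlas_Y \<Gamma> J"
  then show "orbifold_chart A W (curve_Y \<Gamma>) (total_Y \<Gamma> J W) proj_Y c"
    using orbifold_chart_Y by (auto simp: atlas_Y_def)
  fix c' assume c': "c' \<in> atlas_Y \<Gamma> J"
  obtain U U' where U: "precisely_invariant \<Gamma> U" "c = (U, \<lambda>\<tau>. orb \<Gamma> (Some \<tau>), class_Y \<Gamma> J)"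
    "precisely_invariant \<Gamma> U'" "c' = (U', \<lambda>\<tau>. orb \<Gamma> (Some \<tau>), class_Y \<Gamma> J)"
    using c c' by (auto simp: atlas_Y_def)
  show "compatible_charts A W c c'"
    unfolding compatible_charts_def U prod.case
    using uniformized_compatible[of id, OF uniformized_Y[OF U(1), of id, simplified] uniformized_Y[OF U(3), of id, simplified]]
    by blast
next
  show "proj_Y ` total_Y \<Gamma> J W \<subseteq> curve_Y \<Gamma>" by (auto simp: total_Y_def proj_class_Y orb_in_curve_Y)
  show "curve_Y \<Gamma> = (\<Union>(U, p, P)\<in>atlas_Y \<Gamma> J. p ` U)"
  proof
    show "curve_Y \<Gamma> \<subseteq> (\<Union>(U, p, P)\<in>atlas_Y \<Gamma> J. p ` U)"
    proof
      fix x assume "x \<in> curve_Y \<Gamma>"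
      then obtain \<tau> where t: "\<tau> \<in> \<bbbH>" "x = orb \<Gamma> (Some \<tau>)" by (auto simp: curve_Y_def)
      then obtain U where "precisely_invariant \<Gamma> U" "\<tau> \<in> U" using precisely_invariant_nbhd[of \<tau> UNIV] by auto
      then show "x \<in> (\<Union>(U, p, P)\<in>atlas_Y \<Gamma> J. p ` U)" using t unfolding atlas_Y_def by blast
    qed
    show "(\<Union>(U, p, P)\<in>atlas_Y \<Gamma> J. p ` U) \<subseteq> curve_Y \<Gamma>"
      using orb_in_curve_Y by (auto simp: atlas_Y_def precisely_invariant_def subset_iff)
  qed
  show "hausdorff_atlas (curve_Y \<Gamma>) (atlas_Y \<Gamma> J)"
    unfolding hausdorff_atlas_def
  proof (intro ballI impI)
    fix x y assume xy: "x \<in> curve_Y \<Gamma>" "y \<in> curve_Y \<Gamma>" "x \<noteq> y"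
    then obtain \<tau> \<tau>' where t: "\<tau> \<in> \<bbbH>" "x = orb \<Gamma> (Some \<tau>)" "\<tau>' \<in> \<bbbH>" "y = orb \<Gamma> (Some \<tau>')"
      by (auto simp: curve_Y_def)
    obtain U U' where U: "precisely_invariant \<Gamma> U" "precisely_invariant \<Gamma> U'" "\<tau> \<in> U" "\<tau>' \<in> U'"
      "(\<lambda>z. orb \<Gamma> (Some z)) ` U \<inter> (\<lambda>z. orb \<Gamma> (Some z)) ` U' = {}"
      using separated_points t xy(3) by metis
    show "\<exists>(U, p, P)\<in>atlas_Y \<Gamma> J. \<exists>(U', p', P')\<in>atlas_Y \<Gamma> J. x \<in> p ` U \<and> y \<in> p' ` U' \<and> p ` U \<inter> p' ` U' = {}"
      by (rule bexI[of _ "(U, \<lambda>\<tau>. orb \<Gamma> (Some \<tau>), class_Y \<Gamma> J)"], unfold prod.case,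
          rule bexI[of _ "(U', \<lambda>\<tau>. orb \<Gamma> (Some \<tau>), class_Y \<Gamma> J)"])
        (use U t in \<open>auto simp: atlas_Y_def\<close>)
  qed
qed

lemma injective_charts_Y:
  assumes "torsion_free \<Gamma>" "\<And>\<tau> v. \<tau> \<in> \<bbbH> \<Longrightarrow> v \<in> W \<Longrightarrow> J (- mat 1) \<tau> v = v" "precisely_invariant \<Gamma> U"
  shows "inj_on (\<lambda>\<tau>. orb \<Gamma> (Some \<tau>)) U" "inj_on (class_Y \<Gamma> J) (U \<times> W)"
proof -
  obtain \<tau> where t: "\<tau> \<in> \<bbbH>" and U: "U \<subseteq> \<bbbH>"
    and stab: "\<And>\<gamma> z. \<gamma> \<in> lifts \<Gamma> \<Longrightarrow> z \<in> U \<Longrightarrow> moeb \<gamma> z \<in> U \<Longrightarrow> \<gamma> \<in> stab \<Gamma> \<tau>"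
    using preciselyE[OF assms(3)] by metis
  have triv: "\<gamma> = mat 1 \<or> \<gamma> = - mat 1" if "\<gamma> \<in> lifts \<Gamma>" "z \<in> U" "moeb \<gamma> z \<in> U" for \<gamma> z
    using torsion_free_stab[OF assms(1) t stab[OF that]] .
  show "inj_on (\<lambda>\<tau>. orb \<Gamma> (Some \<tau>)) U"
  proof (rule inj_onI)
    fix z z' assume z: "z \<in> U" "z' \<in> U" "orb \<Gamma> (Some z) = orb \<Gamma> (Some z')"
    then obtain \<gamma> where g: "\<gamma> \<in> lifts \<Gamma>" "moeb \<gamma> z = z'" using orb_Some_eq_iff U by blast
    then have "\<gamma> = mat 1 \<or> \<gamma> = - mat 1" using triv z by blast
    then show "z = z'" using g by auto
  qed
  show "inj_on (class_Y \<Gamma> J) (U \<times> W)"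
  proof (rule inj_onI)
    fix x y assume xy: "x \<in> U \<times> W" "y \<in> U \<times> W" "class_Y \<Gamma> J x = class_Y \<Gamma> J y"
    then obtain \<gamma> where g: "\<gamma> \<in> lifts \<Gamma>" "act \<gamma> x = y" using class_Y_eq_iff[of x y] U by blast
    obtain z v where x: "x = (z, v)" "z \<in> U" "v \<in> W" using xy by blast
    have "moeb \<gamma> z \<in> U" using g xy x by auto
    then have "\<gamma> = mat 1 \<or> \<gamma> = - mat 1" using triv g x by blast
    then show "x = y" using g x U assms(2)[of z v] J_one[of z v] by auto
  qed
qed

theorem ordinary_bundle_Y:
  assumes "torsion_free \<Gamma>" "\<And>\<tau> v. \<tau> \<in> \<bbbH> \<Longrightarrow> v \<in> W \<Longrightarrow> J (- mat 1) \<tau> v = v"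
  shows "ordinary_bundle A W (curve_Y \<Gamma>) (total_Y \<Gamma> J W) proj_Y (atlas_Y \<Gamma> J)"
  unfolding ordinary_bundle_def using orbifold_bundle_Y injective_charts_Y[OF assms]
  by (auto simp: atlas_Y_def)

end

section \<open>The parameter at a cusp\<close>

lemma qpar_nonzero [simp]: "qpar \<omega> \<tau> \<noteq> 0"
  by (simp add: qpar_def)

lemma qpar_add_period: "\<omega> > 0 \<Longrightarrow> qpar \<omega> (\<tau> + of_real (of_int n * \<omega>)) = qpar \<omega> \<tau>"
proof -
  assume "\<omega> > 0"
  then have "2 * of_real pi * \<i> * (\<tau> + of_real (of_int n * \<omega>)) / of_real \<omega> =
      2 * of_real pi * \<i> * \<tau> / of_real \<omega> + of_int n * (2 * of_real pi * \<i>)"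
    by (simp add: field_simps)
  then show ?thesis unfolding qpar_def exp_eq by (intro exI[of _ n]) (simp add: algebra_simps)
qed

lemma qpar_eq_iff:
  assumes "\<omega> > 0"
  shows "qpar \<omega> \<tau> = qpar \<omega> \<tau>' \<longleftrightarrow> (\<exists>n::int. \<tau> = \<tau>' + of_real (of_int n * \<omega>))"
proof
  assume "qpar \<omega> \<tau> = qpar \<omega> \<tau>'"
  then obtain n :: int where "2 * of_real pi * \<i> * \<tau> / of_real \<omega> =
      2 * of_real pi * \<i> * \<tau>' / of_real \<omega> + of_real (of_int (2 * n) * pi) * \<i>"
    unfolding qpar_def exp_eq by blast
  then have "(2 * of_real pi * \<i>) * \<tau> = (2 * of_real pi * \<i>) * (\<tau>' + of_real (of_int n * \<omega>))"
    using assms by (simp add: field_simps)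
  then have "\<tau> = \<tau>' + of_real (of_int n * \<omega>)" unfolding mult_cancel_left by simp
  then show "\<exists>n::int. \<tau> = \<tau>' + of_real (of_int n * \<omega>)" ..
qed (use qpar_add_period[OF assms] in auto)

lemma qpar_qlog: "\<omega> > 0 \<Longrightarrow> q \<noteq> 0 \<Longrightarrow> qpar \<omega> (qlog \<omega> q) = q"
  by (simp add: qpar_def qlog_def)

lemma qlog_in_upper_half:
  assumes "\<omega> > 0" "q \<noteq> 0" "norm q < 1" shows "qlog \<omega> q \<in> \<bbbH>"
proof -
  have "exp (- 2 * pi * Im (qlog \<omega> q) / \<omega>) < 1"
    using qpar_norm[of \<omega> "qlog \<omega> q"] qpar_qlog[OF assms(1,2)] assms(3) by simp
  then have "pi * Im (qlog \<omega> q) / \<omega> > 0" by simp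
  then show ?thesis using assms(1) pi_gt_zero by (simp add: upper_half_iff zero_less_divide_iff zero_less_mult_iff)
qed

lemma qpar_norm_less_one: "\<omega> > 0 \<Longrightarrow> \<tau> \<in> \<bbbH> \<Longrightarrow> norm (qpar \<omega> \<tau>) < 1"
  by (simp add: qpar_norm upper_half_iff)

lemma qlog_qpar: assumes "\<omega> > 0" obtains n :: int where "qlog \<omega> (qpar \<omega> \<tau>) = \<tau> + of_real (of_int n * \<omega>)"
  using qpar_eq_iff[OF assms, of "qlog \<omega> (qpar \<omega> \<tau>)" \<tau>] qpar_qlog[OF assms qpar_nonzero, of \<omega> \<tau>] by blast

lemma divide_through: "k \<noteq> 0 \<Longrightarrow> w \<noteq> 0 \<Longrightarrow> k * (w * l / k + x) / w = l + k * x / (w :: complex)"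
  by (simp add: field_simps)

text \<open>A local inverse of the parameter that is holomorphic near \<open>q\<^sub>0\<close>. As the principal logarithm jumps
  across the negative axis, it is applied to \<open>q/q\<^sub>0\<close>, which is near 1.\<close>

lemma local_log:
  assumes "\<omega> > 0" "q0 \<noteq> 0" "norm q0 < r" "r \<le> 1"
  obtains D t where "open D" "q0 \<in> D" "D \<subseteq> ball 0 r - {0}" "t holomorphic_on D" "inj_on t D" "t ` D \<subseteq> \<bbbH>"
    "\<And>q. q \<in> D \<Longrightarrow> qpar \<omega> (t q) = q"
proof -
  define D where "D = ball 0 r \<inter> ball q0 (norm q0)"
  define t where "t = (\<lambda>q. of_real \<omega> * Ln (q / q0) / (2 * of_real pi * \<i>) + qlog \<omega> q0)"
  have D0: "q \<noteq> 0" "q / q0 \<notin> \<real>\<^sub>\<le>\<^sub>0" if q: "q \<in> D" for q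
  proof -
    have lt: "norm (q / q0 - 1) < 1"
    proof -
      have "q / q0 - 1 = (q - q0) / q0" using assms(2) by (simp add: field_simps)
      then show ?thesis using q assms(2) by (simp add: D_def dist_norm norm_divide norm_minus_commute)
    qed
    then show "q \<noteq> 0" by auto
    have "\<bar>Re (q / q0 - 1)\<bar> < 1" using lt abs_Re_le_cmod le_less_trans by blast
    then have "Re (q / q0) > 0" by simp
    then show "q / q0 \<notin> \<real>\<^sub>\<le>\<^sub>0" by (auto simp: complex_nonpos_Reals_iff)
  qed
  have qt: "qpar \<omega> (t q) = q" if q: "q \<in> D" for q
  proof -
    have "qpar \<omega> (t q) = exp (Ln (q / q0)) * qpar \<omega> (qlog \<omega> q0)"
      unfolding qpar_def t_def exp_add[symmetric] using assms(1) by (subst divide_through) auto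
    then show ?thesis using D0(1)[OF q] assms by (simp add: qpar_qlog)
  qed
  show thesis
  proof (rule that[of D t])
    show "open D" unfolding D_def by (intro open_Int open_ball)
    show "q0 \<in> D" using assms by (simp add: D_def)
    show "D \<subseteq> ball 0 r - {0}" using D0 by (auto simp: D_def)
    show "t holomorphic_on D" unfolding t_def using D0 assms(2) by (intro holomorphic_intros) auto
    show "inj_on t D" using qt by (metis inj_onI)
    show "t ` D \<subseteq> \<bbbH>"
    proof clarify
      fix q assume q: "q \<in> D"
      then have "norm q < 1" using assms by (auto simp: D_def)
      then have "exp (- 2 * pi * Im (t q) / \<omega>) < 1" using qpar_norm[of \<omega> "t q"] qt[OF q] by simp
      then have "pi * Im (t q) / \<omega> > 0" by simp
      then show "t q \<in> \<bbbH>" using assms(1) pi_gt_zero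
        by (simp add: upper_half_iff zero_less_divide_iff zero_less_mult_iff)
    qed
  qed (rule qt)
qed

context fuchsian begin

lemma cusp_frame_real: "\<sigma> \<in> cusp_frames \<Gamma> \<Longrightarrow> moeb_sphere \<sigma> None \<in> insert None (Some ` \<real>)"
  using frame_cusp unfolding cusps_def by blast

lemma cusp_frame_exists:
  assumes "s \<in> cusps \<Gamma>"
  obtains \<sigma> where "\<sigma> \<in> cusp_frames \<Gamma>" "moeb_sphere \<sigma> None = s"
proof (cases s)
  case None
  then show thesis using that[of "mat 1"] frameI[of "mat 1"] assms by simp
next
  case (Some z)
  then obtain x where x: "z = of_real x" using assms by (auto simp: cusps_def elim!: Reals_cases)
  have "moeb_sphere (mat22 x (-1) 1 0) None = s" using Some x by (simp add: moeb_sphere_def)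
  then show thesis using that[of "mat22 x (-1) 1 0"] frameI[of "mat22 x (-1) 1 0"] assms by simp
qed

lemma orb_cusp_neq_orb_Some:
  assumes "\<sigma> \<in> cusp_frames \<Gamma>" "\<tau> \<in> \<bbbH>"
  shows "orb \<Gamma> (moeb_sphere \<sigma> None) \<noteq> orb \<Gamma> (Some \<tau>)"
proof
  assume "orb \<Gamma> (moeb_sphere \<sigma> None) = orb \<Gamma> (Some \<tau>)"
  then obtain \<gamma> where "moeb_sphere \<gamma> (moeb_sphere \<sigma> None) = Some \<tau>" unfolding orb_eq_iff by blast
  then have "Some \<tau> \<in> insert None (Some ` \<real>)"
    using moeb_sphere_real[OF cusp_frame_real[OF assms(1)], of \<gamma>] by simp
  then show False using assms(2) by (auto simp: upper_half_iff complex_is_Real_iff)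
qed

lemma frames_same_cusp:
  assumes "\<sigma> \<in> cusp_frames \<Gamma>" "\<sigma>' \<in> cusp_frames \<Gamma>"
    and "\<gamma> \<in> lifts \<Gamma>" "moeb_sphere \<gamma> (moeb_sphere \<sigma> None) = moeb_sphere \<sigma>' None"
  obtains \<beta> where "det \<beta> = 1" "\<beta>$2$1 = 0" "\<sigma>' ** \<beta> = \<gamma> ** \<sigma>"
proof -
  have d: "det \<sigma> = 1" "det \<sigma>' = 1" "det \<gamma> = 1" using assms by simp_all
  define \<beta> where "\<beta> = matrix_inv \<sigma>' ** (\<gamma> ** \<sigma>)"
  have "det \<beta> = 1" using d by (simp add: \<beta>_def det_mul)
  moreover have "\<sigma>' ** \<beta> = \<gamma> ** \<sigma>" unfolding \<beta>_def using mat2_cancel(2)[of \<sigma>'] d by simp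
  moreover have "moeb_sphere \<beta> None = None"
    using d assms(4) moeb_sphere_inverse(1)[OF d(2), of None] by (simp add: \<beta>_def moeb_sphere_mult det_mul)
  then have "\<beta>$2$1 = 0" by (simp add: moeb_sphere_None_iff)
  ultimately show thesis using that by blast
qed

text \<open>The two stabilizers are conjugate under \<open>\<beta>\<close>, which scales translations by \<open>a\<^sup>2\<close>.\<close>

lemma cusp_width_change_frame:
  assumes w: "cusp_width \<Gamma> \<sigma> \<omega>" and d: "det \<sigma> = 1" "det \<sigma>' = 1"
    and b: "det \<beta> = 1" "\<beta>$2$1 = 0" "\<sigma>' ** \<beta> = \<gamma> ** \<sigma>" "\<gamma> \<in> lifts \<Gamma>"
  shows "cusp_width \<Gamma> \<sigma>' ((\<beta>$1$1)\<^sup>2 * \<omega>)"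
proof -
  have a: "\<beta>$1$1 \<noteq> 0" using b by (auto simp: det_2)
  have bi: "matrix_inv \<beta> $ 2 $ 1 = 0" using b by (simp add: matrix_inv_SL2)
  have tr: "\<beta> ** translation s ** matrix_inv \<beta> = translation ((\<beta>$1$1)\<^sup>2 * s)" for s
    unfolding conjugate_translation[OF b(1)] by (simp add: b(2) translation_mat22)
  have move: "matrix_inv \<beta> ** x ** \<beta> = y \<longleftrightarrow> x = \<beta> ** y ** matrix_inv \<beta>" for x y
    using b(1) mat2_cancel by (metis matrix_mul_assoc one_neq_zero)
  have "x \<in> conj_stab \<Gamma> \<sigma>' \<longleftrightarrow> matrix_inv \<beta> ** x ** \<beta> \<in> conj_stab \<Gamma> \<sigma>" for x
  proof -
    have "\<sigma>' = \<gamma> ** \<sigma> ** matrix_inv \<beta>" using b(1,3) mat2_cancel(3)[of \<beta> \<sigma>'] by simp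
    then have "\<sigma>' ** x ** matrix_inv \<sigma>' = \<gamma> ** (\<sigma> ** (matrix_inv \<beta> ** x ** \<beta>) ** matrix_inv \<sigma>) ** matrix_inv \<gamma>"
      using b d by (simp add: matrix_inv_mult2 det_mul matrix_inv_inv2 matrix_mul_assoc)
    moreover have "\<gamma> ** y ** matrix_inv \<gamma> \<in> lifts \<Gamma> \<longleftrightarrow> y \<in> lifts \<Gamma>" for y
    proof
      assume "\<gamma> ** y ** matrix_inv \<gamma> \<in> lifts \<Gamma>"
      then have "matrix_inv \<gamma> ** (\<gamma> ** y ** matrix_inv \<gamma>) ** \<gamma> \<in> lifts \<Gamma>"
        using lifts_mult lifts_inv b(4) by blast
      moreover have "matrix_inv \<gamma> ** (\<gamma> ** y ** matrix_inv \<gamma>) ** \<gamma> = y"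
        using b(4) mat2_cancel lifts_det by (metis matrix_mul_assoc one_neq_zero)
      ultimately show "y \<in> lifts \<Gamma>" by simp
    qed (use lifts_mult lifts_inv b(4) in blast)
    moreover have "x$2$1 = 0 \<longleftrightarrow> (matrix_inv \<beta> ** x ** \<beta>)$2$1 = 0"
    proof -
      have "\<beta>$2$2 \<noteq> 0" using b by (auto simp: det_2)
      then show ?thesis using b a by (simp add: matrix_inv_SL2)
    qed
    ultimately show ?thesis unfolding conj_stab_iff[OF d(1)] conj_stab_iff[OF d(2)] by (simp del: mat2_mult_nth)
  qed
  also have "\<And>x. matrix_inv \<beta> ** x ** \<beta> \<in> conj_stab \<Gamma> \<sigma> \<longleftrightarrow>
      (\<exists>n::int. x = translation (of_int n * ((\<beta>$1$1)\<^sup>2 * \<omega>)) \<or> x = - translation (of_int n * ((\<beta>$1$1)\<^sup>2 * \<omega>)))"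
    unfolding cusp_width_iff[OF w] move by (simp add: tr mult.left_commute)
  finally have "conj_stab \<Gamma> \<sigma>' = generate SL2 {translation ((\<beta>$1$1)\<^sup>2 * \<omega>), - mat 1}"
    unfolding generate_translation by blast
  then show ?thesis using cusp_width_pos[OF w] a by (simp add: cusp_width_def)
qed

text \<open>Since \<open>\<beta>\<tau> = a\<^sup>2\<tau> + ab\<close> and the widths have ratio \<open>a\<^sup>2\<close>, the parameters differ by the constant factor
  \<open>e = exp(2\<pi>iab/\<omega>')\<close>.\<close>

lemma qpar_change_frame:
  assumes w: "cusp_width \<Gamma> \<sigma> \<omega>" and w': "cusp_width \<Gamma> \<sigma>' \<omega>'" and d: "det \<sigma> = 1" "det \<sigma>' = 1"
    and b: "det \<beta> = 1" "\<beta>$2$1 = 0" "\<sigma>' ** \<beta> = \<gamma> ** \<sigma>" and g: "\<gamma> \<in> lifts \<Gamma>"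
  obtains e where "norm e = 1" "\<And>\<tau>. qpar \<omega>' (moeb \<beta> \<tau>) = qpar \<omega> \<tau> * e"
proof -
  have w2: "\<omega>' = (\<beta>$1$1)\<^sup>2 * \<omega>"
    using cusp_width_unique[OF w' cusp_width_change_frame[OF w d b g]] .
  have wp: "\<omega> > 0" "\<omega>' > 0" using cusp_width_pos w w' by auto
  have a0: "\<beta>$1$1 \<noteq> 0" using w2 wp by auto
  define e where "e = exp (2 * of_real pi * \<i> * of_real (\<beta>$1$1 * \<beta>$1$2) / of_real \<omega>')"
  have e: "norm e = 1"
  proof -
    have "e = exp (\<i> * of_real (2 * pi * (\<beta>$1$1 * \<beta>$1$2) / \<omega>'))" unfolding e_def by (simp add: algebra_simps)
    then show ?thesis by (simp only: norm_exp_i_times)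
  qed
  have qh: "qpar \<omega>' (moeb \<beta> \<tau>) = qpar \<omega> \<tau> * e" for \<tau>
  proof -
    have "2 * of_real pi * \<i> * moeb \<beta> \<tau> / of_real \<omega>' = 2 * of_real pi * \<i> * \<tau> / of_real \<omega> +
        2 * of_real pi * \<i> * of_real (\<beta>$1$1 * \<beta>$1$2) / of_real \<omega>'"
      unfolding real_upper_triangular_moeb[OF b(2,1)] w2 using a0 wp(1) by (simp add: field_simps)
    then show ?thesis unfolding qpar_def e_def by (simp add: exp_add)
  qed
  with e that show thesis by blast
qed

lemma cusp_base_zero [simp]: "cusp_base \<Gamma> \<sigma> \<omega> 0 = orb \<Gamma> (moeb_sphere \<sigma> None)"
  and cusp_base_nonzero: "q \<noteq> 0 \<Longrightarrow> cusp_base \<Gamma> \<sigma> \<omega> q = orb \<Gamma> (Some (moeb \<sigma> (qlog \<omega> q)))"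
  by (simp_all add: cusp_base_def)

lemma cusp_radius_pos: "cusp_radius \<Gamma> \<sigma> \<omega> r \<Longrightarrow> 0 < r" and cusp_radius_le_one: "cusp_radius \<Gamma> \<sigma> \<omega> r \<Longrightarrow> r \<le> 1"
  by (simp_all add: cusp_radius_def)

lemma moeb_cusp_shift:
  assumes "cusp_width \<Gamma> \<sigma> \<omega>" "det \<sigma> = 1" "\<tau> \<in> \<bbbH>"
  obtains \<gamma> where "\<gamma> \<in> lifts \<Gamma>" "\<gamma> ** \<sigma> = \<sigma> ** translation (of_int n * \<omega>)"
    "moeb \<gamma> (moeb \<sigma> \<tau>) = moeb \<sigma> (\<tau> + of_real (of_int n * \<omega>))"
proof -
  define \<gamma> where "\<gamma> = \<sigma> ** translation (of_int n * \<omega>) ** matrix_inv \<sigma>"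
  have g: "\<gamma> \<in> lifts \<Gamma>" unfolding \<gamma>_def by (rule cusp_width_translation[OF assms(1,2)])
  have e: "\<gamma> ** \<sigma> = \<sigma> ** translation (of_int n * \<omega>)" unfolding \<gamma>_def using mat2_cancel(4)[of \<sigma>] assms(2) by simp
  have "moeb (\<gamma> ** \<sigma>) \<tau> = moeb (\<sigma> ** translation (of_int n * \<omega>)) \<tau>" by (simp only: e)
  then have "moeb \<gamma> (moeb \<sigma> \<tau>) = moeb \<sigma> (moeb (translation (of_int n * \<omega>)) \<tau>)"
    using assms g by (simp add: moeb_mult)
  then show thesis using that[OF g e] by simp
qed

lemma orb_cusp_shift:
  assumes "cusp_width \<Gamma> \<sigma> \<omega>" "det \<sigma> = 1" "\<tau> \<in> \<bbbH>"
  shows "orb \<Gamma> (Some (moeb \<sigma> (\<tau> + of_real (of_int n * \<omega>)))) = orb \<Gamma> (Some (moeb \<sigma> \<tau>))"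
proof -
  obtain \<gamma> where "\<gamma> \<in> lifts \<Gamma>" "moeb \<gamma> (moeb \<sigma> \<tau>) = moeb \<sigma> (\<tau> + of_real (of_int n * \<omega>))"
    using moeb_cusp_shift[OF assms] by metis
  then show ?thesis using orb_Some_eq_iff[of "moeb \<sigma> \<tau>"] moeb_in_upper_half assms by (metis zero_less_one)
qed

lemma cusp_base_qpar:
  assumes "cusp_width \<Gamma> \<sigma> \<omega>" "det \<sigma> = 1" "\<tau> \<in> \<bbbH>"
  shows "cusp_base \<Gamma> \<sigma> \<omega> (qpar \<omega> \<tau>) = orb \<Gamma> (Some (moeb \<sigma> \<tau>))"
proof -
  obtain n :: int where "qlog \<omega> (qpar \<omega> \<tau>) = \<tau> + of_real (of_int n * \<omega>)"
    using qlog_qpar cusp_width_pos[OF assms(1)] by blast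
  then show ?thesis using orb_cusp_shift[OF assms] by (simp add: cusp_base_nonzero)
qed

text \<open>Within the radius, \<open>\<gamma>\<close> fixes the cusp, and so it is a power of the generating translation, up to
  sign.\<close>

lemma near_cusp_translation:
  assumes w: "cusp_width \<Gamma> \<sigma> \<omega>" and s: "\<sigma> \<in> cusp_frames \<Gamma>" and r: "cusp_radius \<Gamma> \<sigma> \<omega> r"
    and t: "\<tau> \<in> \<bbbH>" "\<tau>' \<in> \<bbbH>" "norm (qpar \<omega> \<tau>) < r" "norm (qpar \<omega> \<tau>') < r"
    and g: "\<gamma> \<in> lifts \<Gamma>" "moeb \<gamma> (moeb \<sigma> \<tau>) = moeb \<sigma> \<tau>'"
  obtains n :: int where "\<tau>' = \<tau> + of_real (of_int n * \<omega>)"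
    "\<gamma> ** \<sigma> = \<sigma> ** translation (of_int n * \<omega>) \<or> \<gamma> ** \<sigma> = - (\<sigma> ** translation (of_int n * \<omega>))"
proof -
  have d: "det \<sigma> = 1" "det \<gamma> = 1" using s g by simp_all
  have "moeb_sphere \<gamma> (moeb_sphere \<sigma> None) = moeb_sphere \<sigma> None"
    using r t g unfolding cusp_radius_def by blast
  then obtain \<beta> where b: "det \<beta> = 1" "\<beta>$2$1 = 0" "\<sigma> ** \<beta> = \<gamma> ** \<sigma>"
    using frames_same_cusp[OF s s g(1)] by blast
  have "\<sigma> ** \<beta> ** matrix_inv \<sigma> = \<gamma>" unfolding b(3) using d mat2_cancel(3)[of \<sigma> \<gamma>] by simp
  then have "\<beta> \<in> conj_stab \<Gamma> \<sigma>" using g(1) b d by (simp add: conj_stab_iff)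
  then obtain n :: int where n: "\<beta> = translation (of_int n * \<omega>) \<or> \<beta> = - translation (of_int n * \<omega>)"
    using cusp_width_iff[OF w] by blast
  have "moeb \<sigma> (moeb \<beta> \<tau>) = moeb \<sigma> \<tau>'"
    using g(2) arg_cong[OF b(3), of "\<lambda>x. moeb x \<tau>"] b(1) d t(1) by (simp add: moeb_mult)
  then have "moeb \<beta> \<tau> = \<tau>'"
    using inj_on_moeb[OF d(1)] moeb_in_upper_half[of \<beta> \<tau>] b t unfolding inj_on_def by simp
  then have "\<tau>' = \<tau> + of_real (of_int n * \<omega>)" using n by (auto simp: moeb_minus)
  then show thesis using that n b(3) by (metis matrix_mult_minus_right)
qed

lemma cusp_base_inj:
  assumes w: "cusp_width \<Gamma> \<sigma> \<omega>" and s: "\<sigma> \<in> cusp_frames \<Gamma>" and r: "cusp_radius \<Gamma> \<sigma> \<omega> r"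
  shows "inj_on (cusp_base \<Gamma> \<sigma> \<omega>) (ball 0 r)"
proof (rule inj_onI)
  fix q q' assume q: "q \<in> ball 0 r" "q' \<in> ball 0 r" "cusp_base \<Gamma> \<sigma> \<omega> q = cusp_base \<Gamma> \<sigma> \<omega> q'"
  have d: "det \<sigma> = 1" using s by simp
  have wp: "\<omega> > 0" by (rule cusp_width_pos[OF w])
  have H: "qlog \<omega> q \<in> \<bbbH>" "moeb \<sigma> (qlog \<omega> q) \<in> \<bbbH>" if "q \<noteq> 0" "q \<in> ball 0 r" for q
    using qlog_in_upper_half[OF wp that(1)] that(2) cusp_radius_le_one[OF r] moeb_in_upper_half d by auto
  show "q = q'"
  proof (cases "q = 0 \<or> q' = 0")
    case True
    then show ?thesis
      using q H orb_cusp_neq_orb_Some[OF s] by (cases "q = 0"; cases "q' = 0") (auto simp: cusp_base_nonzero, metis)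
  next
    case False
    then obtain \<gamma> where g: "\<gamma> \<in> lifts \<Gamma>" "moeb \<gamma> (moeb \<sigma> (qlog \<omega> q)) = moeb \<sigma> (qlog \<omega> q')"
      using q(3) orb_Some_eq_iff H(2)[of q] q(1) by (auto simp: cusp_base_nonzero)
    have "norm (qpar \<omega> (qlog \<omega> q)) < r" "norm (qpar \<omega> (qlog \<omega> q')) < r"
      using q False wp by (auto simp: qpar_qlog)
    then obtain n :: int where "qlog \<omega> q' = qlog \<omega> q + of_real (of_int n * \<omega>)"
      using near_cusp_translation[OF w s r H(1)[of q] H(1)[of q'] _ _ g] False q by blast
    then have "qpar \<omega> (qlog \<omega> q') = qpar \<omega> (qlog \<omega> q)" using qpar_add_period[OF wp] by simp
    then show ?thesis using False wp by (simp add: qpar_qlog)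
  qed
qed

text \<open>In the coordinate of the frame, elements fixing the cusp preserve the height of a point, and all
  others bound it by \<open>Im_mult_Im_moeb_le\<close>. So a neighbourhood of \<open>\<tau>\<close> on which the height is bounded
  above and below has no translates near the cusp.\<close>

lemma point_cusp_height_bound:
  assumes s: "\<sigma> \<in> cusp_frames \<Gamma>" and t: "\<tau> \<in> \<bbbH>"
  obtains h N where "open N" "\<tau> \<in> N" "N \<subseteq> \<bbbH>"
    "\<And>\<gamma> z w. \<gamma> \<in> lifts \<Gamma> \<Longrightarrow> z \<in> N \<Longrightarrow> w \<in> \<bbbH> \<Longrightarrow> moeb \<gamma> z = moeb \<sigma> w \<Longrightarrow> Im w \<le> h"
proof -
  have d: "det \<sigma> = 1" using s by simp
  obtain \<omega> where w: "cusp_width \<Gamma> \<sigma> \<omega>" using cusp_width_exists[OF s] by blast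
  obtain c0 where c0: "c0 > 0"
    "\<And>\<gamma>. \<gamma> \<in> lifts \<Gamma> \<Longrightarrow> (matrix_inv \<sigma> ** \<gamma> ** \<sigma>)$2$1 = 0 \<or> \<bar>(matrix_inv \<sigma> ** \<gamma> ** \<sigma>)$2$1\<bar> \<ge> c0"
    using cusp_lower_left_gap[OF s s] by blast
  let ?u = "moeb (matrix_inv \<sigma>)"
  define y where "y = Im (?u \<tau>)"
  have y: "y > 0" unfolding y_def using moeb_in_upper_half[of "matrix_inv \<sigma>" \<tau>] d t by (simp add: upper_half_iff)
  define N where "N = \<bbbH> \<inter> (\<lambda>z. Im (?u z)) -` {y/2<..<2*y}"
  have "continuous_on \<bbbH> (\<lambda>z. Im (?u z))"
    using holomorphic_moeb[of "\<lambda>z. z" \<bbbH> "matrix_inv \<sigma>"] d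
    by (intro continuous_intros holomorphic_on_imp_continuous_on) auto
  then have oN: "open N" unfolding N_def by (intro continuous_open_preimage) auto
  have tN: "\<tau> \<in> N" using t y by (simp add: N_def y_def[symmetric])
  define h where "h = max (2 * y) (1 / c0\<^sup>2 / (y / 2))"
  have "Im w \<le> h" if g: "\<gamma> \<in> lifts \<Gamma>" and z: "z \<in> N" and wH: "w \<in> \<bbbH>" and e: "moeb \<gamma> z = moeb \<sigma> w" for \<gamma> z w
  proof -
    define z0 where "z0 = ?u z"
    have z0: "z0 \<in> \<bbbH>" "moeb \<sigma> z0 = z" "y/2 < Im z0" "Im z0 < 2 * y"
      using z d moeb_in_upper_half[of "matrix_inv \<sigma>" z] moeb_inverse[OF d, of z] by (auto simp: z0_def N_def)
    define \<beta> where "\<beta> = matrix_inv \<sigma> ** \<gamma> ** \<sigma>"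
    have dg: "det \<gamma> = 1" using g by simp
    have db: "det \<beta> = 1" using d dg by (simp add: \<beta>_def det_mul)
    have "moeb \<beta> z0 = ?u (moeb \<gamma> (moeb \<sigma> z0))"
      using d dg z0(1) by (simp add: \<beta>_def moeb_mult det_mul moeb_in_upper_half)
    then have bz: "moeb \<beta> z0 = w" using z0(2) e wH d by (simp add: moeb_inverse)
    show ?thesis
    proof (cases "\<beta>$2$1 = 0")
      case True
      have "\<sigma> ** \<beta> ** matrix_inv \<sigma> = \<gamma>"
        unfolding \<beta>_def using d mat2_cancel by (metis matrix_mul_assoc one_neq_zero)
      then have "\<beta> \<in> conj_stab \<Gamma> \<sigma>" using True g d by (simp add: conj_stab_iff)
      then obtain n :: int where "\<beta> = translation (of_int n * \<omega>) \<or> \<beta> = - translation (of_int n * \<omega>)"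
        using cusp_width_iff[OF w] by blast
      then have "Im w = Im z0" using bz by (auto simp: moeb_minus)
      then show ?thesis using z0 by (simp add: h_def)
    next
      case False
      then have "Im z0 * Im w \<le> 1 / c0\<^sup>2"
        using Im_mult_Im_moeb_le[OF db _ c0(1) z0(1)] c0(2)[OF g] bz unfolding \<beta>_def by blast
      moreover have "y / 2 * Im w \<le> Im z0 * Im w" using z0(3) wH by (intro mult_right_mono) (auto simp: upper_half_iff)
      ultimately have "y / 2 * Im w \<le> 1 / c0\<^sup>2" by linarith
      then have "Im w \<le> 1 / c0\<^sup>2 / (y / 2)" using y by (subst pos_le_divide_eq) (auto simp: mult.commute)
      then show ?thesis by (simp add: h_def)
    qed
  qed
  then show thesis using that[OF oN tN, of h] by (auto simp: N_def)
qed

end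

section \<open>The bundle on the compactified curve\<close>

context automorphy begin

text \<open>Translation by a multiple of the width acts through an element of \<open>\<Gamma>\<close>. Hence the trivialization at a
  cusp does not depend on the branch of the logarithm.\<close>

lemma class_Y_cusp_shift:
  assumes "cusp_width \<Gamma> \<sigma> \<omega>" "det \<sigma> = 1" "\<tau> \<in> \<bbbH>" "v \<in> W"
  shows "class_Y \<Gamma> J (act \<sigma> (\<tau> + of_real (of_int n * \<omega>), v)) = class_Y \<Gamma> J (act \<sigma> (\<tau>, v))"
proof -
  let ?T = "translation (of_int n * \<omega>)"
  obtain \<gamma> where g: "\<gamma> \<in> lifts \<Gamma>" "\<gamma> ** \<sigma> = \<sigma> ** ?T" using moeb_cusp_shift[OF assms(1-3)] by metis
  have x: "(\<tau>, v) \<in> \<bbbH> \<times> W" using assms by simp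
  have "act \<sigma> (\<tau> + of_real (of_int n * \<omega>), v) = act \<sigma> (act ?T (\<tau>, v))" using assms by (simp add: J_translation)
  also have "\<dots> = act \<gamma> (act \<sigma> (\<tau>, v))"
    using act_mult[OF _ _ x, of \<sigma> ?T] act_mult[OF _ _ x, of \<gamma> \<sigma>] g assms(2) by simp
  finally show ?thesis using class_Y_act[OF g(1) act_closed[OF assms(2) x]] by simp
qed

lemma cusp_triv_zero [simp]: "cusp_triv \<Gamma> J \<sigma> \<omega> (0, v) = Inr (class_cusp \<Gamma> J (\<sigma>, v))"
  and cusp_triv_nonzero: "q \<noteq> 0 \<Longrightarrow> cusp_triv \<Gamma> J \<sigma> \<omega> (q, v) = Inl (class_Y \<Gamma> J (act \<sigma> (qlog \<omega> q, v)))"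
  by (simp_all add: cusp_triv_def)

lemma cusp_triv_qpar:
  assumes "cusp_width \<Gamma> \<sigma> \<omega>" "det \<sigma> = 1" "\<tau> \<in> \<bbbH>" "v \<in> W"
  shows "cusp_triv \<Gamma> J \<sigma> \<omega> (qpar \<omega> \<tau>, v) = Inl (class_Y \<Gamma> J (act \<sigma> (\<tau>, v)))"
proof -
  obtain n :: int where "qlog \<omega> (qpar \<omega> \<tau>) = \<tau> + of_real (of_int n * \<omega>)"
    using qlog_qpar cusp_width_pos[OF assms(1)] by blast
  then show ?thesis using class_Y_cusp_shift[OF assms] by (simp add: cusp_triv_nonzero del: act_pair)
qed

lemma proj_class_cusp:
  assumes "det \<sigma> = 1"
  shows "proj_X (Inr (class_cusp \<Gamma> J (\<sigma>, v))) = orb \<Gamma> (moeb_sphere \<sigma> None)"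
proof -
  have *: "moeb_sphere (\<gamma> ** \<sigma> ** matrix_inv \<beta>) None = moeb_sphere \<gamma> (moeb_sphere \<sigma> None)"
    if "\<gamma> \<in> lifts \<Gamma>" "det \<beta> = 1" "moeb_sphere \<beta> None = None" for \<gamma> \<beta>
  proof -
    have "moeb_sphere (matrix_inv \<beta>) None = None" using moeb_sphere_inverse(1)[OF that(2), of None] that(3) by simp
    then show ?thesis using that assms by (simp add: moeb_sphere_mult det_mul)
  qed
  have "proj_X (Inr (class_cusp \<Gamma> J (\<sigma>, v))) =
      {moeb_sphere (\<gamma> ** \<sigma> ** matrix_inv \<beta>) None | \<gamma> \<beta>. \<gamma> \<in> lifts \<Gamma> \<and> det \<beta> = 1 \<and> moeb_sphere \<beta> None = None}"
    by (force simp: proj_X_def class_cusp_def)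
  also have "\<dots> = {moeb_sphere \<gamma> (moeb_sphere \<sigma> None) | \<gamma>. \<gamma> \<in> lifts \<Gamma>}"
  proof -
    have "\<exists>\<beta> :: mat2. det \<beta> = 1 \<and> moeb_sphere \<beta> None = None" by (intro exI[of _ "mat 1"]) simp
    then show ?thesis using * by (auto, metis)
  qed
  finally show ?thesis by (auto simp: orb_def)
qed

lemma class_cusp_mem_iff:
  "(\<sigma>', v') \<in> class_cusp \<Gamma> J (\<sigma>, v) \<longleftrightarrow>
    (\<exists>\<gamma> \<beta>. \<gamma> \<in> lifts \<Gamma> \<and> det \<beta> = 1 \<and> \<beta>$2$1 = 0 \<and> \<sigma>' ** \<beta> = \<gamma> ** \<sigma> \<and> v' = J \<beta> \<i> v)"
proof -
  have "\<sigma>' = \<gamma> ** \<sigma> ** matrix_inv \<beta> \<longleftrightarrow> \<sigma>' ** \<beta> = \<gamma> ** \<sigma>" if "det \<beta> = 1" for \<gamma> \<beta>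
    using mat2_cancel(3,4)[of \<beta>] that by (metis one_neq_zero)
  then show ?thesis unfolding class_cusp_def by (auto simp: moeb_sphere_None_iff)
qed

lemma J_upper_mult:
  assumes "det \<beta> = 1" "\<beta>$2$1 = 0" "det \<beta>' = 1" "v \<in> W"
  shows "J \<beta> \<i> (J \<beta>' \<i> v) = J (\<beta> ** \<beta>') \<i> v"
  using J_cocycle[of \<beta> \<beta>' \<i> v] J_upper_triangular[OF assms(2), of "moeb \<beta>' \<i>" _ \<i>] assms by simp

lemma class_cusp_subset:
  assumes "v \<in> W" "(\<sigma>', v') \<in> class_cusp \<Gamma> J (\<sigma>, v)"
  shows "class_cusp \<Gamma> J (\<sigma>', v') \<subseteq> class_cusp \<Gamma> J (\<sigma>, v)"
proof clarify
  fix \<sigma>'' v'' assume "(\<sigma>'', v'') \<in> class_cusp \<Gamma> J (\<sigma>', v')"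
  then obtain \<gamma>' \<beta>' where b': "\<gamma>' \<in> lifts \<Gamma>" "det \<beta>' = 1" "\<beta>'$2$1 = 0" "\<sigma>'' ** \<beta>' = \<gamma>' ** \<sigma>'" "v'' = J \<beta>' \<i> v'"
    unfolding class_cusp_mem_iff by blast
  obtain \<gamma> \<beta> where b: "\<gamma> \<in> lifts \<Gamma>" "det \<beta> = 1" "\<beta>$2$1 = 0" "\<sigma>' ** \<beta> = \<gamma> ** \<sigma>" "v' = J \<beta> \<i> v"
    using assms(2) unfolding class_cusp_mem_iff by blast
  have "\<sigma>'' ** (\<beta>' ** \<beta>) = (\<gamma>' ** \<gamma>) ** \<sigma>" using b(4) b'(4) by (metis matrix_mul_assoc)
  moreover have "v'' = J (\<beta>' ** \<beta>) \<i> v" using b b' assms(1) by (simp add: J_upper_mult)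
  ultimately show "(\<sigma>'', v'') \<in> class_cusp \<Gamma> J (\<sigma>, v)"
    unfolding class_cusp_mem_iff using b b' lifts_mult
    by (intro exI[of _ "\<gamma>' ** \<gamma>"] exI[of _ "\<beta>' ** \<beta>"]) (simp add: det_mul)
qed

lemma class_cusp_eqI:
  assumes "v \<in> W" "\<gamma> \<in> lifts \<Gamma>" "det \<beta> = 1" "\<beta>$2$1 = 0" "\<sigma>' ** \<beta> = \<gamma> ** \<sigma>"
  shows "class_cusp \<Gamma> J (\<sigma>, v) = class_cusp \<Gamma> J (\<sigma>', J \<beta> \<i> v)"
proof
  have mem: "(\<sigma>', J \<beta> \<i> v) \<in> class_cusp \<Gamma> J (\<sigma>, v)" unfolding class_cusp_mem_iff using assms by blast
  then show "class_cusp \<Gamma> J (\<sigma>', J \<beta> \<i> v) \<subseteq> class_cusp \<Gamma> J (\<sigma>, v)" by (rule class_cusp_subset[OF assms(1)])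
  have "\<sigma> ** matrix_inv \<beta> = matrix_inv \<gamma> ** \<sigma>'"
    using assms(2,3,5) mat2_cancel lifts_det by (metis matrix_mul_assoc one_neq_zero)
  moreover have bi: "matrix_inv \<beta> $ 2 $ 1 = 0" using assms(3,4) by (simp add: matrix_inv_SL2)
  moreover have "J (matrix_inv \<beta>) \<i> (J \<beta> \<i> v) = v"
    using J_upper_mult[OF _ bi assms(3,1)] assms(1,3) by (simp add: matrix_inv_props J_one)
  ultimately have "(\<sigma>, v) \<in> class_cusp \<Gamma> J (\<sigma>', J \<beta> \<i> v)"
    unfolding class_cusp_mem_iff using assms(2,3) lifts_inv
    by (intro exI[of _ "matrix_inv \<gamma>"] exI[of _ "matrix_inv \<beta>"]) simp
  then show "class_cusp \<Gamma> J (\<sigma>, v) \<subseteq> class_cusp \<Gamma> J (\<sigma>', J \<beta> \<i> v)"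
    by (rule class_cusp_subset[OF J_W[OF assms(3) i_in_upper_half assms(1)]])
qed

lemma class_cusp_self: "v \<in> W \<Longrightarrow> (\<sigma>, v) \<in> class_cusp \<Gamma> J (\<sigma>, v)"
  unfolding class_cusp_mem_iff by (intro exI[of _ "mat 1"]) (simp add: J_one)

lemma uniformized_cusp:
  assumes w: "cusp_width \<Gamma> \<sigma> \<omega>" and s: "\<sigma> \<in> cusp_frames \<Gamma>" and r: "cusp_radius \<Gamma> \<sigma> \<omega> r"
    and q: "q0 \<in> ball 0 r" "q0 \<noteq> 0"
  obtains D t where "uniformized Inl (ball 0 r, cusp_base \<Gamma> \<sigma> \<omega>, cusp_triv \<Gamma> J \<sigma> \<omega>) D t \<sigma>" "q0 \<in> D"
proof -
  have d: "det \<sigma> = 1" using s by simp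
  obtain D t where D: "open D" "q0 \<in> D" "D \<subseteq> ball 0 r - {0}" "t holomorphic_on D" "inj_on t D" "t ` D \<subseteq> \<bbbH>"
    and t: "\<And>q. q \<in> D \<Longrightarrow> qpar \<omega> (t q) = q"
    using local_log[OF cusp_width_pos[OF w] q(2), of r] q(1) cusp_radius_le_one[OF r] by auto
  have "cusp_base \<Gamma> \<sigma> \<omega> q = orb \<Gamma> (Some (moeb \<sigma> (t q)))" if "q \<in> D" for q
    using cusp_base_qpar[OF w d, of "t q"] t D(6) that by auto
  moreover have "cusp_triv \<Gamma> J \<sigma> \<omega> (q, v) = Inl (class_Y \<Gamma> J (act \<sigma> (t q, v)))" if "q \<in> D" "v \<in> W" for q v
    using cusp_triv_qpar[OF w d, of "t q" v] t D(6) that by auto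
  moreover have "D \<subseteq> ball 0 r" using D(3) by blast
  ultimately have "uniformized Inl (ball 0 r, cusp_base \<Gamma> \<sigma> \<omega>, cusp_triv \<Gamma> J \<sigma> \<omega>) D t \<sigma>"
    unfolding uniformized_def prod.case using D d by blast
  then show thesis using that D(2) by blast
qed

lemma const_holomorphic_GL:
  assumes "det \<beta> = 1" shows "holomorphic_GL A W D (\<lambda>_. J \<beta> \<i>)"
  by (rule holomorphic_GL_compose[OF J_GL[OF assms], where h = "\<lambda>_. \<i>"]) auto

lemma id_holomorphic_GL: "holomorphic_GL A W D (\<lambda>_ v. v)"
proof -
  obtain B where B: "finite B" "basis_of A W B" using finite_basis by blast
  have "holomorphic_into A W D (\<lambda>_. v)" if "v \<in> W" for v
    by (rule holomorphic_into_sumI(1)[OF B, of "{()}" "\<lambda>_ _. 1" _ "\<lambda>_. v"]) (use that in auto)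
  then show ?thesis unfolding holomorphic_GL_def by (auto simp: bij_betw_def inj_on_def)
qed

text \<open>The parameters differ by a rotation \<open>q \<mapsto> qe\<close>, which fixes the cusp \<open>q = 0\<close>, and on every fibre of
  the disc, including the one at the cusp, the change of frame is the constant map \<open>J(\<beta>,\<i>)\<close>.\<close>

lemma compatible_at_cusp:
  assumes w: "cusp_width \<Gamma> \<sigma> \<omega>" and s: "\<sigma> \<in> cusp_frames \<Gamma>" and r: "cusp_radius \<Gamma> \<sigma> \<omega> r"
    and w': "cusp_width \<Gamma> \<sigma>' \<omega>'" and s': "\<sigma>' \<in> cusp_frames \<Gamma>" and r': "cusp_radius \<Gamma> \<sigma>' \<omega>' r'"
    and eq: "orb \<Gamma> (moeb_sphere \<sigma> None) = orb \<Gamma> (moeb_sphere \<sigma>' None)"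
  shows "\<exists>D h g. open D \<and> 0 \<in> D \<and> D \<subseteq> ball 0 r \<and>
          h holomorphic_on D \<and> inj_on h D \<and> h ` D \<subseteq> ball 0 r' \<and> h 0 = 0 \<and> holomorphic_GL A W D g \<and>
          (\<forall>q\<in>D. cusp_base \<Gamma> \<sigma> \<omega> q = cusp_base \<Gamma> \<sigma>' \<omega>' (h q) \<and>
            (\<forall>v\<in>W. cusp_triv \<Gamma> J \<sigma> \<omega> (q, v) = cusp_triv \<Gamma> J \<sigma>' \<omega>' (h q, g q v)))"
proof -
  have d: "det \<sigma> = 1" "det \<sigma>' = 1" using s s' by simp_all
  obtain \<gamma> where g: "\<gamma> \<in> lifts \<Gamma>" "moeb_sphere \<gamma> (moeb_sphere \<sigma> None) = moeb_sphere \<sigma>' None"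
    using eq unfolding orb_eq_iff by blast
  obtain \<beta> where b: "det \<beta> = 1" "\<beta>$2$1 = 0" "\<sigma>' ** \<beta> = \<gamma> ** \<sigma>" using frames_same_cusp[OF s s' g] .
  have wp: "\<omega> > 0" "\<omega>' > 0" using cusp_width_pos w w' by auto
  obtain e where e: "norm e = 1" and qh: "\<And>\<tau>. qpar \<omega>' (moeb \<beta> \<tau>) = qpar \<omega> \<tau> * e"
    using qpar_change_frame[OF w w' d b g(1)] by blast
  have e0: "e \<noteq> 0" using e by auto
  define h where "h = (\<lambda>q::complex. q * e)"
  define D where "D = ball (0::complex) (min r r')"
  have rp: "0 < r" "0 < r'" "r \<le> 1" using r r' cusp_radius_pos cusp_radius_le_one by auto
  have "cusp_base \<Gamma> \<sigma> \<omega> q = cusp_base \<Gamma> \<sigma>' \<omega>' (h q) \<and>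
      (\<forall>v\<in>W. cusp_triv \<Gamma> J \<sigma> \<omega> (q, v) = cusp_triv \<Gamma> J \<sigma>' \<omega>' (h q, J \<beta> \<i> v))" if q: "q \<in> D" for q
  proof (cases "q = 0")
    case True
    then show ?thesis using eq class_cusp_eqI[OF _ g(1) b] by (simp add: h_def)
  next
    case False
    define \<tau> where "\<tau> = qlog \<omega> q"
    have t: "\<tau> \<in> \<bbbH>" "qpar \<omega> \<tau> = q"
      using qlog_in_upper_half[OF wp(1) False] q rp qpar_qlog[OF wp(1) False] by (auto simp: \<tau>_def D_def)
    have t': "moeb \<beta> \<tau> \<in> \<bbbH>" "qpar \<omega>' (moeb \<beta> \<tau>) = h q"
      using moeb_in_upper_half[of \<beta> \<tau>] b t qh by (auto simp: h_def)
    have m: "moeb \<sigma>' (moeb \<beta> \<tau>) = moeb \<gamma> (moeb \<sigma> \<tau>)"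
      using arg_cong[OF b(3), of "\<lambda>x. moeb x \<tau>"] b(1) d g(1) t(1) by (simp add: moeb_mult)
    have "cusp_base \<Gamma> \<sigma>' \<omega>' (h q) = orb \<Gamma> (Some (moeb \<gamma> (moeb \<sigma> \<tau>)))"
      using cusp_base_qpar[OF w' d(2) t'(1)] t'(2) m by simp
    also have "\<dots> = orb \<Gamma> (Some (moeb \<sigma> \<tau>))"
      using orb_Some_eq_iff[of "moeb \<sigma> \<tau>"] moeb_in_upper_half[of \<sigma> \<tau>] d t g(1) by auto
    also have "\<dots> = cusp_base \<Gamma> \<sigma> \<omega> q" using False by (simp add: cusp_base_nonzero \<tau>_def)
    finally have base: "cusp_base \<Gamma> \<sigma> \<omega> q = cusp_base \<Gamma> \<sigma>' \<omega>' (h q)" ..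
    have "cusp_triv \<Gamma> J \<sigma> \<omega> (q, v) = cusp_triv \<Gamma> J \<sigma>' \<omega>' (h q, J \<beta> \<i> v)" if v: "v \<in> W" for v
    proof -
      have x: "(\<tau>, v) \<in> \<bbbH> \<times> W" using t v by simp
      have Jv: "J \<beta> \<i> v = J \<beta> \<tau> v" by (rule J_upper_triangular[OF b(2)])
      have "act \<sigma>' (moeb \<beta> \<tau>, J \<beta> \<i> v) = act \<sigma>' (act \<beta> (\<tau>, v))" by (simp add: Jv)
      also have "\<dots> = act \<gamma> (act \<sigma> (\<tau>, v))"
        using act_mult[OF _ _ x, of \<sigma>' \<beta>] act_mult[OF _ _ x, of \<gamma> \<sigma>] b d g by simp
      finally have "class_Y \<Gamma> J (act \<sigma>' (moeb \<beta> \<tau>, J \<beta> \<i> v)) = class_Y \<Gamma> J (act \<sigma> (\<tau>, v))"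
        using class_Y_act[OF g(1) act_closed[OF d(1) x]] by simp
      moreover have "J \<beta> \<i> v \<in> W" using J_W b v by simp
      ultimately show ?thesis
        using cusp_triv_qpar[OF w' d(2) t'(1), of "J \<beta> \<i> v"] t'(2) cusp_triv_qpar[OF w d(1) t(1) v] t(2) by simp
    qed
    with base show ?thesis by blast
  qed
  moreover have "inj_on h D" using e0 by (auto simp: inj_on_def h_def)
  moreover have "h ` D \<subseteq> ball 0 r'" using e by (auto simp: h_def D_def norm_mult)
  moreover have "h holomorphic_on D" unfolding h_def by (intro holomorphic_intros)
  ultimately show ?thesis
    using const_holomorphic_GL[OF b(1), of D] rp
    by (intro exI[of _ D] exI[of _ h] exI[of _ "\<lambda>_. J \<beta> \<i>"]) (auto simp: D_def h_def)
qed

lemma proj_X_Inl: "proj_X (Inl e) = proj_Y e"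
  by (simp add: proj_X_def)

lemma total_X_cases:
  assumes "e \<in> total_X \<Gamma> J W"
  obtains (point) \<tau> v where "\<tau> \<in> \<bbbH>" "v \<in> W" "e = Inl (class_Y \<Gamma> J (\<tau>, v))" "proj_X e = orb \<Gamma> (Some \<tau>)"
  | (cusp) \<sigma> v where "\<sigma> \<in> cusp_frames \<Gamma>" "v \<in> W" "e = Inr (class_cusp \<Gamma> J (\<sigma>, v))"
      "proj_X e = orb \<Gamma> (moeb_sphere \<sigma> None)"
  using assms unfolding total_X_def total_Y_def
  by (auto simp: proj_X_Inl proj_class_Y proj_class_cusp)

lemma total_X_over_Y: "{e \<in> total_X \<Gamma> J W. proj_X e \<in> curve_Y \<Gamma>} = Inl ` total_Y \<Gamma> J W"
proof
  show "{e \<in> total_X \<Gamma> J W. proj_X e \<in> curve_Y \<Gamma>} \<subseteq> Inl ` total_Y \<Gamma> J W"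
  proof clarify
    fix e assume e: "e \<in> total_X \<Gamma> J W" "proj_X e \<in> curve_Y \<Gamma>"
    from e(1) show "e \<in> Inl ` total_Y \<Gamma> J W"
    proof (cases rule: total_X_cases)
      case (cusp \<sigma> v)
      then show ?thesis using e(2) orb_cusp_neq_orb_Some[OF cusp(1)] by (auto simp: curve_Y_def)
    qed (auto simp: total_Y_def)
  qed
  show "Inl ` total_Y \<Gamma> J W \<subseteq> {e \<in> total_X \<Gamma> J W. proj_X e \<in> curve_Y \<Gamma>}"
    by (auto simp: total_X_def total_Y_def proj_X_Inl proj_class_Y orb_in_curve_Y)
qed

lemma orb_in_curve_X:
  "\<tau> \<in> \<bbbH> \<Longrightarrow> orb \<Gamma> (Some \<tau>) \<in> curve_X \<Gamma>" "\<sigma> \<in> cusp_frames \<Gamma> \<Longrightarrow> orb \<Gamma> (moeb_sphere \<sigma> None) \<in> curve_X \<Gamma>"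
  unfolding curve_X_def ext_half_plane_def using frame_cusp by blast+

lemma curve_X_cases:
  assumes "x \<in> curve_X \<Gamma>"
  obtains (point) \<tau> where "\<tau> \<in> \<bbbH>" "x = orb \<Gamma> (Some \<tau>)"
  | (cusp) \<sigma> where "\<sigma> \<in> cusp_frames \<Gamma>" "x = orb \<Gamma> (moeb_sphere \<sigma> None)"
proof -
  obtain s where s: "s \<in> ext_half_plane \<Gamma>" "x = orb \<Gamma> s" using assms by (auto simp: curve_X_def)
  show thesis
  proof (cases "s \<in> cusps \<Gamma>")
    case True
    then show thesis using cusp_frame_exists[OF True] cusp s by metis
  next
    case False
    then show thesis using point s by (auto simp: ext_half_plane_def)
  qed
qed

lemma orbifold_chart_X_of_Y:
  assumes "precisely_invariant \<Gamma> U"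
  shows "orbifold_chart A W (curve_X \<Gamma>) (total_X \<Gamma> J W) proj_X (U, \<lambda>\<tau>. orb \<Gamma> (Some \<tau>), Inl \<circ> class_Y \<Gamma> J)"
proof -
  have U: "open U" "U \<subseteq> \<bbbH>" using assms by (auto simp: precisely_invariant_def)
  have pU: "(\<lambda>\<tau>. orb \<Gamma> (Some \<tau>)) ` U \<subseteq> curve_Y \<Gamma>" using U orb_in_curve_Y by auto
  have "{e \<in> total_X \<Gamma> J W. proj_X e \<in> (\<lambda>\<tau>. orb \<Gamma> (Some \<tau>)) ` U} =
      {e \<in> Inl ` total_Y \<Gamma> J W. proj_X e \<in> (\<lambda>\<tau>. orb \<Gamma> (Some \<tau>)) ` U}"
    unfolding total_X_over_Y[symmetric] using pU by blast
  also have "\<dots> = Inl ` {e \<in> total_Y \<Gamma> J W. proj_Y e \<in> (\<lambda>\<tau>. orb \<Gamma> (Some \<tau>)) ` U}"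
    by (auto simp: proj_X_Inl)
  also have "\<dots> = (Inl \<circ> class_Y \<Gamma> J) ` (U \<times> W)" unfolding fiber_over_chart[OF U(2), symmetric] by (simp add: image_comp)
  finally have fib: "(Inl \<circ> class_Y \<Gamma> J) ` (U \<times> W) = {e \<in> total_X \<Gamma> J W. proj_X e \<in> (\<lambda>\<tau>. orb \<Gamma> (Some \<tau>)) ` U}" ..
  have pX: "(\<lambda>\<tau>. orb \<Gamma> (Some \<tau>)) ` U \<subseteq> curve_X \<Gamma>" using U orb_in_curve_X(1) by auto
  have pr: "\<forall>z\<in>U. \<forall>v\<in>W. proj_X ((Inl \<circ> class_Y \<Gamma> J) (z, v)) = orb \<Gamma> (Some z)"
    using U by (auto simp: proj_X_Inl proj_class_Y)
  show ?thesis unfolding orbifold_chart_def prod.case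
    using U(1) pX fib pr local_group_chart[OF assms] by simp
qed

lemma cusp_triv_in_total:
  assumes "\<sigma> \<in> cusp_frames \<Gamma>" "cusp_width \<Gamma> \<sigma> \<omega>" "q \<in> ball 0 1" "v \<in> W"
  shows "cusp_triv \<Gamma> J \<sigma> \<omega> (q, v) \<in> total_X \<Gamma> J W" "proj_X (cusp_triv \<Gamma> J \<sigma> \<omega> (q, v)) = cusp_base \<Gamma> \<sigma> \<omega> q"
    "cusp_base \<Gamma> \<sigma> \<omega> q \<in> curve_X \<Gamma>"
proof -
  have d: "det \<sigma> = 1" using assms by simp
  have H: "qlog \<omega> q \<in> \<bbbH>" if "q \<noteq> 0" using qlog_in_upper_half cusp_width_pos assms that by auto
  show "cusp_triv \<Gamma> J \<sigma> \<omega> (q, v) \<in> total_X \<Gamma> J W"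
    using assms act_closed[OF d, of "(qlog \<omega> q, v)"] H
    by (cases "q = 0") (auto simp: total_X_def total_Y_def cusp_triv_nonzero)
  show "proj_X (cusp_triv \<Gamma> J \<sigma> \<omega> (q, v)) = cusp_base \<Gamma> \<sigma> \<omega> q"
    using d H moeb_in_upper_half[of \<sigma>]
    by (cases "q = 0") (auto simp: cusp_triv_nonzero cusp_base_nonzero proj_X_Inl proj_class_Y proj_class_cusp)
  show "cusp_base \<Gamma> \<sigma> \<omega> q \<in> curve_X \<Gamma>"
    using assms(1) d H moeb_in_upper_half[of \<sigma>]
    by (cases "q = 0") (auto simp: cusp_base_nonzero intro!: orb_in_curve_X)
qed

lemma fiber_over_cusp_chart:
  assumes s: "\<sigma> \<in> cusp_frames \<Gamma>" and w: "cusp_width \<Gamma> \<sigma> \<omega>" and r: "cusp_radius \<Gamma> \<sigma> \<omega> r"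
  shows "cusp_triv \<Gamma> J \<sigma> \<omega> ` (ball 0 r \<times> W) = {e \<in> total_X \<Gamma> J W. proj_X e \<in> cusp_base \<Gamma> \<sigma> \<omega> ` ball 0 r}"
proof
  have b1: "q \<in> ball 0 1" if "q \<in> ball 0 r" for q :: complex using that cusp_radius_le_one[OF r] by auto
  show "cusp_triv \<Gamma> J \<sigma> \<omega> ` (ball 0 r \<times> W) \<subseteq> {e \<in> total_X \<Gamma> J W. proj_X e \<in> cusp_base \<Gamma> \<sigma> \<omega> ` ball 0 r}"
    using cusp_triv_in_total[OF s w b1] by blast
  have d: "det \<sigma> = 1" using s by simp
  show "{e \<in> total_X \<Gamma> J W. proj_X e \<in> cusp_base \<Gamma> \<sigma> \<omega> ` ball 0 r} \<subseteq> cusp_triv \<Gamma> J \<sigma> \<omega> ` (ball 0 r \<times> W)"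
  proof clarify
    fix e q assume e: "e \<in> total_X \<Gamma> J W" "proj_X e = cusp_base \<Gamma> \<sigma> \<omega> q" and q: "q \<in> ball 0 r"
    have H: "qlog \<omega> q \<in> \<bbbH>" "moeb \<sigma> (qlog \<omega> q) \<in> \<bbbH>" if "q \<noteq> 0"
      using qlog_in_upper_half[OF cusp_width_pos[OF w] that] moeb_in_upper_half[of \<sigma> "qlog \<omega> q"] b1[OF q] d by auto
    from e(1) show "e \<in> cusp_triv \<Gamma> J \<sigma> \<omega> ` (ball 0 r \<times> W)"
    proof (cases rule: total_X_cases)
      case (point \<tau> v)
      have q0: "q \<noteq> 0" using point e(2) orb_cusp_neq_orb_Some[OF s point(1)] by auto
      then obtain \<gamma> where g: "\<gamma> \<in> lifts \<Gamma>" "moeb \<gamma> \<tau> = moeb \<sigma> (qlog \<omega> q)"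
        using point e(2) orb_Some_eq_iff[OF point(1)] by (auto simp: cusp_base_nonzero)
      have x: "(moeb \<gamma> \<tau>, J \<gamma> \<tau> v) \<in> \<bbbH> \<times> W"
        using act_closed[of \<gamma> "(\<tau>, v)"] g point by simp
      define v' where "v' = J (matrix_inv \<sigma>) (moeb \<gamma> \<tau>) (J \<gamma> \<tau> v)"
      have v': "v' \<in> W" using J_W[of "matrix_inv \<sigma>" "moeb \<gamma> \<tau>"] x d by (simp add: v'_def)
      have "act (matrix_inv \<sigma>) (moeb \<gamma> \<tau>, J \<gamma> \<tau> v) = (qlog \<omega> q, v')"
        using g(2) H[OF q0] d by (simp add: v'_def moeb_inverse)
      moreover have "act \<sigma> (act (matrix_inv \<sigma>) (moeb \<gamma> \<tau>, J \<gamma> \<tau> v)) = (moeb \<gamma> \<tau>, J \<gamma> \<tau> v)"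
        using act_inverse[of "matrix_inv \<sigma>", OF _ x] d by (simp add: matrix_inv_inv2 del: act_pair)
      ultimately have "act \<sigma> (qlog \<omega> q, v') = act \<gamma> (\<tau>, v)" by simp
      then have "cusp_triv \<Gamma> J \<sigma> \<omega> (q, v') = e"
        using point q0 class_Y_act[OF g(1), of "(\<tau>, v)"] by (simp add: cusp_triv_nonzero)
      then show ?thesis using q v' by blast
    next
      case (cusp \<sigma>' v)
      have q0: "q = 0"
      proof (rule ccontr)
        assume "q \<noteq> 0"
        then show False using cusp e(2) orb_cusp_neq_orb_Some[OF cusp(1) H(2)] by (simp add: cusp_base_nonzero)
      qed
      then obtain \<gamma> where g: "\<gamma> \<in> lifts \<Gamma>" "moeb_sphere \<gamma> (moeb_sphere \<sigma>' None) = moeb_sphere \<sigma> None"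
        using cusp e(2) orb_eq_iff by auto
      obtain \<beta> where b: "det \<beta> = 1" "\<beta>$2$1 = 0" "\<sigma> ** \<beta> = \<gamma> ** \<sigma>'" using frames_same_cusp[OF cusp(1) s g] .
      have "e = cusp_triv \<Gamma> J \<sigma> \<omega> (q, J \<beta> \<i> v)" using cusp q0 class_cusp_eqI[OF cusp(2) g(1) b] by simp
      moreover have "J \<beta> \<i> v \<in> W" using J_W b cusp by simp
      ultimately show ?thesis using q by blast
    qed
  qed
qed

end

text \<open>The pairs \<open>(\<sigma>, v)\<close> and \<open>(\<sigma>, J(-1)v)\<close> represent the same vector of the fibre at the cusp, and likewise
  over ordinary points. So the fibre of a chart at a cusp is \<open>W\<close> itself only if \<open>-1\<close> acts trivially.\<close>

locale even_automorphy = automorphy +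
  assumes J_minus: "\<tau> \<in> \<bbbH> \<Longrightarrow> v \<in> W \<Longrightarrow> J (- mat 1) \<tau> v = v"
begin

lemma J_minus_translation:
  assumes "\<tau> \<in> \<bbbH>" "v \<in> W" shows "J (- translation t) \<tau> v = v"
  using J_cocycle[of "- mat 1" "translation t" \<tau> v] assms
    J_minus[of "\<tau> + of_real t" v] moeb_in_upper_half[of "translation t" \<tau>]
  by (simp add: J_translation)

lemma cusp_triv_inj:
  assumes w: "cusp_width \<Gamma> \<sigma> \<omega>" and s: "\<sigma> \<in> cusp_frames \<Gamma>" and r: "cusp_radius \<Gamma> \<sigma> \<omega> r"
  shows "inj_on (cusp_triv \<Gamma> J \<sigma> \<omega>) (ball 0 r \<times> W)"
proof (rule inj_onI, clarify)
  fix q v q' v' assume qv: "q \<in> ball 0 r" "v \<in> W" "q' \<in> ball 0 r" "v' \<in> W"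
    and eq: "cusp_triv \<Gamma> J \<sigma> \<omega> (q, v) = cusp_triv \<Gamma> J \<sigma> \<omega> (q', v')"
  have d: "det \<sigma> = 1" using s by simp
  have wp: "\<omega> > 0" by (rule cusp_width_pos[OF w])
  have b1: "q \<in> ball 0 1" "q' \<in> ball 0 1" using qv cusp_radius_le_one[OF r] by auto
  have "cusp_base \<Gamma> \<sigma> \<omega> q = cusp_base \<Gamma> \<sigma> \<omega> q'"
    using cusp_triv_in_total(2)[OF s w b1(1) qv(2)] cusp_triv_in_total(2)[OF s w b1(2) qv(4)] eq by simp
  then have qq: "q = q'" using cusp_base_inj[OF w s r] qv by (auto dest: inj_onD)
  have "v = v'"
  proof (cases "q = 0")
    case True
    then have "(\<sigma>, v') \<in> class_cusp \<Gamma> J (\<sigma>, v)" using eq qq class_cusp_self[OF qv(4)] by simp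
    then obtain \<gamma> \<beta> where b: "\<gamma> \<in> lifts \<Gamma>" "det \<beta> = 1" "\<beta>$2$1 = 0" "\<sigma> ** \<beta> = \<gamma> ** \<sigma>" "v' = J \<beta> \<i> v"
      unfolding class_cusp_mem_iff by blast
    have "\<sigma> ** \<beta> ** matrix_inv \<sigma> = \<gamma>" unfolding b(4) using d mat2_cancel(3)[of \<sigma> \<gamma>] by simp
    then have "\<beta> \<in> conj_stab \<Gamma> \<sigma>" using b d by (simp add: conj_stab_iff)
    then obtain n :: int where "\<beta> = translation (of_int n * \<omega>) \<or> \<beta> = - translation (of_int n * \<omega>)"
      using cusp_width_iff[OF w] by blast
    then show ?thesis using b(5) qv(2) by (auto simp: J_translation J_minus_translation)
  next
    case False
    define \<tau> where "\<tau> = qlog \<omega> q"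
    have t: "\<tau> \<in> \<bbbH>" "norm (qpar \<omega> \<tau>) < r"
      using qlog_in_upper_half[OF wp False] b1 qpar_qlog[OF wp False] qv by (auto simp: \<tau>_def)
    have x: "(\<tau>, v) \<in> \<bbbH> \<times> W" "(\<tau>, v') \<in> \<bbbH> \<times> W" using t qv by auto
    have "class_Y \<Gamma> J (act \<sigma> (\<tau>, v)) = class_Y \<Gamma> J (act \<sigma> (\<tau>, v'))"
      using eq qq False by (simp add: cusp_triv_nonzero \<tau>_def)
    then obtain \<gamma> where g: "\<gamma> \<in> lifts \<Gamma>" "act \<gamma> (act \<sigma> (\<tau>, v)) = act \<sigma> (\<tau>, v')"
      using class_Y_eq_iff act_closed[OF d] x by meson
    then have gm: "moeb \<gamma> (moeb \<sigma> \<tau>) = moeb \<sigma> \<tau>" by simp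
    obtain n :: int where n: "\<tau> = \<tau> + of_real (of_int n * \<omega>)"
      "\<gamma> ** \<sigma> = \<sigma> ** translation (of_int n * \<omega>) \<or> \<gamma> ** \<sigma> = - (\<sigma> ** translation (of_int n * \<omega>))"
      using near_cusp_translation[OF w s r t(1) t(1) t(2) t(2) g(1) gm] .
    have "n = 0" using n(1) wp by simp
    then have gs: "\<gamma> ** \<sigma> = \<sigma> \<or> \<gamma> ** \<sigma> = \<sigma> ** (- mat 1)" using n(2) by simp
    have e: "act (\<gamma> ** \<sigma>) (\<tau>, v) = act \<sigma> (\<tau>, v')" using g act_mult[OF _ d x(1), of \<gamma>] by simp
    have "act (\<sigma> ** (- mat 1)) (\<tau>, v) = act \<sigma> (act (- mat 1) (\<tau>, v))" using act_mult[OF d _ x(1), of "- mat 1"] by simp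
    also have "\<dots> = act \<sigma> (\<tau>, v)" using J_minus t qv by simp
    finally have "act (\<gamma> ** \<sigma>) (\<tau>, v) = act \<sigma> (\<tau>, v)" using gs by metis
    with e have "act \<sigma> (\<tau>, v) = act \<sigma> (\<tau>, v')" by simp
    then show ?thesis using J_inj[OF d t(1) qv(2,4)] by simp
  qed
  with qq show "q = q' \<and> v = v'" by simp
qed

text \<open>By injectivity the local group of a chart at a cusp is trivial.\<close>

lemma orbifold_chart_cusp:
  assumes w: "cusp_width \<Gamma> \<sigma> \<omega>" and s: "\<sigma> \<in> cusp_frames \<Gamma>" and r: "cusp_radius \<Gamma> \<sigma> \<omega> r"
  shows "orbifold_chart A W (curve_X \<Gamma>) (total_X \<Gamma> J W) proj_X (ball 0 r, cusp_base \<Gamma> \<sigma> \<omega>, cusp_triv \<Gamma> J \<sigma> \<omega>)"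
proof -
  have b1: "q \<in> ball 0 1" if "q \<in> ball 0 r" for q :: complex using that cusp_radius_le_one[OF r] by auto
  let ?E = "ball 0 r \<times> W"
  let ?G = "{\<one>\<^bsub>BijGroup ?E\<^esub>}"
  have G1: "\<one>\<^bsub>BijGroup ?E\<^esub> = (\<lambda>x\<in>?E. x)" by (simp add: BijGroup_def)
  have "subgroup ?G (BijGroup ?E)" using group.triv_subgroup[OF group_BijGroup] .
  moreover have "bundle_automorphism A W (ball 0 r) (\<lambda>x\<in>?E. x)"
    unfolding bundle_automorphism_def
    by (rule exI[of _ "\<lambda>z. z"], rule exI[of _ "\<lambda>_ v. v"]) (auto simp: id_holomorphic_GL bij_betw_def)
  ultimately have "\<exists>G. finite G \<and> subgroup G (BijGroup ?E) \<and> (\<forall>\<phi>\<in>G. bundle_automorphism A W (ball 0 r) \<phi>) \<and>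
        (\<forall>z\<in>ball 0 r. \<forall>z'\<in>ball 0 r. cusp_base \<Gamma> \<sigma> \<omega> z = cusp_base \<Gamma> \<sigma> \<omega> z' \<longleftrightarrow> (\<exists>\<phi>\<in>G. fst (\<phi> (z, 0)) = z')) \<and>
        (\<forall>x\<in>?E. \<forall>y\<in>?E. cusp_triv \<Gamma> J \<sigma> \<omega> x = cusp_triv \<Gamma> J \<sigma> \<omega> y \<longleftrightarrow> (\<exists>\<phi>\<in>G. \<phi> x = y))"
    using inj_on_eq_iff[OF cusp_base_inj[OF w s r]] inj_on_eq_iff[OF cusp_triv_inj[OF w s r]]
    by (intro exI[of _ ?G]) (simp add: G1)
  moreover have "cusp_base \<Gamma> \<sigma> \<omega> ` ball 0 r \<subseteq> curve_X \<Gamma>"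
    using cusp_triv_in_total(3)[OF s w b1 zero_W] by (rule image_subsetI)
  moreover have "\<forall>z\<in>ball 0 r. \<forall>v\<in>W. proj_X (cusp_triv \<Gamma> J \<sigma> \<omega> (z, v)) = cusp_base \<Gamma> \<sigma> \<omega> z"
    using cusp_triv_in_total(2)[OF s w b1] by (intro ballI)
  ultimately show ?thesis
    unfolding orbifold_chart_def prod.case
    using fiber_over_cusp_chart[OF s w r] by (intro conjI open_ball)
qed

lemma atlas_X_cases:
  assumes "c \<in> atlas_X \<Gamma> J"
  obtains (point) U where "precisely_invariant \<Gamma> U" "c = (U, \<lambda>\<tau>. orb \<Gamma> (Some \<tau>), Inl \<circ> class_Y \<Gamma> J)"
  | (cusp) r \<sigma> \<omega> where "\<sigma> \<in> cusp_frames \<Gamma>" "cusp_width \<Gamma> \<sigma> \<omega>" "cusp_radius \<Gamma> \<sigma> \<omega> r"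
     "c = (ball 0 r, cusp_base \<Gamma> \<sigma> \<omega>, cusp_triv \<Gamma> J \<sigma> \<omega>)"
  using assms unfolding atlas_X_def atlas_Y_def by blast

lemma atlas_X_point: "precisely_invariant \<Gamma> U \<Longrightarrow> (U, \<lambda>\<tau>. orb \<Gamma> (Some \<tau>), Inl \<circ> class_Y \<Gamma> J) \<in> atlas_X \<Gamma> J"
  and atlas_X_cusp: "\<sigma> \<in> cusp_frames \<Gamma> \<Longrightarrow> cusp_width \<Gamma> \<sigma> \<omega> \<Longrightarrow> cusp_radius \<Gamma> \<sigma> \<omega> r \<Longrightarrow>
    (ball 0 r, cusp_base \<Gamma> \<sigma> \<omega>, cusp_triv \<Gamma> J \<sigma> \<omega>) \<in> atlas_X \<Gamma> J"
  unfolding atlas_X_def atlas_Y_def by blast+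

text \<open>Except at the centres of the charts at the cusps, compatibility reduces to
  \<open>uniformized_compatible\<close>.\<close>

lemma uniformized_atlas_X:
  assumes "(U, p, P) \<in> atlas_X \<Gamma> J" "z \<in> U"
  shows "(\<exists>D t \<alpha>. uniformized Inl (U, p, P) D t \<alpha> \<and> z \<in> D) \<or>
    (\<exists>\<sigma> \<omega> r. \<sigma> \<in> cusp_frames \<Gamma> \<and> cusp_width \<Gamma> \<sigma> \<omega> \<and> cusp_radius \<Gamma> \<sigma> \<omega> r \<and> z = 0 \<and>
      (U, p, P) = (ball 0 r, cusp_base \<Gamma> \<sigma> \<omega>, cusp_triv \<Gamma> J \<sigma> \<omega>))"
  using assms(1)
proof (cases rule: atlas_X_cases)
  case (point U')
  then show ?thesis using uniformized_Y[OF point(1), of Inl] assms(2) by auto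
next
  case (cusp r \<sigma> \<omega>)
  show ?thesis
  proof (cases "z = 0")
    case True
    then show ?thesis using cusp by blast
  next
    case False
    then show ?thesis using uniformized_cusp[OF cusp(2,1,3), of z] assms(2) cusp(4) by (metis prod.inject)
  qed
qed

lemma uniformized_not_cusp:
  assumes "uniformized f (U, p, P) D t \<alpha>" "z \<in> D" "\<sigma> \<in> cusp_frames \<Gamma>"
  shows "p z \<noteq> orb \<Gamma> (moeb_sphere \<sigma> None)"
proof -
  have "t z \<in> \<bbbH>" "det \<alpha> = 1" "p z = orb \<Gamma> (Some (moeb \<alpha> (t z)))"
    using assms(1,2) unfolding uniformized_def by auto
  then show ?thesis using orb_cusp_neq_orb_Some[OF assms(3), of "moeb \<alpha> (t z)"] moeb_in_upper_half[of \<alpha> "t z"] by simp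
qed

lemma compatible_atlas_X:
  assumes "c \<in> atlas_X \<Gamma> J" "c' \<in> atlas_X \<Gamma> J"
  shows "compatible_charts A W c c'"
proof -
  obtain U p P U' p' P' where c: "c = (U, p, P)" "c' = (U', p', P')" by (metis prod_cases3)
  show ?thesis
    unfolding c compatible_charts_def prod.case
  proof (intro ballI impI)
    fix z z' assume z: "z \<in> U" "z' \<in> U'" "p z = p' z'"
    have c1: "(\<exists>D t \<alpha>. uniformized Inl (U, p, P) D t \<alpha> \<and> z \<in> D) \<or>
      (\<exists>\<sigma> \<omega> r. \<sigma> \<in> cusp_frames \<Gamma> \<and> cusp_width \<Gamma> \<sigma> \<omega> \<and> cusp_radius \<Gamma> \<sigma> \<omega> r \<and> z = 0 \<and>
      (U, p, P) = (ball 0 r, cusp_base \<Gamma> \<sigma> \<omega>, cusp_triv \<Gamma> J \<sigma> \<omega>))"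
      by (rule uniformized_atlas_X[OF assms(1)[unfolded c] z(1)])
    have c2: "(\<exists>D t \<alpha>. uniformized Inl (U', p', P') D t \<alpha> \<and> z' \<in> D) \<or>
      (\<exists>\<sigma> \<omega> r. \<sigma> \<in> cusp_frames \<Gamma> \<and> cusp_width \<Gamma> \<sigma> \<omega> \<and> cusp_radius \<Gamma> \<sigma> \<omega> r \<and> z' = 0 \<and>
      (U', p', P') = (ball 0 r, cusp_base \<Gamma> \<sigma> \<omega>, cusp_triv \<Gamma> J \<sigma> \<omega>))"
      by (rule uniformized_atlas_X[OF assms(2)[unfolded c] z(2)])
    show "\<exists>D h g. open D \<and> z \<in> D \<and> D \<subseteq> U \<and>
          h holomorphic_on D \<and> inj_on h D \<and> h ` D \<subseteq> U' \<and> h z = z' \<and> holomorphic_GL A W D g \<and>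
          (\<forall>w\<in>D. p w = p' (h w) \<and> (\<forall>v\<in>W. P (w, v) = P' (h w, g w v)))"
    proof (cases "\<exists>\<sigma>\<in>cusp_frames \<Gamma>. p z = orb \<Gamma> (moeb_sphere \<sigma> None)")
      case True
      then obtain \<sigma>0 where \<sigma>0: "\<sigma>0 \<in> cusp_frames \<Gamma>" "p z = orb \<Gamma> (moeb_sphere \<sigma>0 None)" by blast
      have "\<not> (uniformized Inl (U, p, P) D t \<alpha> \<and> z \<in> D)" "\<not> (uniformized Inl (U', p', P') D t \<alpha> \<and> z' \<in> D)" for D t \<alpha>
        using uniformized_not_cusp[OF _ _ \<sigma>0(1)] \<sigma>0(2) z(3) by metis+
      with c1 c2 obtain \<sigma> \<omega> r \<sigma>' \<omega>' r' where
        C: "\<sigma> \<in> cusp_frames \<Gamma>" "cusp_width \<Gamma> \<sigma> \<omega>" "cusp_radius \<Gamma> \<sigma> \<omega> r" "z = 0"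
          "(U, p, P) = (ball 0 r, cusp_base \<Gamma> \<sigma> \<omega>, cusp_triv \<Gamma> J \<sigma> \<omega>)"
        and C': "\<sigma>' \<in> cusp_frames \<Gamma>" "cusp_width \<Gamma> \<sigma>' \<omega>'" "cusp_radius \<Gamma> \<sigma>' \<omega>' r'" "z' = 0"
          "(U', p', P') = (ball 0 r', cusp_base \<Gamma> \<sigma>' \<omega>', cusp_triv \<Gamma> J \<sigma>' \<omega>')"
        by blast
      have "orb \<Gamma> (moeb_sphere \<sigma> None) = orb \<Gamma> (moeb_sphere \<sigma>' None)" using C C' z(3) by simp
      from compatible_at_cusp[OF C(2,1,3) C'(2,1,3) this] show ?thesis using C(4,5) C'(4,5) by simp
    next
      case False
      then have "p z \<noteq> cusp_base \<Gamma> \<sigma> \<omega> 0" if "\<sigma> \<in> cusp_frames \<Gamma>" for \<sigma> \<omega> using that by auto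
      then have "\<exists>D t \<alpha>. uniformized Inl (U, p, P) D t \<alpha> \<and> z \<in> D" "\<exists>D t \<alpha>. uniformized Inl (U', p', P') D t \<alpha> \<and> z' \<in> D"
        using c1 c2 z(3) by (metis prod.inject)+
      then obtain D t \<alpha> D' t' \<alpha>' where u: "uniformized Inl (U, p, P) D t \<alpha>" "z \<in> D"
        "uniformized Inl (U', p', P') D' t' \<alpha>'" "z' \<in> D'" by blast
      show ?thesis by (rule uniformized_compatible[OF u(1,3,2,4) z(3)])
    qed
  qed
qed

lemma hausdorff_atlasI:
  assumes "(U, p, P) \<in> \<A>" "(U', p', P') \<in> \<A>" "x \<in> p ` U" "y \<in> p' ` U'" "p ` U \<inter> p' ` U' = {}"
  shows "\<exists>(U, p, P)\<in>\<A>. \<exists>(U', p', P')\<in>\<A>. x \<in> p ` U \<and> y \<in> p' ` U' \<and> p ` U \<inter> p' ` U' = {}"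
  using assms by (intro bexI[of _ "(U, p, P)"], unfold prod.case, intro bexI[of _ "(U', p', P')"]) auto

lemma small_cusp_chart:
  assumes "\<sigma> \<in> cusp_frames \<Gamma>"
  obtains \<omega> r where "cusp_width \<Gamma> \<sigma> \<omega>" "cusp_radius \<Gamma> \<sigma> \<omega> r"
    "\<And>q. q \<in> ball 0 r \<Longrightarrow> q \<noteq> 0 \<Longrightarrow> qlog \<omega> q \<in> \<bbbH> \<and> h < Im (qlog \<omega> q)"
proof -
  obtain \<omega> where w: "cusp_width \<Gamma> \<sigma> \<omega>" using cusp_width_exists[OF assms] by blast
  obtain r0 where r0: "cusp_radius \<Gamma> \<sigma> \<omega> r0" using cusp_radius_exists[OF assms w] by blast
  have wp: "\<omega> > 0" by (rule cusp_width_pos[OF w])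
  define r where "r = min r0 (exp (- 2 * pi * h / \<omega>))"
  have r: "cusp_radius \<Gamma> \<sigma> \<omega> r"
    by (rule cusp_radius_mono[OF r0]) (use cusp_radius_pos[OF r0] in \<open>auto simp: r_def\<close>)
  show thesis
  proof (rule that[OF w r])
    fix q :: complex assume q: "q \<in> ball 0 r" "q \<noteq> 0"
    have "norm (qpar \<omega> (qlog \<omega> q)) < exp (- 2 * pi * h / \<omega>)" using q wp by (simp add: qpar_qlog r_def)
    then show "qlog \<omega> q \<in> \<bbbH> \<and> h < Im (qlog \<omega> q)"
      using qpar_norm_less_iff[OF wp] qlog_in_upper_half[OF wp q(2)] q(1) cusp_radius_le_one[OF r] by auto
  qed
qed

lemma separated_point_cusp:
  assumes t: "\<tau> \<in> \<bbbH>" and s: "\<sigma> \<in> cusp_frames \<Gamma>"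
  obtains U \<omega> r where "precisely_invariant \<Gamma> U" "\<tau> \<in> U" "cusp_width \<Gamma> \<sigma> \<omega>" "cusp_radius \<Gamma> \<sigma> \<omega> r"
    "(\<lambda>z. orb \<Gamma> (Some z)) ` U \<inter> cusp_base \<Gamma> \<sigma> \<omega> ` ball 0 r = {}"
proof -
  obtain h N where N: "open N" "\<tau> \<in> N" "N \<subseteq> \<bbbH>"
    "\<And>\<gamma> z w. \<gamma> \<in> lifts \<Gamma> \<Longrightarrow> z \<in> N \<Longrightarrow> w \<in> \<bbbH> \<Longrightarrow> moeb \<gamma> z = moeb \<sigma> w \<Longrightarrow> Im w \<le> h"
    using point_cusp_height_bound[OF s t] by metis
  obtain U where U: "precisely_invariant \<Gamma> U" "\<tau> \<in> U" "U \<subseteq> N" using precisely_invariant_nbhd[OF t N(1,2)] by metis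
  obtain \<omega> r where w: "cusp_width \<Gamma> \<sigma> \<omega>" "cusp_radius \<Gamma> \<sigma> \<omega> r"
    "\<And>q. q \<in> ball 0 r \<Longrightarrow> q \<noteq> 0 \<Longrightarrow> qlog \<omega> q \<in> \<bbbH> \<and> h < Im (qlog \<omega> q)"
    using small_cusp_chart[OF s, of h] by metis
  have "orb \<Gamma> (Some z) \<noteq> cusp_base \<Gamma> \<sigma> \<omega> q" if z: "z \<in> U" "q \<in> ball 0 r" for z q
  proof
    assume e: "orb \<Gamma> (Some z) = cusp_base \<Gamma> \<sigma> \<omega> q"
    have zH: "z \<in> \<bbbH>" using z U N by blast
    have q0: "q \<noteq> 0" using e orb_cusp_neq_orb_Some[OF s zH] cusp_base_zero by metis
    then obtain \<gamma> where "\<gamma> \<in> lifts \<Gamma>" "moeb \<gamma> z = moeb \<sigma> (qlog \<omega> q)"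
      using e orb_Some_eq_iff[OF zH] by (auto simp: cusp_base_nonzero)
    then show False using N(4)[of \<gamma> z "qlog \<omega> q"] w(3)[OF z(2) q0] z U by auto
  qed
  then show thesis using that[OF U(1,2) w(1,2)] by blast
qed

lemma separated_cusps:
  assumes s: "\<sigma> \<in> cusp_frames \<Gamma>" "\<sigma>' \<in> cusp_frames \<Gamma>"
    and ne: "orb \<Gamma> (moeb_sphere \<sigma> None) \<noteq> orb \<Gamma> (moeb_sphere \<sigma>' None)"
  obtains \<omega> r \<omega>' r' where "cusp_width \<Gamma> \<sigma> \<omega>" "cusp_radius \<Gamma> \<sigma> \<omega> r" "cusp_width \<Gamma> \<sigma>' \<omega>'" "cusp_radius \<Gamma> \<sigma>' \<omega>' r'"
    "cusp_base \<Gamma> \<sigma> \<omega> ` ball 0 r \<inter> cusp_base \<Gamma> \<sigma>' \<omega>' ` ball 0 r' = {}"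
proof -
  obtain h where h: "\<And>\<gamma> \<tau> \<tau>'. \<gamma> \<in> lifts \<Gamma> \<Longrightarrow> \<tau> \<in> \<bbbH> \<Longrightarrow> h < Im \<tau> \<Longrightarrow> h < Im \<tau>' \<Longrightarrow>
      moeb \<gamma> (moeb \<sigma> \<tau>) = moeb \<sigma>' \<tau>' \<Longrightarrow> moeb_sphere \<gamma> (moeb_sphere \<sigma> None) = moeb_sphere \<sigma>' None"
    using frames_height_gap[OF s] by metis
  obtain \<omega> r where w: "cusp_width \<Gamma> \<sigma> \<omega>" "cusp_radius \<Gamma> \<sigma> \<omega> r"
    "\<And>q. q \<in> ball 0 r \<Longrightarrow> q \<noteq> 0 \<Longrightarrow> qlog \<omega> q \<in> \<bbbH> \<and> h < Im (qlog \<omega> q)"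
    using small_cusp_chart[OF s(1), of h] by metis
  obtain \<omega>' r' where w': "cusp_width \<Gamma> \<sigma>' \<omega>'" "cusp_radius \<Gamma> \<sigma>' \<omega>' r'"
    "\<And>q. q \<in> ball 0 r' \<Longrightarrow> q \<noteq> 0 \<Longrightarrow> qlog \<omega>' q \<in> \<bbbH> \<and> h < Im (qlog \<omega>' q)"
    using small_cusp_chart[OF s(2), of h] by metis
  have d: "det \<sigma> = 1" "det \<sigma>' = 1" using s by simp_all
  have "cusp_base \<Gamma> \<sigma> \<omega> q \<noteq> cusp_base \<Gamma> \<sigma>' \<omega>' q'" if q: "q \<in> ball 0 r" "q' \<in> ball 0 r'" for q q'
  proof
    assume e: "cusp_base \<Gamma> \<sigma> \<omega> q = cusp_base \<Gamma> \<sigma>' \<omega>' q'"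
    have H: "moeb \<sigma> (qlog \<omega> q) \<in> \<bbbH>" if "q \<noteq> 0" using w(3)[OF q(1) that] moeb_in_upper_half d by simp
    have H': "moeb \<sigma>' (qlog \<omega>' q') \<in> \<bbbH>" if "q' \<noteq> 0" using w'(3)[OF q(2) that] moeb_in_upper_half d by simp
    consider "q = 0" "q' = 0" | "q = 0" "q' \<noteq> 0" | "q \<noteq> 0" "q' = 0" | "q \<noteq> 0" "q' \<noteq> 0" by blast
    then show False
    proof cases
      case 1
      then show ?thesis using e ne by simp
    next
      case 2
      then show ?thesis using e orb_cusp_neq_orb_Some[OF s(1) H'] by (simp add: cusp_base_nonzero)
    next
      case 3
      then show ?thesis using e orb_cusp_neq_orb_Some[OF s(2) H] by (simp add: cusp_base_nonzero)
    next
      case 4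
      then obtain \<gamma> where "\<gamma> \<in> lifts \<Gamma>" "moeb \<gamma> (moeb \<sigma> (qlog \<omega> q)) = moeb \<sigma>' (qlog \<omega>' q')"
        using e orb_Some_eq_iff[OF H] by (auto simp: cusp_base_nonzero)
      then have "\<gamma> \<in> lifts \<Gamma> \<and> moeb_sphere \<gamma> (moeb_sphere \<sigma> None) = moeb_sphere \<sigma>' None"
        using h w(3)[OF q(1)] w'(3)[OF q(2)] 4 by blast
      then show ?thesis using ne orb_eq_iff by blast
    qed
  qed
  then show thesis using that[OF w(1,2) w'(1,2)] by blast
qed

lemma hausdorff_X: "hausdorff_atlas (curve_X \<Gamma>) (atlas_X \<Gamma> J)"
  unfolding hausdorff_atlas_def
proof (intro ballI impI)
  fix x y assume xy: "x \<in> curve_X \<Gamma>" "y \<in> curve_X \<Gamma>" "x \<noteq> y"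
  have pc: "\<exists>(U, p, P)\<in>atlas_X \<Gamma> J. \<exists>(U', p', P')\<in>atlas_X \<Gamma> J.
      orb \<Gamma> (Some \<tau>) \<in> p ` U \<and> orb \<Gamma> (moeb_sphere \<sigma> None) \<in> p' ` U' \<and> p ` U \<inter> p' ` U' = {}"
    "\<exists>(U, p, P)\<in>atlas_X \<Gamma> J. \<exists>(U', p', P')\<in>atlas_X \<Gamma> J.
      orb \<Gamma> (moeb_sphere \<sigma> None) \<in> p ` U \<and> orb \<Gamma> (Some \<tau>) \<in> p' ` U' \<and> p ` U \<inter> p' ` U' = {}"
    if ts: "\<tau> \<in> \<bbbH>" "\<sigma> \<in> cusp_frames \<Gamma>" for \<tau> \<sigma>
  proof -
    obtain U \<omega> r where U: "precisely_invariant \<Gamma> U" "\<tau> \<in> U" "cusp_width \<Gamma> \<sigma> \<omega>" "cusp_radius \<Gamma> \<sigma> \<omega> r"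
      and dj: "(\<lambda>z. orb \<Gamma> (Some z)) ` U \<inter> cusp_base \<Gamma> \<sigma> \<omega> ` ball 0 r = {}"
      using separated_point_cusp[OF ts] .
    have x: "orb \<Gamma> (Some \<tau>) \<in> (\<lambda>z. orb \<Gamma> (Some z)) ` U" using U by blast
    have y: "orb \<Gamma> (moeb_sphere \<sigma> None) \<in> cusp_base \<Gamma> \<sigma> \<omega> ` ball 0 r"
      using cusp_radius_pos[OF U(4)] by (intro image_eqI[of _ _ 0]) auto
    note a = atlas_X_point[OF U(1)] atlas_X_cusp[OF ts(2) U(3,4)]
    from hausdorff_atlasI[OF a x y dj] show "\<exists>(U, p, P)\<in>atlas_X \<Gamma> J. \<exists>(U', p', P')\<in>atlas_X \<Gamma> J.
      orb \<Gamma> (Some \<tau>) \<in> p ` U \<and> orb \<Gamma> (moeb_sphere \<sigma> None) \<in> p' ` U' \<and> p ` U \<inter> p' ` U' = {}" .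
    have dj': "cusp_base \<Gamma> \<sigma> \<omega> ` ball 0 r \<inter> (\<lambda>z. orb \<Gamma> (Some z)) ` U = {}" using dj by blast
    from hausdorff_atlasI[OF a(2,1) y x dj'] show "\<exists>(U, p, P)\<in>atlas_X \<Gamma> J. \<exists>(U', p', P')\<in>atlas_X \<Gamma> J.
      orb \<Gamma> (moeb_sphere \<sigma> None) \<in> p ` U \<and> orb \<Gamma> (Some \<tau>) \<in> p' ` U' \<and> p ` U \<inter> p' ` U' = {}" .
  qed
  show "\<exists>(U, p, P)\<in>atlas_X \<Gamma> J. \<exists>(U', p', P')\<in>atlas_X \<Gamma> J. x \<in> p ` U \<and> y \<in> p' ` U' \<and> p ` U \<inter> p' ` U' = {}"
    using xy(1)
  proof (cases rule: curve_X_cases)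
    case x: (point \<tau>)
    from xy(2) show ?thesis
    proof (cases rule: curve_X_cases)
      case y: (point \<tau>')
      obtain U U' where U: "precisely_invariant \<Gamma> U" "precisely_invariant \<Gamma> U'" "\<tau> \<in> U" "\<tau>' \<in> U'"
        and dj: "(\<lambda>z. orb \<Gamma> (Some z)) ` U \<inter> (\<lambda>z. orb \<Gamma> (Some z)) ` U' = {}"
        using separated_points[OF x(1) y(1)] x y xy(3) by metis
      show ?thesis
        by (rule hausdorff_atlasI[OF atlas_X_point[OF U(1)] atlas_X_point[OF U(2)] _ _ dj]) (use U x y in auto)
    next
      case y: (cusp \<sigma>)
      show ?thesis using pc(1)[OF x(1) y(1)] x y by simp
    qed
  next
    case x: (cusp \<sigma>)
    from xy(2) show ?thesis
    proof (cases rule: curve_X_cases)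
      case y: (point \<tau>')
      show ?thesis using pc(2)[OF y(1) x(1)] x y by simp
    next
      case y: (cusp \<sigma>')
      obtain \<omega> r \<omega>' r' where w: "cusp_width \<Gamma> \<sigma> \<omega>" "cusp_radius \<Gamma> \<sigma> \<omega> r" "cusp_width \<Gamma> \<sigma>' \<omega>'" "cusp_radius \<Gamma> \<sigma>' \<omega>' r'"
        and dj: "cusp_base \<Gamma> \<sigma> \<omega> ` ball 0 r \<inter> cusp_base \<Gamma> \<sigma>' \<omega>' ` ball 0 r' = {}"
        using separated_cusps[OF x(1) y(1)] x y xy(3) by metis
      have "x \<in> cusp_base \<Gamma> \<sigma> \<omega> ` ball 0 r" "y \<in> cusp_base \<Gamma> \<sigma>' \<omega>' ` ball 0 r'"
        using cusp_radius_pos[OF w(2)] cusp_radius_pos[OF w(4)] x y by (auto intro!: image_eqI[of _ _ 0])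
      then show ?thesis by (rule hausdorff_atlasI[OF atlas_X_cusp[OF x(1) w(1,2)] atlas_X_cusp[OF y(1) w(3,4)] _ _ dj])
    qed
  qed
qed

theorem orbifold_bundle_X: "orbifold_bundle A W (curve_X \<Gamma>) (total_X \<Gamma> J W) proj_X (atlas_X \<Gamma> J)"
  unfolding orbifold_bundle_def
proof (intro conjI ballI)
  fix c assume c: "c \<in> atlas_X \<Gamma> J"
  then show "orbifold_chart A W (curve_X \<Gamma>) (total_X \<Gamma> J W) proj_X c"
    by (cases rule: atlas_X_cases) (auto intro: orbifold_chart_X_of_Y orbifold_chart_cusp)
  show "compatible_charts A W c c'" if "c' \<in> atlas_X \<Gamma> J" for c' using compatible_atlas_X[OF c that] .
next
  show "proj_X ` total_X \<Gamma> J W \<subseteq> curve_X \<Gamma>"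
  proof clarify
    fix e assume "e \<in> total_X \<Gamma> J W"
    then show "proj_X e \<in> curve_X \<Gamma>" by (cases rule: total_X_cases) (auto simp: orb_in_curve_X)
  qed
  show "curve_X \<Gamma> = (\<Union>(U, p, P)\<in>atlas_X \<Gamma> J. p ` U)"
  proof
    show "curve_X \<Gamma> \<subseteq> (\<Union>(U, p, P)\<in>atlas_X \<Gamma> J. p ` U)"
    proof
      fix x assume "x \<in> curve_X \<Gamma>"
      then show "x \<in> (\<Union>(U, p, P)\<in>atlas_X \<Gamma> J. p ` U)"
      proof (cases rule: curve_X_cases)
        case (point \<tau>)
        then obtain U where "precisely_invariant \<Gamma> U" "\<tau> \<in> U" using precisely_invariant_nbhd[of \<tau> UNIV] by auto
        then show ?thesis using atlas_X_point point by blast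
      next
        case (cusp \<sigma>)
        obtain \<omega> r where w: "cusp_width \<Gamma> \<sigma> \<omega>" "cusp_radius \<Gamma> \<sigma> \<omega> r" using small_cusp_chart[OF cusp(1)] by metis
        have "x \<in> cusp_base \<Gamma> \<sigma> \<omega> ` ball 0 r"
          using cusp_radius_pos[OF w(2)] cusp by (auto intro!: image_eqI[of _ _ 0])
        then show ?thesis using atlas_X_cusp[OF cusp(1) w] by blast
      qed
    qed
    show "(\<Union>(U, p, P)\<in>atlas_X \<Gamma> J. p ` U) \<subseteq> curve_X \<Gamma>"
    proof clarify
      fix U p P z assume "(U, p, P) \<in> atlas_X \<Gamma> J" "z \<in> U"
      from this(1) show "p z \<in> curve_X \<Gamma>"
      proof (cases rule: atlas_X_cases)
        case (point U')
        then show ?thesis using \<open>z \<in> U\<close> orb_in_curve_X(1) by (auto simp: precisely_invariant_def)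
      next
        case (cusp r \<sigma> \<omega>)
        then have "z \<in> ball 0 1" using \<open>z \<in> U\<close> cusp_radius_le_one[OF cusp(3)] by auto
        then show ?thesis using cusp_triv_in_total(3)[OF cusp(1,2) _ zero_W] cusp(4) by simp
      qed
    qed
  qed
qed (rule hausdorff_X)

theorem ordinary_bundle_X:
  assumes "torsion_free \<Gamma>"
  shows "ordinary_bundle A W (curve_X \<Gamma>) (total_X \<Gamma> J W) proj_X (atlas_X \<Gamma> J)"
  unfolding ordinary_bundle_def
proof (intro conjI orbifold_bundle_X ballI, clarify)
  fix U p P assume "(U, p, P) \<in> atlas_X \<Gamma> J"
  then show "inj_on p U \<and> inj_on P (U \<times> W)"
  proof (cases rule: atlas_X_cases)
    case (point U')
    have "inj_on (Inl \<circ> class_Y \<Gamma> J) (U' \<times> W)"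
      by (intro comp_inj_on injective_charts_Y(2)[OF assms J_minus point(1)]) auto
    then show ?thesis using injective_charts_Y(1)[OF assms J_minus point(1)] point(2) by simp
  next
    case (cusp r \<sigma> \<omega>)
    then show ?thesis using cusp_base_inj cusp_triv_inj by simp
  qed
qed

end

section \<open>Invariant functions, expansions and sections\<close>

lemma holomorphic_on_local:
  assumes "\<And>z. z \<in> S \<Longrightarrow> \<exists>T. open T \<and> z \<in> T \<and> f holomorphic_on T"
  shows "f holomorphic_on S"
  unfolding holomorphic_on_def
  using assms holomorphic_on_imp_differentiable_at field_differentiable_at_within by metis

context quasi_VOA begin

lemma holomorphic_into_mono:
  assumes "holomorphic_into A W U f" "W \<subseteq> W'" "finite B'" "basis_of A W' B'"
  shows "holomorphic_into A W' U f"
proof -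
  obtain B c where e: "finite B" "basis_of A W B" "\<And>b. b \<in> B \<Longrightarrow> b \<in> W"
    "\<And>b. b \<in> B \<Longrightarrow> c b holomorphic_on U" "\<And>z. z \<in> U \<Longrightarrow> f z = (\<Sum>b\<in>B. smul A (c b z) b)"
    by (rule holomorphic_into_expansion[OF assms(1)]) (rule that)
  show ?thesis by (rule holomorphic_into_sumI(1)[OF assms(3,4) e(1,4) _ e(5)]) (use e(3) assms(2) in auto)
qed

lemma representation_lincomb:
  assumes "independent B" "finite B" "b \<in> B"
  shows "representation B (\<Sum>b\<in>B. smul A (c b) b) b = c b"
proof -
  have "representation B (\<Sum>b\<in>B. smul A (c b) b) b = (\<Sum>b'\<in>B. representation B (smul A (c b') b') b)"
    by (subst representation_sum[OF assms(1)]) (auto intro: span_scale span_base)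
  also have "\<dots> = (\<Sum>b'\<in>B. if b' = b then c b' else 0)"
    by (intro sum.cong refl) (auto simp: representation_scale[OF assms(1) span_base] representation_basis[OF assms(1)])
  finally show ?thesis using assms by simp
qed

lemma holomorphic_into_eq_at_center:
  assumes "holomorphic_into A W (ball 0 r) g" "holomorphic_into A W (ball 0 r) g'" "0 < r"
    and eq: "\<And>q. q \<in> ball 0 r \<Longrightarrow> q \<noteq> 0 \<Longrightarrow> g q = g' q"
  shows "g 0 = g' 0"
proof -
  obtain B where B: "finite B" "basis_of A W B" using assms(1) unfolding holomorphic_into_def by blast
  have B': "independent B" "span B = W" using B(2) by (auto simp: basis_of_def)
  have "representation B (g 0) b = representation B (g' 0) b" if b: "b \<in> B" for b
  proof -
    let ?f = "\<lambda>g q. representation B (g q) b"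
    have lim: "(?f g \<longlongrightarrow> ?f g 0) (at 0)" if "holomorphic_into A W (ball 0 r) g" for g
    proof -
      have "?f g holomorphic_on ball 0 r" using that b unfolding holomorphic_into_basis[OF B] by blast
      then have "isCont (?f g) 0"
        using assms(3) holomorphic_on_imp_continuous_on continuous_on_interior[of "ball 0 r" "?f g" 0] by simp
      then show ?thesis by (simp add: isCont_def)
    qed
    have "\<forall>\<^sub>F q in at (0::complex). q \<in> ball 0 r \<and> q \<noteq> 0"
      using assms(3) eventually_at_in_open[of "ball 0 r" "0::complex"] by simp
    then have "\<forall>\<^sub>F q in at 0. ?f g q = ?f g' q" by eventually_elim (use eq in simp)
    then have "(?f g' \<longlongrightarrow> ?f g 0) (at 0)" using lim[OF assms(1)] by (rule Lim_transform_eventually[rotated])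
    then show ?thesis by (rule tendsto_unique[OF trivial_limit_at _ lim[OF assms(2)]])
  qed
  then have "(\<Sum>b\<in>B. smul A (representation B (g 0) b) b) = (\<Sum>b\<in>B. smul A (representation B (g' 0) b) b)" by simp
  moreover have "g 0 \<in> W" "g' 0 \<in> W" using assms(1-3) unfolding holomorphic_into_def by auto
  ultimately show ?thesis using sum_representation_eq[of B _ B] B B' by simp
qed

end

context automorphy begin

definition invariant :: "(complex \<Rightarrow> 'v) \<Rightarrow> bool" where
  "invariant f \<longleftrightarrow> f ` \<bbbH> \<subseteq> W \<and> (\<forall>\<gamma>\<in>lifts \<Gamma>. \<forall>\<tau>\<in>\<bbbH>. J \<gamma> \<tau> (f \<tau>) = f (moeb \<gamma> \<tau>))"

text \<open>The function \<open>f\<parallel>\<sigma>\<close>, written with \<open>J(\<sigma>\<^sup>-\<^sup>1,\<sigma>\<tau>)\<close> for the inverse of \<open>J(\<sigma>,\<tau>)\<close>: the values of \<open>f\<close> in the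
  trivialization given by the frame \<open>\<sigma>\<close>.\<close>

definition pull :: "mat2 \<Rightarrow> (complex \<Rightarrow> 'v) \<Rightarrow> complex \<Rightarrow> 'v" where
  "pull \<sigma> f \<tau> = J (matrix_inv \<sigma>) (moeb \<sigma> \<tau>) (f (moeb \<sigma> \<tau>))"

lemma J_pull:
  assumes "f ` \<bbbH> \<subseteq> W" "det \<sigma> = 1" "\<tau> \<in> \<bbbH>"
  shows "pull \<sigma> f \<tau> \<in> W" "J \<sigma> \<tau> (pull \<sigma> f \<tau>) = f (moeb \<sigma> \<tau>)"
proof -
  have m: "moeb \<sigma> \<tau> \<in> \<bbbH>" using moeb_in_upper_half assms by simp
  then have f: "f (moeb \<sigma> \<tau>) \<in> W" using assms(1) by blast
  show "pull \<sigma> f \<tau> \<in> W" unfolding pull_def using J_W[OF _ m f] assms(2) by simp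
  show "J \<sigma> \<tau> (pull \<sigma> f \<tau>) = f (moeb \<sigma> \<tau>)"
    using J_inverse[of "matrix_inv \<sigma>", OF _ m f] assms by (simp add: pull_def matrix_inv_inv2 moeb_inverse)
qed

lemma pull_unique:
  assumes "f ` \<bbbH> \<subseteq> W" "det \<sigma> = 1" "\<tau> \<in> \<bbbH>" "v \<in> W"
  shows "J \<sigma> \<tau> v = f (moeb \<sigma> \<tau>) \<longleftrightarrow> v = pull \<sigma> f \<tau>"
  using J_pull[OF assms(1-3)] J_inj[OF assms(2,3,4)] by metis

lemma pull_holomorphic:
  assumes "holomorphic_into A W \<bbbH> f" "det \<sigma> = 1"
  shows "holomorphic_into A W \<bbbH> (pull \<sigma> f)"
proof -
  have h: "moeb \<sigma> holomorphic_on \<bbbH>" "moeb \<sigma> ` \<bbbH> \<subseteq> \<bbbH>"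
    using holomorphic_moeb[of "\<lambda>z. z" \<bbbH> \<sigma>] moeb_in_upper_half assms(2) by auto
  have "holomorphic_into A W \<bbbH> (\<lambda>\<tau>. J (matrix_inv \<sigma>) (moeb \<sigma> \<tau>) (f (moeb \<sigma> \<tau>)))"
    by (rule holomorphic_GL_apply[OF holomorphic_GL_compose[OF J_GL h] holomorphic_into_compose[OF assms(1) h]])
      (use assms(2) in simp)
  then show ?thesis unfolding pull_def[abs_def] .
qed

lemma invariant_W: "invariant f \<Longrightarrow> f ` \<bbbH> \<subseteq> W" and invariant_J:
  "invariant f \<Longrightarrow> \<gamma> \<in> lifts \<Gamma> \<Longrightarrow> \<tau> \<in> \<bbbH> \<Longrightarrow> J \<gamma> \<tau> (f \<tau>) = f (moeb \<gamma> \<tau>)"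
  by (auto simp: invariant_def)

lemma pull_change_frame:
  assumes f: "invariant f" and d: "det \<sigma> = 1" "det \<sigma>' = 1" and t: "\<tau> \<in> \<bbbH>"
    and b: "det \<beta> = 1" "\<sigma>' ** \<beta> = \<gamma> ** \<sigma>" and g: "\<gamma> \<in> lifts \<Gamma>"
  shows "pull \<sigma>' f (moeb \<beta> \<tau>) = J \<beta> \<tau> (pull \<sigma> f \<tau>)"
proof -
  have m: "moeb \<sigma> \<tau> \<in> \<bbbH>" "moeb \<beta> \<tau> \<in> \<bbbH>" using moeb_in_upper_half d b t by auto
  note p = J_pull[OF invariant_W[OF f] d(1) t]
  have "moeb (\<sigma>' ** \<beta>) \<tau> = moeb (\<gamma> ** \<sigma>) \<tau>" by (simp only: b(2))
  then have e: "moeb \<sigma>' (moeb \<beta> \<tau>) = moeb \<gamma> (moeb \<sigma> \<tau>)" using d b(1) t g by (simp add: moeb_mult)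
  have "J \<sigma>' (moeb \<beta> \<tau>) (J \<beta> \<tau> (pull \<sigma> f \<tau>)) = J (\<gamma> ** \<sigma>) \<tau> (pull \<sigma> f \<tau>)"
    using J_cocycle[OF d(2) b(1) t p(1)] b(2) by simp
  also have "\<dots> = J \<gamma> (moeb \<sigma> \<tau>) (f (moeb \<sigma> \<tau>))" using J_cocycle[OF _ d(1) t p(1), of \<gamma>] g p(2) by simp
  also have "\<dots> = f (moeb \<sigma>' (moeb \<beta> \<tau>))" using invariant_J[OF f g m(1)] e by simp
  finally show ?thesis
    using pull_unique[OF invariant_W[OF f] d(2) m(2)] J_W[OF b(1) t p(1)] by metis
qed

lemma pull_period:
  assumes "invariant f" "cusp_width \<Gamma> \<sigma> \<omega>" "det \<sigma> = 1" "\<tau> \<in> \<bbbH>"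
  shows "pull \<sigma> f (\<tau> + of_real (of_int n * \<omega>)) = pull \<sigma> f \<tau>"
proof -
  obtain \<gamma> where g: "\<gamma> \<in> lifts \<Gamma>" "\<gamma> ** \<sigma> = \<sigma> ** translation (of_int n * \<omega>)"
    using moeb_cusp_shift[OF assms(2-4)] by metis
  have "pull \<sigma> f (moeb (translation (of_int n * \<omega>)) \<tau>) = J (translation (of_int n * \<omega>)) \<tau> (pull \<sigma> f \<tau>)"
    by (rule pull_change_frame[OF assms(1,3,3,4) det_translation g(2)[symmetric] g(1)])
  then show ?thesis using J_translation[OF assms(4) J_pull(1)[OF invariant_W[OF assms(1)] assms(3,4)]] by simp
qed

text \<open>Representatives of a class over the same point differ by its stabilizer, and the stabilizer of \<open>\<sigma>\<tau>\<close>
  fixes \<open>f(\<sigma>\<tau>)\<close>. So an invariant function is determined by its classes even at elliptic points.\<close>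

lemma class_Y_invariant_iff:
  assumes f: "invariant f" and d: "det \<sigma> = 1" and t: "\<tau> \<in> \<bbbH>" and v: "v \<in> W"
  shows "class_Y \<Gamma> J (act \<sigma> (\<tau>, v)) = class_Y \<Gamma> J (moeb \<sigma> \<tau>, f (moeb \<sigma> \<tau>)) \<longleftrightarrow> v = pull \<sigma> f \<tau>"
proof
  have m: "moeb \<sigma> \<tau> \<in> \<bbbH>" using moeb_in_upper_half d t by simp
  have fW: "f (moeb \<sigma> \<tau>) \<in> W" using invariant_W[OF f] m by blast
  have Jv: "J \<sigma> \<tau> v \<in> W" by (rule J_W[OF d t v])
  assume "class_Y \<Gamma> J (act \<sigma> (\<tau>, v)) = class_Y \<Gamma> J (moeb \<sigma> \<tau>, f (moeb \<sigma> \<tau>))"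
  then obtain \<gamma> where g: "\<gamma> \<in> lifts \<Gamma>" "moeb \<gamma> (moeb \<sigma> \<tau>) = moeb \<sigma> \<tau>" "J \<gamma> (moeb \<sigma> \<tau>) (J \<sigma> \<tau> v) = f (moeb \<sigma> \<tau>)"
    using class_Y_eq_iff[of "(moeb \<sigma> \<tau>, J \<sigma> \<tau> v)" "(moeb \<sigma> \<tau>, f (moeb \<sigma> \<tau>))"] m fW Jv by auto
  then have "J \<gamma> (moeb \<sigma> \<tau>) (J \<sigma> \<tau> v) = J \<gamma> (moeb \<sigma> \<tau>) (f (moeb \<sigma> \<tau>))" using invariant_J[OF f g(1) m] by simp
  then have "J \<sigma> \<tau> v = f (moeb \<sigma> \<tau>)" using J_inj[OF _ m Jv fW] g(1) by simp
  then show "v = pull \<sigma> f \<tau>" using pull_unique[OF invariant_W[OF f] d t v] by simp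
next
  assume "v = pull \<sigma> f \<tau>"
  then show "class_Y \<Gamma> J (act \<sigma> (\<tau>, v)) = class_Y \<Gamma> J (moeb \<sigma> \<tau>, f (moeb \<sigma> \<tau>))"
    using J_pull(2)[OF invariant_W[OF f] d t] by simp
qed

lemma pull_one: "\<tau> \<in> \<bbbH> \<Longrightarrow> f ` \<bbbH> \<subseteq> W \<Longrightarrow> pull (mat 1) f \<tau> = f \<tau>"
  unfolding pull_def by (auto intro: J_one)

definition expansion_at :: "mat2 \<Rightarrow> real \<Rightarrow> (complex \<Rightarrow> 'v) \<Rightarrow> real \<Rightarrow> (complex \<Rightarrow> 'v) \<Rightarrow> bool" where
  "expansion_at \<sigma> \<omega> f r g \<longleftrightarrow> 0 < r \<and> r \<le> 1 \<and> holomorphic_into A W (ball 0 r) g \<and>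
     (\<forall>q\<in>ball 0 r. q \<noteq> 0 \<longrightarrow> g q = pull \<sigma> f (qlog \<omega> q))"

lemma qlog_H: "cusp_width \<Gamma> \<sigma> \<omega> \<Longrightarrow> q \<noteq> 0 \<Longrightarrow> norm q < 1 \<Longrightarrow> qlog \<omega> q \<in> \<bbbH>"
  using qlog_in_upper_half cusp_width_pos by blast

lemma pull_qlog_qpar:
  assumes "invariant f" "cusp_width \<Gamma> \<sigma> \<omega>" "det \<sigma> = 1" "\<tau> \<in> \<bbbH>"
  shows "pull \<sigma> f (qlog \<omega> (qpar \<omega> \<tau>)) = pull \<sigma> f \<tau>"
proof -
  obtain n :: int where "qlog \<omega> (qpar \<omega> \<tau>) = \<tau> + of_real (of_int n * \<omega>)"
    using qlog_qpar cusp_width_pos[OF assms(2)] by blast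
  then show ?thesis using pull_period[OF assms] by simp
qed

text \<open>A power series in \<open>q\<close> that converges on the punctured unit disc is holomorphic at 0. Conversely,
  \<open>f\<parallel>\<sigma>\<close> is periodic and so defines a holomorphic function on the punctured unit disc; if it extends
  holomorphically to \<open>q = 0\<close>, its Taylor series converges on the whole unit disc, whatever the radius
  \<open>r\<close> of the given extension.\<close>

lemma q_expansion_iff:
  assumes f: "invariant f" and hf: "holomorphic_into A W \<bbbH> f" and w: "cusp_width \<Gamma> \<sigma> \<omega>" and d: "det \<sigma> = 1"
  shows "q_expansion A W \<omega> (pull \<sigma> f) \<longleftrightarrow> (\<exists>r g. expansion_at \<sigma> \<omega> f r g)"
proof
  let ?F = "pull \<sigma> f"
  have FW: "?F \<tau> \<in> W" if "\<tau> \<in> \<bbbH>" for \<tau> using J_pull(1)[OF invariant_W[OF f] d that] .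
  have wp: "\<omega> > 0" by (rule cusp_width_pos[OF w])
  assume "q_expansion A W \<omega> ?F"
  then obtain a B where aW: "range a \<subseteq> W" and B: "finite B" "basis_of A W B"
    and sums: "\<And>\<tau> b. \<tau> \<in> \<bbbH> \<Longrightarrow> b \<in> B \<Longrightarrow>
      (\<lambda>n. representation B (a n) b * qpar \<omega> \<tau> ^ n) sums representation B (?F \<tau>) b"
    unfolding q_expansion_def by blast
  have B': "independent B" "span B = W" using B(2) by (auto simp: basis_of_def)
  define c where "c b q = suminf (\<lambda>n. representation B (a n) b * q ^ n)" for b q
  have sums_c: "(\<lambda>n. representation B (a n) b * q ^ n) sums c b q" if "b \<in> B" "q \<in> ball 0 1" for b q
  proof (cases "q = 0")
    case True
    have "summable (\<lambda>n. representation B (a n) b * 0 ^ n)" by (rule sums_summable[OF powser_sums_zero])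
    then show ?thesis unfolding c_def True by (rule summable_sums)
  next
    case False
    have "(\<lambda>n. representation B (a n) b * q ^ n) sums representation B (?F (qlog \<omega> q)) b"
      using sums[OF qlog_H[OF w False] that(1)] that(2) qpar_qlog[OF wp False] by simp
    then show ?thesis unfolding c_def using sums_summable summable_sums by blast
  qed
  define g where "g q = (\<Sum>b\<in>B. smul A (c b q) b)" for q
  have "c b holomorphic_on ball 0 1" if "b \<in> B" for b
    by (rule power_series_holomorphic[of 0 1 "\<lambda>n. representation B (a n) b"]) (use sums_c[OF that] in simp)
  then have "holomorphic_into A W (ball 0 1) g"
    using B' span_base by (intro holomorphic_into_sumI(1)[OF B, of B c _ "\<lambda>b. b"]) (auto simp: g_def B(1))
  moreover have "g q = ?F (qlog \<omega> q)" if q: "q \<in> ball 0 1" "q \<noteq> 0" for q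
  proof -
    have t: "qlog \<omega> q \<in> \<bbbH>" using qlog_H[OF w q(2)] q(1) by simp
    have "c b q = representation B (?F (qlog \<omega> q)) b" if b: "b \<in> B" for b
      using sums[OF t b] sums_c[OF b q(1)] qpar_qlog[OF wp q(2)] sums_unique2 by simp
    then have "g q = (\<Sum>b\<in>B. smul A (representation B (?F (qlog \<omega> q)) b) b)" by (simp add: g_def)
    also have "\<dots> = ?F (qlog \<omega> q)" using sum_representation_eq[of B _ B] B B' FW[OF t] by simp
    finally show ?thesis .
  qed
  ultimately show "\<exists>r g. expansion_at \<sigma> \<omega> f r g"
    unfolding expansion_at_def by (intro exI[of _ 1] exI[of _ g]) simp
next
  let ?F = "pull \<sigma> f"
  have FW: "?F \<tau> \<in> W" if "\<tau> \<in> \<bbbH>" for \<tau> using J_pull(1)[OF invariant_W[OF f] d that] .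
  have wp: "\<omega> > 0" by (rule cusp_width_pos[OF w])
  assume "\<exists>r g. expansion_at \<sigma> \<omega> f r g"
  then obtain r g where r: "0 < r" "r \<le> 1" and hg: "holomorphic_into A W (ball 0 r) g"
    and g: "\<And>q. q \<in> ball 0 r \<Longrightarrow> q \<noteq> 0 \<Longrightarrow> g q = ?F (qlog \<omega> q)"
    unfolding expansion_at_def by blast
  obtain B where B: "finite B" "basis_of A W B" using finite_basis by blast
  have B': "independent B" "span B = W" using B(2) by (auto simp: basis_of_def)
  define G where "G q = (if q = 0 then g 0 else ?F (qlog \<omega> q))" for q
  define \<phi> where "\<phi> b q = representation B (G q) b" for b q
  have hF: "(\<lambda>\<tau>. representation B (?F \<tau>) b) holomorphic_on \<bbbH>" if "b \<in> B" for b
    using pull_holomorphic[OF hf d] that unfolding holomorphic_into_basis[OF B] by blast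
  have h\<phi>: "\<phi> b holomorphic_on ball 0 1" if b: "b \<in> B" for b
  proof (rule holomorphic_on_local)
    fix q0 :: complex assume q0: "q0 \<in> ball 0 1"
    show "\<exists>T. open T \<and> q0 \<in> T \<and> \<phi> b holomorphic_on T"
    proof (cases "q0 = 0")
      case True
      have "(\<lambda>q. representation B (g q) b) holomorphic_on ball 0 r"
        using hg b unfolding holomorphic_into_basis[OF B] by blast
      moreover have "\<phi> b q = representation B (g q) b" if "q \<in> ball 0 r" for q
        using g[OF that] by (simp add: \<phi>_def G_def)
      ultimately have "\<phi> b holomorphic_on ball 0 r" using holomorphic_cong by (metis (no_types, lifting))
      then show ?thesis using True r(1) by (intro exI[of _ "ball 0 r"]) simp
    next
      case False
      obtain D t where D: "open D" "q0 \<in> D" "D \<subseteq> ball 0 1 - {0}" "t holomorphic_on D" "t ` D \<subseteq> \<bbbH>"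
        and t: "\<And>q. q \<in> D \<Longrightarrow> qpar \<omega> (t q) = q"
        by (rule local_log[OF wp False, of 1]) (use q0 in auto)
      have "\<phi> b q = representation B (?F (t q)) b" if q: "q \<in> D" for q
      proof -
        have "?F (qlog \<omega> q) = ?F (t q)" using pull_qlog_qpar[OF f w d, of "t q"] t[OF q] D(5) q by auto
        then show ?thesis using q D(3) by (auto simp: \<phi>_def G_def)
      qed
      moreover have "(\<lambda>q. representation B (?F (t q)) b) holomorphic_on D"
        using holomorphic_on_compose_gen[OF D(4) hF[OF b] D(5)] by (simp add: o_def)
      ultimately have "\<phi> b holomorphic_on D" using holomorphic_cong by (metis (no_types, lifting))
      then show ?thesis using D by blast
    qed
  qed
  define a where "a n = (\<Sum>b\<in>B. smul A ((deriv ^^ n) (\<phi> b) 0 / fact n) b)" for n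
  have "a n \<in> W" for n
    unfolding a_def B'(2)[symmetric] by (intro span_sum span_scale span_base)
  moreover have "(\<lambda>n. representation B (a n) b * qpar \<omega> \<tau> ^ n) sums representation B (?F \<tau>) b"
    if t: "\<tau> \<in> \<bbbH>" and b: "b \<in> B" for \<tau> b
  proof -
    have "representation B (a n) b = (deriv ^^ n) (\<phi> b) 0 / fact n" for n
      unfolding a_def by (rule representation_lincomb[OF B'(1) B(1) b])
    moreover have "(\<lambda>n. (deriv ^^ n) (\<phi> b) 0 / fact n * (qpar \<omega> \<tau> - 0) ^ n) sums \<phi> b (qpar \<omega> \<tau>)"
      using qpar_norm_less_one[OF wp t] by (intro holomorphic_power_series[OF h\<phi>[OF b]]) simp
    moreover have "\<phi> b (qpar \<omega> \<tau>) = representation B (?F \<tau>) b"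
      using pull_qlog_qpar[OF f w d t] by (simp add: \<phi>_def G_def)
    ultimately show ?thesis by simp
  qed
  ultimately show "q_expansion A W \<omega> ?F"
    unfolding q_expansion_def using B FW by (intro conjI exI[of _ a] exI[of _ B]) auto
qed

text \<open>The value at the cusp \<open>\<sigma>\<infinity>\<close>, in the frame \<open>\<sigma>\<close>.\<close>

definition cusp_value :: "(complex \<Rightarrow> 'v) \<Rightarrow> mat2 \<Rightarrow> 'v \<Rightarrow> bool" where
  "cusp_value f \<sigma> v \<longleftrightarrow> (\<exists>\<omega> r g. cusp_width \<Gamma> \<sigma> \<omega> \<and> expansion_at \<sigma> \<omega> f r g \<and> v = g 0)"

lemma cusp_value_W: "cusp_value f \<sigma> v \<Longrightarrow> v \<in> W"
  unfolding cusp_value_def expansion_at_def holomorphic_into_def by force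

lemma cusp_value_unique:
  assumes "cusp_value f \<sigma> v" "cusp_value f \<sigma> v'" shows "v = v'"
proof -
  obtain \<omega> r g where 1: "cusp_width \<Gamma> \<sigma> \<omega>" "expansion_at \<sigma> \<omega> f r g" "v = g 0"
    using assms(1) unfolding cusp_value_def by blast
  obtain \<omega>' r' g' where 2: "cusp_width \<Gamma> \<sigma> \<omega>'" "expansion_at \<sigma> \<omega>' f r' g'" "v' = g' 0"
    using assms(2) unfolding cusp_value_def by blast
  have e: "\<omega>' = \<omega>" using cusp_width_unique 1(1) 2(1) by blast
  let ?r = "min r r'"
  have "holomorphic_into A W (ball 0 ?r) g" "holomorphic_into A W (ball 0 ?r) g'"
    using 1(2) 2(2) unfolding expansion_at_def by (auto intro: holomorphic_into_subset)
  then have "g 0 = g' 0"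
    by (rule holomorphic_into_eq_at_center) (use 1(2) 2(2) e in \<open>auto simp: expansion_at_def\<close>)
  then show ?thesis using 1 2 by simp
qed

text \<open>The expansion in the new frame is the old one after the rotation of the parameter, with \<open>J(\<beta>,\<i>)\<close>
  applied to its values.\<close>

lemma cusp_value_change_frame:
  assumes f: "invariant f" and v: "cusp_value f \<sigma> v" and s: "\<sigma> \<in> cusp_frames \<Gamma>" "\<sigma>' \<in> cusp_frames \<Gamma>"
    and b: "det \<beta> = 1" "\<beta>$2$1 = 0" "\<sigma>' ** \<beta> = \<gamma> ** \<sigma>" and g: "\<gamma> \<in> lifts \<Gamma>"
  shows "cusp_value f \<sigma>' (J \<beta> \<i> v)"
proof -
  have d: "det \<sigma> = 1" "det \<sigma>' = 1" using s by simp_all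
  obtain \<omega> r h where w: "cusp_width \<Gamma> \<sigma> \<omega>" and r: "0 < r" "r \<le> 1" and hh: "holomorphic_into A W (ball 0 r) h"
    and h: "\<And>q. q \<in> ball 0 r \<Longrightarrow> q \<noteq> 0 \<Longrightarrow> h q = pull \<sigma> f (qlog \<omega> q)" and v: "v = h 0"
    using v unfolding cusp_value_def expansion_at_def by blast
  obtain \<omega>' where w': "cusp_width \<Gamma> \<sigma>' \<omega>'" using cusp_width_exists[OF s(2)] by blast
  obtain e where e: "norm e = 1" and qe: "\<And>\<tau>. qpar \<omega>' (moeb \<beta> \<tau>) = qpar \<omega> \<tau> * e"
    using qpar_change_frame[OF w w' d b g] by blast
  have e0: "e \<noteq> 0" using e by auto
  have ball: "q / e \<in> ball 0 r" if "q \<in> ball 0 r" for q using that e by (simp add: norm_divide)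
  define h' where "h' q = J \<beta> \<i> (h (q / e))" for q
  have "holomorphic_into A W (ball 0 r) h'"
    unfolding h'_def
  proof (rule holomorphic_GL_apply[OF const_holomorphic_GL[OF b(1)]])
    show "holomorphic_into A W (ball 0 r) (\<lambda>z. h (z / e))"
      by (rule holomorphic_into_compose[OF hh]) (use ball e0 in \<open>auto intro!: holomorphic_intros\<close>)
  qed
  moreover have "h' q = pull \<sigma>' f (qlog \<omega>' q)" if q: "q \<in> ball 0 r" "q \<noteq> 0" for q
  proof -
    define \<tau> where "\<tau> = qlog \<omega> (q / e)"
    have qe0: "q / e \<noteq> 0" using q e0 by simp
    have t: "\<tau> \<in> \<bbbH>" unfolding \<tau>_def using qlog_H[OF w qe0] ball[OF q(1)] r by simp
    have bt: "moeb \<beta> \<tau> \<in> \<bbbH>" using moeb_in_upper_half b t by simp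
    have "qpar \<omega>' (moeb \<beta> \<tau>) = q"
      using qe qpar_qlog[OF cusp_width_pos[OF w] qe0] e0 by (simp add: \<tau>_def)
    then have "pull \<sigma>' f (qlog \<omega>' q) = pull \<sigma>' f (moeb \<beta> \<tau>)" using pull_qlog_qpar[OF f w' d(2) bt] by simp
    also have "\<dots> = J \<beta> \<tau> (pull \<sigma> f \<tau>)" by (rule pull_change_frame[OF f d t b(1,3) g])
    also have "\<dots> = h' q" unfolding h'_def using h[OF ball[OF q(1)] qe0] J_upper_triangular[OF b(2), of \<tau> _ \<i>] by (simp add: \<tau>_def)
    finally show ?thesis ..
  qed
  moreover have "h' 0 = J \<beta> \<i> v" by (simp add: h'_def v)
  ultimately show ?thesis unfolding cusp_value_def expansion_at_def
    using w' r by (intro exI[of _ \<omega>'] exI[of _ r] exI[of _ h']) simp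
qed

definition section_of :: "(complex option set \<Rightarrow> (complex \<times> 'v) set + (mat2 \<times> 'v) set) \<Rightarrow> (complex \<Rightarrow> 'v) \<Rightarrow> bool" where
  "section_of s f \<longleftrightarrow> (\<forall>\<tau>\<in>\<bbbH>. s (orb \<Gamma> (Some \<tau>)) = Inl (class_Y \<Gamma> J (\<tau>, f \<tau>)))"

lemma section_of_unique:
  assumes "section_of s f" "section_of s f'" "invariant f" "invariant f'" "\<tau> \<in> \<bbbH>"
  shows "f \<tau> = f' \<tau>"
proof -
  have fW: "f \<tau> \<in> W" using invariant_W[OF assms(3)] assms(5) by blast
  have "class_Y \<Gamma> J (act (mat 1) (\<tau>, f \<tau>)) = class_Y \<Gamma> J (moeb (mat 1) \<tau>, f' (moeb (mat 1) \<tau>))"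
    using assms(1,2,5) fW by (simp add: section_of_def J_one)
  then have "f \<tau> = pull (mat 1) f' \<tau>" using class_Y_invariant_iff[OF assms(4) _ assms(5) fW, of "mat 1"] by simp
  then show ?thesis using pull_one[OF assms(5) invariant_W[OF assms(4)]] by simp
qed

text \<open>Off the centre, the local representative of a section near a cusp is forced to be the expansion of
  the function that represents the section on the upper half plane.\<close>

lemma section_expansion:
  assumes s: "\<sigma> \<in> cusp_frames \<Gamma>" and w: "cusp_width \<Gamma> \<sigma> \<omega>" and r: "0 < r" "r \<le> 1"
    and hg: "holomorphic_into A W (ball 0 r) g" and f: "invariant f" and sf: "section_of s f"
  shows "(\<forall>q\<in>ball 0 r. q \<noteq> 0 \<longrightarrow> s (cusp_base \<Gamma> \<sigma> \<omega> q) = cusp_triv \<Gamma> J \<sigma> \<omega> (q, g q)) \<longleftrightarrow>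
    expansion_at \<sigma> \<omega> f r g"
proof -
  have d: "det \<sigma> = 1" using s by simp
  have "s (cusp_base \<Gamma> \<sigma> \<omega> q) = cusp_triv \<Gamma> J \<sigma> \<omega> (q, g q) \<longleftrightarrow> g q = pull \<sigma> f (qlog \<omega> q)"
    if q: "q \<in> ball 0 r" "q \<noteq> 0" for q
  proof -
    have t: "qlog \<omega> q \<in> \<bbbH>" using qlog_H[OF w q(2)] q(1) r by simp
    have m: "moeb \<sigma> (qlog \<omega> q) \<in> \<bbbH>" using moeb_in_upper_half d t by simp
    have "g q \<in> W" using hg q unfolding holomorphic_into_def by blast
    from class_Y_invariant_iff[OF f d t this] show ?thesis
      using sf m by (auto simp: cusp_base_nonzero[OF q(2)] cusp_triv_nonzero[OF q(2)] section_of_def)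
  qed
  then show ?thesis unfolding expansion_at_def using r hg by blast
qed

definition forms :: "(complex \<Rightarrow> 'v) \<Rightarrow> bool" where
  "forms f \<longleftrightarrow> holomorphic_into A W \<bbbH> f \<and> invariant f \<and>
     (\<forall>\<sigma>\<in>cusp_frames \<Gamma>. \<forall>\<omega>. cusp_width \<Gamma> \<sigma> \<omega> \<longrightarrow> q_expansion A W \<omega> (pull \<sigma> f))"

lemma forms_expansion:
  assumes "forms f" "\<sigma> \<in> cusp_frames \<Gamma>" "cusp_width \<Gamma> \<sigma> \<omega>"
  shows "\<exists>r g. expansion_at \<sigma> \<omega> f r g"
  using assms q_expansion_iff[of f \<sigma> \<omega>] unfolding forms_def by simp

lemma act_invariant_iff:
  assumes "f ` \<bbbH> \<subseteq> W"
  shows "(\<forall>\<gamma>\<in>lifts \<Gamma>. \<forall>\<tau>\<in>\<bbbH>. act \<gamma> (\<tau>, f \<tau>) = (moeb \<gamma> \<tau>, f (moeb \<gamma> \<tau>))) \<longleftrightarrow> invariant f"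
  using assms by (simp add: invariant_def)

theorem form_of_section:
  assumes "holomorphic_section A \<Gamma> J W s"
  obtains f where "f \<in> extensional \<bbbH>" "forms f" "section_of s f"
proof -
  obtain f0 where hf0: "holomorphic_into A W \<bbbH> f0"
    and inv: "\<forall>\<gamma>\<in>lifts \<Gamma>. \<forall>\<tau>\<in>\<bbbH>. act \<gamma> (\<tau>, f0 \<tau>) = (moeb \<gamma> \<tau>, f0 (moeb \<gamma> \<tau>))"
    and sf0: "\<forall>\<tau>\<in>\<bbbH>. s (orb \<Gamma> (Some \<tau>)) = Inl (class_Y \<Gamma> J (\<tau>, f0 \<tau>))"
    and cusp: "\<forall>\<sigma>\<in>cusp_frames \<Gamma>. \<forall>\<omega>. cusp_width \<Gamma> \<sigma> \<omega> \<longrightarrow>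
        (\<exists>r g. 0 < r \<and> r \<le> 1 \<and> holomorphic_into A W (ball 0 r) g \<and>
           (\<forall>q\<in>ball 0 r. s (cusp_base \<Gamma> \<sigma> \<omega> q) = cusp_triv \<Gamma> J \<sigma> \<omega> (q, g q)))"
    using assms unfolding holomorphic_section_def by blast
  have f0W: "f0 ` \<bbbH> \<subseteq> W" using hf0 unfolding holomorphic_into_def by blast
  define f where "f = restrict f0 \<bbbH>"
  have ff0: "f \<tau> = f0 \<tau>" if "\<tau> \<in> \<bbbH>" for \<tau> using that by (simp add: f_def)
  have hf: "holomorphic_into A W \<bbbH> f" using hf0 holomorphic_into_cong[of \<bbbH> f f0 W] ff0 by simp
  have "invariant f0" using inv act_invariant_iff[OF f0W] by simp
  then have f: "invariant f" unfolding invariant_def using ff0 moeb_in_upper_half by (simp add: image_subset_iff)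
  have sf: "section_of s f" using sf0 ff0 by (simp add: section_of_def)
  have "q_expansion A W \<omega> (pull \<sigma> f)" if sw: "\<sigma> \<in> cusp_frames \<Gamma>" "cusp_width \<Gamma> \<sigma> \<omega>" for \<sigma> \<omega>
  proof -
    obtain r g where r: "0 < r" "r \<le> 1" "holomorphic_into A W (ball 0 r) g"
      and g: "\<forall>q\<in>ball 0 r. s (cusp_base \<Gamma> \<sigma> \<omega> q) = cusp_triv \<Gamma> J \<sigma> \<omega> (q, g q)" using cusp sw by metis
    have "expansion_at \<sigma> \<omega> f r g" using section_expansion[OF sw r f sf] g by blast
    then show ?thesis using q_expansion_iff[OF f hf sw(2)] sw(1) by auto
  qed
  then have "forms f" using hf f by (simp add: forms_def)
  then show thesis using that[of f] sf by (simp add: f_def)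
qed

lemma section_cusp_value:
  assumes s: "holomorphic_section A \<Gamma> J W s" and sf: "section_of s f" and f: "invariant f"
    and \<sigma>: "\<sigma> \<in> cusp_frames \<Gamma>"
  obtains v where "cusp_value f \<sigma> v" "s (orb \<Gamma> (moeb_sphere \<sigma> None)) = Inr (class_cusp \<Gamma> J (\<sigma>, v))"
proof -
  obtain \<omega> where w: "cusp_width \<Gamma> \<sigma> \<omega>" using cusp_width_exists[OF \<sigma>] by blast
  obtain r g where r: "0 < r" "r \<le> 1" "holomorphic_into A W (ball 0 r) g"
    and g: "\<forall>q\<in>ball 0 r. s (cusp_base \<Gamma> \<sigma> \<omega> q) = cusp_triv \<Gamma> J \<sigma> \<omega> (q, g q)"
    using s \<sigma> w unfolding holomorphic_section_def by blast
  have "expansion_at \<sigma> \<omega> f r g" using section_expansion[OF \<sigma> w r f sf] g by blast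
  then have "cusp_value f \<sigma> (g 0)" unfolding cusp_value_def using w by blast
  moreover have "s (orb \<Gamma> (moeb_sphere \<sigma> None)) = Inr (class_cusp \<Gamma> J (\<sigma>, g 0))"
    using bspec[OF g, of 0] r(1) by simp
  ultimately show thesis using that by blast
qed

text \<open>At a cusp the value is the limit of the expansion of \<open>f\<close>, by continuity.\<close>

theorem section_determined_by_form:
  assumes s: "holomorphic_section A \<Gamma> J W s" "section_of s f" and s': "holomorphic_section A \<Gamma> J W s'" "section_of s' f"
    and f: "invariant f"
  shows "s = s'"
proof (rule PiE_ext)
  show "s \<in> curve_X \<Gamma> \<rightarrow>\<^sub>E total_X \<Gamma> J W" by (rule conjunct1[OF s(1)[unfolded holomorphic_section_def]])
  show "s' \<in> curve_X \<Gamma> \<rightarrow>\<^sub>E total_X \<Gamma> J W" by (rule conjunct1[OF s'(1)[unfolded holomorphic_section_def]])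
  fix x assume "x \<in> curve_X \<Gamma>"
  then show "s x = s' x"
  proof (cases rule: curve_X_cases)
    case (point \<tau>)
    then show ?thesis using s(2) s'(2) by (simp add: section_of_def)
  next
    case (cusp \<sigma>)
    obtain v where v: "cusp_value f \<sigma> v" "s x = Inr (class_cusp \<Gamma> J (\<sigma>, v))"
      using section_cusp_value[OF s f cusp(1)] cusp(2) by metis
    obtain v' where v': "cusp_value f \<sigma> v'" "s' x = Inr (class_cusp \<Gamma> J (\<sigma>, v'))"
      using section_cusp_value[OF s' f cusp(1)] cusp(2) by metis
    show ?thesis using cusp_value_unique[OF v(1) v'(1)] v(2) v'(2) by simp
  qed
qed

text \<open>The point over \<open>x\<close> of the section defined by \<open>f\<close>, as a relation, because it is given by choosing a
  representative of the orbit \<open>x\<close> and, at a cusp, a frame.\<close>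

definition value_at :: "(complex \<Rightarrow> 'v) \<Rightarrow> complex option set \<Rightarrow> (complex \<times> 'v) set + (mat2 \<times> 'v) set \<Rightarrow> bool" where
  "value_at f x e \<longleftrightarrow> (\<exists>\<tau>\<in>\<bbbH>. x = orb \<Gamma> (Some \<tau>) \<and> e = Inl (class_Y \<Gamma> J (\<tau>, f \<tau>))) \<or>
     (\<exists>\<sigma>\<in>cusp_frames \<Gamma>. \<exists>v. x = orb \<Gamma> (moeb_sphere \<sigma> None) \<and> cusp_value f \<sigma> v \<and> e = Inr (class_cusp \<Gamma> J (\<sigma>, v)))"

lemma value_atE:
  assumes "value_at f x e"
  obtains (point) \<tau> where "\<tau> \<in> \<bbbH>" "x = orb \<Gamma> (Some \<tau>)" "e = Inl (class_Y \<Gamma> J (\<tau>, f \<tau>))"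
  | (cusp) \<sigma> v where "\<sigma> \<in> cusp_frames \<Gamma>" "x = orb \<Gamma> (moeb_sphere \<sigma> None)" "cusp_value f \<sigma> v"
      "e = Inr (class_cusp \<Gamma> J (\<sigma>, v))"
  using assms unfolding value_at_def by blast

lemma value_at_unique:
  assumes f: "invariant f" and e: "value_at f x e" "value_at f x e'"
  shows "e = e'"
  using e(1)
proof (cases rule: value_atE)
  case p: (point \<tau>)
  from e(2) show ?thesis
  proof (cases rule: value_atE)
    case p': (point \<tau>')
    have "orb \<Gamma> (Some \<tau>) = orb \<Gamma> (Some \<tau>')" using p(2) p'(2) by simp
    then obtain \<gamma> where g: "\<gamma> \<in> lifts \<Gamma>" "moeb \<gamma> \<tau> = \<tau>'" using orb_Some_eq_iff[OF p(1)] by blast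
    have "act \<gamma> (\<tau>, f \<tau>) = (\<tau>', f \<tau>')" using invariant_J[OF f g(1) p(1)] g(2) by simp
    moreover have "(\<tau>, f \<tau>) \<in> \<bbbH> \<times> W" using invariant_W[OF f] p(1) by blast
    ultimately show ?thesis using class_Y_act[OF g(1), of "(\<tau>, f \<tau>)"] p(3) p'(3) by simp
  next
    case c: (cusp \<sigma> v)
    then show ?thesis using orb_cusp_neq_orb_Some[OF c(1) p(1)] p(2) by simp
  qed
next
  case c: (cusp \<sigma> v)
  from e(2) show ?thesis
  proof (cases rule: value_atE)
    case p: (point \<tau>)
    then show ?thesis using orb_cusp_neq_orb_Some[OF c(1) p(1)] c(2) by simp
  next
    case c': (cusp \<sigma>' v')
    have "orb \<Gamma> (moeb_sphere \<sigma> None) = orb \<Gamma> (moeb_sphere \<sigma>' None)" using c(2) c'(2) by simp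
    then obtain \<gamma> where g: "\<gamma> \<in> lifts \<Gamma>" "moeb_sphere \<gamma> (moeb_sphere \<sigma> None) = moeb_sphere \<sigma>' None"
      unfolding orb_eq_iff by blast
    obtain \<beta> where b: "det \<beta> = 1" "\<beta>$2$1 = 0" "\<sigma>' ** \<beta> = \<gamma> ** \<sigma>" using frames_same_cusp[OF c(1) c'(1) g] .
    have "v' = J \<beta> \<i> v"
      using cusp_value_unique[OF c'(3) cusp_value_change_frame[OF f c(3,1) c'(1) b g(1)]] .
    then show ?thesis using class_cusp_eqI[OF cusp_value_W[OF c(3)] g(1) b] c(4) c'(4) by simp
  qed
qed

theorem section_of_form:
  assumes "forms f"
  obtains s where "holomorphic_section A \<Gamma> J W s" "section_of s f"
proof -
  have hf: "holomorphic_into A W \<bbbH> f" and f: "invariant f" using assms by (auto simp: forms_def)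
  define s where "s = (\<lambda>x\<in>curve_X \<Gamma>. THE e. value_at f x e)"
  have sI: "s x = e" if "x \<in> curve_X \<Gamma>" "value_at f x e" for x e
    unfolding s_def using that value_at_unique[OF f] by (simp add: the_equality)
  have point: "s (orb \<Gamma> (Some \<tau>)) = Inl (class_Y \<Gamma> J (\<tau>, f \<tau>))" if "\<tau> \<in> \<bbbH>" for \<tau>
    by (rule sI[OF orb_in_curve_X(1)[OF that]]) (use that in \<open>auto simp: value_at_def\<close>)
  have cusp: "s (orb \<Gamma> (moeb_sphere \<sigma> None)) = Inr (class_cusp \<Gamma> J (\<sigma>, v))" if "\<sigma> \<in> cusp_frames \<Gamma>" "cusp_value f \<sigma> v" for \<sigma> v
    by (rule sI[OF orb_in_curve_X(2)[OF that(1)]]) (use that in \<open>auto simp: value_at_def\<close>)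
  have sf: "section_of s f" using point by (simp add: section_of_def)
  have val: "s x \<in> total_X \<Gamma> J W \<and> proj_X (s x) = x" if "x \<in> curve_X \<Gamma>" for x
    using that
  proof (cases rule: curve_X_cases)
    case p: (point \<tau>)
    have "f \<tau> \<in> W" using invariant_W[OF f] p(1) by blast
    then show ?thesis using p point[OF p(1)] by (auto simp: total_X_def total_Y_def proj_X_Inl proj_class_Y)
  next
    case c: (cusp \<sigma>)
    obtain \<omega> where w: "cusp_width \<Gamma> \<sigma> \<omega>" using cusp_width_exists[OF c(1)] by blast
    obtain r g where "expansion_at \<sigma> \<omega> f r g" using forms_expansion[OF assms c(1) w] by blast
    then have v: "cusp_value f \<sigma> (g 0)" unfolding cusp_value_def using w by blast
    show ?thesis using c cusp[OF c(1) v] cusp_value_W[OF v] by (auto simp: total_X_def proj_class_cusp)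
  qed
  have local: "\<exists>r g. 0 < r \<and> r \<le> 1 \<and> holomorphic_into A W (ball 0 r) g \<and>
      (\<forall>q\<in>ball 0 r. s (cusp_base \<Gamma> \<sigma> \<omega> q) = cusp_triv \<Gamma> J \<sigma> \<omega> (q, g q))"
    if sw: "\<sigma> \<in> cusp_frames \<Gamma>" "cusp_width \<Gamma> \<sigma> \<omega>" for \<sigma> \<omega>
  proof -
    obtain r g where e: "expansion_at \<sigma> \<omega> f r g" using forms_expansion[OF assms sw] by blast
    then have v: "cusp_value f \<sigma> (g 0)" unfolding cusp_value_def using sw by blast
    have r: "0 < r" "r \<le> 1" "holomorphic_into A W (ball 0 r) g" using e by (auto simp: expansion_at_def)
    have "s (cusp_base \<Gamma> \<sigma> \<omega> q) = cusp_triv \<Gamma> J \<sigma> \<omega> (q, g q)" if "q \<in> ball 0 r" for q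
    proof (cases "q = 0")
      case True
      then show ?thesis using cusp[OF sw(1) v] by simp
    next
      case False
      then show ?thesis using section_expansion[OF sw r f sf] e that by blast
    qed
    then show ?thesis using r by blast
  qed
  have "s \<in> curve_X \<Gamma> \<rightarrow>\<^sub>E total_X \<Gamma> J W" using val by (auto simp: s_def)
  moreover have "\<exists>f. holomorphic_into A W \<bbbH> f \<and>
        (\<forall>\<gamma>\<in>lifts \<Gamma>. \<forall>\<tau>\<in>\<bbbH>. act \<gamma> (\<tau>, f \<tau>) = (moeb \<gamma> \<tau>, f (moeb \<gamma> \<tau>))) \<and>
        (\<forall>\<tau>\<in>\<bbbH>. s (orb \<Gamma> (Some \<tau>)) = Inl (class_Y \<Gamma> J (\<tau>, f \<tau>)))"
    using hf f point act_invariant_iff[OF invariant_W[OF f]] by blast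
  ultimately have "holomorphic_section A \<Gamma> J W s"
    unfolding holomorphic_section_def using val local by blast
  then show thesis using that sf by blast
qed

lemma holomorphic_section_mono:
  assumes "holomorphic_section A \<Gamma> J W' s" "W' \<subseteq> W"
  shows "holomorphic_section A \<Gamma> J W s"
proof -
  obtain B where B: "finite B" "basis_of A W B" using finite_basis by blast
  have mono: "holomorphic_into A W U f" if "holomorphic_into A W' U f" for U f
    using holomorphic_into_mono[OF that assms(2) B] .
  have "total_X \<Gamma> J W' \<subseteq> total_X \<Gamma> J W" using assms(2) by (auto simp: total_X_def total_Y_def)
  then have "s \<in> curve_X \<Gamma> \<rightarrow>\<^sub>E total_X \<Gamma> J W" using assms(1) unfolding holomorphic_section_def by (auto simp: PiE_iff)
  then show ?thesis using assms(1) mono unfolding holomorphic_section_def by meson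
qed

end

section \<open>The bundles of a quasi-vertex operator algebra\<close>

lemma bij_betw_of_relation:
  assumes "\<And>s. s \<in> S \<Longrightarrow> \<exists>f\<in>F. R s f" "\<And>f. f \<in> F \<Longrightarrow> \<exists>s\<in>S. R s f"
    "\<And>s f f'. s \<in> S \<Longrightarrow> f \<in> F \<Longrightarrow> f' \<in> F \<Longrightarrow> R s f \<Longrightarrow> R s f' \<Longrightarrow> f = f'"
    "\<And>s s' f. s \<in> S \<Longrightarrow> s' \<in> S \<Longrightarrow> f \<in> F \<Longrightarrow> R s f \<Longrightarrow> R s' f \<Longrightarrow> s = s'"
  shows "\<exists>\<Phi>. bij_betw \<Phi> S F \<and> (\<forall>s\<in>S. R s (\<Phi> s))"
proof -
  obtain \<Phi> where \<Phi>: "\<forall>s\<in>S. \<Phi> s \<in> F \<and> R s (\<Phi> s)" using assms(1) by metis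
  have "inj_on \<Phi> S" by (rule inj_onI) (metis \<Phi> assms(4))
  moreover have "\<Phi> ` S = F"
  proof
    show "\<Phi> ` S \<subseteq> F" using \<Phi> by blast
    show "F \<subseteq> \<Phi> ` S"
    proof
      fix f assume f: "f \<in> F"
      then obtain s where s: "s \<in> S" "R s f" using assms(2) by blast
      then have "f = \<Phi> s" using assms(3)[OF s(1) f] \<Phi> by blast
      then show "f \<in> \<Phi> ` S" using s(1) by blast
    qed
  qed
  ultimately show ?thesis using \<Phi> unfolding bij_betw_def by blast
qed

lemma fuchsian_of_first_kind: "fuchsian_first_kind \<Gamma> \<Longrightarrow> fuchsian \<Gamma>"
  by (simp add: fuchsian_first_kind_def fuchsian_def)

context quasi_VOA begin

lemma bundle_act_K [simp]: "bundle_act (K A) \<gamma> (\<tau>, v) = (moeb \<gamma> \<tau>, K A \<gamma> \<tau> v)"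
  by (simp add: bundle_act_def)

lemma group_action_GL2p: "group_action GL2p (\<bbbH> \<times> UNIV) (\<lambda>\<gamma>. restrict (bundle_act (K A) \<gamma>) (\<bbbH> \<times> UNIV))"
  by (rule group_action_restrict[OF group_GL2p])
    (auto simp: moeb_in_upper_half moeb_mult K_cocycle K_one GL2p_def)

lemma group_action_fuchsian:
  assumes "fuchsian \<Gamma>"
  shows "\<exists>\<phi>. group_action (PSL2\<lparr>carrier := \<Gamma>\<rparr>) (\<bbbH> \<times> UNIV) \<phi> \<and>
           (\<forall>g\<in>\<Gamma>. \<forall>\<gamma>\<in>g. \<forall>x\<in>\<bbbH> \<times> UNIV. \<phi> g x = bundle_act (K A) \<gamma> x)"
proof -
  interpret fuchsian \<Gamma> by fact
  \<comment> \<open>Either lift of \<open>g\<close> may be chosen, as \<open>\<gamma>\<close> and \<open>-\<gamma>\<close> act in the same way.\<close>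
  define a where "a g = bundle_act (K A) (SOME \<gamma>. \<gamma> \<in> g)" for g
  have a: "a g x = bundle_act (K A) \<gamma> x" if g: "g \<in> \<Gamma>" "\<gamma> \<in> g" for g \<gamma> x
  proof -
    have "(SOME \<gamma>. \<gamma> \<in> g) \<in> g" using g(2) by (rule someI)
    then have "(SOME \<gamma>. \<gamma> \<in> g) = \<gamma> \<or> (SOME \<gamma>. \<gamma> \<in> g) = - \<gamma>" using elementE[OF g] by blast
    then show ?thesis unfolding a_def by (cases x) (auto simp: moeb_minus K_minus)
  qed
  have ex: "\<exists>\<gamma>. \<gamma> \<in> g \<and> det \<gamma> = 1 \<and> g = {\<gamma>, - \<gamma>}" if "g \<in> \<Gamma>" for g
    using subgroup.subset[OF subgroup_PSL2] that carrier_PSL2 by blast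
  have "group_action (PSL2\<lparr>carrier := \<Gamma>\<rparr>) (\<bbbH> \<times> UNIV) (\<lambda>g. restrict (a g) (\<bbbH> \<times> UNIV))"
  proof (rule group_action_restrict)
    show "group (PSL2\<lparr>carrier := \<Gamma>\<rparr>)" by (rule subgroup.subgroup_is_group[OF subgroup_PSL2 group_PSL2])
    fix g x assume g: "g \<in> carrier (PSL2\<lparr>carrier := \<Gamma>\<rparr>)" and x: "x \<in> \<bbbH> \<times> (UNIV :: 'v set)"
    obtain \<gamma> where c: "\<gamma> \<in> g" "det \<gamma> = 1" "g = {\<gamma>, - \<gamma>}" using ex g by auto
    show "a g x \<in> \<bbbH> \<times> UNIV" using a[of g \<gamma> x] g c x by (cases x) (auto simp: moeb_in_upper_half)
    fix h assume h: "h \<in> carrier (PSL2\<lparr>carrier := \<Gamma>\<rparr>)"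
    obtain \<beta> where b: "\<beta> \<in> h" "det \<beta> = 1" "h = {\<beta>, - \<beta>}" using ex h by auto
    have "g \<otimes>\<^bsub>PSL2\<^esub> h \<in> \<Gamma>" using subgroup.m_closed[OF subgroup_PSL2, of g h] g h by simp
    moreover have "\<gamma> ** \<beta> \<in> g \<otimes>\<^bsub>PSL2\<^esub> h" unfolding c(3) b(3) PSL2_mult by simp
    ultimately have "a (g \<otimes>\<^bsub>PSL2\<^esub> h) x = bundle_act (K A) (\<gamma> ** \<beta>) x" by (rule a)
    also have "\<dots> = bundle_act (K A) \<gamma> (bundle_act (K A) \<beta> x)"
      using x b c by (cases x) (simp add: moeb_mult K_cocycle)
    also have "\<dots> = a g (a h x)" using a[of g \<gamma>] a[of h \<beta>] g h b(1) c(1) by simp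
    finally show "a (g \<otimes>\<^bsub>PSL2\<lparr>carrier := \<Gamma>\<rparr>\<^esub> h) x = a g (a h x)" by simp
  next
    fix x assume "x \<in> \<bbbH> \<times> (UNIV :: 'v set)"
    have "\<one>\<^bsub>PSL2\<^esub> \<in> \<Gamma>" using subgroup.one_closed[OF subgroup_PSL2] .
    then have "a \<one>\<^bsub>PSL2\<^esub> x = bundle_act (K A) (mat 1) x" by (rule a) (simp add: PSL2_one)
    then show "a \<one>\<^bsub>PSL2\<lparr>carrier := \<Gamma>\<rparr>\<^esub> x = x" by (cases x) (simp add: K_one)
  qed
  then show ?thesis using a by (intro exI[of _ "\<lambda>g. restrict (a g) (\<bbbH> \<times> UNIV)"]) simp
qed

lemma K_automorphy:
  assumes "fuchsian \<Gamma>" shows "even_automorphy A \<Gamma> (filt A N) (K A)"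
proof -
  interpret fuchsian \<Gamma> by fact
  show ?thesis
  proof
    show "\<exists>B. finite B \<and> basis_of A (filt A N) B" by (rule filt_finite_basis)
    show "K A (- mat 1) \<tau> v = v" for \<tau> v by (simp add: K_minus K_one)
    show "\<beta> $ 2 $ 1 = 0 \<Longrightarrow> K A \<beta> \<tau> v = K A \<beta> \<tau>' v" for \<beta> \<tau> \<tau>' v by (rule K_upper_triangular)
  qed (simp_all add: K_cocycle K_holomorphic_GL K_translation)
qed

lemma twisted_K_automorphy:
  assumes "fuchsian \<Gamma>" shows "automorphy A \<Gamma> (filt A N) (twisted_K A k)"
proof -
  interpret fuchsian \<Gamma> by fact
  show ?thesis
  proof
    show "\<exists>B. finite B \<and> basis_of A (filt A N) B" by (rule filt_finite_basis)
    show "\<beta> $ 2 $ 1 = 0 \<Longrightarrow> twisted_K A k \<beta> \<tau> v = twisted_K A k \<beta> \<tau>' v" for \<beta> \<tau> \<tau>' v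
      unfolding twisted_K_def using K_upper_triangular[of \<beta> \<tau> v \<tau>'] by (simp add: jfac_def)
    show "twisted_K A k (translation t) \<tau> v = v" for t \<tau> v by (simp add: twisted_K_def K_translation)
  qed (simp_all add: twisted_K_cocycle twisted_K_holomorphic_GL)
qed

text \<open>The inverse of \<open>K(\<gamma>,\<tau>)\<close> is \<open>K(\<gamma>\<^sup>-\<^sup>1,\<gamma>\<tau>)\<close>, and \<open>j(\<gamma>,\<tau>)\<^sup>-\<^sup>1 = j(\<gamma>\<^sup>-\<^sup>1,\<gamma>\<tau>)\<close>.\<close>

lemma slash_eq:
  assumes "det \<gamma> = 1" "\<tau> \<in> \<bbbH>"
  shows "slash A k \<gamma> f \<tau> = twisted_K A k (matrix_inv \<gamma>) (moeb \<gamma> \<tau>) (f (moeb \<gamma> \<tau>))"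
proof -
  have "K A \<gamma> \<tau> (K A (matrix_inv \<gamma>) (moeb \<gamma> \<tau>) w) = w" for w
    using K_cocycle[of \<gamma> "matrix_inv \<gamma>" "moeb \<gamma> \<tau>" w] assms
    by (simp add: matrix_inv_props K_one moeb_in_upper_half moeb_inverse)
  then have "inv_into UNIV (K A \<gamma> \<tau>) w = K A (matrix_inv \<gamma>) (moeb \<gamma> \<tau>) w" for w
    using K_bij_filt(2)[OF assms] by (metis bij_inv_eq_iff)
  moreover have "jfac (matrix_inv \<gamma>) (moeb \<gamma> \<tau>) * jfac \<gamma> \<tau> = 1"
    using jfac_mult[of \<gamma> \<tau> "matrix_inv \<gamma>"] assms by (simp add: matrix_inv_props)
  then have "jfac (matrix_inv \<gamma>) (moeb \<gamma> \<tau>) = inverse (jfac \<gamma> \<tau>)" by (metis inverse_unique mult.commute)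
  ultimately show ?thesis using assms(1) by (simp add: slash_def twisted_K_def power_int_minus power_int_inverse)
qed

lemma q_expansion_cong:
  assumes "\<And>\<tau>. \<tau> \<in> \<bbbH> \<Longrightarrow> h \<tau> = h' \<tau>"
  shows "q_expansion A W \<omega> h \<longleftrightarrow> q_expansion A W \<omega> h'"
  unfolding q_expansion_def using assms by (simp cong: image_cong)

text \<open>The condition at elliptic points is an instance of invariance, as a generator of the stabilizer fixes
  the point.\<close>

lemma automorphic_forms_iff:
  assumes "fuchsian \<Gamma>"
  shows "f \<in> automorphic_forms A \<Gamma> k \<longleftrightarrow>
    f \<in> extensional \<bbbH> \<and> (\<exists>N. automorphy.forms A \<Gamma> (filt A N) (twisted_K A k) f)"
proof -
  interpret au: automorphy A \<Gamma> "filt A N" "twisted_K A k" for N by (rule twisted_K_automorphy[OF assms])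
  have sl: "slash A k \<gamma> f \<tau> = au.pull \<gamma> f \<tau>" if "det \<gamma> = 1" "\<tau> \<in> \<bbbH>" for \<gamma> \<tau>
    using slash_eq[OF that] by (simp add: au.pull_def)
  have "(holomorphic_into A (filt A N) \<bbbH> f \<and>
     (\<forall>\<gamma>\<in>lifts \<Gamma>. \<forall>\<tau>\<in>\<bbbH>. slash A k \<gamma> f \<tau> = f \<tau>) \<and>
     (\<forall>\<sigma>\<in>cusp_frames \<Gamma>. \<forall>\<omega>. cusp_width \<Gamma> \<sigma> \<omega> \<longrightarrow> q_expansion A (filt A N) \<omega> (slash A k \<sigma> f)) \<and>
     (\<forall>\<tau>\<in>elliptic_points \<Gamma>. \<forall>\<gamma>. stab \<Gamma> \<tau> = generate SL2 {\<gamma>, - mat 1} \<longrightarrow>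
        smul A (jfac \<gamma> \<tau> powi k) (K A \<gamma> \<tau> (f \<tau>)) = f \<tau>)) \<longleftrightarrow> au.forms N f" for N
  proof (cases "holomorphic_into A (filt A N) \<bbbH> f")
    case True
    then have fW: "f ` \<bbbH> \<subseteq> filt A N" unfolding holomorphic_into_def by blast
    have inv: "(\<forall>\<gamma>\<in>lifts \<Gamma>. \<forall>\<tau>\<in>\<bbbH>. slash A k \<gamma> f \<tau> = f \<tau>) \<longleftrightarrow> au.invariant N f"
    proof -
      have "slash A k \<gamma> f \<tau> = f \<tau> \<longleftrightarrow> twisted_K A k \<gamma> \<tau> (f \<tau>) = f (moeb \<gamma> \<tau>)"
        if gt: "\<gamma> \<in> lifts \<Gamma>" "\<tau> \<in> \<bbbH>" for \<gamma> \<tau>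
      proof -
        have "det \<gamma> = 1" "f \<tau> \<in> filt A N" using gt fW by auto
        then show ?thesis using au.pull_unique[OF fW _ gt(2)] sl gt(2) by metis
      qed
      then show ?thesis using fW by (simp add: au.invariant_def)
    qed
    have q: "q_expansion A (filt A N) \<omega> (slash A k \<sigma> f) \<longleftrightarrow> q_expansion A (filt A N) \<omega> (au.pull \<sigma> f)"
      if "\<sigma> \<in> cusp_frames \<Gamma>" for \<sigma> \<omega>
      using that sl by (intro q_expansion_cong) simp
    have ell: "smul A (jfac \<gamma> \<tau> powi k) (K A \<gamma> \<tau> (f \<tau>)) = f \<tau>"
      if "au.invariant N f" "\<tau> \<in> elliptic_points \<Gamma>" "stab \<Gamma> \<tau> = generate SL2 {\<gamma>, - mat 1}" for \<tau> \<gamma>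
    proof -
      have "\<gamma> \<in> stab \<Gamma> \<tau>" unfolding that(3) by (rule generate.incl) simp
      then have "\<gamma> \<in> lifts \<Gamma>" "moeb \<gamma> \<tau> = \<tau>" "\<tau> \<in> \<bbbH>" using that(2) by (auto simp: au.stab_iff elliptic_points_def)
      then have "twisted_K A k \<gamma> \<tau> (f \<tau>) = f \<tau>" using au.invariant_J[OF that(1)] by metis
      then show ?thesis by (simp add: twisted_K_def)
    qed
    show ?thesis unfolding au.forms_def inv using True q ell by blast
  qed (simp add: au.forms_def)
  then show ?thesis unfolding automorphic_forms_def by simp
qed

lemma filt_mono: "N \<le> M \<Longrightarrow> filt A N \<subseteq> filt A M"
  by (auto simp: filt_iff)

text \<open>Sections and forms with different bounds on the degree are compared in the larger step of the
  filtration.\<close>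

theorem weight_sections_bij:
  assumes "fuchsian \<Gamma>"
  shows "\<exists>\<Phi>. bij_betw \<Phi> (weight_sections A \<Gamma> k) (automorphic_forms A \<Gamma> k) \<and>
           (\<forall>s\<in>weight_sections A \<Gamma> k. \<forall>\<tau>\<in>\<bbbH>.
              s (orb \<Gamma> (Some \<tau>)) = Inl (class_Y \<Gamma> (twisted_K A k) (\<tau>, \<Phi> s \<tau>)))"
proof -
  interpret au: automorphy A \<Gamma> "filt A N" "twisted_K A k" for N by (rule twisted_K_automorphy[OF assms])
  note forms = automorphic_forms_iff[OF assms, of _ k]
  have mono: "au.invariant M f" if "au.invariant N f" "N \<le> M" for N M f
    using that filt_mono[OF that(2)] unfolding au.invariant_def by blast
  have "\<exists>\<Phi>. bij_betw \<Phi> (weight_sections A \<Gamma> k) (automorphic_forms A \<Gamma> k) \<and>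
      (\<forall>s\<in>weight_sections A \<Gamma> k. au.section_of s (\<Phi> s))"
  proof (rule bij_betw_of_relation)
    fix s assume "s \<in> weight_sections A \<Gamma> k"
    then obtain N where N: "holomorphic_section A \<Gamma> (twisted_K A k) (filt A N) s" by (auto simp: weight_sections_def)
    obtain f where "f \<in> extensional \<bbbH>" "au.forms N f" "au.section_of s f" using au.form_of_section[OF N] .
    then show "\<exists>f\<in>automorphic_forms A \<Gamma> k. au.section_of s f" using forms by blast
  next
    fix f assume "f \<in> automorphic_forms A \<Gamma> k"
    then obtain N where N: "au.forms N f" using forms by blast
    obtain s where "holomorphic_section A \<Gamma> (twisted_K A k) (filt A N) s" "au.section_of s f"
      using au.section_of_form[OF N] .
    then show "\<exists>s\<in>weight_sections A \<Gamma> k. au.section_of s f" unfolding weight_sections_def by blast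
  next
    fix s f f' assume f: "f \<in> automorphic_forms A \<Gamma> k" "f' \<in> automorphic_forms A \<Gamma> k"
      and s: "au.section_of s f" "au.section_of s f'"
    obtain N N' where N: "au.invariant N f" "au.invariant N' f'" using f forms unfolding au.forms_def by blast
    have "au.invariant (max N N') f" "au.invariant (max N N') f'"
      using mono N by (meson max.cobounded1 max.cobounded2)+
    then have "f \<tau> = f' \<tau>" if "\<tau> \<in> \<bbbH>" for \<tau> using au.section_of_unique[OF s] that by blast
    moreover have "f \<in> extensional \<bbbH>" "f' \<in> extensional \<bbbH>" using f forms by blast+
    ultimately show "f = f'" by (intro extensionalityI)
  next
    fix s s' f assume s: "s \<in> weight_sections A \<Gamma> k" "s' \<in> weight_sections A \<Gamma> k"
      and f: "f \<in> automorphic_forms A \<Gamma> k" and R: "au.section_of s f" "au.section_of s' f"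
    obtain N1 N2 where N: "holomorphic_section A \<Gamma> (twisted_K A k) (filt A N1) s"
      "holomorphic_section A \<Gamma> (twisted_K A k) (filt A N2) s'" using s by (auto simp: weight_sections_def)
    obtain N3 where N3: "au.invariant N3 f" using f forms unfolding au.forms_def by blast
    define M where "M = max N1 (max N2 N3)"
    have le: "N1 \<le> M" "N2 \<le> M" "N3 \<le> M" by (auto simp: M_def)
    have "holomorphic_section A \<Gamma> (twisted_K A k) (filt A M) s" "holomorphic_section A \<Gamma> (twisted_K A k) (filt A M) s'"
      using au.holomorphic_section_mono[OF N(1) filt_mono[OF le(1)]] au.holomorphic_section_mono[OF N(2) filt_mono[OF le(2)]] .
    then show "s = s'" using au.section_determined_by_form R mono[OF N3 le(3)] by blast
  qed
  then show ?thesis by (simp add: au.section_of_def)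
qed

lemma total_spaces_exhausted:
  "total_Y \<Gamma> J UNIV = (\<Union>N. total_Y \<Gamma> J (filt A N))" "total_X \<Gamma> J UNIV = (\<Union>N. total_X \<Gamma> J (filt A N))"
proof -
  have U: "(UNIV :: 'v set) = (\<Union>N. filt A N)" using filt_exhaust by blast
  show Y: "total_Y \<Gamma> J UNIV = (\<Union>N. total_Y \<Gamma> J (filt A N))" unfolding total_Y_def U by blast
  show "total_X \<Gamma> J UNIV = (\<Union>N. total_X \<Gamma> J (filt A N))" unfolding total_X_def Y by (auto simp: U)
qed

end

theorem theoremA:
  fixes A :: "'v::ab_group_add qvoa"
  assumes "quasi_VOA A"
  shows
    "((\<forall>\<gamma>\<in>carrier GL2p. \<forall>\<tau>\<in>\<bbbH>. Vector_Spaces.linear (smul A) (smul A) (K A \<gamma> \<tau>)) \<and>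
      (\<forall>\<gamma>\<in>carrier GL2p. \<forall>\<beta>\<in>carrier GL2p. \<forall>\<tau>\<in>\<bbbH>.
         K A (\<gamma> ** \<beta>) \<tau> = K A \<gamma> (moeb \<beta> \<tau>) \<circ> K A \<beta> \<tau>) \<and>
      group_action GL2p (\<bbbH> \<times> UNIV) (\<lambda>\<gamma>. restrict (bundle_act (K A) \<gamma>) (\<bbbH> \<times> UNIV)))
     \<and>
     (\<forall>\<Gamma>. fuchsian_first_kind \<Gamma> \<longrightarrow>
        (\<exists>\<phi>. group_action (PSL2\<lparr>carrier := \<Gamma>\<rparr>) (\<bbbH> \<times> UNIV) \<phi> \<and>
           (\<forall>g\<in>\<Gamma>. \<forall>\<gamma>\<in>g. \<forall>x\<in>\<bbbH> \<times> UNIV. \<phi> g x = bundle_act (K A) \<gamma> x)) \<and>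
        (\<forall>N. automorphy_factor A \<Gamma> (filt A N) (K A) \<and>
           orbifold_bundle A (filt A N) (curve_Y \<Gamma>) (total_Y \<Gamma> (K A) (filt A N)) proj_Y
             (atlas_Y \<Gamma> (K A)) \<and>
           (torsion_free \<Gamma> \<longrightarrow>
              ordinary_bundle A (filt A N) (curve_Y \<Gamma>) (total_Y \<Gamma> (K A) (filt A N)) proj_Y
                (atlas_Y \<Gamma> (K A)))) \<and>
        total_Y \<Gamma> (K A) UNIV = (\<Union>N. total_Y \<Gamma> (K A) (filt A N)) \<and>
        (\<forall>\<sigma>\<in>cusp_frames \<Gamma>.
           (\<exists>!\<omega>. cusp_width \<Gamma> \<sigma> \<omega>) \<and>
           (\<forall>\<gamma>\<in>conj_stab \<Gamma> \<sigma>. \<forall>\<tau>\<in>\<bbbH>. K A \<gamma> \<tau> = id) \<and>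
           (\<forall>\<omega>. cusp_width \<Gamma> \<sigma> \<omega> \<longrightarrow> (\<exists>r. cusp_radius \<Gamma> \<sigma> \<omega> r))) \<and>
        (\<forall>N. orbifold_bundle A (filt A N) (curve_X \<Gamma>) (total_X \<Gamma> (K A) (filt A N)) proj_X
             (atlas_X \<Gamma> (K A)) \<and>
           (torsion_free \<Gamma> \<longrightarrow>
              ordinary_bundle A (filt A N) (curve_X \<Gamma>) (total_X \<Gamma> (K A) (filt A N)) proj_X
                (atlas_X \<Gamma> (K A))) \<and>
           {e \<in> total_X \<Gamma> (K A) (filt A N). proj_X e \<in> curve_Y \<Gamma>} = Inl ` total_Y \<Gamma> (K A) (filt A N)) \<and>
        total_X \<Gamma> (K A) UNIV = (\<Union>N. total_X \<Gamma> (K A) (filt A N)) \<and>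
        (\<forall>k. \<exists>\<Phi>. bij_betw \<Phi> (weight_sections A \<Gamma> k) (automorphic_forms A \<Gamma> k) \<and>
           (\<forall>s\<in>weight_sections A \<Gamma> k. \<forall>\<tau>\<in>\<bbbH>.
              s (orb \<Gamma> (Some \<tau>)) = Inl (class_Y \<Gamma> (twisted_K A k) (\<tau>, \<Phi> s \<tau>)))))"
proof -
  interpret quasi_VOA A by fact
  have cocycle: "K A (\<gamma> ** \<beta>) \<tau> = K A \<gamma> (moeb \<beta> \<tau>) \<circ> K A \<beta> \<tau>"
    if "\<gamma> \<in> carrier GL2p" "\<beta> \<in> carrier GL2p" "\<tau> \<in> \<bbbH>" for \<gamma> \<beta> \<tau>
    using that by (intro ext) (simp add: K_cocycle)
  show ?thesis
  proof (intro conjI allI impI ballI)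
    fix \<Gamma> :: "mat2 set set" assume "fuchsian_first_kind \<Gamma>"
    then have F: "fuchsian \<Gamma>" by (rule fuchsian_of_first_kind)
    interpret B: even_automorphy A \<Gamma> "filt A N" "K A" for N by (rule K_automorphy[OF F])
    show "\<exists>\<phi>. group_action (PSL2\<lparr>carrier := \<Gamma>\<rparr>) (\<bbbH> \<times> UNIV) \<phi> \<and>
           (\<forall>g\<in>\<Gamma>. \<forall>\<gamma>\<in>g. \<forall>x\<in>\<bbbH> \<times> UNIV. \<phi> g x = bundle_act (K A) \<gamma> x)"
      by (rule group_action_fuchsian[OF F])
    show "automorphy_factor A \<Gamma> (filt A N) (K A)" for N
      unfolding automorphy_factor_def using B.J_GL B.J_cocycle B.J_minus by auto
    show "orbifold_bundle A (filt A N) (curve_Y \<Gamma>) (total_Y \<Gamma> (K A) (filt A N)) proj_Y (atlas_Y \<Gamma> (K A))" for N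
      by (rule B.orbifold_bundle_Y)
    show "ordinary_bundle A (filt A N) (curve_Y \<Gamma>) (total_Y \<Gamma> (K A) (filt A N)) proj_Y (atlas_Y \<Gamma> (K A))"
      if "torsion_free \<Gamma>" for N
      using B.ordinary_bundle_Y[OF that B.J_minus] .
    show "total_Y \<Gamma> (K A) UNIV = (\<Union>N. total_Y \<Gamma> (K A) (filt A N))"
      "total_X \<Gamma> (K A) UNIV = (\<Union>N. total_X \<Gamma> (K A) (filt A N))"
      by (rule total_spaces_exhausted)+
    show "\<exists>!\<omega>. cusp_width \<Gamma> \<sigma> \<omega>" if "\<sigma> \<in> cusp_frames \<Gamma>" for \<sigma> by (rule B.ex1_cusp_width[OF that])
    show "K A \<gamma> \<tau> = id" if \<sigma>: "\<sigma> \<in> cusp_frames \<Gamma>" and \<gamma>: "\<gamma> \<in> conj_stab \<Gamma> \<sigma>" for \<sigma> \<gamma> \<tau>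
    proof -
      obtain \<omega> where "cusp_width \<Gamma> \<sigma> \<omega>" using B.cusp_width_exists[OF \<sigma>] by blast
      then have "\<exists>t. \<gamma> = translation t \<or> \<gamma> = - translation t" using B.cusp_width_iff \<gamma> by blast
      then show ?thesis by (auto simp: K_translation K_minus)
    qed
    show "\<exists>r. cusp_radius \<Gamma> \<sigma> \<omega> r" if "\<sigma> \<in> cusp_frames \<Gamma>" "cusp_width \<Gamma> \<sigma> \<omega>" for \<sigma> \<omega>
      by (rule B.cusp_radius_exists[OF that])
    show "orbifold_bundle A (filt A N) (curve_X \<Gamma>) (total_X \<Gamma> (K A) (filt A N)) proj_X (atlas_X \<Gamma> (K A))" for N
      by (rule B.orbifold_bundle_X)
    show "ordinary_bundle A (filt A N) (curve_X \<Gamma>) (total_X \<Gamma> (K A) (filt A N)) proj_X (atlas_X \<Gamma> (K A))"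
      if "torsion_free \<Gamma>" for N
      by (rule B.ordinary_bundle_X[OF that])
    show "{e \<in> total_X \<Gamma> (K A) (filt A N). proj_X e \<in> curve_Y \<Gamma>} = Inl ` total_Y \<Gamma> (K A) (filt A N)" for N
      by (rule B.total_X_over_Y)
    show "\<exists>\<Phi>. bij_betw \<Phi> (weight_sections A \<Gamma> k) (automorphic_forms A \<Gamma> k) \<and>
           (\<forall>s\<in>weight_sections A \<Gamma> k. \<forall>\<tau>\<in>\<bbbH>.
              s (orb \<Gamma> (Some \<tau>)) = Inl (class_Y \<Gamma> (twisted_K A k) (\<tau>, \<Phi> s \<tau>)))" for k
      by (rule weight_sections_bij[OF F])
  qed (rule K_linear cocycle group_action_GL2p; assumption?)+
qed

end
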